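(* Let $\Omega\subset\mathbb{R}^d$ ($d=2,3$), with boundary splitting $\partial\Omega=\Gamma_D\cup\Gamma_N$, and consider a shape-regular family of simplicial triangulations $\mathcal{T}_h$ of $\Omega$ with the associated spaces $\boldsymbol V_h$ and $W_h$ (lowest-order Raviart–Thomas and piecewise constants; see context). There is a constant $\alpha_0>0$, which may depend on $\Omega,\Gamma_D,\Gamma_N$ and on the shape regularity of the mesh but is independent of the contrast $\kappa$ and of the mesh size $h$, such that for every permeability coefficient $K$ satisfying $$\xi\cdot\xi\le K(x)\xi\cdot\xi\qquad\text{for all }\xi\in\mathbb{R}^d\text{ and almost all }x\in\Omega,$$ with $\alpha=K^{-1}$, every mesh $\mathcal{T}_h$ of the family, and all $\mathbf u\in\boldsymbol V_h$, $p\in W_h$, $$\alpha_0\left(\|\mathbf u\|_{\Lambda_\alpha}^2+\|p\|^2\right)^{1/2}\le\sup_{\mathbf v\in\boldsymbol V_h,\;q\in W_h,\;(\mathbf v,q)\ne(0,0)}\frac{\mathcal A(\mathbf u,p;\mathbf v,q)}{\left(\|\mathbf v\|_{\Lambda_\alpha}^2+\|q\|^2\right)^{1/2}}\le\left(\|\mathbf u\|_{\Lambda_\alpha}^2+\|p\|^2\right)^{1/2}.$$ In fact, this holds with an $\alpha_0\ge 1/(1+1/\gamma^2)$, where $\gamma>0$ is a constant, independent of $\kappa$ and $h$, for which $$\inf_{0\ne q_h\in W_h}\;\sup_{0\ne\mathbf v_h\in\boldsymbol V_h}\frac{(\operatorname{div}\mathbf v_h,q_h)}{\|\mathbf v_h\|_{\Lambda_\alpha}\|q_h\|}\ge\gamma$$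 for all such $K$ and $\mathcal{T}_h$.
   Context: $\Omega\subset\mathbb{R}^d$, $d=2,3$, is a bounded connected polygonal (polyhedral) domain. Its boundary is split into two non-overlapping parts $\Gamma_D$ and $\Gamma_N$; $\Gamma_D$ is closed relative to $\partial\Omega$ and has strictly positive surface measure. $\mathbf n$ is the unit outward normal. The permeability $K:\Omega\to\mathbb{R}^{d\times d}$ is measurable, with $K(x)$ symmetric positive definite for almost all $x$ (the case of primary interest is $K(x)=k(x)I$ with $k$ scalar), and $\alpha(x)=K^{-1}(x)$. The contrast is $\kappa=\big(\max_{x}\|K(x)\|_{\ell^2}\big)\big(\max_{x}\|K^{-1}(x)\|_{\ell^2}\big)$ (essential maxima over $\Omega$, spectral norm), assumed finite; for scalar $K$ it is $\max_x K/\min_x K$. $(\cdot,\cdot)$ and $\|\cdot\|$ are the $L^2(\Omega)$ (or $[L^2(\Omega)]^d$) inner product and norm. $\boldsymbol H(\operatorname{div};\Omega)$ is the space of square-integrable vector fields with square-integrable divergence; $\boldsymbol V=\{\mathbf v\in\boldsymbol H(\operatorname{div};\Omega):\mathbf v\cdot\mathbf n=0\text{ on }\Gamma_N\}$. Weighted norm: $\|\mathbf v\|_{\Lambda_\alpha}^2=(\alpha\mathbf v,\mathbf v)+(\operatorname{div}\mathbf v,\operatorname{div}\mathbf v)$. Bilinear form: $\mathcal A(\mathbf u,p;\mathbf v,q)=(\alpha\mathbf u,\mathbf v)-(p,\operatorname{div}\mathbf v)-(\operatorname{div}\mathbf u,q)$. Meshes: $\mathcal{T}_h$ is a conforming triangulation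 of $\Omega$ by $d$-simplices, every boundary face lying in either $\overline{\Gamma_D}$ or $\overline{\Gamma_N}$; the family is shape regular, i.e. the ratio between the diameter of a simplex and that of its inscribed ball is bounded above uniformly over all simplices and all meshes of the family. $h$ is the mesh size. Finite element spaces: $\boldsymbol V_h=\{\mathbf v\in\boldsymbol V:\mathbf v|_T\in\mathcal{RT}_0\ \text{for all }T\in\mathcal{T}_h\}$, where $\mathcal{RT}_0=\{x\mapsto\mathbf a+bx:\mathbf a\in\mathbb{R}^d,\,b\in\mathbb{R}\}$ is the lowest-order Raviart–Thomas space; $W_h=\{q\in L^2(\Omega):q|_T\text{ is constant for all }T\in\mathcal{T}_h\}$.
   Formalization: "Non-overlapping" is taken to mean that the closures of Γ_D and Γ_N meet in a set of zero surface measure (for merely disjoint parts, e.g. Γ_D a fat Cantor set, the claim fails), and the polyhedral domain Ω equals the interior of its closure (no slits), so that the outward normal makes sense. *)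

theory Defs
  imports "HOL-Analysis.Analysis" "HOL-Probability.Essential_Supremum"
begin

text \<open>The last conjunct says that the domain lies on one side of its boundary (no slits), so
  that the outward normal makes sense. The boundary need not be Lipschitz.\<close>

definition polyhedral_domain :: "(real^'d) set \<Rightarrow> bool" where
  "polyhedral_domain \<Omega> \<longleftrightarrow>
     open \<Omega> \<and> connected \<Omega> \<and> bounded \<Omega> \<and> \<Omega> \<noteq> {} \<and>
     (\<exists>\<P>. finite \<P> \<and> (\<forall>P\<in>\<P>. polytope P) \<and> closure \<Omega> = \<Union>\<P>) \<and>
     interior (closure \<Omega>) = \<Omega>"

text \<open>The (d-1)-dimensional Hausdorff outer measure, without the normalising constant. On the
  boundary of a polyhedral domain it is a constant multiple of the usual surface measure.\<close>

definition surface_measure :: "(real^'d) set \<Rightarrow> ennreal" where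
  "surface_measure A =
     (SUP \<delta>\<in>{0<..}. INF C\<in>{C :: nat \<Rightarrow> (real^'d) set.
          A \<subseteq> (\<Union>i. C i) \<and> (\<forall>i. bounded (C i) \<and> diameter (C i) \<le> \<delta>)}.
        \<Sum>i. ennreal (diameter (C i) ^ (CARD('d) - 1)))"

text \<open>The two parts do not overlap in the sense that their closures meet in a set of surface
  measure zero. Disjointness alone would admit for \<open>\<Gamma>D\<close> a nowhere dense set of positive measure,
  which no mesh can resolve.\<close>

definition boundary_splitting :: "(real^'d) set \<Rightarrow> (real^'d) set \<Rightarrow> (real^'d) set \<Rightarrow> bool" where
  "boundary_splitting \<Omega> \<Gamma>D \<Gamma>N \<longleftrightarrow>
     \<Gamma>D \<union> \<Gamma>N = frontier \<Omega> \<and>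
     surface_measure (closure \<Gamma>D \<inter> closure \<Gamma>N) = 0 \<and>
     closedin (top_of_set (frontier \<Omega>)) \<Gamma>D \<and>
     surface_measure \<Gamma>D > 0"

text \<open>Elements of the function spaces are represented by functions that matter only up to
  null sets of \<open>\<Omega>\<close>; values outside \<open>\<Omega>\<close> are irrelevant.\<close>

definition L2 :: "(real^'d) set \<Rightarrow> (real^'d \<Rightarrow> 'b::euclidean_space) set" where
  "L2 \<Omega> = {f \<in> borel_measurable (lebesgue_on \<Omega>). integrable (lebesgue_on \<Omega>) (\<lambda>x. (norm (f x))\<^sup>2)}"

definition L2_inner :: "(real^'d) set \<Rightarrow> (real^'d \<Rightarrow> 'b::euclidean_space) \<Rightarrow> (real^'d \<Rightarrow> 'b) \<Rightarrow> real" where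
  "L2_inner \<Omega> f g = (\<integral>x. f x \<bullet> g x \<partial>lebesgue_on \<Omega>)"

definition L2_norm :: "(real^'d) set \<Rightarrow> (real^'d \<Rightarrow> 'b::euclidean_space) \<Rightarrow> real" where
  "L2_norm \<Omega> f = sqrt (L2_inner \<Omega> f f)"

definition L2_zero :: "(real^'d) set \<Rightarrow> (real^'d \<Rightarrow> 'b::euclidean_space) \<Rightarrow> bool" where
  "L2_zero \<Omega> f \<longleftrightarrow> (AE x in lebesgue_on \<Omega>. f x = 0)"

definition supp :: "(real^'d \<Rightarrow> real) \<Rightarrow> (real^'d) set" where
  "supp \<phi> = closure {x. \<phi> x \<noteq> 0}"

text \<open>\<open>\<phi>\<close> is a compactly supported continuously differentiable function on the whole space, with
  gradient \<open>\<psi>\<close>. By mollification, such test functions define the same weak divergence as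
  compactly supported smooth ones.\<close>

definition test_function :: "(real^'d \<Rightarrow> real) \<Rightarrow> (real^'d \<Rightarrow> real^'d) \<Rightarrow> bool" where
  "test_function \<phi> \<psi> \<longleftrightarrow>
     (\<forall>x. GDERIV \<phi> x :> \<psi> x) \<and> continuous_on UNIV \<psi> \<and> compact (supp \<phi>)"

definition has_weak_div :: "(real^'d) set \<Rightarrow> (real^'d \<Rightarrow> real^'d) \<Rightarrow> (real^'d \<Rightarrow> real) \<Rightarrow> bool" where
  "has_weak_div \<Omega> v g \<longleftrightarrow>
     (\<forall>\<phi> \<psi>. test_function \<phi> \<psi> \<and> supp \<phi> \<subseteq> \<Omega> \<longrightarrow> L2_inner \<Omega> v \<psi> = - L2_inner \<Omega> g \<phi>)"

definition Hdiv :: "(real^'d) set \<Rightarrow> (real^'d \<Rightarrow> real^'d) set" where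
  "Hdiv \<Omega> = {v \<in> L2 \<Omega>. \<exists>g \<in> L2 \<Omega>. has_weak_div \<Omega> v g}"

text \<open>The choice is unique up to null sets for \<open>v \<in> Hdiv \<Omega>\<close>.\<close>

definition weak_div :: "(real^'d) set \<Rightarrow> (real^'d \<Rightarrow> real^'d) \<Rightarrow> real^'d \<Rightarrow> real" where
  "weak_div \<Omega> v = (SOME g. g \<in> L2 \<Omega> \<and> has_weak_div \<Omega> v g)"

text \<open>The normal trace of a field in \<open>Hdiv \<Omega>\<close> is the functional
  \<open>\<phi> \<mapsto> (v, grad \<phi>) + (div v, \<phi>)\<close> (Green's formula). It vanishes on a part \<open>\<Gamma>\<close> of the
  boundary if it vanishes on all test functions whose support meets the boundary within \<open>\<Gamma>\<close>.\<close>

definition zero_normal_trace :: "(real^'d) set \<Rightarrow> (real^'d) set \<Rightarrow> (real^'d \<Rightarrow> real^'d) \<Rightarrow> bool" where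
  "zero_normal_trace \<Omega> \<Gamma> v \<longleftrightarrow>
     (\<forall>\<phi> \<psi>. test_function \<phi> \<psi> \<and> supp \<phi> \<inter> frontier \<Omega> \<subseteq> \<Gamma> \<longrightarrow>
        L2_inner \<Omega> v \<psi> + L2_inner \<Omega> (weak_div \<Omega> v) \<phi> = 0)"

definition V_space :: "(real^'d) set \<Rightarrow> (real^'d) set \<Rightarrow> (real^'d \<Rightarrow> real^'d) set" where
  "V_space \<Omega> \<Gamma>N = {v \<in> Hdiv \<Omega>. zero_normal_trace \<Omega> \<Gamma>N v}"

definition inverse_field :: "(real^'d \<Rightarrow> real^'d^'d) \<Rightarrow> real^'d \<Rightarrow> real^'d^'d" where
  "inverse_field K x = matrix_inv (K x)"

definition contrast :: "(real^'d) set \<Rightarrow> (real^'d \<Rightarrow> real^'d^'d) \<Rightarrow> ereal" where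
  "contrast \<Omega> K =
     esssup (lebesgue_on \<Omega>) (\<lambda>x. ereal (onorm ((*v) (K x)))) *
     esssup (lebesgue_on \<Omega>) (\<lambda>x. ereal (onorm ((*v) (inverse_field K x))))"

definition permeability :: "(real^'d) set \<Rightarrow> (real^'d \<Rightarrow> real^'d^'d) \<Rightarrow> bool" where
  "permeability \<Omega> K \<longleftrightarrow>
     K \<in> borel_measurable (lebesgue_on \<Omega>) \<and>
     (AE x in lebesgue_on \<Omega>. transpose (K x) = K x \<and> (\<forall>\<xi>. \<xi> \<noteq> 0 \<longrightarrow> (K x *v \<xi>) \<bullet> \<xi> > 0)) \<and>
     contrast \<Omega> K < \<infinity>"

definition bounded_below_by_identity :: "(real^'d) set \<Rightarrow> (real^'d \<Rightarrow> real^'d^'d) \<Rightarrow> bool" where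
  "bounded_below_by_identity \<Omega> K \<longleftrightarrow> (AE x in lebesgue_on \<Omega>. \<forall>\<xi>. \<xi> \<bullet> \<xi> \<le> (K x *v \<xi>) \<bullet> \<xi>)"

definition weighted_inner ::
  "(real^'d) set \<Rightarrow> (real^'d \<Rightarrow> real^'d^'d) \<Rightarrow> (real^'d \<Rightarrow> real^'d) \<Rightarrow> (real^'d \<Rightarrow> real^'d) \<Rightarrow> real" where
  "weighted_inner \<Omega> \<alpha> u v = L2_inner \<Omega> (\<lambda>x. \<alpha> x *v u x) v"

definition Lambda_norm ::
  "(real^'d) set \<Rightarrow> (real^'d \<Rightarrow> real^'d^'d) \<Rightarrow> (real^'d \<Rightarrow> real^'d) \<Rightarrow> real" where
  "Lambda_norm \<Omega> \<alpha> v =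
     sqrt (weighted_inner \<Omega> \<alpha> v v + L2_inner \<Omega> (weak_div \<Omega> v) (weak_div \<Omega> v))"

definition pair_norm ::
  "(real^'d) set \<Rightarrow> (real^'d \<Rightarrow> real^'d^'d) \<Rightarrow> (real^'d \<Rightarrow> real^'d) \<Rightarrow> (real^'d \<Rightarrow> real) \<Rightarrow> real" where
  "pair_norm \<Omega> \<alpha> v q = sqrt ((Lambda_norm \<Omega> \<alpha> v)\<^sup>2 + (L2_norm \<Omega> q)\<^sup>2)"

definition A_form ::
  "(real^'d) set \<Rightarrow> (real^'d \<Rightarrow> real^'d^'d) \<Rightarrow> (real^'d \<Rightarrow> real^'d) \<Rightarrow> (real^'d \<Rightarrow> real) \<Rightarrow>
     (real^'d \<Rightarrow> real^'d) \<Rightarrow> (real^'d \<Rightarrow> real) \<Rightarrow> real" where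
  "A_form \<Omega> \<alpha> u p v q =
     weighted_inner \<Omega> \<alpha> u v - L2_inner \<Omega> p (weak_div \<Omega> v) - L2_inner \<Omega> (weak_div \<Omega> u) q"

text \<open>A facet of a simplex that is contained in \<open>frontier \<Omega>\<close> is a boundary face.\<close>

definition mesh ::
  "(real^'d) set \<Rightarrow> (real^'d) set \<Rightarrow> (real^'d) set \<Rightarrow> (real^'d) set set \<Rightarrow> bool" where
  "mesh \<Omega> \<Gamma>D \<Gamma>N \<T> \<longleftrightarrow>
     triangulation \<T> \<and> (\<forall>T\<in>\<T>. int CARD('d) simplex T) \<and> \<Union>\<T> = closure \<Omega> \<and>
     (\<forall>T\<in>\<T>. \<forall>F. F facet_of T \<and> F \<subseteq> frontier \<Omega> \<longrightarrow> F \<subseteq> closure \<Gamma>D \<or> F \<subseteq> closure \<Gamma>N)"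

definition inscribed_ball_diameter :: "(real^'d) set \<Rightarrow> real" where
  "inscribed_ball_diameter T = 2 * Sup {r. 0 \<le> r \<and> (\<exists>c. cball c r \<subseteq> T)}"

definition shape_regular_family ::
  "(real^'d) set \<Rightarrow> (real^'d) set \<Rightarrow> (real^'d) set \<Rightarrow> real \<Rightarrow> (real^'d) set set set \<Rightarrow> bool" where
  "shape_regular_family \<Omega> \<Gamma>D \<Gamma>N \<rho> \<F> \<longleftrightarrow>
     (\<forall>\<T>\<in>\<F>. mesh \<Omega> \<Gamma>D \<Gamma>N \<T> \<and> (\<forall>T\<in>\<T>. diameter T / inscribed_ball_diameter T \<le> \<rho>))"

definition RT0 :: "(real^'d \<Rightarrow> real^'d) set" where
  "RT0 = {\<lambda>x. a + b *\<^sub>R x | a b. True}"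

definition V_h ::
  "(real^'d) set \<Rightarrow> (real^'d) set \<Rightarrow> (real^'d) set set \<Rightarrow> (real^'d \<Rightarrow> real^'d) set" where
  "V_h \<Omega> \<Gamma>N \<T> = {v \<in> V_space \<Omega> \<Gamma>N. \<forall>T\<in>\<T>. \<exists>w\<in>RT0. AE x in lebesgue_on T. v x = w x}"

definition W_h :: "(real^'d) set \<Rightarrow> (real^'d) set set \<Rightarrow> (real^'d \<Rightarrow> real) set" where
  "W_h \<Omega> \<T> = {q \<in> L2 \<Omega>. \<forall>T\<in>\<T>. \<exists>c. AE x in lebesgue_on T. q x = c}"

text \<open>They are taken in the extended reals, so that an inequality for a supremum or an infimum
  also says what it should about unbounded or empty index sets.\<close>

definition stability_sup ::
  "(real^'d) set \<Rightarrow> (real^'d) set \<Rightarrow> (real^'d) set set \<Rightarrow> (real^'d \<Rightarrow> real^'d^'d) \<Rightarrow>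
     (real^'d \<Rightarrow> real^'d) \<Rightarrow> (real^'d \<Rightarrow> real) \<Rightarrow> ereal" where
  "stability_sup \<Omega> \<Gamma>N \<T> \<alpha> u p =
     (SUP (v, q) \<in> {(v, q). v \<in> V_h \<Omega> \<Gamma>N \<T> \<and> q \<in> W_h \<Omega> \<T> \<and> \<not> (L2_zero \<Omega> v \<and> L2_zero \<Omega> q)}.
        ereal (A_form \<Omega> \<alpha> u p v q / pair_norm \<Omega> \<alpha> v q))"

definition stable_with ::
  "(real^'d) set \<Rightarrow> (real^'d) set \<Rightarrow> (real^'d) set set \<Rightarrow> (real^'d \<Rightarrow> real^'d^'d) \<Rightarrow> real \<Rightarrow> bool" where
  "stable_with \<Omega> \<Gamma>N \<T> \<alpha> \<alpha>0 \<longleftrightarrow>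
     (\<forall>u \<in> V_h \<Omega> \<Gamma>N \<T>. \<forall>p \<in> W_h \<Omega> \<T>.
        ereal (\<alpha>0 * pair_norm \<Omega> \<alpha> u p) \<le> stability_sup \<Omega> \<Gamma>N \<T> \<alpha> u p \<and>
        stability_sup \<Omega> \<Gamma>N \<T> \<alpha> u p \<le> ereal (pair_norm \<Omega> \<alpha> u p))"

definition inf_sup_value ::
  "(real^'d) set \<Rightarrow> (real^'d) set \<Rightarrow> (real^'d) set set \<Rightarrow> (real^'d \<Rightarrow> real^'d^'d) \<Rightarrow> ereal" where
  "inf_sup_value \<Omega> \<Gamma>N \<T> \<alpha> =
     (INF q \<in> {q \<in> W_h \<Omega> \<T>. \<not> L2_zero \<Omega> q}. SUP v \<in> {v \<in> V_h \<Omega> \<Gamma>N \<T>. \<not> L2_zero \<Omega> v}.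
        ereal (L2_inner \<Omega> (weak_div \<Omega> v) q / (Lambda_norm \<Omega> \<alpha> v * L2_norm \<Omega> q)))"

definition uniformly_stable ::
  "(real^'d) set \<Rightarrow> (real^'d) set \<Rightarrow> (real^'d) set set set \<Rightarrow> real \<Rightarrow> bool" where
  "uniformly_stable \<Omega> \<Gamma>N \<F> \<alpha>0 \<longleftrightarrow>
     (\<forall>K. permeability \<Omega> K \<and> bounded_below_by_identity \<Omega> K \<longrightarrow>
        (\<forall>\<T>\<in>\<F>. stable_with \<Omega> \<Gamma>N \<T> (inverse_field K) \<alpha>0))"

definition uniform_inf_sup ::
  "(real^'d) set \<Rightarrow> (real^'d) set \<Rightarrow> (real^'d) set set set \<Rightarrow> real \<Rightarrow> bool" where
  "uniform_inf_sup \<Omega> \<Gamma>N \<F> \<gamma> \<longleftrightarrow>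
     (\<forall>K. permeability \<Omega> K \<and> bounded_below_by_identity \<Omega> K \<longrightarrow>
        (\<forall>\<T>\<in>\<F>. ereal \<gamma> \<le> inf_sup_value \<Omega> \<Gamma>N \<T> (inverse_field K)))"

end

theory Submission
  imports Defs
begin

text \<open>Stability of the saddle point problem with \<open>\<alpha>\<^sub>0 = 1 / (1 + 1 / \<gamma>\<^sup>2)\<close> is an exercise in the span of
  two fields. Given \<open>(u, p)\<close>, put \<open>y = div u + p\<close> and take \<open>v\<close> nearly optimal in the inf-sup
  condition for \<open>y\<close>; a combination of \<open>u\<close> and \<open>v\<close>, together with a suitable \<open>q\<close>, is a test pair
  that is good enough.

  Since \<open>K \<ge> 1\<close> makes the weighted norm smaller than the unweighted one, the inf-sup condition is
  only needed without a weight. It is obtained from a finite volume Laplacian rather than from the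
  regularity theory of the continuous problem: for piecewise constant \<open>q\<close> one solves
  \<open>\<Sum>\<^sub>F diam(F)\<^bsup>d-2\<^esup> [r]\<^sub>F [s]\<^sub>F = (q, s)\<close>, summed over all facets off the Neumann boundary, and the
  Raviart-Thomas field whose fluxes are the weighted jumps of \<open>r\<close> has divergence \<open>q\<close> up to a
  factor. The bound on this field is the discrete Poincare inequality
  \<open>\<Sum>\<^sub>T w\<^sub>T |T| \<le> A \<Sum>\<^sub>F diam(F)\<^bsup>d-1\<^esup> |[w]\<^sub>F|\<close> for \<open>w = r\<^sup>2\<close>, in which \<open>A\<close> does not depend on the mesh.
  It follows by transporting mass along segments from one ball to the next until the Dirichlet
  boundary is crossed. Each facet met on the way is paid for by the volume of the tube of
  segments through it.\<close>

section \<open>Barycentric coordinates\<close>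

definition bary_grad :: "'a::euclidean_space set \<Rightarrow> 'a \<Rightarrow> 'a" where
  "bary_grad C a = (SOME g. \<forall>c\<in>C - {a}. g \<bullet> (a - c) = 1)"

definition bary :: "'a::euclidean_space set \<Rightarrow> 'a \<Rightarrow> 'a \<Rightarrow> real" where
  "bary C a x = 1 + bary_grad C a \<bullet> (x - a)"

locale full_simplex =
  fixes C :: "'a::euclidean_space set"
  assumes aff_indep: "\<not> affine_dependent C" and card_C: "card C = DIM('a) + 1"
begin

lemma finite_C: "finite C"
  using aff_indep aff_independent_finite by blast

lemma bary_grad_diff:
  assumes "a \<in> C" "c \<in> C" "c \<noteq> a"
  shows "bary_grad C a \<bullet> (a - c) = 1"
proof -
  have ind: "\<not> affine_dependent (C - {a})"
    using aff_indep affine_independent_Diff by blast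
  have "aff_dim (C - {a}) = int (card (C - {a})) - 1"
    using aff_dim_affine_independent[OF ind] by simp
  also have "card (C - {a}) = DIM('a)" using card_C assms(1) finite_C by simp
  finally have "aff_dim (C - {a}) = DIM('a) - 1" using DIM_positive[where 'a='a] by linarith
  then obtain n b where n: "n \<noteq> 0" and hp: "affine hull (C - {a}) = {x. n \<bullet> x = b}"
    using aff_dim_eq_hyperplane by blast
  have "a \<notin> affine hull (C - {a})"
    using aff_indep assms(1) unfolding affine_dependent_def by blast
  then have na: "n \<bullet> a - b \<noteq> 0" using hp by auto
  have "\<forall>c\<in>C - {a}. (n /\<^sub>R (n \<bullet> a - b)) \<bullet> (a - c) = 1"
  proof
    fix c assume "c \<in> C - {a}"
    then have "c \<in> affine hull (C - {a})" by (rule hull_inc)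
    then have "n \<bullet> c = b" using hp by simp
    then show "(n /\<^sub>R (n \<bullet> a - b)) \<bullet> (a - c) = 1"
      using na by (simp add: inner_diff_right flip: right_diff_distrib)
  qed
  then have "\<forall>c\<in>C - {a}. bary_grad C a \<bullet> (a - c) = 1"
    unfolding bary_grad_def by (rule someI)
  then show ?thesis using assms by blast
qed

lemma bary_vertex: "a \<in> C \<Longrightarrow> c \<in> C \<Longrightarrow> bary C a c = (if c = a then 1 else 0)"
  using bary_grad_diff[of a c] by (auto simp: bary_def inner_diff_right)

lemma bary_affine_sum:
  assumes "finite I" "sum u I = 1"
  shows "bary D a (\<Sum>i\<in>I. u i *\<^sub>R x i) = (\<Sum>i\<in>I. u i * bary D a (x i))"
proof -
  have "(\<Sum>i\<in>I. u i * bary D a (x i))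
      = (\<Sum>i\<in>I. u i * (1 - bary_grad D a \<bullet> a) + u i * (bary_grad D a \<bullet> x i))"
    by (intro sum.cong) (auto simp: bary_def inner_diff_right algebra_simps)
  also have "\<dots> = sum u I * (1 - bary_grad D a \<bullet> a) + (\<Sum>i\<in>I. u i * (bary_grad D a \<bullet> x i))"
    by (simp only: sum.distrib sum_distrib_right)
  finally show ?thesis
    using assms by (simp add: bary_def inner_diff_right inner_sum_right)
qed

lemma bary_combination: "(\<Sum>a\<in>C. bary C a x) = 1" "(\<Sum>a\<in>C. bary C a x *\<^sub>R a) = x"
proof -
  have "aff_dim C = DIM('a)"
    using aff_dim_affine_independent[OF aff_indep] card_C by simp
  then have "affine hull C = UNIV" by (rule affine_hull_UNIV)
  then have "x \<in> {y. \<exists>u. sum u C = 1 \<and> (\<Sum>v\<in>C. u v *\<^sub>R v) = y}"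
    using affine_hull_finite[OF finite_C] by simp
  then obtain u where u: "sum u C = 1" "(\<Sum>v\<in>C. u v *\<^sub>R v) = x"
    by blast
  have "bary C a x = u a" if "a \<in> C" for a
  proof -
    have "bary C a x = (\<Sum>v\<in>C. u v * bary C a v)"
      using bary_affine_sum[OF finite_C u(1), of C a "\<lambda>v. v"] u(2) by simp
    also have "\<dots> = (\<Sum>v\<in>C. if v = a then u v else 0)"
      using that by (intro sum.cong) (auto simp: bary_vertex)
    finally show ?thesis using that finite_C by simp
  qed
  then show "(\<Sum>a\<in>C. bary C a x) = 1" "(\<Sum>a\<in>C. bary C a x *\<^sub>R a) = x"
    using u by simp_all
qed

lemma mem_simplex_iff: "x \<in> convex hull C \<longleftrightarrow> (\<forall>a\<in>C. 0 \<le> bary C a x)"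
proof
  assume "x \<in> convex hull C"
  then obtain u where u: "\<forall>v\<in>C. 0 \<le> u v" "sum u C = 1" "(\<Sum>v\<in>C. u v *\<^sub>R v) = x"
    unfolding convex_hull_finite[OF finite_C] by blast
  show "\<forall>a\<in>C. 0 \<le> bary C a x"
  proof
    fix a assume a: "a \<in> C"
    have "bary C a x = (\<Sum>v\<in>C. u v * bary C a v)"
      using bary_affine_sum[OF finite_C u(2), of C a "\<lambda>v. v"] u(3) by simp
    also have "\<dots> \<ge> 0" using u(1) a by (intro sum_nonneg) (auto simp: bary_vertex)
    finally show "0 \<le> bary C a x" .
  qed
next
  assume "\<forall>a\<in>C. 0 \<le> bary C a x"
  then show "x \<in> convex hull C"
    unfolding convex_hull_finite[OF finite_C]
    by (intro CollectI exI[of _ "\<lambda>a. bary C a x"]) (simp add: bary_combination)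
qed

lemma mem_facet_iff:
  assumes "a \<in> C"
  shows "x \<in> convex hull (C - {a}) \<longleftrightarrow> bary C a x = 0 \<and> (\<forall>c\<in>C. 0 \<le> bary C c x)"
proof
  assume x: "x \<in> convex hull (C - {a})"
  then obtain u where u: "\<forall>v\<in>C-{a}. 0 \<le> u v" "sum u (C-{a}) = 1" "(\<Sum>v\<in>C-{a}. u v *\<^sub>R v) = x"
    unfolding convex_hull_finite[OF finite_Diff[OF finite_C]] by blast
  have "bary C a x = (\<Sum>v\<in>C-{a}. u v * bary C a v)"
    using bary_affine_sum[of "C-{a}" u C a "\<lambda>v. v"] finite_C u(2,3) by simp
  also have "\<dots> = 0" using assms by (intro sum.neutral) (auto simp: bary_vertex)
  moreover have "x \<in> convex hull C" using x hull_mono[of "C - {a}" C convex] by blast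
  ultimately show "bary C a x = 0 \<and> (\<forall>c\<in>C. 0 \<le> bary C c x)" using mem_simplex_iff by auto
next
  assume x: "bary C a x = 0 \<and> (\<forall>c\<in>C. 0 \<le> bary C c x)"
  have "(\<Sum>c\<in>C-{a}. bary C c x) = 1" "(\<Sum>c\<in>C-{a}. bary C c x *\<^sub>R c) = x"
    using bary_combination[of x] x sum.remove[OF finite_C assms, of "\<lambda>c. bary C c x"]
      sum.remove[OF finite_C assms, of "\<lambda>c. bary C c x *\<^sub>R c"] by auto
  then show "x \<in> convex hull (C - {a})"
    unfolding convex_hull_finite[OF finite_Diff[OF finite_C]] using x
    by (intro CollectI exI[of _ "\<lambda>c. bary C c x"]) simp
qed

lemma facet_iff: "F facet_of convex hull C \<longleftrightarrow> (\<exists>a\<in>C. F = convex hull (C - {a}))"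
proof -
  have "card C \<ge> 2" using card_C DIM_positive[where 'a='a] by linarith
  then show ?thesis
    using facet_of_convex_hull_affine_independent_alt[OF aff_indep] by blast
qed

lemma vertex_not_in_facet: "a \<in> C \<Longrightarrow> a \<notin> convex hull (C - {a})"
  by (simp add: mem_facet_iff bary_vertex)

lemma other_vertex:
  assumes "a \<in> C" obtains c where "c \<in> C" "c \<noteq> a"
proof -
  have "card (C - {a}) > 0" using assms finite_C card_C by simp
  then show ?thesis using that by (metis Diff_iff card_gt_0_iff ex_in_conv singletonI)
qed

lemma bary_grad_nonzero:
  assumes "a \<in> C"
  shows "bary_grad C a \<noteq> 0"
proof -
  obtain c where "c \<in> C" "c \<noteq> a" using other_vertex[OF assms] .
  then show ?thesis using bary_grad_diff[OF assms, of c] by auto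
qed

lemma bary_diff: "bary C a x - bary C a y = bary_grad C a \<bullet> (x - y)"
  by (simp add: bary_def inner_diff_right)

lemma continuous_bary: "continuous_on S (bary C a)"
  unfolding bary_def by (intro continuous_intros)

lemma open_interior_simplex: "open {x. \<forall>a\<in>C. 0 < bary C a x}"
proof -
  have "{x. \<forall>a\<in>C. 0 < bary C a x} = (\<Inter>a\<in>C. {x. 0 < bary C a x})" by auto
  then show ?thesis
    by (auto intro!: open_INT finite_C open_Collect_less continuous_bary)
qed

lemma bary_pos_interior: "{x. \<forall>a\<in>C. 0 < bary C a x} \<subseteq> interior (convex hull C)"
  using open_interior_simplex by (intro interior_maximal) (auto simp: mem_simplex_iff less_imp_le)

lemma interior_nonempty: "interior (convex hull C) \<noteq> {}"
proof -
  let ?u = "\<lambda>c. 1 / card C"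
  have n: "card C > 0" using card_C by simp
  have s: "sum ?u C = 1" using n by simp
  have "bary C a (\<Sum>v\<in>C. ?u v *\<^sub>R v) = 1 / card C" if "a \<in> C" for a
  proof -
    have "bary C a (\<Sum>v\<in>C. ?u v *\<^sub>R v) = (\<Sum>v\<in>C. ?u v * bary C a v)"
      using bary_affine_sum[OF finite_C s, of C a "\<lambda>v. v"] by simp
    also have "\<dots> = (\<Sum>v\<in>C. if v = a then 1 / card C else 0)"
      using that by (intro sum.cong) (auto simp: bary_vertex)
    finally show ?thesis using that finite_C by simp
  qed
  then have "(\<Sum>v\<in>C. ?u v *\<^sub>R v) \<in> {x. \<forall>a\<in>C. 0 < bary C a x}" using n by auto
  then show ?thesis using bary_pos_interior by blast
qed

lemma normal_parallel:
  assumes "a \<in> C" "n \<noteq> 0" "\<And>c. c \<in> C - {a} \<Longrightarrow> n \<bullet> c = b"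
  obtains k where "k \<noteq> 0" "bary_grad C a = k *\<^sub>R n"
proof -
  have nx: "n \<bullet> x = b + (n \<bullet> a - b) * bary C a x" for x
  proof -
    have "n \<bullet> x = (\<Sum>c\<in>C. bary C c x * (n \<bullet> c))"
      using arg_cong[OF bary_combination(2)[of x], of "\<lambda>y. n \<bullet> y"] by (simp add: inner_sum_right)
    also have "\<dots> = (\<Sum>c\<in>C. bary C c x * b + (if c = a then bary C a x * (n \<bullet> a - b) else 0))"
      using assms(3) by (intro sum.cong) (auto simp: algebra_simps)
    also have "\<dots> = b + (n \<bullet> a - b) * bary C a x"
      using assms(1) finite_C bary_combination(1)[of x]
      by (simp add: sum.distrib flip: sum_distrib_right)
    finally show ?thesis .
  qed
  define k where "k = n \<bullet> a - b"
  have "n \<bullet> x = (k *\<^sub>R bary_grad C a) \<bullet> x" for x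
    using nx[of x] nx[of 0] bary_diff[of a x 0] by (simp add: k_def algebra_simps)
  then have nk: "n = k *\<^sub>R bary_grad C a"
    by (rule vector_eq_rdot[THEN iffD1, OF allI])
  have "k \<noteq> 0"
  proof
    assume "k = 0"
    then have "n = 0" by (subst nk) simp
    then show False using assms(2) by contradiction
  qed
  moreover have "(1 / k) *\<^sub>R n = (1 / k * k) *\<^sub>R bary_grad C a" unfolding nk scaleR_scaleR ..
  ultimately have "bary_grad C a = (1 / k) *\<^sub>R n" by simp
  then show ?thesis using \<open>k \<noteq> 0\<close> that[of "1 / k"] by simp
qed

end

section \<open>The discrete Poincare inequality\<close>

lemma entering_count:
  fixes p s :: "'i \<Rightarrow> real"
  assumes fin: "finite C" and p: "\<And>a. a \<in> C \<Longrightarrow> p a \<noteq> 0"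
    and dbl: "\<And>a b t. a \<in> C \<Longrightarrow> b \<in> C \<Longrightarrow> a \<noteq> b \<Longrightarrow> 0 \<le> t \<Longrightarrow> t \<le> 1 \<Longrightarrow>
               p a + t * s a = 0 \<Longrightarrow> p b + t * s b = 0 \<Longrightarrow> False"
  shows "(\<Sum>a\<in>C. if (\<exists>t\<in>{0..1}. p a + t * s a = 0 \<and> (\<forall>c\<in>C. 0 \<le> p c + t * s c)) \<and> 0 < s a then 1 else 0 :: real)
       = (if (\<exists>t\<in>{0..1}. \<forall>c\<in>C. 0 \<le> p c + t * s c) \<and> \<not> (\<forall>c\<in>C. 0 \<le> p c) then 1 else 0)"
proof -
  define hit where "hit a t \<longleftrightarrow> 0 \<le> t \<and> t \<le> 1 \<and> p a + t * s a = 0 \<and> (\<forall>c\<in>C. 0 \<le> p c + t * s c)" for a t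
  define Z where "Z = {a\<in>C. (\<exists>t. hit a t) \<and> 0 < s a}"
  have uniq: "a = b" if a: "a \<in> C" "hit a t" "0 < s a" and b: "b \<in> C" "hit b u" "0 < s b" and "t \<le> u" for a b t u
  proof (rule ccontr)
    assume ne: "a \<noteq> b"
    have "0 \<le> p b + t * s b" "p b + u * s b = 0" using a b unfolding hit_def by auto
    then have "0 \<le> (t - u) * s b" by (simp add: algebra_simps)
    then have "t = u" using b(3) \<open>t \<le> u\<close> by (simp add: zero_le_mult_iff)
    then show False using dbl[OF a(1) b(1) ne, of t] a(2) b(2) unfolding hit_def by auto
  qed
  have le1: "a = b" if ab: "a \<in> Z" "b \<in> Z" for a b
  proof -
    obtain t where "hit a t" using ab(1) unfolding Z_def by blast
    moreover obtain u where "hit b u" using ab(2) unfolding Z_def by blast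
    ultimately have "t \<le> u \<Longrightarrow> a = b" "u \<le> t \<Longrightarrow> b = a"
      using uniq[of a t b u] uniq[of b u a t] ab unfolding Z_def by blast+
    then show ?thesis by (metis linear)
  qed
  have "card Z = (if (\<exists>t\<in>{0..1}. \<forall>c\<in>C. 0 \<le> p c + t * s c) \<and> \<not> (\<forall>c\<in>C. 0 \<le> p c) then 1 else 0)"
  proof (cases "(\<exists>t\<in>{0..1}. \<forall>c\<in>C. 0 \<le> p c + t * s c) \<and> \<not> (\<forall>c\<in>C. 0 \<le> p c)")
    case True
    then obtain tm where tm: "0 \<le> tm" "tm \<le> 1" "\<And>c. c \<in> C \<Longrightarrow> 0 \<le> p c + tm * s c" by auto
    define A where "A = {a\<in>C. p a < 0}"
    have A: "finite A" "A \<noteq> {}" using fin True unfolding A_def by (auto simp: not_le)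
    have sA: "0 < s a \<and> - p a / s a \<le> tm" if "a \<in> A" for a
    proof -
      have "p a < 0" "0 \<le> p a + tm * s a" using that tm(3) unfolding A_def by auto
      then have "0 < tm * s a" by linarith
      then have "0 < s a" using tm(1) by (simp add: zero_less_mult_iff)
      moreover have "- p a / s a \<le> tm"
        using \<open>0 \<le> p a + tm * s a\<close> pos_divide_le_eq[OF calculation, of "- p a" tm] by linarith
      ultimately show ?thesis ..
    qed
    define t where "t = Max ((\<lambda>a. - p a / s a) ` A)"
    have "t \<in> (\<lambda>a. - p a / s a) ` A" unfolding t_def using A by (intro Max_in) auto
    then obtain b where b: "b \<in> A" "t = - p b / s b" by auto
    have tmax: "- p a / s a \<le> t" if "a \<in> A" for a unfolding t_def using A that by (intro Max_ge) auto
    have t0: "0 \<le> t" "t \<le> tm"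
    proof -
      have "0 \<le> - p b" "0 < s b" using b(1) sA[OF b(1)] unfolding A_def by auto
      then show "0 \<le> t" unfolding b(2) by (rule divide_nonneg_pos)
      show "t \<le> tm" using sA[OF b(1)] b(2) by simp
    qed
    have "hit b t"
      unfolding hit_def
    proof (intro conjI ballI)
      show "0 \<le> t" "t \<le> 1" using t0 tm by auto
      show "p b + t * s b = 0" using b(2) sA[OF b(1)] by simp
      fix c assume c: "c \<in> C"
      show "0 \<le> p c + t * s c"
      proof (cases "c \<in> A")
        case True
        have sc: "0 < s c" using sA[OF True] by blast
        have "- p c \<le> t * s c" using tmax[OF True] pos_divide_le_eq[OF sc, of "- p c" t] by blast
        then show ?thesis by linarith
      next
        case False
        then have pc: "0 \<le> p c" using c unfolding A_def by auto
        show ?thesis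
        proof (cases "0 \<le> s c")
          case True then show ?thesis using pc t0 by simp
        next
          case False
          then have "tm * s c \<le> t * s c" using t0 by (intro mult_right_mono_neg) auto
          then show ?thesis using tm(3)[OF c] by linarith
        qed
      qed
    qed
    then have "b \<in> Z" using b(1) sA[OF b(1)] unfolding Z_def A_def by auto
    then have "Z = {b}" using le1 by blast
    then show ?thesis using True by simp
  next
    case False
    have "Z = {}"
    proof (rule ccontr)
      assume "Z \<noteq> {}"
      then obtain a t where a: "a \<in> C" "hit a t" "0 < s a" unfolding Z_def by auto
      have "0 \<le> t * s a" "p a + t * s a = 0" using a unfolding hit_def by auto
      then have "p a \<le> 0" by linarith
      then have "\<not> 0 \<le> p a" using p[OF a(1)] by linarith
      moreover have "\<exists>t\<in>{0..1}. \<forall>c\<in>C. 0 \<le> p c + t * s c"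
        using a(2) unfolding hit_def by (intro bexI[of _ t]) auto
      ultimately show False using False a(1) by blast
    qed
    then show ?thesis unfolding if_not_P[OF False] by simp
  qed
  moreover have "(\<Sum>a\<in>C. if (\<exists>t\<in>{0..1}. p a + t * s a = 0 \<and> (\<forall>c\<in>C. 0 \<le> p c + t * s c)) \<and> 0 < s a then 1 else 0 :: real)
     = (\<Sum>a\<in>C. if a \<in> Z then 1 else 0)"
    by (intro sum.cong refl if_cong) (auto simp: Z_def hit_def Bex_def)
  moreover have "(\<Sum>a\<in>C. if a \<in> Z then 1 else 0 :: real) = card Z"
    using fin by (simp add: sum.If_cases Z_def Int_def)
  ultimately show ?thesis by simp
qed

lemma crossing_count:
  fixes p s :: "'i \<Rightarrow> real"
  assumes fin: "finite C" and p: "\<And>a. a \<in> C \<Longrightarrow> p a \<noteq> 0" and q: "\<And>a. a \<in> C \<Longrightarrow> p a + s a \<noteq> 0"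
    and dbl: "\<And>a b t. a \<in> C \<Longrightarrow> b \<in> C \<Longrightarrow> a \<noteq> b \<Longrightarrow> 0 \<le> t \<Longrightarrow> t \<le> 1 \<Longrightarrow>
               p a + t * s a = 0 \<Longrightarrow> p b + t * s b = 0 \<Longrightarrow> False"
  shows "(\<Sum>a\<in>C. if (\<exists>t\<in>{0..1}. p a + t * s a = 0 \<and> (\<forall>c\<in>C. 0 \<le> p c + t * s c)) then sgn (s a) else 0)
       = (if \<forall>c\<in>C. 0 \<le> p c + s c then 1 else 0) - (if \<forall>c\<in>C. 0 \<le> p c then 1 else 0)"
proof -
  define hit where "hit a \<longleftrightarrow> (\<exists>t\<in>{0..1}. p a + t * s a = 0 \<and> (\<forall>c\<in>C. 0 \<le> p c + t * s c))" for a
  define met where "met \<longleftrightarrow> (\<exists>t\<in>{0..1}. \<forall>c\<in>C. 0 \<le> p c + t * s c)"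
  have enter: "(\<Sum>a\<in>C. if hit a \<and> 0 < s a then 1 else 0 :: real) = (if met \<and> \<not> (\<forall>c\<in>C. 0 \<le> p c) then 1 else 0)"
    unfolding hit_def met_def by (rule entering_count[OF fin p dbl])
  have flip: "(\<exists>t\<in>{0..1}. P (1 - t)) \<longleftrightarrow> (\<exists>t\<in>{0..1}. P t)" for P :: "real \<Rightarrow> bool"
  proof
    assume "\<exists>t\<in>{0..1}. P (1 - t)"
    then obtain t where "t \<in> {0..1}" "P (1 - t)" by blast
    then show "\<exists>t\<in>{0..1}. P t" by (intro bexI[of _ "1 - t"]) auto
  next
    assume "\<exists>t\<in>{0..1}. P t"
    then obtain t where "t \<in> {0..1}" "P t" by blast
    then show "\<exists>t\<in>{0..1}. P (1 - t)" by (intro bexI[of _ "1 - t"]) auto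
  qed
  have r: "p c + s c + t * - s c = p c + (1 - t) * s c" for c t by (simp add: algebra_simps)
  have leave: "(\<Sum>a\<in>C. if hit a \<and> 0 < - s a then 1 else 0 :: real) = (if met \<and> \<not> (\<forall>c\<in>C. 0 \<le> p c + s c) then 1 else 0)"
  proof -
    have "(\<Sum>a\<in>C. if (\<exists>t\<in>{0..1}. p a + s a + t * - s a = 0 \<and> (\<forall>c\<in>C. 0 \<le> p c + s c + t * - s c)) \<and> 0 < - s a then 1 else 0 :: real)
       = (if (\<exists>t\<in>{0..1}. \<forall>c\<in>C. 0 \<le> p c + s c + t * - s c) \<and> \<not> (\<forall>c\<in>C. 0 \<le> p c + s c) then 1 else 0)"
    proof (rule entering_count[OF fin q])
      fix a b t assume "a \<in> C" "b \<in> C" "a \<noteq> b" "0 \<le> t" "t \<le> 1"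
        "p a + s a + t * - s a = 0" "p b + s b + t * - s b = 0"
      then show False using dbl[of a b "1 - t"] unfolding r by simp
    qed
    then show ?thesis
      unfolding r flip[of "\<lambda>t. p _ + t * s _ = 0 \<and> (\<forall>c\<in>C. 0 \<le> p c + t * s c)"]
        flip[of "\<lambda>t. \<forall>c\<in>C. 0 \<le> p c + t * s c"] hit_def met_def .
  qed
  have "(\<Sum>a\<in>C. if hit a then sgn (s a) else 0)
      = (\<Sum>a\<in>C. (if hit a \<and> 0 < s a then 1 else 0) - (if hit a \<and> 0 < - s a then 1 else 0))"
    by (intro sum.cong) (auto simp: sgn_if)
  also have "\<dots> = (if met \<and> \<not> (\<forall>c\<in>C. 0 \<le> p c) then 1 else 0) - (if met \<and> \<not> (\<forall>c\<in>C. 0 \<le> p c + s c) then 1 else 0)"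
    by (simp only: sum_subtractf enter leave)
  also have "\<dots> = (if \<forall>c\<in>C. 0 \<le> p c + s c then 1 else 0) - (if \<forall>c\<in>C. 0 \<le> p c then 1 else 0)"
  proof -
    have m0: met if "\<forall>c\<in>C. 0 \<le> p c" unfolding met_def using that by (intro bexI[of _ 0]) auto
    have m1: met if "\<forall>c\<in>C. 0 \<le> p c + s c" unfolding met_def using that by (intro bexI[of _ 1]) auto
    show ?thesis using m0 m1 by auto
  qed
  finally show ?thesis unfolding hit_def .
qed

context full_simplex
begin

lemma bary_add: "bary C a (x + t *\<^sub>R e) = bary C a x + t * (bary_grad C a \<bullet> e)"
  by (simp add: bary_def inner_diff_right inner_add_right)

lemma simplex_crossing:
  assumes "\<And>a. a \<in> C \<Longrightarrow> bary C a x \<noteq> 0" "\<And>a. a \<in> C \<Longrightarrow> bary C a (x + e) \<noteq> 0"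
    and "\<And>a b t. a \<in> C \<Longrightarrow> b \<in> C \<Longrightarrow> a \<noteq> b \<Longrightarrow> t \<in> {0..1} \<Longrightarrow>
               bary C a (x + t *\<^sub>R e) = 0 \<Longrightarrow> bary C b (x + t *\<^sub>R e) = 0 \<Longrightarrow> False"
  shows "(\<Sum>a\<in>C. if \<exists>t\<in>{0..1}. x + t *\<^sub>R e \<in> convex hull (C - {a}) then sgn (bary_grad C a \<bullet> e) else 0)
       = indicator (convex hull C) (x + e) - indicator (convex hull C) x"
proof -
  have 1: "bary C a (x + e) = bary C a x + bary_grad C a \<bullet> e" for a
    using bary_add[of a x 1 e] by simp
  have "(\<Sum>a\<in>C. if \<exists>t\<in>{0..1}. x + t *\<^sub>R e \<in> convex hull (C - {a}) then sgn (bary_grad C a \<bullet> e) else 0)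
    = (\<Sum>a\<in>C. if \<exists>t\<in>{0..1}. bary C a x + t * (bary_grad C a \<bullet> e) = 0 \<and> (\<forall>c\<in>C. 0 \<le> bary C c x + t * (bary_grad C c \<bullet> e))
         then sgn (bary_grad C a \<bullet> e) else 0)"
    by (intro sum.cong refl) (simp add: mem_facet_iff bary_add)
  also have "\<dots> = (if \<forall>c\<in>C. 0 \<le> bary C c x + bary_grad C c \<bullet> e then 1 else 0) - (if \<forall>c\<in>C. 0 \<le> bary C c x then 1 else 0)"
  proof (rule crossing_count[OF finite_C])
    show "bary C a x \<noteq> 0" if "a \<in> C" for a using assms(1) that .
    show "bary C a x + bary_grad C a \<bullet> e \<noteq> 0" if "a \<in> C" for a using assms(2) that unfolding 1 .
    fix a b t assume "a \<in> C" "b \<in> C" "a \<noteq> b" "0 \<le> t" "t \<le> (1::real)"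
      "bary C a x + t * (bary_grad C a \<bullet> e) = 0" "bary C b x + t * (bary_grad C b \<bullet> e) = 0"
    then show False using assms(3)[of a b t] unfolding bary_add by simp
  qed
  finally show ?thesis
    by (simp add: indicator_def mem_simplex_iff 1)
qed

definition generic_contraction :: "'a \<Rightarrow> real \<Rightarrow> 'a \<Rightarrow> bool" where
  "generic_contraction c \<theta> x \<longleftrightarrow>
     (\<forall>a\<in>C. bary C a x \<noteq> 0 \<and> bary C a (x + (1 - \<theta>) *\<^sub>R (c - x)) \<noteq> 0 \<and>
        (\<forall>b\<in>C. a \<noteq> b \<longrightarrow> (\<forall>t\<in>{0..1}. \<not> (bary C a (x + t *\<^sub>R ((1 - \<theta>) *\<^sub>R (c - x))) = 0 \<and>
            bary C b (x + t *\<^sub>R ((1 - \<theta>) *\<^sub>R (c - x))) = 0))))"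

lemma negligible_bary_combination:
  assumes "a \<in> C" "b \<in> C" "a \<noteq> b" "\<alpha> \<noteq> 0 \<or> \<beta> \<noteq> 0"
  shows "negligible {x. \<alpha> * bary C a x + \<beta> * bary C b x = 0}"
proof -
  define g where "g = \<alpha> *\<^sub>R bary_grad C a + \<beta> *\<^sub>R bary_grad C b"
  define k where "k = \<alpha> * bary C a 0 + \<beta> * bary C b 0"
  have h: "\<alpha> * bary C a x + \<beta> * bary C b x = k + g \<bullet> x" for x
    by (simp add: g_def k_def bary_def inner_diff_right inner_add_left algebra_simps)
  have "g \<noteq> 0 \<or> - k \<noteq> 0"
  proof (rule ccontr)
    assume "\<not> (g \<noteq> 0 \<or> - k \<noteq> 0)"
    then have z: "\<alpha> * bary C a x + \<beta> * bary C b x = 0" for x unfolding h by simp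
    show False using z[of a] z[of b] assms by (simp add: bary_vertex split: if_splits)
  qed
  then have "negligible {x. g \<bullet> x = - k}" by (rule negligible_hyperplane)
  moreover have "{x. \<alpha> * bary C a x + \<beta> * bary C b x = 0} = {x. g \<bullet> x = - k}"
    unfolding h by (auto simp: add_eq_0_iff)
  ultimately show ?thesis by simp
qed

lemma negligible_bary_zero: "a \<in> C \<Longrightarrow> negligible {x. bary C a x = 0}"
  by (rule other_vertex[of a], assumption) (use negligible_bary_combination[of a _ 1 0] in auto)

lemma negligible_not_generic:
  assumes "0 < \<theta>" "\<theta> < 1"
  shows "negligible {x. \<not> generic_contraction c \<theta> x}"
proof -
  let ?N1 = "\<lambda>a. {x. bary C a x = 0}"
  let ?N2 = "\<lambda>a. {x. bary C a (x + (1 - \<theta>) *\<^sub>R (c - x)) = 0}"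
  let ?N3 = "\<lambda>a b. {x. \<exists>t\<in>{0..1}. bary C a (x + t *\<^sub>R ((1 - \<theta>) *\<^sub>R (c - x))) = 0 \<and>
            bary C b (x + t *\<^sub>R ((1 - \<theta>) *\<^sub>R (c - x))) = 0}"
  have path: "bary C a (x + s *\<^sub>R (c - x)) = (1 - s) * bary C a x + s * bary C a c" for a s x
    unfolding bary_add bary_diff[of a c x, symmetric] by (simp add: algebra_simps)
  have N2: "negligible (?N2 a)" if a: "a \<in> C" for a
  proof -
    have "\<theta> *\<^sub>R bary_grad C a \<noteq> 0" using bary_grad_nonzero[OF a] assms by simp
    then have "negligible {x. (\<theta> *\<^sub>R bary_grad C a) \<bullet> x = \<theta> * (bary_grad C a \<bullet> a) - \<theta> - (1 - \<theta>) * bary C a c}"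
      by (intro negligible_hyperplane) auto
    moreover have "?N2 a = {x. (\<theta> *\<^sub>R bary_grad C a) \<bullet> x = \<theta> * (bary_grad C a \<bullet> a) - \<theta> - (1 - \<theta>) * bary C a c}"
      unfolding path by (auto simp: bary_def inner_diff_right algebra_simps)
    ultimately show ?thesis by simp
  qed
  have N3: "negligible (?N3 a b)" if ab: "a \<in> C" "b \<in> C" "a \<noteq> b" for a b
  proof -
    obtain \<alpha> \<beta> where \<alpha>\<beta>: "\<alpha> \<noteq> 0 \<or> \<beta> \<noteq> 0" "\<alpha> * bary C a c + \<beta> * bary C b c = 0"
    proof (cases "bary C a c = 0")
      case True then show ?thesis using that[of 1 0] by simp
    next
      case False then show ?thesis using that[of "bary C b c" "- bary C a c"] by simp
    qed
    have "?N3 a b \<subseteq> {x. \<alpha> * bary C a x + \<beta> * bary C b x = 0}"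
    proof safe
      fix x t assume t: "t \<in> {0..1::real}" and z: "bary C a (x + t *\<^sub>R ((1 - \<theta>) *\<^sub>R (c - x))) = 0"
            "bary C b (x + t *\<^sub>R ((1 - \<theta>) *\<^sub>R (c - x))) = 0"
      define s where "s = t * (1 - \<theta>)"
      have "s \<le> 1 * (1 - \<theta>)" unfolding s_def using t assms by (intro mult_right_mono) auto
      then have s: "1 - s > 0" using assms by simp
      have za: "(1 - s) * bary C a x = - s * bary C a c" and zb: "(1 - s) * bary C b x = - s * bary C b c"
        using z path[of a x s] path[of b x s] by (simp_all add: s_def)
      have "(1 - s) * (\<alpha> * bary C a x + \<beta> * bary C b x) = \<alpha> * ((1 - s) * bary C a x) + \<beta> * ((1 - s) * bary C b x)"
        by (simp add: algebra_simps)
      also have "\<dots> = - s * (\<alpha> * bary C a c + \<beta> * bary C b c)" unfolding za zb by (simp add: algebra_simps)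
      also have "\<dots> = 0" using \<alpha>\<beta>(2) by simp
      finally show "\<alpha> * bary C a x + \<beta> * bary C b x = 0" using s by simp
    qed
    then show ?thesis using negligible_bary_combination[OF ab \<alpha>\<beta>(1)] negligible_subset by blast
  qed
  have "negligible (\<Union>a\<in>C. ?N1 a \<union> ?N2 a \<union> (\<Union>b\<in>C - {a}. ?N3 a b))"
    using finite_C N2 N3 negligible_bary_zero
    by (intro negligible_Union finite_imageI) (auto intro!: negligible_Un negligible_Union)
  then show ?thesis
    by (rule negligible_subset) (auto simp: generic_contraction_def)
qed

end

lemma tube_cover:
  fixes p e :: "'a::euclidean_space"
  assumes H: "0 < h" "h \<le> H" and e: "norm e \<le> L" and K: "0 \<le> K"
  defines "A \<equiv> (1 + 2 * H) * unit_ball_vol (real DIM('a)) * (K + L) ^ DIM('a)"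
  obtains R where "R \<in> lmeasurable" "{p + \<sigma> *\<^sub>R e + z |\<sigma> z. 0 \<le> \<sigma> \<and> \<sigma> \<le> 1 \<and> norm z \<le> K * h} \<subseteq> R"
    "measure lebesgue R \<le> A * h ^ (DIM('a) - 1)"
proof -
  define N where "N = nat \<lceil>1 / h\<rceil>"
  have N: "1 / h \<le> N" "N \<le> 1 / h + 1" "0 < N"
  proof -
    have "0 < 1 / h" using H(1) by simp
    then have "real N = of_int \<lceil>1 / h\<rceil>" "0 < \<lceil>1 / h\<rceil>" unfolding N_def by auto
    then show "1 / h \<le> N" "N \<le> 1 / h + 1" "0 < N" by (linarith | simp)+
  qed
  have L: "0 \<le> L" using e norm_ge_zero order_trans by blast
  define R where "R = (\<Union>j\<in>{..N}. cball (p + (real j / real N) *\<^sub>R e) ((K + L) * h))"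
  have "{p + \<sigma> *\<^sub>R e + z |\<sigma> z. 0 \<le> \<sigma> \<and> \<sigma> \<le> 1 \<and> norm z \<le> K * h} \<subseteq> R"
  proof safe
    fix \<sigma> :: real and z :: 'a assume s: "0 \<le> \<sigma>" "\<sigma> \<le> 1" and z: "norm z \<le> K * h"
    define j where "j = nat \<lfloor>\<sigma> * N\<rfloor>"
    have fl: "0 \<le> \<lfloor>\<sigma> * N\<rfloor>" using s by simp
    then have "real j = of_int \<lfloor>\<sigma> * N\<rfloor>" unfolding j_def by simp
    then have j: "j \<le> \<sigma> * N" "\<sigma> * N < j + 1" by linarith+
    have "\<sigma> * N \<le> N" using s by (simp add: mult_left_le_one_le)
    then have jN: "j \<le> N" using j(1) by linarith
    have "\<bar>\<sigma> - real j / real N\<bar> = \<bar>\<sigma> * N - j\<bar> / N" using N(3) by (simp add: abs_div_pos field_simps flip: abs_divide)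
    also have "\<dots> \<le> 1 / N" using j by (intro divide_right_mono) auto
    also have "\<dots> \<le> h" using N H(1) by (simp add: field_simps)
    finally have "\<bar>\<sigma> - real j / real N\<bar> \<le> h" .
    then have "\<bar>\<sigma> - real j / real N\<bar> * norm e \<le> h * L" using e by (intro mult_mono) auto
    then have le: "\<bar>\<sigma> - real j / real N\<bar> * norm e + norm z \<le> h * L + K * h" using z by linarith
    have "norm ((\<sigma> - real j / real N) *\<^sub>R e + z) \<le> norm ((\<sigma> - real j / real N) *\<^sub>R e) + norm z"
      by (rule norm_triangle_ineq)
    also have "\<dots> \<le> (K + L) * h" using le unfolding norm_scaleR by (simp only: distrib_right mult.commute[of h L] add.commute[of "L * h"])
    finally have "norm ((\<sigma> - real j / real N) *\<^sub>R e + z) \<le> (K + L) * h" .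
    then have "p + \<sigma> *\<^sub>R e + z \<in> cball (p + (real j / real N) *\<^sub>R e) ((K + L) * h)"
      by (simp add: mem_cball dist_norm norm_minus_commute algebra_simps)
    then show "p + \<sigma> *\<^sub>R e + z \<in> R" unfolding R_def using jN by blast
  qed
  moreover have "R \<in> lmeasurable" unfolding R_def by (intro fmeasurable.finite_UN) auto
  moreover have "measure lebesgue R \<le> A * h ^ (DIM('a) - 1)"
  proof -
    let ?V = "unit_ball_vol (real DIM('a)) * ((K + L) * h) ^ DIM('a)"
    have V0: "0 \<le> ?V" using K L H(1) by simp
    have "measure lebesgue R \<le> (\<Sum>j\<in>{..N}. measure lebesgue (cball (p + (real j / real N) *\<^sub>R e) ((K + L) * h)))"
      unfolding R_def by (intro measure_UNION_le) auto
    also have "\<dots> = (\<Sum>j\<in>{..N}. ?V)"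
      using K L H(1) by (intro sum.cong) (simp_all add: content_cball)
    also have "\<dots> = (N + 1) * ?V" by simp
    also have "\<dots> \<le> ((1 + 2 * H) / h) * ?V"
      using N(2) H V0 by (intro mult_right_mono) (auto simp: field_simps)
    also have "\<dots> = A * (h ^ DIM('a) / h)" unfolding A_def by (simp add: power_mult_distrib)
    also have "h ^ DIM('a) / h = h ^ (DIM('a) - 1)"
      using H(1) DIM_positive[where 'a='a] by (metis less_irrefl nonzero_mult_div_cancel_left power_eq_if)
    finally show ?thesis .
  qed
  ultimately show ?thesis using that by blast
qed

definition verts :: "'a::euclidean_space set \<Rightarrow> 'a set" where
  "verts T = {x. x extreme_point_of T}"

definition simplicial :: "'a::euclidean_space set set \<Rightarrow> bool" where
  "simplicial \<T> \<longleftrightarrow> finite \<T> \<and> (\<forall>T\<in>\<T>. int DIM('a) simplex T)"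

definition opp :: "'a::euclidean_space set \<Rightarrow> 'a set \<Rightarrow> 'a" where
  "opp T F = (SOME a. a \<in> verts T \<and> F = convex hull (verts T - {a}))"

definition facets :: "'a::euclidean_space set set \<Rightarrow> 'a set set" where
  "facets \<T> = {F. \<exists>T\<in>\<T>. F facet_of T}"

definition facet_grad :: "'a::euclidean_space set \<Rightarrow> 'a set \<Rightarrow> 'a" where
  "facet_grad T F = bary_grad (verts T) (opp T F)"

definition facet_normal :: "'a::euclidean_space set \<Rightarrow> 'a" where
  "facet_normal F = (SOME n. n \<noteq> 0 \<and> (\<exists>b. \<forall>x\<in>F. n \<bullet> x = b))"

definition orient :: "'a::euclidean_space set \<Rightarrow> 'a set \<Rightarrow> real" where
  "orient T F = sgn (facet_grad T F \<bullet> facet_normal F)"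

definition jump :: "'a::euclidean_space set set \<Rightarrow> ('a set \<Rightarrow> real) \<Rightarrow> 'a set \<Rightarrow> real" where
  "jump \<T> w F = (\<Sum>T\<in>{T\<in>\<T>. F facet_of T}. orient T F * w T)"

lemma simplex_verts:
  fixes T :: "'a::euclidean_space set"
  assumes "int DIM('a) simplex T"
  shows "full_simplex (verts T)" "T = convex hull (verts T)"
proof -
  obtain C where C: "\<not> affine_dependent C" "int (card C) = int DIM('a) + 1" "T = convex hull C"
    using assms unfolding simplex_def by blast
  have "verts T = C"
    unfolding verts_def C(3) extreme_point_of_convex_hull_affine_independent[OF C(1)] by simp
  then show "full_simplex (verts T)" "T = convex hull (verts T)"
    using C by (auto simp: full_simplex_def)
qed

lemma facet_simplex_iff:
  fixes T :: "'a::euclidean_space set"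
  assumes "int DIM('a) simplex T"
  shows "F facet_of T \<longleftrightarrow> (\<exists>a\<in>verts T. F = convex hull (verts T - {a}))"
  using full_simplex.facet_iff[OF simplex_verts(1)[OF assms]] simplex_verts(2)[OF assms] by simp

lemma opp_facet:
  fixes T :: "'a::euclidean_space set"
  assumes "int DIM('a) simplex T" "F facet_of T"
  shows "opp T F \<in> verts T" "F = convex hull (verts T - {opp T F})"
proof -
  have "\<exists>a. a \<in> verts T \<and> F = convex hull (verts T - {a})"
    using facet_simplex_iff[OF assms(1)] assms(2) by blast
  then have "opp T F \<in> verts T \<and> F = convex hull (verts T - {opp T F})"
    unfolding opp_def by (rule someI_ex)
  then show "opp T F \<in> verts T" "F = convex hull (verts T - {opp T F})" by blast+
qed

lemma opp_unique:
  fixes T :: "'a::euclidean_space set"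
  assumes "int DIM('a) simplex T" "a \<in> verts T"
  shows "opp T (convex hull (verts T - {a})) = a"
proof -
  interpret full_simplex "verts T" by (rule simplex_verts(1)[OF assms(1)])
  let ?F = "convex hull (verts T - {a})"
  have "?F facet_of T" using facet_simplex_iff[OF assms(1)] assms(2) by blast
  note o = opp_facet[OF assms(1) this]
  show ?thesis
  proof (rule ccontr)
    assume "opp T ?F \<noteq> a"
    then have "opp T ?F \<in> ?F" using o(1) by (intro hull_inc) auto
    then show False using vertex_not_in_facet[OF o(1)] o(2) by simp
  qed
qed

lemma facets_bij:
  fixes T :: "'a::euclidean_space set"
  assumes "int DIM('a) simplex T"
  shows "bij_betw (\<lambda>a. convex hull (verts T - {a})) (verts T) {F. F facet_of T}"
proof (rule bij_betw_imageI)
  show "inj_on (\<lambda>a. convex hull (verts T - {a})) (verts T)"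
    by (rule inj_on_inverseI[where g = "opp T"]) (rule opp_unique[OF assms])
  show "(\<lambda>a. convex hull (verts T - {a})) ` verts T = {F. F facet_of T}"
    using facet_simplex_iff[OF assms] by auto
qed

lemma facet_orient:
  fixes T :: "'a::euclidean_space set"
  assumes "int DIM('a) simplex T" "F facet_of T"
  obtains k where "k \<noteq> 0" "facet_grad T F = k *\<^sub>R facet_normal F" "orient T F = sgn k" "facet_normal F \<noteq> 0"
proof -
  interpret full_simplex "verts T" by (rule simplex_verts(1)[OF assms(1)])
  note o = opp_facet(1)[OF assms] opp_facet(2)[OF assms, symmetric]
  have "facet_grad T F \<bullet> x = facet_grad T F \<bullet> opp T F - 1" if "x \<in> F" for x
  proof -
    have "bary (verts T) (opp T F) x = 0" using that mem_facet_iff[OF o(1), of x] unfolding o(2) by blast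
    then show ?thesis by (simp add: bary_def facet_grad_def inner_diff_right)
  qed
  then have "\<exists>n. n \<noteq> 0 \<and> (\<exists>b. \<forall>x\<in>F. n \<bullet> x = b)"
    using bary_grad_nonzero[OF o(1)] unfolding facet_grad_def by blast
  then have n: "facet_normal F \<noteq> 0 \<and> (\<exists>b. \<forall>x\<in>F. facet_normal F \<bullet> x = b)"
    unfolding facet_normal_def by (rule someI_ex)
  then obtain b where b: "\<forall>x\<in>F. facet_normal F \<bullet> x = b" by blast
  have nb: "facet_normal F \<bullet> c = b" if "c \<in> verts T - {opp T F}" for c
    using b hull_inc[OF that, of convex] unfolding o(2) by blast
  obtain k where k: "k \<noteq> 0" "facet_grad T F = k *\<^sub>R facet_normal F"
    using normal_parallel[OF o(1) conjunct1[OF n] nb] unfolding facet_grad_def by blast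
  have "facet_normal F \<bullet> facet_normal F > 0" using n by simp
  then have "orient T F = sgn k"
    unfolding orient_def k(2) inner_scaleR_left sgn_mult by simp
  then show ?thesis using that[OF k] n by blast
qed

lemma finite_facets:
  fixes \<T> :: "'a::euclidean_space set set"
  assumes "simplicial \<T>" shows "finite (facets \<T>)"
proof -
  have "facets \<T> = (\<Union>T\<in>\<T>. {F. F facet_of T})" unfolding facets_def by auto
  then show ?thesis
    using assms unfolding simplicial_def by (auto intro!: finite_polytope_facets simplex_imp_polytope)
qed

lemma piecewise_crossing:
  fixes \<T> :: "'a::euclidean_space set set"
  assumes \<T>: "simplicial \<T>"
    and gen: "\<And>T. T \<in> \<T> \<Longrightarrow> full_simplex.generic_contraction (verts T) c \<theta> x"
  defines "e \<equiv> (1 - \<theta>) *\<^sub>R (c - x)"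
  shows "(\<Sum>T\<in>\<T>. w T * indicator T (x + e)) - (\<Sum>T\<in>\<T>. w T * indicator T x)
    = (\<Sum>F\<in>facets \<T>. if \<exists>t\<in>{0..1}. x + t *\<^sub>R e \<in> F then sgn (facet_normal F \<bullet> e) * jump \<T> w F else 0)"
proof -
  let ?hit = "\<lambda>F. \<exists>t\<in>{0..1}. x + t *\<^sub>R e \<in> F"
  have fin: "finite \<T>" and simp\<T>: "\<And>T. T \<in> \<T> \<Longrightarrow> int DIM('a) simplex T" using \<T> unfolding simplicial_def by auto
  have one: "w T * indicator T (x + e) - w T * indicator T x
     = (\<Sum>F\<in>{F\<in>facets \<T>. F facet_of T}. if ?hit F then w T * orient T F * sgn (facet_normal F \<bullet> e) else 0)"
    if T: "T \<in> \<T>" for T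
  proof -
    note sT = simp\<T>[OF T]
    interpret full_simplex "verts T" by (rule simplex_verts(1)[OF sT])
    have g: "generic_contraction c \<theta> x" using gen[OF T] .
    have "(\<Sum>a\<in>verts T. if ?hit (convex hull (verts T - {a})) then sgn (bary_grad (verts T) a \<bullet> e) else 0 :: real)
       = indicator (convex hull (verts T)) (x + e) - indicator (convex hull (verts T)) x"
    proof (rule simplex_crossing)
      show "bary (verts T) a x \<noteq> 0" "bary (verts T) a (x + e) \<noteq> 0" if "a \<in> verts T" for a
        using g that unfolding generic_contraction_def e_def by blast+
      show False if "a \<in> verts T" "b \<in> verts T" "a \<noteq> b" "t \<in> {0..1}"
        "bary (verts T) a (x + t *\<^sub>R e) = 0" "bary (verts T) b (x + t *\<^sub>R e) = 0" for a b t
        using g that unfolding generic_contraction_def e_def by blast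
    qed
    then have "indicator T (x + e) - indicator T x
       = (\<Sum>a\<in>verts T. if ?hit (convex hull (verts T - {a})) then sgn (bary_grad (verts T) a \<bullet> e) else 0 :: real)"
      unfolding simplex_verts(2)[OF sT, symmetric] by (rule sym)
    also have "\<dots> = (\<Sum>a\<in>verts T. (\<lambda>F. if ?hit F then sgn (facet_grad T F \<bullet> e) else 0) (convex hull (verts T - {a})))"
      by (intro sum.cong refl) (simp add: facet_grad_def opp_unique[OF sT])
    also have "\<dots> = (\<Sum>F\<in>{F. F facet_of T}. if ?hit F then sgn (facet_grad T F \<bullet> e) else 0)"
      by (rule sum.reindex_bij_betw[OF facets_bij[OF sT]])
    also have "\<dots> = (\<Sum>F\<in>{F. F facet_of T}. if ?hit F then orient T F * sgn (facet_normal F \<bullet> e) else 0)"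
    proof (intro sum.cong refl)
      fix F assume "F \<in> {F. F facet_of T}"
      then have "F facet_of T" by simp
      then obtain k where "facet_grad T F = k *\<^sub>R facet_normal F" "orient T F = sgn k"
        using facet_orient[OF sT] by metis
      then show "(if ?hit F then sgn (facet_grad T F \<bullet> e) else 0) = (if ?hit F then orient T F * sgn (facet_normal F \<bullet> e) else 0)"
        by (simp add: sgn_mult)
    qed
    also have "{F. F facet_of T} = {F\<in>facets \<T>. F facet_of T}" using T unfolding facets_def by auto
    finally have "w T * (indicator T (x + e) - indicator T x)
      = w T * (\<Sum>F\<in>{F\<in>facets \<T>. F facet_of T}. if ?hit F then orient T F * sgn (facet_normal F \<bullet> e) else 0)" by simp
    also have "\<dots> = (\<Sum>F\<in>{F\<in>facets \<T>. F facet_of T}. if ?hit F then w T * orient T F * sgn (facet_normal F \<bullet> e) else 0)"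
      unfolding sum_distrib_left by (intro sum.cong refl) simp
    finally show ?thesis unfolding right_diff_distrib .
  qed
  have "(\<Sum>T\<in>\<T>. w T * indicator T (x + e)) - (\<Sum>T\<in>\<T>. w T * indicator T x)
     = (\<Sum>T\<in>\<T>. \<Sum>F\<in>{F\<in>facets \<T>. F facet_of T}. if ?hit F then w T * orient T F * sgn (facet_normal F \<bullet> e) else 0)"
    unfolding sum_subtractf[symmetric] by (intro sum.cong refl one)
  also have "\<dots> = (\<Sum>F\<in>facets \<T>. \<Sum>T\<in>{T\<in>\<T>. F facet_of T}. if ?hit F then w T * orient T F * sgn (facet_normal F \<bullet> e) else 0)"
    by (rule sum.swap_restrict[OF fin finite_facets[OF \<T>]])
  also have "\<dots> = (\<Sum>F\<in>facets \<T>. if ?hit F then sgn (facet_normal F \<bullet> e) * jump \<T> w F else 0)"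
  proof (intro sum.cong refl)
    fix F
    have "(\<Sum>T\<in>{T\<in>\<T>. F facet_of T}. w T * orient T F * sgn (facet_normal F \<bullet> e)) = sgn (facet_normal F \<bullet> e) * jump \<T> w F"
      unfolding jump_def sum_distrib_left by (intro sum.cong refl) (simp only: mult_ac)
    then show "(\<Sum>T\<in>{T\<in>\<T>. F facet_of T}. if ?hit F then w T * orient T F * sgn (facet_normal F \<bullet> e) else 0)
       = (if ?hit F then sgn (facet_normal F \<bullet> e) * jump \<T> w F else 0)" by simp
  qed
  finally show ?thesis .
qed

lemma diameter_facet_pos:
  fixes T :: "'a::euclidean_space set"
  assumes "int DIM('a) simplex T" "F facet_of T" "2 \<le> DIM('a)"
  shows "0 < diameter F"
proof -
  interpret full_simplex "verts T" by (rule simplex_verts(1)[OF assms(1)])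
  note o = opp_facet[OF assms(1,2)]
  have "card (verts T - {opp T F}) \<ge> 2" using card_C assms(3) o(1) finite_C by simp
  then obtain a b where ab: "a \<in> verts T - {opp T F}" "b \<in> verts T - {opp T F}" "a \<noteq> b"
    by (metis card_le_Suc0_iff_eq card.infinite not_less_eq_eq numeral_2_eq_2 le_zero_eq nat.distinct(1))
  have "a \<in> F" "b \<in> F"
    using hull_inc[OF ab(1), of convex] hull_inc[OF ab(2), of convex] unfolding o(2)[symmetric] by blast+
  moreover have "bounded F"
    by (subst o(2)) (intro compact_imp_bounded finite_imp_compact_convex_hull finite_Diff finite_C)
  ultimately have "dist a b \<le> diameter F" by (intro diameter_bounded_bound)
  then show ?thesis using ab(3) by (metis dist_pos_lt less_le_trans)
qed

definition mass :: "'a::euclidean_space set set \<Rightarrow> ('a set \<Rightarrow> real) \<Rightarrow> 'a set \<Rightarrow> real" where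
  "mass \<T> w B = (\<Sum>T\<in>\<T>. w T * measure lebesgue (T \<inter> B))"

lemma contraction_estimate:
  fixes \<theta> R :: real
  assumes \<theta>: "0 < \<theta>" "\<theta> < 1" and R: "0 < R" and dim: "2 \<le> DIM('a::euclidean_space)"
  obtains A where "0 \<le> A" "\<And>\<T> w Q B c. simplicial \<T> \<Longrightarrow> (\<And>T. T \<in> \<T> \<Longrightarrow> 0 \<le> w T) \<Longrightarrow> \<Union>\<T> \<subseteq> cball c R \<Longrightarrow>
     convex Q \<Longrightarrow> Q \<in> lmeasurable \<Longrightarrow> c \<in> Q \<Longrightarrow> B \<in> sets lebesgue \<Longrightarrow>
     (\<lambda>x. x + (1 - \<theta>) *\<^sub>R (c - x)) ` Q \<subseteq> B \<Longrightarrow>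
     mass \<T> w Q \<le> inverse \<theta> ^ DIM('a) * mass \<T> w B +
        A * (\<Sum>F\<in>{F\<in>facets \<T>. F \<inter> Q \<noteq> {}}. diameter F ^ (DIM('a) - 1) * \<bar>jump \<T> w (F::'a set)\<bar>)"
proof -
  define L where "L = (1 / \<theta> - 1) * R"
  define A where "A = (1 + 2 * (2 * R)) * unit_ball_vol (real DIM('a)) * (1 / \<theta> + L) ^ DIM('a)"
  have \<theta>1: "1 / \<theta> - 1 > 0" using \<theta> by (simp add: field_simps)
  have L: "0 \<le> L" unfolding L_def using \<theta>1 R by simp
  have A0: "0 \<le> A" unfolding A_def using R L \<theta> by (intro mult_nonneg_nonneg zero_le_power add_nonneg_nonneg) auto
  show ?thesis
  proof (rule that[OF A0])
    fix \<T> and w :: "'a set \<Rightarrow> real" and Q B :: "'a set" and c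
    assume \<T>: "simplicial \<T>" and w: "\<And>T. T \<in> \<T> \<Longrightarrow> 0 \<le> w T" and bd: "\<Union>\<T> \<subseteq> cball c R"
      and Q: "convex Q" "Q \<in> lmeasurable" and c: "c \<in> Q" and B: "B \<in> sets lebesgue"
      and im: "(\<lambda>x. x + (1 - \<theta>) *\<^sub>R (c - x)) ` Q \<subseteq> B"
    define m where "m x = x + (1 - \<theta>) *\<^sub>R (c - x)" for x
    define FQ where "FQ = {F\<in>facets \<T>. F \<inter> Q \<noteq> {}}"
    have fin: "finite \<T>" and simp\<T>: "\<And>T. T \<in> \<T> \<Longrightarrow> int DIM('a) simplex T" using \<T> unfolding simplicial_def by auto
    have finF: "finite FQ" using finite_facets[OF \<T>] unfolding FQ_def by simp
    have "\<exists>U. U \<in> lmeasurable \<and> measure lebesgue U \<le> A * diameter F ^ (DIM('a) - 1) \<and>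
       (\<forall>x. (\<exists>t\<in>{0..1}. x + t *\<^sub>R ((1 - \<theta>) *\<^sub>R (c - x)) \<in> F) \<longrightarrow> x \<in> U)" if F: "F \<in> FQ" for F
    proof -
      obtain T where T: "T \<in> \<T>" "F facet_of T" using F unfolding FQ_def facets_def by auto
      have FT: "F \<subseteq> T" using T(2) by (rule facet_of_imp_subset)
      then have FR: "F \<subseteq> cball c R" using T(1) bd by blast
      then have bF: "bounded F" using bounded_subset bounded_cball by blast
      have dF: "0 < diameter F" using diameter_facet_pos[OF simp\<T>[OF T(1)] T(2) dim] .
      have "diameter F \<le> diameter (cball c R)" using FR bounded_cball by (rule diameter_subset)
      then have dF2: "diameter F \<le> 2 * R" using R by (simp add: diameter_cball split: if_splits)
      obtain y0 where y0: "y0 \<in> F" using F unfolding FQ_def by auto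
      let ?e = "(1 / \<theta> - 1) *\<^sub>R (y0 - c)"
      have "norm (y0 - c) \<le> R" using y0 FR by (auto simp: dist_norm norm_minus_commute)
      then have "norm ?e \<le> L" unfolding L_def using \<theta>1 by (simp add: mult_left_mono)
      then obtain U where U: "U \<in> lmeasurable"
        "{y0 + \<sigma> *\<^sub>R ?e + z |\<sigma> z. 0 \<le> \<sigma> \<and> \<sigma> \<le> 1 \<and> norm z \<le> 1 / \<theta> * diameter F} \<subseteq> U"
        "measure lebesgue U \<le> A * diameter F ^ (DIM('a) - 1)"
        unfolding A_def using tube_cover[OF dF dF2, of ?e L "1 / \<theta>" y0] \<theta> by auto
      have "x \<in> U" if xt: "t \<in> {0..1}" "x + t *\<^sub>R ((1 - \<theta>) *\<^sub>R (c - x)) \<in> F" for x t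
      proof -
        define s where "s = 1 - t * (1 - \<theta>)"
        define y where "y = x + t *\<^sub>R ((1 - \<theta>) *\<^sub>R (c - x))"
        have "t * (1 - \<theta>) \<le> 1 * (1 - \<theta>)" using xt \<theta> by (intro mult_right_mono) auto
        moreover have "0 \<le> t * (1 - \<theta>)" using xt \<theta> by simp
        ultimately have s: "\<theta> \<le> s" "s \<le> 1" unfolding s_def by auto
        have s0: "s > 0" using s \<theta> by linarith
        have ys: "y - c = s *\<^sub>R (x - c)"
          unfolding y_def s_def by (simp add: algebra_simps)
        have "(1 / s) *\<^sub>R (y - c) = x - c" unfolding ys using s0 by simp
        then have "x = c + (1 / s) *\<^sub>R (y - c)" by simp
        define \<sigma> where "\<sigma> = (1 / s - 1) / (1 / \<theta> - 1)"
        have "1 / s \<le> 1 / \<theta>" using s \<theta> by (simp add: frac_le)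
        moreover have "1 \<le> 1 / s" using s s0 by simp
        ultimately have sg: "0 \<le> \<sigma>" "\<sigma> \<le> 1" unfolding \<sigma>_def using \<theta>1 by (auto simp: divide_le_eq_1)
        have "1 / \<theta> - 1 \<noteq> 0" using \<theta>1 by linarith
        then have "\<sigma> * (1 / \<theta> - 1) = 1 / s - 1" unfolding \<sigma>_def times_divide_eq_left
          by (rule nonzero_mult_div_cancel_right)
        then have "\<sigma> *\<^sub>R ?e = (1 / s - 1) *\<^sub>R (y0 - c)" by (metis scaleR_scaleR)
        then have "x = y0 + \<sigma> *\<^sub>R ?e + (1 / s) *\<^sub>R (y - y0)"
        proof -
          have "y0 + (1 / s - 1) *\<^sub>R (y0 - c) + (1 / s) *\<^sub>R (y - y0) = c + (1 / s) *\<^sub>R (y - c)"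
            by (simp add: scaleR_diff_right scaleR_diff_left)
          then show ?thesis
            using \<open>x = c + (1 / s) *\<^sub>R (y - c)\<close> \<open>\<sigma> *\<^sub>R ?e = (1 / s - 1) *\<^sub>R (y0 - c)\<close> by (simp only:)
        qed
        moreover have "norm ((1 / s) *\<^sub>R (y - y0)) \<le> 1 / \<theta> * diameter F"
        proof -
          have "norm (y - y0) \<le> diameter F"
            using diameter_bounded_bound[OF bF, of y y0] xt(2) y0 unfolding y_def by (simp add: dist_norm)
          then have "1 / s * norm (y - y0) \<le> 1 / \<theta> * diameter F"
            using \<open>1 / s \<le> 1 / \<theta>\<close> \<theta> by (intro mult_mono) auto
          then show ?thesis using s0 by simp
        qed
        ultimately have "x \<in> {y0 + \<sigma> *\<^sub>R ?e + z |\<sigma> z. 0 \<le> \<sigma> \<and> \<sigma> \<le> 1 \<and> norm z \<le> 1 / \<theta> * diameter F}"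
          using sg by (intro CollectI exI[of _ \<sigma>] exI[of _ "(1 / s) *\<^sub>R (y - y0)"] conjI)
        then show "x \<in> U" using U(2) by (rule subsetD[rotated])
      qed
      then show ?thesis using U by blast
    qed
    then obtain U where *: "\<forall>F\<in>FQ. U F \<in> lmeasurable \<and> measure lebesgue (U F) \<le> A * diameter F ^ (DIM('a) - 1) \<and>
       (\<forall>x. (\<exists>t\<in>{0..1}. x + t *\<^sub>R ((1 - \<theta>) *\<^sub>R (c - x)) \<in> F) \<longrightarrow> x \<in> U F)"
      using bchoice[of FQ "\<lambda>F U. U \<in> lmeasurable \<and> measure lebesgue U \<le> A * diameter F ^ (DIM('a) - 1) \<and>
       (\<forall>x. (\<exists>t\<in>{0..1}. x + t *\<^sub>R ((1 - \<theta>) *\<^sub>R (c - x)) \<in> F) \<longrightarrow> x \<in> U)"] by blast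
    then have U: "\<And>F. F \<in> FQ \<Longrightarrow> U F \<in> lmeasurable"
      "\<And>F. F \<in> FQ \<Longrightarrow> measure lebesgue (U F) \<le> A * diameter F ^ (DIM('a) - 1)"
      "\<And>F x t. F \<in> FQ \<Longrightarrow> t \<in> {0..1} \<Longrightarrow> x + t *\<^sub>R ((1 - \<theta>) *\<^sub>R (c - x)) \<in> F \<Longrightarrow> x \<in> U F"
      by blast+
    have Tm: "T \<in> lmeasurable" if "T \<in> \<T>" for T
      using compact_simplex[OF simp\<T>[OF that]] lmeasurable_compact by blast
    have Bl: "(T \<inter> B) \<in> lmeasurable" "T \<inter> Q \<in> lmeasurable" if "T \<in> \<T>" for T
      using Tm[OF that] B Q(2) by (auto intro: fmeasurable_Int_fmeasurable fmeasurable.Int)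
    define P where "P T = (\<lambda>x. (1 / \<theta>) *\<^sub>R x + (1 - 1 / \<theta>) *\<^sub>R c) ` (T \<inter> B)" for T
    have Pmem: "x \<in> P T" if "m x \<in> T \<inter> B" for x T
    proof -
      have "x = (1 / \<theta>) *\<^sub>R m x + (1 - 1 / \<theta>) *\<^sub>R c"
      proof -
        have "m x = \<theta> *\<^sub>R x + (1 - \<theta>) *\<^sub>R c" unfolding m_def by (simp add: algebra_simps)
        then have "(1 / \<theta>) *\<^sub>R m x = x + (1 / \<theta> * (1 - \<theta>)) *\<^sub>R c" using \<theta> by (simp add: scaleR_add_right)
        moreover have "1 / \<theta> * (1 - \<theta>) + (1 - 1 / \<theta>) = 0" using \<theta> by (simp add: field_simps)
        ultimately show ?thesis by (metis add.assoc add.right_neutral scaleR_add_left scaleR_zero_left)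
      qed
      then show ?thesis unfolding P_def using that by blast
    qed
    have Pm: "P T \<in> lmeasurable" "measure lebesgue (P T) = inverse \<theta> ^ DIM('a) * measure lebesgue (T \<inter> B)" if "T \<in> \<T>" for T
    proof -
      have em: "emeasure lebesgue (P T) = \<bar>1 / \<theta>\<bar> ^ DIM('a) * emeasure lebesgue (T \<inter> B)"
        unfolding P_def by (rule emeasure_lebesgue_affine)
      have "P T \<in> sets lebesgue"
        unfolding P_def using Bl(1)[OF that]
        by (intro differentiable_image_in_sets_lebesgue) (auto intro!: derivative_intros)
      then show "P T \<in> lmeasurable"
        using em Bl(1)[OF that] by (simp add: fmeasurable_def ennreal_mult_less_top del: emeasure_completion)
      show "measure lebesgue (P T) = inverse \<theta> ^ DIM('a) * measure lebesgue (T \<inter> B)"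
        unfolding P_def using \<theta> by (subst measure_lebesgue_affine) (simp add: divide_inverse)
    qed
    define N where "N = (\<Union>T\<in>\<T>. {x. \<not> full_simplex.generic_contraction (verts T) c \<theta> x})"
    have "negligible N"
      unfolding N_def using fin full_simplex.negligible_not_generic[OF simplex_verts(1)[OF simp\<T>] \<theta>]
      by (intro negligible_Union finite_imageI) auto
    then have nullN: "N \<in> null_sets lebesgue" using negligible_iff_null_sets by blast
    have pw: "(\<Sum>T\<in>\<T>. w T * indicator (T \<inter> Q) x)
       \<le> (\<Sum>T\<in>\<T>. w T * indicator (P T) x) + (\<Sum>F\<in>FQ. \<bar>jump \<T> w F\<bar> * indicator (U F) x)" if x: "x \<notin> N" for x
    proof (cases "x \<in> Q")
      case False
      then have "indicator (T \<inter> Q) x = (0::real)" for T unfolding indicator_def by (metis IntD2 of_bool_eq(1))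
      then have "(\<Sum>T\<in>\<T>. w T * indicator (T \<inter> Q) x) = 0" by (simp only: mult_zero_right sum.neutral_const)
      moreover have "0 \<le> (\<Sum>T\<in>\<T>. w T * indicator (P T) x)" using w by (intro sum_nonneg mult_nonneg_nonneg) simp_all
      moreover have "0 \<le> (\<Sum>F\<in>FQ. \<bar>jump \<T> w F\<bar> * indicator (U F) x)" by (intro sum_nonneg mult_nonneg_nonneg) simp_all
      ultimately show ?thesis by linarith
    next
      case True
      have seg: "x + t *\<^sub>R ((1 - \<theta>) *\<^sub>R (c - x)) \<in> Q" if "t \<in> {0..1}" for t
      proof -
        have "t * (1 - \<theta>) \<le> 1 * 1" using that \<theta> by (intro mult_mono) auto
        moreover have "0 \<le> t * (1 - \<theta>)" using that \<theta> by simp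
        ultimately have "(1 - t * (1 - \<theta>)) *\<^sub>R x + (t * (1 - \<theta>)) *\<^sub>R c \<in> Q"
          using convexD_alt[OF Q(1) True c, of "t * (1 - \<theta>)"] by simp
        then show ?thesis by (simp add: algebra_simps)
      qed
      have "m x \<in> B" using im True unfolding m_def by auto
      then have "(\<Sum>T\<in>\<T>. w T * indicator T (m x)) \<le> (\<Sum>T\<in>\<T>. w T * indicator (P T) x)"
        using w Pmem by (intro sum_mono mult_left_mono) (auto simp: indicator_def)
      moreover have "(\<Sum>T\<in>\<T>. w T * indicator T (m x)) - (\<Sum>T\<in>\<T>. w T * indicator T x)
         = (\<Sum>F\<in>facets \<T>. if \<exists>t\<in>{0..1}. x + t *\<^sub>R ((1 - \<theta>) *\<^sub>R (c - x)) \<in> F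
               then sgn (facet_normal F \<bullet> ((1 - \<theta>) *\<^sub>R (c - x))) * jump \<T> w F else 0)" (is "_ = (\<Sum>F\<in>_. ?g F)")
        unfolding m_def using x by (intro piecewise_crossing[OF \<T>]) (auto simp: N_def)
      moreover have "- (\<Sum>F\<in>facets \<T>. ?g F) \<le> (\<Sum>F\<in>FQ. \<bar>jump \<T> w F\<bar> * indicator (U F) x)"
      proof -
        have "- (\<Sum>F\<in>facets \<T>. ?g F) \<le> (\<Sum>F\<in>facets \<T>. \<bar>?g F\<bar>)"
          by (rule abs_le_D2[OF sum_abs])
        also have "\<dots> = (\<Sum>F\<in>FQ. \<bar>?g F\<bar>)"
        proof (rule sum.mono_neutral_right[OF finite_facets[OF \<T>]])
          show "FQ \<subseteq> facets \<T>" unfolding FQ_def by blast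
          show "\<forall>F\<in>facets \<T> - FQ. \<bar>?g F\<bar> = 0"
          proof
            fix F assume "F \<in> facets \<T> - FQ"
            then have "F \<inter> Q = {}" unfolding FQ_def by blast
            then have "\<not> (\<exists>t\<in>{0..1}. x + t *\<^sub>R ((1 - \<theta>) *\<^sub>R (c - x)) \<in> F)" using seg by blast
            then show "\<bar>?g F\<bar> = 0" by (simp only: if_False abs_zero)
          qed
        qed
        also have "\<dots> \<le> (\<Sum>F\<in>FQ. \<bar>jump \<T> w F\<bar> * indicator (U F) x)"
        proof (intro sum_mono)
          fix F assume F: "F \<in> FQ"
          have "\<bar>sgn r * j\<bar> \<le> \<bar>j\<bar>" for r j :: real by (simp add: abs_mult abs_sgn_eq)
          show "\<bar>?g F\<bar> \<le> \<bar>jump \<T> w F\<bar> * indicator (U F) x"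
          proof (cases "\<exists>t\<in>{0..1}. x + t *\<^sub>R ((1 - \<theta>) *\<^sub>R (c - x)) \<in> F")
            case True
            then obtain t where t: "t \<in> {0..1}" "x + t *\<^sub>R ((1 - \<theta>) *\<^sub>R (c - x)) \<in> F" by blast
            have "x \<in> U F" by (rule U(3)[OF F t])
            then show ?thesis using True \<open>\<And>r j :: real. \<bar>sgn r * j\<bar> \<le> \<bar>j\<bar>\<close> by simp
          next
            case False
            then show ?thesis by (simp only: if_False) simp
          qed
        qed
        finally show ?thesis .
      qed
      moreover have "(\<Sum>T\<in>\<T>. w T * indicator (T \<inter> Q) x) = (\<Sum>T\<in>\<T>. w T * indicator T x)"
        using True by (intro sum.cong) (auto simp: indicator_def)
      ultimately show ?thesis by linarith
    qed
    have hb: "has_bochner_integral lebesgue (\<lambda>x. a * indicator S x) (a * measure lebesgue S)"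
      if "S \<in> lmeasurable" for a :: real and S :: "'a set"
      using that by (intro has_bochner_integral_mult_right has_bochner_integral_real_indicator) (auto simp: fmeasurable_def)
    have L: "has_bochner_integral lebesgue (\<lambda>x. \<Sum>T\<in>\<T>. w T * indicator (T \<inter> Q) x) (mass \<T> w Q)"
      unfolding mass_def using Bl(2) by (intro has_bochner_integral_sum hb)
    have R: "has_bochner_integral lebesgue (\<lambda>x. (\<Sum>T\<in>\<T>. w T * indicator (P T) x) + (\<Sum>F\<in>FQ. \<bar>jump \<T> w F\<bar> * indicator (U F) x))
       ((\<Sum>T\<in>\<T>. w T * measure lebesgue (P T)) + (\<Sum>F\<in>FQ. \<bar>jump \<T> w F\<bar> * measure lebesgue (U F)))"
      using Pm(1) U(1) by (intro has_bochner_integral_add has_bochner_integral_sum hb)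
    have "AE x in lebesgue. (\<Sum>T\<in>\<T>. w T * indicator (T \<inter> Q) x)
       \<le> (\<Sum>T\<in>\<T>. w T * indicator (P T) x) + (\<Sum>F\<in>FQ. \<bar>jump \<T> w F\<bar> * indicator (U F) x)"
      by (rule AE_I'[OF nullN]) (use pw in blast)
    then have 1: "mass \<T> w Q \<le> (\<Sum>T\<in>\<T>. w T * measure lebesgue (P T)) + (\<Sum>F\<in>FQ. \<bar>jump \<T> w F\<bar> * measure lebesgue (U F))"
      using integral_mono_AE[OF has_bochner_integral_iff[THEN iffD1, THEN conjunct1, OF L] has_bochner_integral_iff[THEN iffD1, THEN conjunct1, OF R]]
      unfolding has_bochner_integral_integral_eq[OF L] has_bochner_integral_integral_eq[OF R] by blast
    have 2: "(\<Sum>T\<in>\<T>. w T * measure lebesgue (P T)) = inverse \<theta> ^ DIM('a) * mass \<T> w B"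
      unfolding mass_def sum_distrib_left by (intro sum.cong) (auto simp: Pm(2))
    have "(\<Sum>F\<in>FQ. \<bar>jump \<T> w F\<bar> * measure lebesgue (U F)) \<le> (\<Sum>F\<in>FQ. \<bar>jump \<T> w F\<bar> * (A * diameter F ^ (DIM('a) - 1)))"
      by (intro sum_mono mult_left_mono U(2)) auto
    also have "\<dots> = A * (\<Sum>F\<in>FQ. diameter F ^ (DIM('a) - 1) * \<bar>jump \<T> w F\<bar>)"
      unfolding sum_distrib_left by (intro sum.cong refl) (simp only: mult_ac)
    finally show "mass \<T> w Q \<le> inverse \<theta> ^ DIM('a) * mass \<T> w B +
        A * (\<Sum>F\<in>{F\<in>facets \<T>. F \<inter> Q \<noteq> {}}. diameter F ^ (DIM('a) - 1) * \<bar>jump \<T> w F\<bar>)"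
      using 1 2 unfolding FQ_def by linarith
  qed
qed

definition jump_sum :: "'a::euclidean_space set \<Rightarrow> 'a set \<Rightarrow> 'a set set \<Rightarrow> ('a set \<Rightarrow> real) \<Rightarrow> real" where
  "jump_sum \<Omega> N \<T> w = (\<Sum>F\<in>{F\<in>facets \<T>. \<not> (F \<subseteq> frontier \<Omega> \<and> F \<subseteq> N)}. diameter F ^ (DIM('a) - 1) * \<bar>jump \<T> w F\<bar>)"

definition controlled :: "'a::euclidean_space set \<Rightarrow> 'a set \<Rightarrow> 'a set \<Rightarrow> bool" where
  "controlled \<Omega> N B \<longleftrightarrow> (\<exists>A\<ge>0. \<forall>\<T> w. simplicial \<T> \<longrightarrow> \<Union>\<T> = closure \<Omega> \<longrightarrow> (\<forall>T\<in>\<T>. 0 \<le> w T) \<longrightarrow>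
     mass \<T> w B \<le> A * jump_sum \<Omega> N \<T> w)"

lemma simplicial_lmeasurable: "simplicial \<T> \<Longrightarrow> T \<in> \<T> \<Longrightarrow> T \<in> lmeasurable"
  unfolding simplicial_def using compact_simplex lmeasurable_compact by blast

lemma mass_mono:
  assumes "simplicial \<T>" "\<And>T. T \<in> \<T> \<Longrightarrow> 0 \<le> w T" "B \<subseteq> B'" "B \<in> sets lebesgue" "B' \<in> sets lebesgue"
  shows "mass \<T> w B \<le> mass \<T> w B'"
  unfolding mass_def
proof (intro sum_mono mult_left_mono)
  fix T assume T: "T \<in> \<T>"
  have "T \<in> lmeasurable" using simplicial_lmeasurable[OF assms(1) T] .
  then show "measure lebesgue (T \<inter> B) \<le> measure lebesgue (T \<inter> B')"
    using assms(3-5) by (intro measure_mono_fmeasurable fmeasurable_Int_fmeasurable) (auto intro: fmeasurableD)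
  show "0 \<le> w T" using assms(2)[OF T] .
qed

lemma controlled_mono:
  assumes "controlled \<Omega> N B'" "B \<subseteq> B'" "B \<in> sets lebesgue" "B' \<in> sets lebesgue"
  shows "controlled \<Omega> N B"
proof -
  obtain A where A: "A \<ge> 0" "\<And>\<T> w. simplicial \<T> \<Longrightarrow> \<Union>\<T> = closure \<Omega> \<Longrightarrow> (\<forall>T\<in>\<T>. 0 \<le> w T) \<Longrightarrow>
     mass \<T> w B' \<le> A * jump_sum \<Omega> N \<T> w"
    using assms(1) unfolding controlled_def by blast
  show ?thesis
    unfolding controlled_def
  proof (intro exI[of _ A] conjI allI impI)
    fix \<T> and w :: "'a set \<Rightarrow> real" assume *: "simplicial \<T>" "\<Union>\<T> = closure \<Omega>" "\<forall>T\<in>\<T>. 0 \<le> w T"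
    have "mass \<T> w B \<le> mass \<T> w B'" using * assms by (intro mass_mono) auto
    then show "mass \<T> w B \<le> A * jump_sum \<Omega> N \<T> w" using A(2)[OF *] by linarith
  qed (rule A(1))
qed

lemma controlled_disjoint:
  assumes "B \<inter> closure \<Omega> = {}"
  shows "controlled \<Omega> N B"
  unfolding controlled_def
proof (intro exI[of _ 0] conjI allI impI)
  fix \<T> and w :: "'a set \<Rightarrow> real" assume *: "\<Union>\<T> = closure \<Omega>"
  have "T \<inter> B = {}" if "T \<in> \<T>" for T using that * assms by blast
  then show "mass \<T> w B \<le> 0 * jump_sum \<Omega> N \<T> w" unfolding mass_def by simp
qed simp

lemma controlled_step:
  fixes \<Omega> :: "'a::euclidean_space set"
  assumes dim: "2 \<le> DIM('a)" and \<Omega>: "bounded \<Omega>"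
    and Q: "convex Q" "Q \<in> lmeasurable" "bounded Q" "c \<in> Q" "Q \<inter> frontier \<Omega> \<inter> N = {}"
    and c: "0 < r" "controlled \<Omega> N (ball c r)"
  shows "controlled \<Omega> N Q"
proof -
  obtain D where D: "0 < D" "\<And>x. x \<in> Q \<Longrightarrow> norm (x - c) \<le> D"
  proof -
    have "bounded ((\<lambda>x. x - c) ` Q)" using Q(3) by (rule bounded_translation_minus)
    then obtain D where "0 < D" "\<forall>x\<in>(\<lambda>x. x - c) ` Q. norm x \<le> D" using bounded_pos by blast
    then show ?thesis using that by blast
  qed
  obtain R where R: "0 < R" "closure \<Omega> \<subseteq> cball c R"
  proof -
    have "bounded ((\<lambda>x. x - c) ` closure \<Omega>)" using bounded_closure[OF \<Omega>] by (rule bounded_translation_minus)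
    then obtain R where "0 < R" "\<forall>x\<in>(\<lambda>x. x - c) ` closure \<Omega>. norm x \<le> R" using bounded_pos by blast
    then have "\<forall>x\<in>closure \<Omega>. norm (c - x) \<le> R" by (simp add: norm_minus_commute)
    then have "closure \<Omega> \<subseteq> cball c R" by (auto simp: dist_norm)
    then show ?thesis using that \<open>0 < R\<close> by blast
  qed
  define \<theta> where "\<theta> = r / (r + D)"
  have \<theta>: "0 < \<theta>" "\<theta> < 1" unfolding \<theta>_def using c(1) D(1) by (auto simp: field_simps)
  obtain A where A: "0 \<le> A" "\<And>\<T> w Q B c. simplicial \<T> \<Longrightarrow> (\<And>T. T \<in> \<T> \<Longrightarrow> 0 \<le> w T) \<Longrightarrow> \<Union>\<T> \<subseteq> cball c R \<Longrightarrow>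
     convex Q \<Longrightarrow> Q \<in> lmeasurable \<Longrightarrow> c \<in> Q \<Longrightarrow> B \<in> sets lebesgue \<Longrightarrow>
     (\<lambda>x. x + (1 - \<theta>) *\<^sub>R (c - x)) ` Q \<subseteq> B \<Longrightarrow>
     mass \<T> w Q \<le> inverse \<theta> ^ DIM('a) * mass \<T> w B +
        A * (\<Sum>F\<in>{F\<in>facets \<T>. F \<inter> Q \<noteq> {}}. diameter F ^ (DIM('a) - 1) * \<bar>jump \<T> w (F::'a set)\<bar>)"
    by (rule contraction_estimate[OF \<theta> R(1) dim]) blast
  obtain E where E: "0 \<le> E" "\<And>\<T> w. simplicial \<T> \<Longrightarrow> \<Union>\<T> = closure \<Omega> \<Longrightarrow> (\<forall>T\<in>\<T>. 0 \<le> w T) \<Longrightarrow>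
     mass \<T> w (ball c r) \<le> E * jump_sum \<Omega> N \<T> w"
    using c(2) unfolding controlled_def by blast
  have im: "(\<lambda>x. x + (1 - \<theta>) *\<^sub>R (c - x)) ` Q \<subseteq> ball c r"
  proof safe
    fix x assume "x \<in> Q"
    have "x + (1 - \<theta>) *\<^sub>R (c - x) - c = \<theta> *\<^sub>R (x - c)" by (simp add: algebra_simps)
    then have "dist (x + (1 - \<theta>) *\<^sub>R (c - x)) c = \<theta> * norm (x - c)" using \<theta> by (simp add: dist_norm)
    also have "\<dots> \<le> \<theta> * D" using D(2)[OF \<open>x \<in> Q\<close>] \<theta> by simp
    also have "\<dots> < r" unfolding \<theta>_def using c(1) D(1) by (simp add: field_simps)
    finally show "x + (1 - \<theta>) *\<^sub>R (c - x) \<in> ball c r" by (simp add: dist_commute)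
  qed
  have nn: "0 \<le> inverse \<theta> ^ DIM('a)" using \<theta> by simp
  show ?thesis
    unfolding controlled_def
  proof (intro exI[of _ "inverse \<theta> ^ DIM('a) * E + A"] conjI allI impI)
    show "0 \<le> inverse \<theta> ^ DIM('a) * E + A" using nn E(1) A(1) by simp
    fix \<T> and w :: "'a set \<Rightarrow> real" assume *: "simplicial \<T>" "\<Union>\<T> = closure \<Omega>" "\<forall>T\<in>\<T>. 0 \<le> w T"
    have "mass \<T> w Q \<le> inverse \<theta> ^ DIM('a) * mass \<T> w (ball c r) +
        A * (\<Sum>F\<in>{F\<in>facets \<T>. F \<inter> Q \<noteq> {}}. diameter F ^ (DIM('a) - 1) * \<bar>jump \<T> w F\<bar>)"
      using * R(2) Q im by (intro A(2)) auto
    moreover have "(\<Sum>F\<in>{F\<in>facets \<T>. F \<inter> Q \<noteq> {}}. diameter F ^ (DIM('a) - 1) * \<bar>jump \<T> w F\<bar>) \<le> jump_sum \<Omega> N \<T> w"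
      unfolding jump_sum_def
    proof (intro sum_mono2)
      show "finite {F \<in> facets \<T>. \<not> (F \<subseteq> frontier \<Omega> \<and> F \<subseteq> N)}" using finite_facets[OF *(1)] by simp
      show "{F \<in> facets \<T>. F \<inter> Q \<noteq> {}} \<subseteq> {F \<in> facets \<T>. \<not> (F \<subseteq> frontier \<Omega> \<and> F \<subseteq> N)}" using Q(5) by blast
      fix F assume "F \<in> {F \<in> facets \<T>. \<not> (F \<subseteq> frontier \<Omega> \<and> F \<subseteq> N)} - {F \<in> facets \<T>. F \<inter> Q \<noteq> {}}"
      then obtain T where T: "T \<in> \<T>" "F facet_of T" unfolding facets_def by blast
      then have "0 < diameter F" using *(1) diameter_facet_pos[OF _ _ dim] unfolding simplicial_def by blast
      then show "0 \<le> diameter F ^ (DIM('a) - 1) * \<bar>jump \<T> w F\<bar>" by simp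
    qed
    ultimately have "mass \<T> w Q \<le> inverse \<theta> ^ DIM('a) * (E * jump_sum \<Omega> N \<T> w) + A * jump_sum \<Omega> N \<T> w"
      using mult_left_mono[OF E(2)[OF *] nn] mult_left_mono[OF _ A(1)] by (smt (verit))
    then show "mass \<T> w Q \<le> (inverse \<theta> ^ DIM('a) * E + A) * jump_sum \<Omega> N \<T> w"
      by (simp only: distrib_right mult.assoc)
  qed
qed

lemma controlled_domain:
  fixes \<Omega> :: "'a::euclidean_space set"
  assumes dim: "2 \<le> DIM('a)" and \<Omega>: "bounded \<Omega>" "open \<Omega>" "connected \<Omega>" "interior (closure \<Omega>) = \<Omega>"
    and N: "closed N" and y0: "y0 \<in> frontier \<Omega>" "y0 \<notin> N"
    and x: "x \<in> \<Omega>"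
  shows "\<exists>r>0. controlled \<Omega> N (ball x r)"
proof -
  define G where "G = {x\<in>\<Omega>. \<exists>r>0. controlled \<Omega> N (ball x r)}"
  have sub: "controlled \<Omega> N (ball y s)" if "controlled \<Omega> N (ball x r)" "ball y s \<subseteq> ball x r" for x y r s
    using controlled_mono[OF that] by simp
  have fr: "frontier \<Omega> = closure \<Omega> - \<Omega>" using \<Omega>(2) by (simp add: frontier_def interior_open)
  obtain \<epsilon> where \<epsilon>: "0 < \<epsilon>" "ball y0 \<epsilon> \<inter> N = {}"
  proof -
    have "open (- N)" "y0 \<in> - N" using N y0(2) by auto
    then obtain e where "0 < e" "ball y0 e \<subseteq> - N" using open_contains_ball by blast
    then show ?thesis using that by blast
  qed
  have "y0 \<notin> interior (closure \<Omega>)" using y0(1) fr \<Omega>(4) by blast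
  then have "\<not> ball y0 \<epsilon> \<subseteq> closure \<Omega>" using \<epsilon>(1) mem_interior by blast
  then obtain c where c: "c \<in> ball y0 \<epsilon>" "c \<notin> closure \<Omega>" by blast
  have "open (- closure \<Omega>)" by (intro open_Compl closed_closure)
  then obtain r where r: "0 < r" "ball c r \<subseteq> - closure \<Omega>" using c(2) open_contains_ball by blast
  then have "controlled \<Omega> N (ball c r)" by (intro controlled_disjoint) blast
  then have Q0: "controlled \<Omega> N (ball y0 \<epsilon>)"
    using \<epsilon> c r dim \<Omega>(1) by (intro controlled_step[of \<Omega> "ball y0 \<epsilon>" c N r]) auto
  have "y0 \<in> closure \<Omega>" using y0(1) fr by blast
  then obtain x0 where x0: "x0 \<in> \<Omega>" "dist x0 y0 < \<epsilon>" using \<epsilon>(1) closure_approachable by blast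
  have "ball x0 (\<epsilon> - dist x0 y0) \<subseteq> ball y0 \<epsilon>"
  proof
    fix z assume "z \<in> ball x0 (\<epsilon> - dist x0 y0)"
    then show "z \<in> ball y0 \<epsilon>" using dist_triangle[of y0 z x0] by (simp add: dist_commute)
  qed
  then have "x0 \<in> G" using sub[OF Q0] x0 unfolding G_def by (auto intro!: exI[of _ "\<epsilon> - dist x0 y0"])
  have nb: "\<exists>e>0. ball y e \<subseteq> ball x r" if "y \<in> ball x r" for x y :: 'a and r
    using that open_ball open_contains_ball by blast
  have openG: "open G"
    unfolding open_contains_ball
  proof
    fix x assume "x \<in> G"
    then obtain r where r: "0 < r" "controlled \<Omega> N (ball x r)" "x \<in> \<Omega>" unfolding G_def by blast
    obtain e where e: "0 < e" "ball x e \<subseteq> \<Omega>" using \<Omega>(2) r(3) open_contains_ball by blast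
    have "ball x (min r e) \<subseteq> G"
    proof
      fix y assume y: "y \<in> ball x (min r e)"
      then have "y \<in> ball x r" "y \<in> \<Omega>" using e by auto
      then show "y \<in> G" using nb[of y x r] sub[OF r(2)] unfolding G_def by blast
    qed
    then show "\<exists>e>0. ball x e \<subseteq> G" using r(1) e(1) by (intro exI[of _ "min r e"]) simp
  qed
  have openG': "open (\<Omega> - G)"
    unfolding open_contains_ball
  proof
    fix x assume x: "x \<in> \<Omega> - G"
    obtain e where e: "0 < e" "ball x e \<subseteq> \<Omega>" using \<Omega>(2) x open_contains_ball by blast
    have "ball x e \<inter> G = {}"
    proof (rule ccontr)
      assume "ball x e \<inter> G \<noteq> {}"
      then obtain y where y: "y \<in> ball x e" "y \<in> G" by blast
      then obtain s where s: "0 < s" "controlled \<Omega> N (ball y s)" unfolding G_def by blast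
      have "ball x e \<inter> frontier \<Omega> = {}" using e(2) fr by blast
      then have "controlled \<Omega> N (ball x e)"
        using s y dim \<Omega>(1) by (intro controlled_step[of \<Omega> "ball x e" y N s]) auto
      then show False using x e(1) unfolding G_def by blast
    qed
    then show "\<exists>e>0. ball x e \<subseteq> \<Omega> - G" using e by blast
  qed
  have "G \<inter> \<Omega> = {} \<or> (\<Omega> - G) \<inter> \<Omega> = {}"
    using connectedD[OF \<Omega>(3) openG openG'] by blast
  then have "\<Omega> \<subseteq> G" using \<open>x0 \<in> G\<close> x0 by blast
  then show ?thesis using x unfolding G_def by blast
qed

theorem discrete_poincare:
  fixes \<Omega> :: "'a::euclidean_space set"
  assumes dim: "2 \<le> DIM('a)" and \<Omega>: "bounded \<Omega>" "open \<Omega>" "connected \<Omega>" "interior (closure \<Omega>) = \<Omega>"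
    and P: "finite \<P>" "\<And>P. P \<in> \<P> \<Longrightarrow> polytope P" "closure \<Omega> = \<Union>\<P>"
    and N: "closed N" and y0: "y0 \<in> frontier \<Omega>" "y0 \<notin> N"
  obtains A where "0 \<le> A" "\<And>\<T> w. simplicial \<T> \<Longrightarrow> \<Union>\<T> = closure \<Omega> \<Longrightarrow> (\<forall>T\<in>\<T>. 0 \<le> w T) \<Longrightarrow>
     (\<Sum>T\<in>\<T>. w T * measure lebesgue T) \<le> A * jump_sum \<Omega> N \<T> w"
proof -
  have fr: "frontier \<Omega> = closure \<Omega> - \<Omega>" using \<Omega>(2) by (simp add: frontier_def interior_open)
  have cP: "convex P" "compact P" if "P \<in> \<P>" for P
    using P(2)[OF that] polytope_imp_convex polytope_imp_compact by blast+
  have con: "controlled \<Omega> N (interior P)" if "P \<in> \<P>" for P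
  proof (cases "interior P = {}")
    case True then show ?thesis using controlled_disjoint[of "interior P"] by simp
  next
    case False
    then obtain c where c: "c \<in> interior P" by blast
    have "interior P \<subseteq> interior (closure \<Omega>)" using that P(3) by (intro interior_mono) blast
    then have sub: "interior P \<subseteq> \<Omega>" using \<Omega>(4) by simp
    then obtain r where r: "0 < r" "controlled \<Omega> N (ball c r)"
      using controlled_domain[OF dim \<Omega> N y0, of c] c by blast
    have bI: "bounded (interior P)" using cP(2)[OF that] compact_imp_bounded bounded_interior by blast
    show ?thesis
    proof (rule controlled_step[OF dim \<Omega>(1) _ _ bI c _ r])
      show "convex (interior P)" using cP(1)[OF that] by (rule convex_interior)
      show "interior P \<in> lmeasurable" using bI by (intro lmeasurable_open) auto
      show "interior P \<inter> frontier \<Omega> \<inter> N = {}" using sub fr by blast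
    qed
  qed
  have "\<forall>P\<in>\<P>. \<exists>A\<ge>0. \<forall>\<T> w. simplicial \<T> \<longrightarrow> \<Union>\<T> = closure \<Omega> \<longrightarrow> (\<forall>T\<in>\<T>. 0 \<le> w T) \<longrightarrow>
     mass \<T> w (interior P) \<le> A * jump_sum \<Omega> N \<T> w"
    using con unfolding controlled_def by blast
  from bchoice[OF this] obtain A where A: "\<forall>P\<in>\<P>. A P \<ge> 0 \<and> (\<forall>\<T> w. simplicial \<T> \<longrightarrow> \<Union>\<T> = closure \<Omega> \<longrightarrow> (\<forall>T\<in>\<T>. 0 \<le> w T) \<longrightarrow>
     mass \<T> w (interior P) \<le> A P * jump_sum \<Omega> N \<T> w)" by blast
  show ?thesis
  proof (rule that[of "\<Sum>P\<in>\<P>. A P"])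
    show "0 \<le> (\<Sum>P\<in>\<P>. A P)" using A by (intro sum_nonneg) blast
    fix \<T> and w :: "'a set \<Rightarrow> real" assume *: "simplicial \<T>" "\<Union>\<T> = closure \<Omega>" "\<forall>T\<in>\<T>. 0 \<le> w T"
    have one: "measure lebesgue T \<le> (\<Sum>P\<in>\<P>. measure lebesgue (T \<inter> interior P))" if T: "T \<in> \<T>" for T
    proof -
      have Tm: "T \<in> lmeasurable" using simplicial_lmeasurable[OF *(1) T] .
      have nP: "negligible (frontier P)" if "P \<in> \<P>" for P using cP(1)[OF that] by (rule negligible_convex_frontier)
      have TI: "T \<inter> interior P \<in> lmeasurable" for P using Tm by (intro fmeasurable_Int_fmeasurable) auto
      have Ul: "(\<Union>P\<in>\<P>. T \<inter> interior P) \<in> lmeasurable" using P(1) TI by (intro fmeasurable.finite_UN) auto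
      have nU: "negligible (\<Union>P\<in>\<P>. frontier P)" using nP P(1) by (intro negligible_Union) auto
      have "T \<subseteq> (\<Union>P\<in>\<P>. T \<inter> interior P) \<union> (\<Union>P\<in>\<P>. frontier P)"
      proof
        fix x assume x: "x \<in> T"
        then obtain P where Px: "P \<in> \<P>" "x \<in> P" using T *(2) P(3) by blast
        then have "x \<in> closure P" using closure_subset by blast
        then show "x \<in> (\<Union>P\<in>\<P>. T \<inter> interior P) \<union> (\<Union>P\<in>\<P>. frontier P)"
          using Px(1) x unfolding frontier_def by blast
      qed
      then have "measure lebesgue T \<le> measure lebesgue ((\<Union>P\<in>\<P>. T \<inter> interior P) \<union> (\<Union>P\<in>\<P>. frontier P))"
        using Tm Ul nU by (intro measure_mono_fmeasurable fmeasurable.Un[OF Ul negligible_imp_measurable[OF nU]]) (auto intro: fmeasurableD)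
      also have "\<dots> \<le> measure lebesgue (\<Union>P\<in>\<P>. T \<inter> interior P) + measure lebesgue (\<Union>P\<in>\<P>. frontier P)"
        using Ul nU by (intro measure_Un_le) (auto intro: fmeasurableD negligible_imp_sets)
      also have "measure lebesgue (\<Union>P\<in>\<P>. frontier P) = 0" using nU by (rule negligible_imp_measure0)
      also have "measure lebesgue (\<Union>P\<in>\<P>. T \<inter> interior P) + 0 \<le> (\<Sum>P\<in>\<P>. measure lebesgue (T \<inter> interior P))"
        unfolding add_0_right using P(1) TI by (intro measure_UNION_le) (auto intro: fmeasurableD)
      finally show ?thesis .
    qed
    have "(\<Sum>T\<in>\<T>. w T * measure lebesgue T) \<le> (\<Sum>T\<in>\<T>. w T * (\<Sum>P\<in>\<P>. measure lebesgue (T \<inter> interior P)))"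
      using one *(3) by (intro sum_mono mult_left_mono) auto
    also have "\<dots> = (\<Sum>P\<in>\<P>. mass \<T> w (interior P))"
      unfolding mass_def sum_distrib_left by (rule sum.swap)
    also have "\<dots> \<le> (\<Sum>P\<in>\<P>. A P * jump_sum \<Omega> N \<T> w)"
      using A * by (intro sum_mono) blast
    also have "\<dots> = (\<Sum>P\<in>\<P>. A P) * jump_sum \<Omega> N \<T> w" by (simp only: sum_distrib_right)
    finally show "(\<Sum>T\<in>\<T>. w T * measure lebesgue T) \<le> (\<Sum>P\<in>\<P>. A P) * jump_sum \<Omega> N \<T> w" .
  qed
qed

section \<open>Fluxes through facets\<close>

lemma nn_integral_lborel_shift:
  fixes g :: "'a::euclidean_space \<Rightarrow> ennreal"
  assumes [measurable]: "g \<in> borel_measurable borel"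
  shows "(\<integral>\<^sup>+x. g (x + t) \<partial>lborel) = (\<integral>\<^sup>+x. g x \<partial>lborel)"
proof -
  have "lborel = density (distr lborel borel (\<lambda>x. t + x)) (\<lambda>_. 1)"
    using lborel_affine[of 1 t] by simp
  from arg_cong[OF this, of "\<lambda>L. nn_integral L g"] show ?thesis
    by (simp add: nn_integral_density nn_integral_distr add.commute)
qed

lemma nn_integral_lborel_reflect:
  fixes g :: "'a::euclidean_space \<Rightarrow> ennreal"
  assumes [measurable]: "g \<in> borel_measurable borel"
  shows "(\<integral>\<^sup>+x. g (t - x) \<partial>lborel) = (\<integral>\<^sup>+x. g x \<partial>lborel)"
proof -
  have "lborel = density (distr lborel borel (\<lambda>x. t - x)) (\<lambda>_. 1)"
    using lborel_affine[of "- 1" t] by simp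
  from arg_cong[OF this, of "\<lambda>L. nn_integral L g"] show ?thesis
    by (simp add: nn_integral_density nn_integral_distr)
qed

text \<open>Uniqueness of Haar measure. The change of variables theorem of the library is not available
  here since it requires a well-ordered index type.\<close>

lemma affine_preimage_measure:
  fixes M :: "'a::euclidean_space \<Rightarrow> 'a"
  assumes f: "linear f" "inj f" and M: "\<And>x. M x = f x + b"
  obtains m where "m < top" "distr lborel borel M = density lborel (\<lambda>_. m)"
proof -
  have "continuous_on UNIV M"
    unfolding M using f(1) by (intro continuous_intros linear_continuous_on) (simp add: linear_conv_bounded_linear)
  then have Mm[measurable]: "M \<in> borel_measurable borel" by (rule borel_measurable_continuous_onI)
  have surj: "surj f" using f linear_injective_imp_surjective by blast
  define \<nu> where "\<nu> A = (\<integral>\<^sup>+x. indicator A (M x) \<partial>lborel)" for A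
  have \<nu>: "\<nu> A = emeasure lborel (M -` A)" if "A \<in> sets borel" for A
  proof -
    have "(\<lambda>x. indicator A (M x)) = (indicator (M -` A) :: 'a \<Rightarrow> ennreal)" by (auto simp: fun_eq_iff indicator_def)
    then show ?thesis unfolding \<nu>_def using measurable_sets_borel[OF Mm that] by simp
  qed
  have swap: "emeasure lborel B * \<nu> A = \<nu> B * emeasure lborel A"
    if [measurable]: "A \<in> sets borel" "B \<in> sets borel" for A B
  proof -
    have "emeasure lborel B * \<nu> A = (\<integral>\<^sup>+x. indicator A (M x) * (\<integral>\<^sup>+y. indicator B (y + M x) \<partial>lborel) \<partial>lborel)"
    proof -
      have "(\<integral>\<^sup>+y. indicator B (y + M x) \<partial>lborel) = emeasure lborel B" for x
        by (subst nn_integral_lborel_shift) auto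
      then show ?thesis unfolding \<nu>_def by (subst nn_integral_cmult[symmetric]) (measurable, simp add: mult.commute)
    qed
    also have "\<dots> = (\<integral>\<^sup>+x. (\<integral>\<^sup>+y. indicator A (M x) * indicator B (y + M x) \<partial>lborel) \<partial>lborel)"
      by (intro nn_integral_cong) (simp add: nn_integral_cmult)
    also have "\<dots> = (\<integral>\<^sup>+y. (\<integral>\<^sup>+x. indicator A (M x) * indicator B (y + M x) \<partial>lborel) \<partial>lborel)"
      by (intro lborel_pair.Fubini') measurable
    also have "\<dots> = (\<integral>\<^sup>+y. (\<integral>\<^sup>+x. indicator A (M x - y) * indicator B (M x) \<partial>lborel) \<partial>lborel)"
    proof (rule nn_integral_cong)
      fix y
      obtain e where e: "y = f e" using surj by (metis surjD)
      have Me: "M (x + - e) = M x - y" for x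
        unfolding M e using f(1) by (simp add: linear_diff)
      have "(\<integral>\<^sup>+x. indicator A (M x) * indicator B (y + M x) \<partial>lborel)
         = (\<integral>\<^sup>+x. (indicator A (M (x + - e)) * indicator B (y + M (x + - e)) :: ennreal) \<partial>lborel)"
        by (rule nn_integral_lborel_shift[symmetric, of "\<lambda>x. indicator A (M x) * indicator B (y + M x)"]) measurable
      also have "\<dots> = (\<integral>\<^sup>+x. indicator A (M x - y) * indicator B (M x) \<partial>lborel)"
        unfolding Me by (intro nn_integral_cong) simp
      finally show "(\<integral>\<^sup>+x. indicator A (M x) * indicator B (y + M x) \<partial>lborel)
         = (\<integral>\<^sup>+x. indicator A (M x - y) * indicator B (M x) \<partial>lborel)" .
    qed
    also have "\<dots> = (\<integral>\<^sup>+x. (\<integral>\<^sup>+y. indicator A (M x - y) * indicator B (M x) \<partial>lborel) \<partial>lborel)"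
      by (intro lborel_pair.Fubini') measurable
    also have "\<dots> = (\<integral>\<^sup>+x. (\<integral>\<^sup>+y. indicator A (M x - y) \<partial>lborel) * indicator B (M x) \<partial>lborel)"
      by (intro nn_integral_cong) (simp add: nn_integral_multc)
    also have "\<dots> = \<nu> B * emeasure lborel A"
    proof -
      have "(\<integral>\<^sup>+y. indicator A (M x - y) \<partial>lborel) = emeasure lborel A" for x
        by (subst nn_integral_lborel_reflect) auto
      then show ?thesis unfolding \<nu>_def by (subst nn_integral_multc[symmetric]) (measurable, simp add: mult.commute)
    qed
    finally show ?thesis .
  qed
  let ?B = "ball (0::'a) 1"
  have B: "emeasure lborel ?B \<noteq> 0" "emeasure lborel ?B < top"
  proof -
    have "measure lborel ?B > 0" by simp
    then show "emeasure lborel ?B \<noteq> 0" by (auto simp: measure_def)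
    show "emeasure lborel ?B < top" using emeasure_bounded_finite[OF bounded_ball] by (simp add: top.not_eq_extremum)
  qed
  obtain g where g: "linear g" "g \<circ> f = id" using linear_injective_left_inverse[OF f] by blast
  have fin: "\<nu> ?B < top"
  proof -
    have "M -` ?B \<subseteq> g ` ((\<lambda>x. x - b) ` ?B)"
    proof
      fix x assume "x \<in> M -` ?B"
      then have "g (M x - b) \<in> g ` ((\<lambda>x. x - b) ` ?B)" by blast
      moreover have "g (M x - b) = x" unfolding M using g(2) by (simp add: pointfree_idE)
      ultimately show "x \<in> g ` ((\<lambda>x. x - b) ` ?B)" by simp
    qed
    moreover have "bounded (g ` ((\<lambda>x. x - b) ` ?B))"
      using g(1) by (intro bounded_linear_image bounded_translation_minus) (auto simp: linear_conv_bounded_linear)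
    ultimately have bd: "bounded (M -` ?B)" by (rule bounded_subset[rotated])
    have "\<nu> ?B = emeasure lborel (M -` ?B)" by (intro \<nu> borel_open open_ball)
    then show ?thesis using emeasure_bounded_finite[OF bd] by (simp add: top.not_eq_extremum)
  qed
  define m where "m = \<nu> ?B / emeasure lborel ?B"
  have "\<nu> A = m * emeasure lborel A" if A: "A \<in> sets borel" for A
  proof -
    have "\<nu> A = (emeasure lborel ?B * \<nu> A) / emeasure lborel ?B"
      using B by (metis ennreal_mult_divide_eq less_irrefl mult.commute)
    also have "\<dots> = m * emeasure lborel A"
      unfolding swap[OF A borel_open[OF open_ball]] m_def by (simp add: ennreal_times_divide mult.commute)
    finally show ?thesis .
  qed
  then have "distr lborel borel M = density lborel (\<lambda>_. m)"
  proof (intro measure_eqI)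
    fix A assume nu: "\<And>A. A \<in> sets borel \<Longrightarrow> \<nu> A = m * emeasure lborel A" and "A \<in> sets (distr lborel borel M)"
    then have A[measurable]: "A \<in> sets borel" by simp
    have "emeasure (distr lborel borel M) A = \<nu> A"
      unfolding \<nu>[OF A] by (simp add: emeasure_distr)
    then show "emeasure (distr lborel borel M) A = emeasure (density lborel (\<lambda>_. m)) A"
      using nu[OF A] by (simp add: emeasure_density nn_integral_cmult)
  qed simp
  moreover have "m \<noteq> top" unfolding m_def using fin B by (auto simp: ennreal_divide_eq_top_iff)
  then have "m < top" by (simp add: top.not_eq_extremum)
  ultimately show ?thesis using that by blast
qed

lemma affine_average:
  fixes M :: "'a::euclidean_space \<Rightarrow> 'a" and h :: "'a \<Rightarrow> real"
  assumes f: "linear f" "inj f" and M: "\<And>x. M x = f x + b"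
    and K: "K \<in> sets borel" "emeasure lborel K < top" and h: "h \<in> borel_measurable borel"
  shows "measure lborel (M ` K) * (LINT x:K|lborel. h (M x)) = measure lborel K * (LINT x:M ` K|lborel. h x)"
    and "M ` K \<in> sets borel"
proof -
  obtain m where m: "m < top" "distr lborel borel M = density lborel (\<lambda>_. m)"
    using affine_preimage_measure[OF f M] by blast
  have "continuous_on UNIV M"
    unfolding M using f(1) by (intro continuous_intros linear_continuous_on) (simp add: linear_conv_bounded_linear)
  then have Mm[measurable]: "M \<in> borel_measurable borel" by (rule borel_measurable_continuous_onI)
  obtain g where g: "linear g" "g \<circ> f = id" using linear_injective_left_inverse[OF f] by blast
  have gM: "g (M x - b) = x" for x unfolding M using g(2) by (simp add: pointfree_idE)
  have surj: "surj f" using f linear_injective_imp_surjective by blast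
  have fg: "f (g y) = y" for y using surj g(2) by (metis comp_apply id_apply surjD)
  have Mg: "M (g (y - b)) = y" for y unfolding M fg by simp
  have im: "M ` K = (\<lambda>y. g (y - b)) -` K"
  proof safe
    fix y assume "g (y - b) \<in> K"
    then have "M (g (y - b)) \<in> M ` K" by blast
    then show "y \<in> M ` K" unfolding Mg .
  qed (simp add: gM)
  have "continuous_on UNIV (\<lambda>y. g (y - b))"
    using g(1) by (intro continuous_on_compose2[OF linear_continuous_on[of g UNIV]] continuous_intros)
      (auto simp: linear_conv_bounded_linear)
  then have "(\<lambda>y. g (y - b)) \<in> borel_measurable borel" by (rule borel_measurable_continuous_onI)
  then show MK[measurable]: "M ` K \<in> sets borel" unfolding im using K(1) by (rule measurable_sets_borel)
  have memK: "M x \<in> M ` K \<longleftrightarrow> x \<in> K" for x using gM by (metis image_iff)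
  have int: "(LINT x:K|lborel. k (M x)) = enn2real m * (LINT x:M ` K|lborel. k x)"
    if [measurable]: "k \<in> borel_measurable borel" for k :: "'a \<Rightarrow> real"
  proof -
    have "(LINT x:K|lborel. k (M x)) = (LINT x|lborel. (\<lambda>y. indicator (M ` K) y *\<^sub>R k y) (M x))"
      unfolding set_lebesgue_integral_def by (intro Bochner_Integration.integral_cong) (auto simp: indicator_def memK)
    also have "\<dots> = (LINT y|distr lborel borel M. indicator (M ` K) y *\<^sub>R k y)"
      by (rule integral_distr[symmetric]) measurable
    also have "\<dots> = (LINT y|density lborel (\<lambda>_. ennreal (enn2real m)). indicator (M ` K) y *\<^sub>R k y)"
      using m by simp
    also have "\<dots> = (LINT y|lborel. enn2real m *\<^sub>R (indicator (M ` K) y *\<^sub>R k y))"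
      using MK that by (intro integral_density borel_measurable_scaleR borel_measurable_indicator) auto
    finally show ?thesis by (simp add: set_lebesgue_integral_def)
  qed
  have "measure lborel K = enn2real m * measure lborel (M ` K)"
    using int[of "\<lambda>_. 1"] by (simp add: set_lebesgue_integral_def)
  then show "measure lborel (M ` K) * (LINT x:K|lborel. h (M x)) = measure lborel K * (LINT x:M ` K|lborel. h x)"
    using int[OF h] by simp
qed

lemma GDERIV_continuous_on: "(\<And>x. GDERIV f x :> g x) \<Longrightarrow> continuous_on S f"
  unfolding gderiv_def by (meson continuous_at_imp_continuous_on has_derivative_continuous)

lemma GDERIV_ray:
  assumes "GDERIV \<phi> (a + s *\<^sub>R v) :> g"
  shows "((\<lambda>s. \<phi> (a + s *\<^sub>R v)) has_real_derivative (g \<bullet> v)) (at s)"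
proof -
  have "((\<lambda>s. a + s *\<^sub>R v) has_derivative (\<lambda>t. t *\<^sub>R v)) (at s)"
    by (auto intro!: derivative_eq_intros)
  then have "((\<lambda>s. \<phi> (a + s *\<^sub>R v)) has_derivative (\<lambda>t. (t *\<^sub>R v) \<bullet> g)) (at s)"
    using assms unfolding gderiv_def by (rule has_derivative_compose)
  then show ?thesis
    unfolding has_field_derivative_def by (simp add: inner_commute mult_commute_abs)
qed

lemma set_integrable_continuous_compact:
  fixes f :: "'a::euclidean_space \<Rightarrow> real"
  assumes "compact K" "continuous_on UNIV f"
  shows "set_integrable lborel K f"
  unfolding set_integrable_def
  by (rule borel_integrable_compact[OF assms(1) continuous_on_subset[OF assms(2)]]) simp

context full_simplex
begin

lemma simplex_compact: "compact (convex hull C)"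
  using finite_C by (rule finite_imp_compact_convex_hull)

lemma simplex_measure_pos: "0 < measure lborel (convex hull C)"
proof -
  obtain c where "c \<in> interior (convex hull C)" using interior_nonempty by blast
  then obtain e where e: "0 < e" "ball c e \<subseteq> convex hull C" using mem_interior by blast
  have "0 < measure lborel (ball c e)" using e(1) by simp
  also have "\<dots> \<le> measure lborel (convex hull C)"
    using e(2) borel_compact[OF simplex_compact] emeasure_compact_finite[OF simplex_compact]
    by (intro measure_mono_fmeasurable) (auto simp: fmeasurable_def top.not_eq_extremum)
  finally show ?thesis .
qed

lemma cone_flux:
  fixes \<phi> :: "'a \<Rightarrow> real"
  assumes \<phi>: "\<And>x. GDERIV \<phi> x :> \<psi> x" and \<psi>: "continuous_on UNIV \<psi>" and a: "a \<in> C"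
    and zero: "\<And>x. x \<in> convex hull C \<Longrightarrow> bary C a x = 0 \<Longrightarrow> \<phi> x = 0"
  shows "(LINT x:convex hull C|lborel. DIM('a) * \<phi> x + \<psi> x \<bullet> (x - a)) = 0"
proof -
  let ?T = "convex hull C"
  let ?d = "DIM('a)"
  define \<sigma> where "\<sigma> n = 1 / (real n + 2)" for n :: nat
  define s where "s n = 1 - \<sigma> n" for n
  have \<sigma>: "0 < \<sigma> n" "\<sigma> n < 1" for n unfolding \<sigma>_def by (auto simp: field_simps)
  then have s: "0 < s n" "s n < 1" for n unfolding s_def by auto
  have c\<phi>: "continuous_on S \<phi>" for S using GDERIV_continuous_on[OF \<phi>] .
  have b\<phi>[measurable]: "\<phi> \<in> borel_measurable borel" using c\<phi>[of UNIV] by (rule borel_measurable_continuous_onI)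
  have c\<psi>: "continuous_on S \<psi>" for S using \<psi> continuous_on_subset by blast
  have b\<psi>[measurable]: "\<psi> \<in> borel_measurable borel" using \<psi> by (rule borel_measurable_continuous_onI)
  have aT: "a \<in> ?T" using a by (rule hull_inc)
  have cT: "convex ?T" by simp
  have Tb[measurable]: "?T \<in> sets borel" using simplex_compact by (rule borel_compact)
  have Tfin: "emeasure lborel ?T < top"
    using emeasure_compact_finite[OF simplex_compact] by (simp add: top.not_eq_extremum)
  define h where "h x r = r ^ ?d * \<phi> (a + r *\<^sub>R (x - a))" for x and r :: real
  define h' where "h' x r = ?d * r ^ (?d - 1) * \<phi> (a + r *\<^sub>R (x - a)) + r ^ ?d * (\<psi> (a + r *\<^sub>R (x - a)) \<bullet> (x - a))" for x and r :: real
  have dh: "(h x has_real_derivative h' x r) (at r)" for x r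
  proof -
    have "((\<lambda>r. r ^ ?d) has_real_derivative ?d * r ^ (?d - 1)) (at r)" using DERIV_pow[of ?d r] by simp
    from DERIV_mult[OF this GDERIV_ray[OF \<phi>, where a = a and s = r and v = "x - a"]]
    show ?thesis unfolding h_def h'_def by (simp add: mult.commute add.commute)
  qed
  have rayT: "a + r *\<^sub>R (x - a) \<in> ?T" if "x \<in> ?T" "0 \<le> r" "r \<le> 1" for x r
    using convexD_alt[OF cT aT that(1) that(2,3)] by (simp add: algebra_simps)
  obtain B0 where B0: "\<And>x. x \<in> ?T \<Longrightarrow> \<bar>\<phi> x\<bar> \<le> B0"
    using compact_imp_bounded[OF compact_continuous_image[OF c\<phi> simplex_compact]] unfolding bounded_iff by auto
  obtain B1 where B1: "\<And>x. x \<in> ?T \<Longrightarrow> norm (\<psi> x) \<le> B1"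
    using compact_imp_bounded[OF compact_continuous_image[OF c\<psi> simplex_compact]] unfolding bounded_iff by auto
  define D where "D = diameter ?T"
  have D: "dist x y \<le> D" if "x \<in> ?T" "y \<in> ?T" for x y
    unfolding D_def using that compact_imp_bounded[OF simplex_compact] by (intro diameter_bounded_bound)
  have B0': "0 \<le> B0" using B0[OF aT] by linarith
  have B1': "0 \<le> B1" using B1[OF aT] norm_ge_zero order_trans by blast
  define B where "B = ?d * B0 + B1 * D"
  have h'B: "\<bar>h' x r\<bar> \<le> B" if "x \<in> ?T" "0 \<le> r" "r \<le> 1" for x r
  proof -
    let ?y = "a + r *\<^sub>R (x - a)"
    have y: "?y \<in> ?T" by (rule rayT[OF that])
    have "\<bar>?d * r ^ (?d - 1) * \<phi> ?y\<bar> = ?d * (r ^ (?d - 1) * \<bar>\<phi> ?y\<bar>)"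
      using that(2) by (simp add: abs_mult)
    also have "\<dots> \<le> ?d * (1 * B0)"
      using that B0[OF y] B0' by (intro mult_left_mono mult_mono power_le_one) auto
    finally have 1: "\<bar>?d * r ^ (?d - 1) * \<phi> ?y\<bar> \<le> ?d * B0" by simp
    have "\<bar>\<psi> ?y \<bullet> (x - a)\<bar> \<le> norm (\<psi> ?y) * norm (x - a)" by (rule Cauchy_Schwarz_ineq2)
    also have "\<dots> \<le> B1 * D" using B1[OF y] B1' D[OF that(1) aT] by (intro mult_mono) (auto simp: dist_norm)
    finally have 2: "\<bar>\<psi> ?y \<bullet> (x - a)\<bar> \<le> B1 * D" .
    have "\<bar>r ^ ?d * (\<psi> ?y \<bullet> (x - a))\<bar> = r ^ ?d * \<bar>\<psi> ?y \<bullet> (x - a)\<bar>" using that(2) by (simp add: abs_mult)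
    also have "\<dots> \<le> 1 * (B1 * D)"
      using that 2 by (intro mult_mono power_le_one) auto
    finally have 3: "\<bar>r ^ ?d * (\<psi> ?y \<bullet> (x - a))\<bar> \<le> B1 * D" by simp
    show ?thesis unfolding h'_def B_def using 1 3 by linarith
  qed
  have dq: "\<bar>(h x 1 - h x (s n)) / \<sigma> n\<bar> \<le> B" if x: "x \<in> ?T" for x n
  proof -
    obtain z where z: "s n < z" "z < 1" "h x 1 - h x (s n) = (1 - s n) * h' x z"
      using MVT2[OF s(2)[of n] dh[of x]] by blast
    have "(h x 1 - h x (s n)) / \<sigma> n = h' x z"
      unfolding z(3) using \<sigma>(1)[of n] by (simp add: s_def)
    then show ?thesis using h'B[OF x] z s(1)[of n] by simp
  qed
  have \<sigma>0: "\<sigma> \<longlonglongrightarrow> 0" unfolding \<sigma>_def by real_asymp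
  have lim: "(\<lambda>n. (h x 1 - h x (s n)) / \<sigma> n) \<longlonglongrightarrow> h' x 1" for x
  proof -
    have "((\<lambda>k. (h x (1 + k) - h x 1) / k) \<longlongrightarrow> h' x 1) (at 0)" using dh[of x 1] by (simp add: DERIV_def)
    moreover have "filterlim (\<lambda>n. - \<sigma> n) (at 0) sequentially"
    proof (rule filterlim_atI)
      show "(\<lambda>n. - \<sigma> n) \<longlonglongrightarrow> 0" using tendsto_minus[OF \<sigma>0] by simp
      have "- \<sigma> n \<noteq> 0" for n using \<sigma>(1)[of n] by simp
      then show "\<forall>\<^sub>F n in sequentially. - \<sigma> n \<noteq> 0" by simp
    qed
    ultimately have "(\<lambda>n. (h x (1 + - \<sigma> n) - h x 1) / - \<sigma> n) \<longlonglongrightarrow> h' x 1" by (rule filterlim_compose)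
    moreover have "(h x (1 + - \<sigma> n) - h x 1) / - \<sigma> n = (h x 1 - h x (s n)) / \<sigma> n" for n
      unfolding s_def by (metis minus_diff_eq minus_divide_divide diff_conv_add_uminus)
    ultimately show ?thesis by simp
  qed
  have meas: "(\<lambda>x. (h x 1 - h x (s n)) / \<sigma> n) \<in> borel_measurable borel" for n
    unfolding h_def by measurable
  have meas': "(\<lambda>x. h' x 1) \<in> borel_measurable borel"
    unfolding h'_def by measurable
  have conv: "(\<lambda>n. LINT x:?T|lborel. (h x 1 - h x (s n)) / \<sigma> n) \<longlonglongrightarrow> (LINT x:?T|lborel. h' x 1)"
    unfolding set_lebesgue_integral_def
  proof (rule integral_dominated_convergence[where w = "\<lambda>x. B * indicator ?T x"])
    show "(\<lambda>x. indicat_real ?T x *\<^sub>R h' x 1) \<in> borel_measurable lborel" using meas' by measurable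
    show "(\<lambda>x. indicat_real ?T x *\<^sub>R ((h x 1 - h x (s n)) / \<sigma> n)) \<in> borel_measurable lborel" for n
      using meas by measurable
    show "integrable lborel (\<lambda>x. B * indicat_real ?T x)" using Tfin by simp
    show "AE x in lborel. (\<lambda>n. indicat_real ?T x *\<^sub>R ((h x 1 - h x (s n)) / \<sigma> n)) \<longlonglongrightarrow> indicat_real ?T x *\<^sub>R h' x 1"
      by (intro AE_I2 tendsto_scaleR tendsto_const lim)
    show "AE x in lborel. norm (indicat_real ?T x *\<^sub>R ((h x 1 - h x (s n)) / \<sigma> n)) \<le> B * indicat_real ?T x" for n
      using dq by (intro AE_I2) (simp add: indicator_def)
  qed
  define Ts where "Ts n = (\<lambda>x. s n *\<^sub>R x + (1 - s n) *\<^sub>R a) ` ?T" for n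
  have Ts: "Ts n \<in> sets borel" "measure lborel (Ts n) = s n ^ ?d * measure lborel ?T"
    "s n ^ ?d * (LINT x:?T|lborel. \<phi> (s n *\<^sub>R x + (1 - s n) *\<^sub>R a)) = (LINT x:Ts n|lborel. \<phi> x)" for n
  proof -
    have lin: "linear ((*\<^sub>R) (s n))" "inj ((*\<^sub>R) (s n) :: 'a \<Rightarrow> 'a)" using s(1)[of n] by (auto simp: injective_scaleR linear_scaleR)
    note av = affine_average[OF lin, of "\<lambda>x. s n *\<^sub>R x + (1 - s n) *\<^sub>R a" "(1 - s n) *\<^sub>R a", OF refl Tb Tfin b\<phi>]
    show sb: "Ts n \<in> sets borel" unfolding Ts_def by (rule av(2))
    have "measure lebesgue (Ts n) = \<bar>s n\<bar> ^ ?d * measure lebesgue ?T" unfolding Ts_def by (rule measure_lebesgue_affine)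
    then show m: "measure lborel (Ts n) = s n ^ ?d * measure lborel ?T" using sb Tb s(1)[of n] by simp
    show "s n ^ ?d * (LINT x:?T|lborel. \<phi> (s n *\<^sub>R x + (1 - s n) *\<^sub>R a)) = (LINT x:Ts n|lborel. \<phi> x)"
      using av(1) m simplex_measure_pos unfolding Ts_def[symmetric] by simp
  qed
  have TsT: "Ts n \<subseteq> ?T" for n
  proof
    fix y assume "y \<in> Ts n"
    then obtain x where "x \<in> ?T" and "y = s n *\<^sub>R x + (1 - s n) *\<^sub>R a" unfolding Ts_def by blast
    moreover have "s n *\<^sub>R x + (1 - s n) *\<^sub>R a = a + s n *\<^sub>R (x - a)" by (simp add: algebra_simps)
    ultimately show "y \<in> ?T" using rayT[of x "s n"] s[of n] by simp
  qed
  have i\<phi>: "set_integrable lborel ?T \<phi>" using simplex_compact c\<phi> by (rule set_integrable_continuous_compact)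
  have val: "(LINT x:?T|lborel. (h x 1 - h x (s n)) / \<sigma> n) = (LINT x:?T - Ts n|lborel. \<phi> x) / \<sigma> n" for n
  proof -
    have i2: "set_integrable lborel ?T (\<lambda>x. \<phi> (s n *\<^sub>R x + (1 - s n) *\<^sub>R a))"
      using simplex_compact by (rule set_integrable_continuous_compact)
        (intro continuous_on_compose2[OF c\<phi>[of UNIV]] continuous_intros, auto)
    have "h x 1 - h x (s n) = \<phi> x - s n ^ ?d * \<phi> (s n *\<^sub>R x + (1 - s n) *\<^sub>R a)" for x
      unfolding h_def by (simp add: algebra_simps)
    then have "(LINT x:?T|lborel. (h x 1 - h x (s n)) / \<sigma> n)
      = (LINT x:?T|lborel. \<phi> x - s n ^ ?d * \<phi> (s n *\<^sub>R x + (1 - s n) *\<^sub>R a)) / \<sigma> n"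
      by simp
    also have "(LINT x:?T|lborel. \<phi> x - s n ^ ?d * \<phi> (s n *\<^sub>R x + (1 - s n) *\<^sub>R a))
       = (LINT x:?T|lborel. \<phi> x) - (LINT x:Ts n|lborel. \<phi> x)"
      using i\<phi> i2 Ts(3)[of n] by (simp add: set_integral_diff)
    also have "(LINT x:?T|lborel. \<phi> x) = (LINT x:Ts n \<union> (?T - Ts n)|lborel. \<phi> x)"
      using TsT[of n] by (simp add: Un_absorb1)
    also have "\<dots> = (LINT x:Ts n|lborel. \<phi> x) + (LINT x:?T - Ts n|lborel. \<phi> x)"
      using i\<phi> TsT[of n] Ts(1)[of n] Tb by (intro set_integral_Un) (auto intro: set_integrable_subset)
    finally show ?thesis by simp
  qed
  have shell: "bary C a x < \<sigma> n" if "x \<in> ?T - Ts n" for x n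
  proof (rule ccontr)
    assume "\<not> bary C a x < \<sigma> n"
    then have ge: "\<sigma> n \<le> bary C a x" by simp
    define y where "y = a + (1 / s n) *\<^sub>R (x - a)"
    have xy: "s n *\<^sub>R y + (1 - s n) *\<^sub>R a = x" unfolding y_def using s(1)[of n] by (simp add: algebra_simps)
    have bsum: "bary C c x = s n * bary C c y + (1 - s n) * bary C c a" for c
      using bary_affine_sum[of "{True, False}" "\<lambda>b. if b then s n else 1 - s n" C c "\<lambda>b. if b then y else a"] xy by simp
    have "y \<in> ?T"
      unfolding mem_simplex_iff
    proof
      fix c assume c: "c \<in> C"
      have "0 \<le> s n * bary C c y"
      proof (cases "c = a")
        case True
        then show ?thesis using bsum[of a] ge a by (simp add: bary_vertex s_def)
      next
        case False
        moreover have "0 \<le> bary C c x" using that c mem_simplex_iff[of x] by blast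
        ultimately show ?thesis using bsum[of c] c a by (simp add: bary_vertex)
      qed
      then show "0 \<le> bary C c y" using s(1)[of n] by (simp add: zero_le_mult_iff)
    qed
    then have "s n *\<^sub>R y + (1 - s n) *\<^sub>R a \<in> Ts n" unfolding Ts_def by (rule imageI)
    then have "x \<in> Ts n" unfolding xy .
    then show False using that by blast
  qed
  have near: "\<exists>y\<in>?T. \<phi> y = 0 \<and> dist x y \<le> \<sigma> n * D" if x: "x \<in> ?T - Ts n" for x n
  proof -
    define l where "l = bary C a x"
    have l: "0 \<le> l" "l < \<sigma> n" "l < 1" using shell[OF x] x a mem_simplex_iff[of x] \<sigma>(2)[of n] unfolding l_def by auto
    define y where "y = a + (1 / (1 - l)) *\<^sub>R (x - a)"
    have xy: "(1 - l) *\<^sub>R y + l *\<^sub>R a = x" unfolding y_def using l by (simp add: algebra_simps)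
    have bsum: "bary C c x = (1 - l) * bary C c y + l * bary C c a" for c
      using bary_affine_sum[of "{True, False}" "\<lambda>b. if b then 1 - l else l" C c "\<lambda>b. if b then y else a"] xy by simp
    have ya: "bary C a y = 0" using bsum[of a] a l by (simp add: bary_vertex l_def[symmetric])
    have "0 \<le> bary C c y" if c: "c \<in> C" for c
    proof (cases "c = a")
      case True then show ?thesis using ya by simp
    next
      case False
      moreover have "0 \<le> bary C c x" using x c mem_simplex_iff[of x] by blast
      ultimately have "0 \<le> (1 - l) * bary C c y" using bsum[of c] c a by (simp add: bary_vertex)
      then show ?thesis using l by (simp add: zero_le_mult_iff)
    qed
    then have yT: "y \<in> ?T" unfolding mem_simplex_iff by blast
    have "x - y = l *\<^sub>R (a - y)" using xy by (simp add: algebra_simps)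
    then have "dist x y = l * dist a y" using l by (simp add: dist_norm)
    also have "\<dots> \<le> \<sigma> n * D" using l D[OF aT yT] by (intro mult_mono) auto
    finally show ?thesis using yT ya zero[OF yT] by blast
  qed
  have small: "\<bar>LINT x:?T|lborel. h' x 1\<bar> \<le> e * (?d * measure lborel ?T)" if e: "0 < e" for e
  proof -
    have "uniformly_continuous_on ?T \<phi>" using c\<phi> simplex_compact by (rule compact_uniformly_continuous)
    then obtain \<delta> where \<delta>: "0 < \<delta>" "\<And>x y. x \<in> ?T \<Longrightarrow> y \<in> ?T \<Longrightarrow> dist y x < \<delta> \<Longrightarrow> dist (\<phi> y) (\<phi> x) < e"
      using e by (rule uniformly_continuous_onE) blast
    have "(\<lambda>n. \<sigma> n * D) \<longlonglongrightarrow> 0 * D" by (intro tendsto_mult \<sigma>0 tendsto_const)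
    then have ev: "\<forall>\<^sub>F n in sequentially. \<sigma> n * D < \<delta>" using \<delta>(1) by (intro order_tendstoD(2)[where y = "0 * D"]) auto
    have "\<forall>\<^sub>F n in sequentially. \<bar>LINT x:?T|lborel. (h x 1 - h x (s n)) / \<sigma> n\<bar> \<le> e * (?d * measure lborel ?T)"
      using ev
    proof eventually_elim
      case (elim n)
      have le: "\<bar>\<phi> x\<bar> \<le> e" if x: "x \<in> ?T - Ts n" for x
      proof -
        obtain y where y: "y \<in> ?T" "\<phi> y = 0" "dist x y \<le> \<sigma> n * D" using near[OF x] by blast
        then show ?thesis using \<delta>(2)[of y x] x elim by (simp add: dist_real_def)
      qed
      have Sb: "?T - Ts n \<in> sets borel" using Ts(1)[of n] Tb by simp
      have iS: "set_integrable lborel (?T - Ts n) \<phi>" using i\<phi> by (rule set_integrable_subset) (use Sb in auto)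
      have em: "emeasure lborel (?T - Ts n) < top" by (rule le_less_trans[OF emeasure_mono Tfin]) (use Tb in auto)
      have "\<bar>LINT x:?T - Ts n|lborel. \<phi> x\<bar> \<le> (LINT x|lborel. \<bar>indicator (?T - Ts n) x *\<^sub>R \<phi> x\<bar>)"
        unfolding set_lebesgue_integral_def by (rule integral_abs_bound)
      also have "\<dots> \<le> (LINT x|lborel. e * indicator (?T - Ts n) x)"
      proof (rule integral_mono)
        show "integrable lborel (\<lambda>x. \<bar>indicator (?T - Ts n) x *\<^sub>R \<phi> x\<bar>)"
          using iS unfolding set_integrable_def by (rule integrable_abs)
        show "integrable lborel (\<lambda>x. e * indicator (?T - Ts n) x)"
          using Sb em by (intro integrable_mult_right integrable_real_indicator) auto
        show "\<bar>indicator (?T - Ts n) x *\<^sub>R \<phi> x\<bar> \<le> e * indicator (?T - Ts n) x" for x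
          using le[of x] by (cases "x \<in> ?T - Ts n") simp_all
      qed
      also have "\<dots> = e * measure lborel (?T - Ts n)" using em Sb by simp
      also have "measure lborel (?T - Ts n) = measure lborel ?T - measure lborel (Ts n)"
        using Tb Ts(1)[of n] TsT[of n] Tfin by (intro measure_Diff) auto
      also have "\<dots> = (1 - s n ^ ?d) * measure lborel ?T" unfolding Ts(2) by (simp add: algebra_simps)
      finally have 1: "\<bar>LINT x:?T - Ts n|lborel. \<phi> x\<bar> \<le> e * ((1 - s n ^ ?d) * measure lborel ?T)" .
      have "1 + real ?d * (- \<sigma> n) \<le> (1 + (- \<sigma> n)) ^ ?d"
        using \<sigma>[of n] by (intro Bernoulli_inequality) auto
      then have "1 - s n ^ ?d \<le> ?d * \<sigma> n" unfolding s_def by simp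
      then have "e * ((1 - s n ^ ?d) * measure lborel ?T) \<le> e * ((?d * \<sigma> n) * measure lborel ?T)"
        using e by (intro mult_left_mono mult_right_mono) auto
      then have "\<bar>LINT x:?T - Ts n|lborel. \<phi> x\<bar> \<le> (e * (?d * measure lborel ?T)) * \<sigma> n"
        using 1 by (simp add: algebra_simps)
      then show ?case unfolding val using \<sigma>(1)[of n] by (simp add: pos_divide_le_eq)
    qed
    then show ?thesis by (rule tendsto_upperbound[OF tendsto_rabs[OF conv]]) simp
  qed
  have "\<bar>LINT x:?T|lborel. h' x 1\<bar> \<le> 0"
  proof (rule field_le_epsilon)
    fix e :: real assume e: "0 < e"
    define k where "k = ?d * measure lborel ?T"
    have "0 < k" unfolding k_def by (intro mult_pos_pos simplex_measure_pos) simp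
    then show "\<bar>LINT x:?T|lborel. h' x 1\<bar> \<le> 0 + e" using small[of "e / k"] e unfolding k_def[symmetric] by simp
  qed
  moreover have "h' x 1 = ?d * \<phi> x + \<psi> x \<bullet> (x - a)" for x unfolding h'_def by simp
  ultimately show ?thesis by simp
qed

end

definition facet_flux :: "('a::euclidean_space \<Rightarrow> real) \<Rightarrow> ('a \<Rightarrow> 'a) \<Rightarrow> 'a set \<Rightarrow> 'a set \<Rightarrow> real" where
  "facet_flux \<phi> \<psi> T F = (LINT x:T|lborel. real DIM('a) * \<phi> x + \<psi> x \<bullet> (x - opp T F)) / measure lborel T"

lemma facet_flux_zero:
  fixes T :: "'a::euclidean_space set"
  assumes T: "int DIM('a) simplex T" "F facet_of T" and \<phi>: "\<And>x. GDERIV \<phi> x :> \<psi> x" "continuous_on UNIV \<psi>"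
    and zero: "\<And>x. x \<in> F \<Longrightarrow> \<phi> x = 0"
  shows "facet_flux \<phi> \<psi> T F = 0"
proof -
  interpret full_simplex "verts T" by (rule simplex_verts(1)[OF T(1)])
  note o = opp_facet(1)[OF T] opp_facet(2)[OF T, symmetric]
  have "(LINT x:convex hull (verts T)|lborel. DIM('a) * \<phi> x + \<psi> x \<bullet> (x - opp T F)) = 0"
  proof (rule cone_flux[OF \<phi> o(1)])
    fix x assume "x \<in> convex hull verts T" "bary (verts T) (opp T F) x = 0"
    then have "x \<in> F" using mem_facet_iff[OF o(1), of x] mem_simplex_iff[of x] unfolding o(2) by blast
    then show "\<phi> x = 0" by (rule zero)
  qed
  then show ?thesis unfolding facet_flux_def simplex_verts(2)[OF T(1), symmetric] by simp
qed

lemma facet_flux_eq: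
  fixes T1 T2 :: "'a::euclidean_space set" and \<phi> :: "'a \<Rightarrow> real"
  assumes T1: "int DIM('a) simplex T1" "F facet_of T1" and T2: "int DIM('a) simplex T2" "F facet_of T2"
    and \<phi>: "\<And>x. GDERIV \<phi> x :> \<psi> x" "continuous_on UNIV \<psi>"
  shows "facet_flux \<phi> \<psi> T1 F = facet_flux \<phi> \<psi> T2 F"
proof -
  interpret S1: full_simplex "verts T1" by (rule simplex_verts(1)[OF T1(1)])
  interpret S2: full_simplex "verts T2" by (rule simplex_verts(1)[OF T2(1)])
  note o1 = opp_facet(1)[OF T1] opp_facet(2)[OF T1, symmetric]
  note o2 = opp_facet(1)[OF T2] opp_facet(2)[OF T2, symmetric]
  note h1 = simplex_verts(2)[OF T1(1), symmetric] and h2 = simplex_verts(2)[OF T2(1), symmetric]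
  define a1 where "a1 = opp T1 F"
  define a2 where "a2 = opp T2 F"
  define g where "g = facet_grad T1 F"
  define u where "u = a2 - a1"
  let ?d = "real DIM('a)"
  have lam1: "bary (verts T1) a1 x = 1 + g \<bullet> (x - a1)" for x
    unfolding bary_def g_def facet_grad_def a1_def by simp
  have lamF: "1 + g \<bullet> (x - a1) = 0" if "x \<in> F" for x
    using S1.mem_facet_iff[OF o1(1), of x] that lam1[of x] unfolding o1(2) a1_def by simp
  have lamF2: "bary (verts T2) a2 x = 0" if "x \<in> F" for x
    using S2.mem_facet_iff[OF o2(1), of x] that unfolding o2(2) a2_def by simp
  obtain y where y: "y \<in> F" using T1(2) unfolding facet_of_def by blast
  have ne: "1 + g \<bullet> u \<noteq> 0"
  proof -
    obtain k1 where k1: "k1 \<noteq> 0" "g = k1 *\<^sub>R facet_normal F" using facet_orient[OF T1] unfolding g_def by blast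
    obtain k2 where k2: "k2 \<noteq> 0" "facet_grad T2 F = k2 *\<^sub>R facet_normal F" using facet_orient[OF T2] by blast
    have "bary (verts T2) a2 a2 = 1" using S2.bary_vertex[OF o2(1) o2(1)] unfolding a2_def by simp
    then have "1 = bary (verts T2) a2 a2 - bary (verts T2) a2 y" using lamF2[OF y] by simp
    also have "\<dots> = facet_grad T2 F \<bullet> (a2 - y)" unfolding S2.bary_diff facet_grad_def a2_def ..
    finally have "facet_normal F \<bullet> (a2 - y) \<noteq> 0" unfolding k2(2) by auto
    then have "g \<bullet> (a2 - y) \<noteq> 0" unfolding k1(2) using k1(1) by simp
    moreover have "g \<bullet> (a2 - y) = 1 + g \<bullet> u" using lamF[OF y] unfolding u_def by (simp add: inner_diff_right)
    ultimately show ?thesis by simp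
  qed
  define f where "f x = x + (g \<bullet> x) *\<^sub>R u" for x
  define M where "M x = f x + (1 - g \<bullet> a1) *\<^sub>R u" for x
  have M: "M x = x + (1 + g \<bullet> (x - a1)) *\<^sub>R u" for x
    unfolding M_def f_def by (simp add: inner_diff_right algebra_simps)
  have lf: "linear f" unfolding f_def by (rule linearI) (simp_all add: inner_add_right algebra_simps)
  have inj: "inj f"
  proof (rule linear_injective_0[OF lf, THEN iffD2], intro allI impI)
    fix x assume 0: "f x = 0"
    have "g \<bullet> f x = (g \<bullet> x) * (1 + g \<bullet> u)" unfolding f_def by (simp add: inner_add_right algebra_simps)
    then have "g \<bullet> x = 0" using 0 ne by simp
    then show "x = 0" using 0 unfolding f_def by simp
  qed
  have vF: "verts T1 - {a1} = verts T2 - {a2}"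
  proof -
    have "{x. x extreme_point_of F} = verts T1 - {a1}"
      using extreme_point_of_convex_hull_affine_independent[OF affine_independent_Diff[OF S1.aff_indep], of _ "{a1}"] o1(2)
      unfolding a1_def by auto
    moreover have "{x. x extreme_point_of F} = verts T2 - {a2}"
      using extreme_point_of_convex_hull_affine_independent[OF affine_independent_Diff[OF S2.aff_indep], of _ "{a2}"] o2(2)
      unfolding a2_def by auto
    ultimately show ?thesis by simp
  qed
  have MF: "M x = x" if "x \<in> F" for x unfolding M lamF[OF that] by simp
  have Ma: "M a1 = a2" unfolding M u_def by simp
  have MC: "M ` verts T1 = verts T2"
  proof -
    have "verts T1 - {a1} \<subseteq> F" using hull_subset[of "verts T1 - {a1}" convex] o1(2) unfolding a1_def by simp
    then have "M ` (verts T1 - {a1}) = verts T1 - {a1}" using MF by (force simp: image_def)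
    moreover have "verts T1 = insert a1 (verts T1 - {a1})" using o1(1) unfolding a1_def by blast
    ultimately have "M ` verts T1 = insert a2 (verts T1 - {a1})" using Ma by (metis image_insert)
    also have "\<dots> = verts T2" unfolding vF using o2(1) unfolding a2_def by blast
    finally show ?thesis .
  qed
  have MT: "M ` T1 = T2"
  proof -
    have "M ` S = (\<lambda>x. (1 - g \<bullet> a1) *\<^sub>R u + x) ` (f ` S)" for S unfolding M_def image_image by (simp add: add.commute)
    then have "M ` (convex hull verts T1) = convex hull (M ` verts T1)"
      by (simp add: convex_hull_linear_image[OF lf] convex_hull_translation)
    then show ?thesis unfolding MC h1 h2 .
  qed
  have c\<phi>: "continuous_on S \<phi>" for S using GDERIV_continuous_on[OF \<phi>(1)] .
  have c\<psi>: "continuous_on S \<psi>" for S using \<phi>(2) continuous_on_subset by blast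
  have cM: "continuous_on S M" for S unfolding M by (intro continuous_intros)
  define \<phi>' where "\<phi>' x = \<phi> (M x)" for x
  define \<psi>' where "\<psi>' x = \<psi> (M x) + (\<psi> (M x) \<bullet> u) *\<^sub>R g" for x
  have c\<phi>': "continuous_on S \<phi>'" for S unfolding \<phi>'_def by (rule continuous_on_compose2[OF c\<phi>[of UNIV] cM]) simp
  have c\<psi>M: "continuous_on S (\<lambda>x. \<psi> (M x))" for S by (rule continuous_on_compose2[OF c\<psi>[of UNIV] cM]) simp
  have c\<psi>': "continuous_on S \<psi>'" for S unfolding \<psi>'_def by (intro continuous_intros c\<psi>M)
  have d': "GDERIV \<phi>' x :> \<psi>' x" for x
  proof -
    have "(M has_derivative f) (at x)"
      unfolding M_def f_def by (auto intro!: derivative_eq_intros)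
    then have "((\<lambda>x. \<phi> (M x)) has_derivative (\<lambda>t. f t \<bullet> \<psi> (M x))) (at x)"
      using \<phi>(1)[of "M x"] unfolding gderiv_def by (rule has_derivative_compose)
    moreover have "f t \<bullet> \<psi> (M x) = t \<bullet> \<psi>' x" for t
      unfolding f_def \<psi>'_def by (simp add: inner_add_left inner_add_right inner_commute mult.commute)
    ultimately show ?thesis unfolding gderiv_def \<phi>'_def by simp
  qed
  define h where "h x = ?d * \<phi> x + \<psi> x \<bullet> (x - a2)" for x
  have hM: "h (M x) = ?d * \<phi>' x + \<psi>' x \<bullet> (x - a1)" for x
  proof -
    have "M x - a2 = (x - a1) + (g \<bullet> (x - a1)) *\<^sub>R u" unfolding M u_def by (simp add: algebra_simps)
    then show ?thesis unfolding h_def \<phi>'_def \<psi>'_def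
      by (simp add: inner_add_left inner_add_right inner_commute mult.commute)
  qed
  have cpt: "compact T1" "compact T2" using S1.simplex_compact S2.simplex_compact unfolding h1 h2 by auto
  have "GDERIV (\<lambda>x. \<phi> x - \<phi>' x) x :> \<psi> x - \<psi>' x" for x
    by (intro GDERIV_diff \<phi>(1) d')
  moreover have "continuous_on UNIV (\<lambda>x. \<psi> x - \<psi>' x)" by (intro continuous_intros c\<psi> c\<psi>')
  ultimately have "facet_flux (\<lambda>x. \<phi> x - \<phi>' x) (\<lambda>x. \<psi> x - \<psi>' x) T1 F = 0"
    by (rule facet_flux_zero[OF T1]) (simp add: \<phi>'_def MF)
  then have "(LINT x:T1|lborel. ?d * (\<phi> x - \<phi>' x) + (\<psi> x - \<psi>' x) \<bullet> (x - a1)) = 0"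
    unfolding facet_flux_def a1_def[symmetric] using S1.simplex_measure_pos unfolding h1 by simp
  moreover have "?d * (\<phi> x - \<phi>' x) + (\<psi> x - \<psi>' x) \<bullet> (x - a1) = (?d * \<phi> x + \<psi> x \<bullet> (x - a1)) - h (M x)" for x
    unfolding hM by (simp add: inner_diff_left algebra_simps)
  moreover have "set_integrable lborel T1 (\<lambda>x. ?d * \<phi> x + \<psi> x \<bullet> (x - a1))"
    using cpt(1) by (rule set_integrable_continuous_compact) (intro continuous_intros c\<phi> c\<psi>)
  moreover have "set_integrable lborel T1 (\<lambda>x. h (M x))"
    unfolding hM using cpt(1) by (rule set_integrable_continuous_compact) (intro continuous_intros c\<phi>' c\<psi>')
  ultimately have eq1: "(LINT x:T1|lborel. ?d * \<phi> x + \<psi> x \<bullet> (x - a1)) = (LINT x:T1|lborel. h (M x))"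
    by (simp add: set_integral_diff)
  have "continuous_on UNIV h" unfolding h_def by (intro continuous_intros c\<phi> c\<psi>)
  then have hb: "h \<in> borel_measurable borel" by (rule borel_measurable_continuous_onI)
  have "emeasure lborel T1 < top" using emeasure_compact_finite[OF cpt(1)] by (simp add: top.not_eq_extremum)
  then have "measure lborel T2 * (LINT x:T1|lborel. h (M x)) = measure lborel T1 * (LINT x:T2|lborel. h x)"
    using affine_average(1)[OF lf inj M_def borel_compact[OF cpt(1)] _ hb] unfolding MT by blast
  moreover have "measure lborel T1 > 0" "measure lborel T2 > 0"
    using S1.simplex_measure_pos S2.simplex_measure_pos unfolding h1 h2 by auto
  ultimately show ?thesis
    unfolding facet_flux_def a1_def[symmetric] a2_def[symmetric] eq1 h_def[symmetric]
    by (simp add: frac_eq_eq mult.commute)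
qed

lemma (in full_simplex) affine_field_flux:
  fixes b :: real
  assumes \<phi>: "\<And>x. GDERIV \<phi> x :> \<psi> x" "continuous_on UNIV \<psi>"
    and zero: "\<And>x a. x \<in> convex hull C \<Longrightarrow> a \<in> C \<Longrightarrow> bary C a x = 0 \<Longrightarrow> \<phi> x = 0"
  shows "(LINT x:convex hull C|lborel. (v + b *\<^sub>R x) \<bullet> \<psi> x) = - (DIM('a) * b) * (LINT x:convex hull C|lborel. \<phi> x)"
proof -
  let ?T = "convex hull C" and ?d = "real DIM('a)"
  have c\<phi>: "continuous_on S \<phi>" for S using GDERIV_continuous_on[OF \<phi>(1)] .
  have c\<psi>: "continuous_on S \<psi>" for S using \<phi>(2) continuous_on_subset by blast
  have si: "set_integrable lborel ?T k" if "continuous_on UNIV k" for k :: "'a \<Rightarrow> real"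
    using simplex_compact that by (rule set_integrable_continuous_compact)
  define I where "I = (LINT x:?T|lborel. \<phi> x)"
  define E where "E = (LINT x:?T|lborel. \<psi> x \<bullet> x)"
  define G where "G w = (LINT x:?T|lborel. \<psi> x \<bullet> w)" for w
  have Gadd: "G (\<Sum>c\<in>C. u c *\<^sub>R c) = (\<Sum>c\<in>C. u c * G c)" for u
  proof -
    have "G (\<Sum>c\<in>C. u c *\<^sub>R c) = (LINT x:?T|lborel. \<Sum>c\<in>C. u c * (\<psi> x \<bullet> c))"
      unfolding G_def by (simp add: inner_sum_right)
    also have "\<dots> = (\<Sum>c\<in>C. u c * G c)"
      unfolding G_def set_lebesgue_integral_def scaleR_sum_right
    proof (subst Bochner_Integration.integral_sum)
      fix c show "integrable lborel (\<lambda>x. indicat_real ?T x *\<^sub>R (u c * (\<psi> x \<bullet> c)))"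
        using si[of "\<lambda>x. u c * (\<psi> x \<bullet> c)"] unfolding set_integrable_def by (simp add: continuous_intros c\<psi>)
    next
      show "(\<Sum>c\<in>C. LINT x|lborel. indicat_real ?T x *\<^sub>R (u c * (\<psi> x \<bullet> c))) = (\<Sum>c\<in>C. u c * (LINT x|lborel. indicat_real ?T x *\<^sub>R (\<psi> x \<bullet> c)))"
        by (intro sum.cong refl) (simp add: mult.left_commute)
    qed
    finally show ?thesis .
  qed
  have Gc: "G c = ?d * I + E" if c: "c \<in> C" for c
  proof -
    have "0 = (LINT x:?T|lborel. ?d * \<phi> x + \<psi> x \<bullet> (x - c))"
      using cone_flux[OF \<phi> c] zero[OF _ c] by simp
    also have "\<dots> = (LINT x:?T|lborel. (?d * \<phi> x + \<psi> x \<bullet> x) - \<psi> x \<bullet> c)"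
      by (simp add: inner_diff_right algebra_simps)
    also have "\<dots> = (LINT x:?T|lborel. ?d * \<phi> x + \<psi> x \<bullet> x) - G c"
      unfolding G_def by (intro set_integral_diff si continuous_intros c\<phi> c\<psi>)
    also have "(LINT x:?T|lborel. ?d * \<phi> x + \<psi> x \<bullet> x) = (LINT x:?T|lborel. ?d * \<phi> x) + E"
      unfolding E_def by (intro set_integral_add si continuous_intros c\<phi> c\<psi>)
    also have "(LINT x:?T|lborel. ?d * \<phi> x) = ?d * I" unfolding I_def by simp
    finally show ?thesis by simp
  qed
  have Gp: "G p = ?d * I + E" for p
  proof -
    have "G p = (\<Sum>c\<in>C. bary C c p * G c)" using Gadd[of "\<lambda>c. bary C c p"] bary_combination(2)[of p] by simp
    also have "\<dots> = (\<Sum>c\<in>C. bary C c p) * (?d * I + E)" unfolding sum_distrib_right by (intro sum.cong refl) (simp add: Gc)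
    finally show ?thesis using bary_combination(1)[of p] by simp
  qed
  have G0: "G p = 0" for p using Gp[of p] Gp[of 0] by (simp add: G_def)
  then have E: "E = - ?d * I" using Gp[of 0] by simp
  have "(v + b *\<^sub>R x) \<bullet> \<psi> x = \<psi> x \<bullet> v + b * (\<psi> x \<bullet> x)" for x
    by (subst inner_commute) (simp add: inner_add_right)
  then have "(LINT x:?T|lborel. (v + b *\<^sub>R x) \<bullet> \<psi> x) = (LINT x:?T|lborel. \<psi> x \<bullet> v + b * (\<psi> x \<bullet> x))"
    by (simp only:)
  also have "\<dots> = G v + (LINT x:?T|lborel. b * (\<psi> x \<bullet> x))"
    unfolding G_def by (intro set_integral_add si continuous_intros c\<psi>)
  also have "\<dots> = b * E" using G0 unfolding E_def by simp
  finally show ?thesis unfolding E I_def by simp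
qed

section \<open>The weak divergence\<close>

definition smoothstep :: "real \<Rightarrow> real" where
  "smoothstep t = 1 - (max 0 (1 - (max 0 t)\<^sup>2))\<^sup>2"

lemma square_max_deriv: "((\<lambda>t. (max 0 t)\<^sup>2) has_real_derivative 2 * max 0 t) (at (t::real))"
proof -
  consider "t < 0" | "t = 0" | "t > 0" by linarith
  then show ?thesis
  proof cases
    case 1
    have "((\<lambda>t. 0) has_real_derivative 2 * max 0 t) (at t)" using 1 by (auto intro!: derivative_eq_intros)
    then show ?thesis
      by (rule DERIV_cong_ev[THEN iffD1, OF refl _ refl, rotated])
         (use 1 in \<open>auto simp: eventually_at_filter intro!: eventually_mono[OF eventually_nhds_in_open[of "{..<0}"]]\<close>)
  next
    case 3
    have "((\<lambda>t. t\<^sup>2) has_real_derivative 2 * max 0 t) (at t)" using 3 by (auto intro!: derivative_eq_intros)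
    then show ?thesis
      by (rule DERIV_cong_ev[THEN iffD1, OF refl _ refl, rotated])
         (use 3 in \<open>auto intro!: eventually_mono[OF eventually_nhds_in_open[of "{0<..}"]]\<close>)
  next
    case 2
    have "((\<lambda>k. (max 0 k)\<^sup>2 / k) \<longlongrightarrow> 0) (at (0::real))"
    proof (rule Lim_null_comparison[where g = "\<lambda>k. \<bar>k\<bar>"])
      show "\<forall>\<^sub>F k in at (0::real). norm ((max 0 k)\<^sup>2 / k) \<le> \<bar>k\<bar>"
        by (rule always_eventually) (auto simp: max_def power2_eq_square)
      show "((\<lambda>k. \<bar>k\<bar>) \<longlongrightarrow> 0) (at (0::real))" by (auto intro!: tendsto_eq_intros)
    qed
    then show ?thesis unfolding DERIV_def 2 by simp
  qed
qed

lemma smoothstep_C1: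
  obtains s' where "\<And>t. (smoothstep has_real_derivative s' t) (at t)" "continuous_on UNIV s'"
proof -
  let ?s' = "\<lambda>t::real. 0 - 2 * max 0 (1 - (max 0 t)\<^sup>2) * (0 - 2 * max 0 t)"
  have "(smoothstep has_real_derivative ?s' t) (at t)" for t
    unfolding smoothstep_def
    by (intro DERIV_diff DERIV_const DERIV_chain2[OF square_max_deriv] square_max_deriv)
  moreover have "continuous_on UNIV ?s'"
    by (intro continuous_on_diff continuous_on_mult continuous_on_const continuous_on_max continuous_on_power continuous_on_id)
  ultimately show ?thesis by (rule that)
qed

lemma smoothstep_simps: "t \<le> 0 \<Longrightarrow> smoothstep t = 0" "1 \<le> t \<Longrightarrow> smoothstep t = 1"
proof -
  show "t \<le> 0 \<Longrightarrow> smoothstep t = 0" unfolding smoothstep_def by simp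
  assume t: "1 \<le> t"
  then have "1 \<le> t\<^sup>2" by simp
  then show "smoothstep t = 1" using t unfolding smoothstep_def by (simp add: max_absorb1 max_absorb2)
qed

lemma smoothstep_bounds: "0 \<le> smoothstep t" "smoothstep t \<le> 1"
proof -
  have "max 0 (1 - (max 0 t)\<^sup>2) \<le> 1" "0 \<le> max 0 (1 - (max 0 t)\<^sup>2)" by auto
  then have "(max 0 (1 - (max 0 t)\<^sup>2))\<^sup>2 \<le> 1" by (simp add: power_le_one)
  then show "0 \<le> smoothstep t" "smoothstep t \<le> 1" unfolding smoothstep_def by auto
qed

definition box_bump :: "'a::euclidean_space \<Rightarrow> 'a \<Rightarrow> nat \<Rightarrow> 'a \<Rightarrow> real" where
  "box_bump a b k x = (\<Prod>i\<in>Basis. smoothstep (real k * ((x \<bullet> i - a \<bullet> i) * (b \<bullet> i - x \<bullet> i))))"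

lemma box_bump_GDERIV:
  obtains \<psi> where "\<And>x. GDERIV (box_bump a b k) x :> \<psi> x" "continuous_on UNIV \<psi>"
proof -
  obtain s' where s': "\<And>t. (smoothstep has_real_derivative s' t) (at t)" "continuous_on UNIV s'"
    by (rule smoothstep_C1) blast
  define q where "q i x = real k * ((x \<bullet> i - a \<bullet> i) * (b \<bullet> i - x \<bullet> i))" for i x :: 'a
  define c where "c i x = s' (q i x) * (real k * ((b \<bullet> i - x \<bullet> i) - (x \<bullet> i - a \<bullet> i))) * (\<Prod>j\<in>Basis - {i}. smoothstep (q j x))" for i x
  have cs: "continuous_on S smoothstep" for S
    by (rule continuous_at_imp_continuous_on) (use DERIV_isCont[OF s'(1)] in blast)
  have cq: "continuous_on S (q i)" for S i unfolding q_def by (intro continuous_intros)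
  have dq: "(q i has_derivative (\<lambda>h. (h \<bullet> i) * (real k * ((b \<bullet> i - x \<bullet> i) - (x \<bullet> i - a \<bullet> i))))) (at x)" for i x
    unfolding q_def by (auto intro!: derivative_eq_intros simp: algebra_simps)
  have ds: "((\<lambda>x. smoothstep (q i x)) has_derivative (\<lambda>h. s' (q i x) * ((h \<bullet> i) * (real k * ((b \<bullet> i - x \<bullet> i) - (x \<bullet> i - a \<bullet> i)))))) (at x)" for i x
    by (rule has_derivative_compose[OF dq s'(1)[unfolded has_field_derivative_def]])
  have "GDERIV (box_bump a b k) x :> (\<Sum>i\<in>Basis. c i x *\<^sub>R i)" for x
  proof -
    have "((\<lambda>x. \<Prod>i\<in>Basis. smoothstep (q i x)) has_derivative
       (\<lambda>h. \<Sum>i\<in>Basis. s' (q i x) * ((h \<bullet> i) * (real k * ((b \<bullet> i - x \<bullet> i) - (x \<bullet> i - a \<bullet> i)))) * (\<Prod>j\<in>Basis - {i}. smoothstep (q j x)))) (at x)"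
      by (rule has_derivative_prod[OF ds])
    moreover have "(\<Sum>i\<in>Basis. s' (q i x) * ((h \<bullet> i) * (real k * ((b \<bullet> i - x \<bullet> i) - (x \<bullet> i - a \<bullet> i)))) * (\<Prod>j\<in>Basis - {i}. smoothstep (q j x)))
       = h \<bullet> (\<Sum>i\<in>Basis. c i x *\<^sub>R i)" for h
      unfolding inner_sum_right c_def by (intro sum.cong refl) (simp add: mult_ac)
    ultimately show ?thesis unfolding gderiv_def box_bump_def q_def[symmetric] by simp
  qed
  moreover have "continuous_on UNIV (\<lambda>x. \<Sum>i\<in>Basis. c i x *\<^sub>R i)"
    unfolding c_def
    by (intro continuous_intros continuous_on_compose2[OF s'(2) cq] continuous_on_compose2[OF cs[of UNIV] cq]) auto
  ultimately show ?thesis by (rule that)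
qed

lemma box_factor_pos:
  fixes x a b :: real
  assumes "a \<le> b"
  shows "0 < (x - a) * (b - x) \<longleftrightarrow> a < x \<and> x < b"
  using assms by (auto simp: zero_less_mult_iff)

lemma box_bump_eq_0:
  assumes "\<And>i. i \<in> Basis \<Longrightarrow> a \<bullet> i \<le> b \<bullet> i" "x \<notin> box a b"
  shows "box_bump a b k x = 0"
proof -
  obtain i where i: "i \<in> Basis" "\<not> (a \<bullet> i < x \<bullet> i \<and> x \<bullet> i < b \<bullet> i)" using assms(2) unfolding mem_box by blast
  then have "(x \<bullet> i - a \<bullet> i) * (b \<bullet> i - x \<bullet> i) \<le> 0" using box_factor_pos[OF assms(1)[OF i(1)]] not_less by blast
  then have "real k * ((x \<bullet> i - a \<bullet> i) * (b \<bullet> i - x \<bullet> i)) \<le> 0" by (rule mult_nonneg_nonpos[OF of_nat_0_le_iff])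
  then show ?thesis using i(1) smoothstep_simps(1) unfolding box_bump_def by (intro prod_zero) auto
qed

lemma box_bump_bounds: "0 \<le> box_bump a b k x" "box_bump a b k x \<le> 1"
  unfolding box_bump_def using smoothstep_bounds by (auto intro!: prod_nonneg prod_le_1)

lemma box_bump_tendsto:
  assumes ab: "\<And>i. i \<in> Basis \<Longrightarrow> a \<bullet> i \<le> b \<bullet> i"
  shows "(\<lambda>k. box_bump a b k x) \<longlonglongrightarrow> indicator (box a b) x"
proof (cases "x \<in> box a b")
  case False
  then show ?thesis using box_bump_eq_0[OF ab False] by simp
next
  case True
  have "(\<lambda>k. box_bump a b k x) \<longlonglongrightarrow> (\<Prod>i\<in>(Basis::'a set). 1)"
    unfolding box_bump_def
  proof (rule tendsto_prod)
    fix i :: 'a assume i: "i \<in> Basis"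
    define p where "p = (x \<bullet> i - a \<bullet> i) * (b \<bullet> i - x \<bullet> i)"
    have "0 < p" unfolding p_def using True i box_factor_pos[OF ab[OF i]] by (simp add: mem_box)
    obtain n where n: "1 / p < real n" using reals_Archimedean2 by blast
    have "1 \<le> real k * p" if "n \<le> k" for k
    proof -
      have "1 / p < real k" using n that by linarith
      then show ?thesis using \<open>0 < p\<close> by (simp add: divide_less_eq)
    qed
    then have "\<forall>\<^sub>F k in sequentially. 1 \<le> real k * p" by (rule eventually_sequentiallyI)
    then have "\<forall>\<^sub>F k in sequentially. smoothstep (real k * p) = 1" by eventually_elim (rule smoothstep_simps(2))
    then show "(\<lambda>k. smoothstep (real k * ((x \<bullet> i - a \<bullet> i) * (b \<bullet> i - x \<bullet> i)))) \<longlonglongrightarrow> 1"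
      unfolding p_def by (rule tendsto_eventually)
  qed
  then show ?thesis using True by simp
qed

lemma box_bump_test_function:
  fixes a b :: "real^'d"
  assumes ab: "\<And>i. i \<in> Basis \<Longrightarrow> a \<bullet> i \<le> b \<bullet> i"
  obtains \<psi> where "test_function (box_bump a b k) \<psi>" "supp (box_bump a b k) \<subseteq> cbox a b"
proof -
  obtain \<psi> where \<psi>: "\<And>x. GDERIV (box_bump a b k) x :> \<psi> x" "continuous_on UNIV \<psi>"
    by (rule box_bump_GDERIV) blast
  have sub: "supp (box_bump a b k) \<subseteq> cbox a b"
    unfolding supp_def
  proof (rule closure_minimal)
    show "{x. box_bump a b k x \<noteq> 0} \<subseteq> cbox a b"
      using box_bump_eq_0[OF ab] box_subset_cbox by blast
  qed (rule closed_cbox)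
  moreover have "compact (supp (box_bump a b k))"
    unfolding compact_eq_bounded_closed using bounded_subset[OF bounded_cbox sub] by (simp add: supp_def)
  ultimately show ?thesis using that \<psi> unfolding test_function_def by blast
qed

lemma fundamental_lemma:
  fixes U :: "(real^'d) set" and g :: "real^'d \<Rightarrow> real"
  assumes U: "open U" and g: "integrable (lebesgue_on U) g"
    and test: "\<And>\<phi> \<psi>. test_function \<phi> \<psi> \<Longrightarrow> supp \<phi> \<subseteq> U \<Longrightarrow> L2_inner U g \<phi> = 0"
  shows "AE x in lebesgue_on U. g x = 0"
proof -
  have Us: "U \<in> sets lebesgue" using U by auto
  define G where "G x = indicator U x * g x" for x
  have G: "integrable lebesgue G"
    using g Us unfolding G_def by (simp add: integrable_restrict_space)
  have Gm: "G \<in> borel_measurable lebesgue" using G by (rule borel_measurable_integrable)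
  have box0: "integral\<^sup>L lebesgue (\<lambda>x. G x * indicator (box a b) x) = 0"
    if sub: "cbox a b \<subseteq> U" and ab: "\<And>i. i \<in> Basis \<Longrightarrow> a \<bullet> i \<le> b \<bullet> i" for a b
  proof -
    have bm: "box_bump a b k \<in> borel_measurable lebesgue" for k
    proof -
      obtain \<psi> where "\<And>x. GDERIV (box_bump a b k) x :> \<psi> x" by (rule box_bump_GDERIV[of a b k]) blast
      then have "continuous_on UNIV (box_bump a b k)" by (rule GDERIV_continuous_on)
      then have "box_bump a b k \<in> borel_measurable borel" by (rule borel_measurable_continuous_onI)
      then show ?thesis by (simp add: measurable_completion)
    qed
    have z: "integral\<^sup>L lebesgue (\<lambda>x. G x * box_bump a b k x) = 0" for k
    proof -
      obtain \<psi> where \<psi>: "test_function (box_bump a b k) \<psi>" "supp (box_bump a b k) \<subseteq> cbox a b"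
        using box_bump_test_function[OF ab] by blast
      then have "L2_inner U g (box_bump a b k) = 0" using test sub by blast
      then show ?thesis
        unfolding L2_inner_def G_def using Us by (simp add: integral_restrict_space mult.assoc)
    qed
    have "(\<lambda>k. integral\<^sup>L lebesgue (\<lambda>x. G x * box_bump a b k x)) \<longlonglongrightarrow> integral\<^sup>L lebesgue (\<lambda>x. G x * indicator (box a b) x)"
    proof (rule integral_dominated_convergence[where w = "\<lambda>x. \<bar>G x\<bar>"])
      show "(\<lambda>x. G x * indicator (box a b) x) \<in> borel_measurable lebesgue"
        by (intro borel_measurable_times[OF Gm] borel_measurable_indicator) auto
      show "(\<lambda>x. G x * box_bump a b k x) \<in> borel_measurable lebesgue" for k
        by (rule borel_measurable_times[OF Gm bm])
      show "integrable lebesgue (\<lambda>x. \<bar>G x\<bar>)" using G by (rule integrable_abs)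
      show "AE x in lebesgue. (\<lambda>k. G x * box_bump a b k x) \<longlonglongrightarrow> G x * indicator (box a b) x"
        by (intro AE_I2 tendsto_mult tendsto_const box_bump_tendsto ab)
      show "AE x in lebesgue. norm (G x * box_bump a b k x) \<le> \<bar>G x\<bar>" for k
        using box_bump_bounds[of a b k] by (intro AE_I2) (simp add: abs_mult mult_left_le)
    qed
    then show ?thesis unfolding z by (simp add: LIMSEQ_const_iff)
  qed
  have Gc: "integrable (lebesgue_on (cbox a b)) G" for a b
    using integrable_mult_indicator[OF _ G, of "cbox a b"] by (simp add: integrable_restrict_space)
  have cbox0: "integral (cbox a b) G = 0" if "cbox a b \<subseteq> U" "\<And>i. i \<in> Basis \<Longrightarrow> a \<bullet> i \<le> b \<bullet> i" for a b
  proof -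
    have "integral (cbox a b) G = integral\<^sup>L (lebesgue_on (cbox a b)) G"
      using Gc by (simp add: lebesgue_integral_eq_integral)
    also have "\<dots> = integral\<^sup>L lebesgue (\<lambda>x. indicator (cbox a b) x * G x)"
      by (simp add: integral_restrict_space)
    also have "\<dots> = integral\<^sup>L lebesgue (\<lambda>x. G x * indicator (box a b) x)"
    proof (rule integral_cong_AE)
      show "(\<lambda>x. indicator (cbox a b) x * G x) \<in> borel_measurable lebesgue" "(\<lambda>x. G x * indicator (box a b) x) \<in> borel_measurable lebesgue"
        by (intro borel_measurable_times Gm borel_measurable_indicator; simp)+
      have "cbox a b - box a b \<in> null_sets lebesgue"
        using negligible_frontier_interval[of a b] negligible_iff_null_sets by blast
      then show "AE x in lebesgue. indicator (cbox a b) x * G x = G x * indicator (box a b) x"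
        by (rule AE_I') (use box_subset_cbox[of a b] in \<open>auto simp: indicator_def\<close>)
    qed
    finally show ?thesis using box0[OF that] by simp
  qed
  obtain N where N: "negligible N" "\<And>x e. x \<notin> N \<Longrightarrow> 0 < e \<Longrightarrow> \<exists>d>0. \<forall>h. 0 < h \<and> h < d \<longrightarrow>
       norm (integral (cbox x (x + h *\<^sub>R One)) G /\<^sub>R h ^ DIM(real^'d) - G x) < e"
    by (rule integrable_ccontinuous_explicit[of G]) (use integrable_on_lebesgue_on[OF Gc] in auto)
  have "g x = 0" if x: "x \<in> U" "x \<notin> N" for x
  proof -
    obtain r where r: "0 < r" "ball x r \<subseteq> U" using U x(1) open_contains_ball by blast
    have "norm (G x) \<le> 0"
    proof (rule field_le_epsilon)
      fix e :: real assume e: "0 < e"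
      obtain d where d: "0 < d" "\<And>h. 0 < h \<and> h < d \<Longrightarrow> norm (integral (cbox x (x + h *\<^sub>R One)) G /\<^sub>R h ^ DIM(real^'d) - G x) < e"
        using N(2)[OF x(2) e] by blast
      define h where "h = min (d / 2) (r / (2 * DIM(real^'d)))"
      have h: "0 < h" "h < d" "DIM(real^'d) * h < r"
      proof -
        show "0 < h" "h < d" unfolding h_def using d r by auto
        have "DIM(real^'d) * h \<le> DIM(real^'d) * (r / (2 * DIM(real^'d)))" unfolding h_def by (intro mult_left_mono) auto
        also have "\<dots> = r / 2" by simp
        finally show "DIM(real^'d) * h < r" using r by simp
      qed
      have "cbox x (x + h *\<^sub>R One) \<subseteq> ball x r"
      proof
        fix y assume y: "y \<in> cbox x (x + h *\<^sub>R One)"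
        have "norm (y - x) \<le> (\<Sum>i\<in>Basis. \<bar>(y - x) \<bullet> i\<bar>)" by (rule norm_le_l1)
        also have "\<dots> \<le> (\<Sum>i\<in>(Basis :: (real^'d) set). h)"
        proof (rule sum_mono)
          fix i :: "real^'d" assume i: "i \<in> Basis"
          have "x \<bullet> i \<le> y \<bullet> i" "y \<bullet> i \<le> (x + h *\<^sub>R One) \<bullet> i" using y i unfolding mem_box by blast+
          moreover have "(x + h *\<^sub>R One) \<bullet> i = x \<bullet> i + h" using i by (simp add: inner_add_left inner_sum_left_Basis)
          ultimately show "\<bar>(y - x) \<bullet> i\<bar> \<le> h" by (simp add: inner_diff_left)
        qed
        also have "\<dots> < r" using h(3) by simp
        finally show "y \<in> ball x r" by (simp add: dist_norm norm_minus_commute)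
      qed
      then have "integral (cbox x (x + h *\<^sub>R One)) G = 0"
        using r(2) h(1) by (intro cbox0) (auto simp: inner_add_left inner_sum_left_Basis)
      then show "norm (G x) \<le> 0 + e" using d(2)[of h] h by simp
    qed
    then show ?thesis using x(1) unfolding G_def by simp
  qed
  then have "{x \<in> space lebesgue. \<not> (x \<in> U \<longrightarrow> g x = 0)} \<subseteq> N" by blast
  moreover have "N \<in> null_sets lebesgue" using N(1) negligible_iff_null_sets by blast
  ultimately have "AE x in lebesgue. x \<in> U \<longrightarrow> g x = 0" by (intro AE_I')
  then show ?thesis using Us by (simp add: AE_restrict_space_iff)
qed

definition lin :: "real \<Rightarrow> ('a \<Rightarrow> 'b::real_vector) \<Rightarrow> real \<Rightarrow> ('a \<Rightarrow> 'b) \<Rightarrow> 'a \<Rightarrow> 'b" where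
  "lin s u t v = (\<lambda>x. s *\<^sub>R u x + t *\<^sub>R v x)"

lemma L2_meas: "f \<in> L2 \<Omega> \<Longrightarrow> f \<in> borel_measurable (lebesgue_on \<Omega>)"
  unfolding L2_def by blast

lemma L2_integrable_inner:
  fixes f g :: "real^'d \<Rightarrow> 'b::euclidean_space"
  assumes "f \<in> L2 \<Omega>" "g \<in> L2 \<Omega>"
  shows "integrable (lebesgue_on \<Omega>) (\<lambda>x. f x \<bullet> g x)"
proof (rule Bochner_Integration.integrable_bound)
  show "integrable (lebesgue_on \<Omega>) (\<lambda>x. (norm (f x))\<^sup>2 + (norm (g x))\<^sup>2)"
    using assms unfolding L2_def by (intro Bochner_Integration.integrable_add) auto
  show "(\<lambda>x. f x \<bullet> g x) \<in> borel_measurable (lebesgue_on \<Omega>)"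
    using assms by (intro borel_measurable_inner L2_meas)
  show "AE x in lebesgue_on \<Omega>. norm (f x \<bullet> g x) \<le> norm ((norm (f x))\<^sup>2 + (norm (g x))\<^sup>2)"
  proof (rule AE_I2)
    fix x
    have "\<bar>f x \<bullet> g x\<bar> \<le> norm (f x) * norm (g x)" by (rule Cauchy_Schwarz_ineq2)
    also have "\<dots> \<le> (norm (f x))\<^sup>2 + (norm (g x))\<^sup>2"
      using sum_squares_bound[of "norm (f x)" "norm (g x)"] mult_nonneg_nonneg[OF norm_ge_zero norm_ge_zero, of "f x" "g x"] by linarith
    finally show "norm (f x \<bullet> g x) \<le> norm ((norm (f x))\<^sup>2 + (norm (g x))\<^sup>2)" by simp
  qed
qed

lemma L2_lin:
  fixes f g :: "real^'d \<Rightarrow> 'b::euclidean_space"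
  assumes "f \<in> L2 \<Omega>" "g \<in> L2 \<Omega>"
  shows "lin s f t g \<in> L2 \<Omega>"
proof -
  have m: "lin s f t g \<in> borel_measurable (lebesgue_on \<Omega>)"
    unfolding lin_def using assms by (intro borel_measurable_add borel_measurable_scaleR borel_measurable_const L2_meas)
  have "(norm (lin s f t g x))\<^sup>2 = s\<^sup>2 * (f x \<bullet> f x) + 2 * s * t * (f x \<bullet> g x) + t\<^sup>2 * (g x \<bullet> g x)" for x
    unfolding lin_def power2_norm_eq_inner
    by (simp add: inner_add_left inner_add_right power2_eq_square inner_commute[of "g x" "f x"] algebra_simps)
  moreover have "integrable (lebesgue_on \<Omega>) (\<lambda>x. s\<^sup>2 * (f x \<bullet> f x) + 2 * s * t * (f x \<bullet> g x) + t\<^sup>2 * (g x \<bullet> g x))"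
    by (intro Bochner_Integration.integrable_add integrable_mult_right L2_integrable_inner assms)
  ultimately show ?thesis using m unfolding L2_def by simp
qed

lemma L2_inner_commute: "L2_inner \<Omega> f g = L2_inner \<Omega> g f"
  unfolding L2_inner_def by (simp add: inner_commute)

lemma L2_inner_lin_left:
  fixes f g :: "real^'d \<Rightarrow> 'b::euclidean_space"
  assumes "f \<in> L2 \<Omega>" "g \<in> L2 \<Omega>" "h \<in> L2 \<Omega>"
  shows "L2_inner \<Omega> (lin s f t g) h = s * L2_inner \<Omega> f h + t * L2_inner \<Omega> g h"
proof -
  have "L2_inner \<Omega> (lin s f t g) h = integral\<^sup>L (lebesgue_on \<Omega>) (\<lambda>x. s * (f x \<bullet> h x) + t * (g x \<bullet> h x))"
    unfolding L2_inner_def lin_def by (simp add: inner_add_left)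
  also have "\<dots> = s * L2_inner \<Omega> f h + t * L2_inner \<Omega> g h"
    unfolding L2_inner_def
    by (subst Bochner_Integration.integral_add)
       (intro integrable_mult_right L2_integrable_inner assms | simp)+
  finally show ?thesis .
qed

lemma L2_inner_lin_right:
  fixes f g :: "real^'d \<Rightarrow> 'b::euclidean_space"
  assumes "f \<in> L2 \<Omega>" "g \<in> L2 \<Omega>" "h \<in> L2 \<Omega>"
  shows "L2_inner \<Omega> h (lin s f t g) = s * L2_inner \<Omega> h f + t * L2_inner \<Omega> h g"
  using L2_inner_lin_left[OF assms] by (simp add: L2_inner_commute)

lemma L2_inner_nonneg: "0 \<le> L2_inner \<Omega> f f"
  unfolding L2_inner_def by (intro Bochner_Integration.integral_nonneg) simp

lemma L2_inner_cong_AE: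
  fixes f g :: "real^'d \<Rightarrow> 'b::euclidean_space"
  assumes "AE x in lebesgue_on \<Omega>. f x = f' x" "AE x in lebesgue_on \<Omega>. g x = g' x"
    and "f \<in> L2 \<Omega>" "g \<in> L2 \<Omega>" "f' \<in> L2 \<Omega>" "g' \<in> L2 \<Omega>"
  shows "L2_inner \<Omega> f g = L2_inner \<Omega> f' g'"
  unfolding L2_inner_def
proof (rule integral_cong_AE)
  show "(\<lambda>x. f x \<bullet> g x) \<in> borel_measurable (lebesgue_on \<Omega>)" "(\<lambda>x. f' x \<bullet> g' x) \<in> borel_measurable (lebesgue_on \<Omega>)"
    by (intro borel_measurable_inner L2_meas assms)+
  show "AE x in lebesgue_on \<Omega>. f x \<bullet> g x = f' x \<bullet> g' x"
    using assms(1,2) by eventually_elim simp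
qed

lemma discriminant_bound:
  fixes A B C :: real
  assumes "\<And>s t. 0 \<le> s\<^sup>2 * A + 2 * s * t * B + t\<^sup>2 * C"
  shows "B\<^sup>2 \<le> A * C"
proof (cases "A = 0")
  case True
  have "B = 0"
  proof (rule ccontr)
    assume B: "B \<noteq> 0"
    have "0 \<le> 2 * (- (C + 1) / (2 * B)) * B + C"
      using assms[of "- (C + 1) / (2 * B)" 1] True by simp
    moreover have "2 * (- (C + 1) / (2 * B)) * B = - (C + 1)" using B by simp
    ultimately show False by simp
  qed
  then show ?thesis using True by simp
next
  case False
  have "0 \<le> A" using assms[of 1 0] by simp
  then have A: "0 < A" using False by simp
  have "0 \<le> B\<^sup>2 * A + 2 * B * (- A) * B + (- A)\<^sup>2 * C" using assms[of B "- A"] .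
  then have "0 \<le> A * (A * C - B\<^sup>2)" by (simp add: power2_eq_square algebra_simps)
  then show ?thesis using A by (simp add: zero_le_mult_iff)
qed

lemma L2_Cauchy_Schwarz:
  fixes f g :: "real^'d \<Rightarrow> 'b::euclidean_space"
  assumes "f \<in> L2 \<Omega>" "g \<in> L2 \<Omega>"
  shows "(L2_inner \<Omega> f g)\<^sup>2 \<le> L2_inner \<Omega> f f * L2_inner \<Omega> g g"
proof (rule discriminant_bound)
  fix s t
  have "0 \<le> L2_inner \<Omega> (lin s f t g) (lin s f t g)" by (rule L2_inner_nonneg)
  also have "\<dots> = s\<^sup>2 * L2_inner \<Omega> f f + 2 * s * t * L2_inner \<Omega> f g + t\<^sup>2 * L2_inner \<Omega> g g"
    using assms L2_lin[OF assms] by (simp add: L2_inner_lin_left L2_inner_lin_right L2_inner_commute[of \<Omega> g f] power2_eq_square algebra_simps)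
  finally show "0 \<le> s\<^sup>2 * L2_inner \<Omega> f f + 2 * s * t * L2_inner \<Omega> f g + t\<^sup>2 * L2_inner \<Omega> g g" .
qed

lemma L2_bounded:
  fixes f :: "real^'d \<Rightarrow> 'b::euclidean_space"
  assumes "\<Omega> \<in> lmeasurable" "f \<in> borel_measurable (lebesgue_on \<Omega>)" "\<And>x. x \<in> \<Omega> \<Longrightarrow> norm (f x) \<le> B"
  shows "f \<in> L2 \<Omega>"
proof -
  have "finite_measure (lebesgue_on \<Omega>)" using assms(1) by (rule finite_measure_lebesgue_on)
  then have "integrable (lebesgue_on \<Omega>) (\<lambda>x. (norm (f x))\<^sup>2)"
  proof (rule finite_measure.integrable_const_bound)
    show "AE x in lebesgue_on \<Omega>. norm ((norm (f x))\<^sup>2) \<le> B\<^sup>2"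
      using assms(3) by (intro AE_I2) (auto intro!: power_mono)
    show "(\<lambda>x. (norm (f x))\<^sup>2) \<in> borel_measurable (lebesgue_on \<Omega>)"
      using assms(2) by (intro borel_measurable_power measurable_compose[OF _ borel_measurable_norm]) simp
  qed
  then show ?thesis using assms(2) unfolding L2_def by simp
qed

lemma continuous_measurable_lebesgue_on:
  fixes f :: "real^'d \<Rightarrow> 'b::euclidean_space"
  assumes "continuous_on UNIV f"
  shows "f \<in> borel_measurable (lebesgue_on S)"
  using borel_measurable_continuous_onI[OF assms] by (intro measurable_restrict_space1 measurable_completion) simp

lemma continuous_L2:
  fixes f :: "real^'d \<Rightarrow> 'b::euclidean_space"
  assumes "continuous_on UNIV f" "\<Omega> \<in> lmeasurable" "bounded \<Omega>"
  shows "f \<in> L2 \<Omega>"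
proof -
  have "compact (f ` closure \<Omega>)"
    by (rule compact_continuous_image[OF continuous_on_subset[OF assms(1) subset_UNIV]]) (simp add: assms(3))
  from compact_imp_bounded[OF this] obtain B where B: "\<forall>y\<in>f ` closure \<Omega>. norm y \<le> B"
    unfolding bounded_iff by (rule exE)
  show ?thesis
  proof (rule L2_bounded[OF assms(2) continuous_measurable_lebesgue_on[OF assms(1)]])
    fix x assume "x \<in> \<Omega>"
    then have "x \<in> closure \<Omega>" by (rule subsetD[OF closure_subset])
    then show "norm (f x) \<le> B" using B by (simp add: ball_simps)
  qed
qed

lemma test_functionD:
  assumes "test_function \<phi> \<psi>"
  shows "\<And>x. GDERIV \<phi> x :> \<psi> x" "continuous_on S \<phi>" "continuous_on S \<psi>"
proof -
  show g: "GDERIV \<phi> x :> \<psi> x" for x using assms unfolding test_function_def by blast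
  show "continuous_on S \<phi>" by (rule GDERIV_continuous_on[OF g])
  show "continuous_on S \<psi>" using assms continuous_on_subset unfolding test_function_def by blast
qed

lemma test_function_outside:
  assumes "test_function \<phi> \<psi>" "x \<notin> supp \<phi>"
  shows "\<phi> x = 0" "\<psi> x = 0"
proof -
  have nz: "y \<in> supp \<phi>" if "\<phi> y \<noteq> 0" for y
    unfolding supp_def by (rule subsetD[OF closure_subset]) (simp add: that)
  show "\<phi> x = 0" using assms(2) nz by blast
  have op: "open (- supp \<phi>)" unfolding supp_def by (intro open_Compl closed_closure)
  have "((\<lambda>x. 0) has_derivative (\<lambda>h. h \<bullet> \<psi> x)) (at x)"
  proof (rule has_derivative_transform_within_open[OF _ op])
    show "(\<phi> has_derivative (\<lambda>h. h \<bullet> \<psi> x)) (at x)"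
      using test_functionD(1)[OF assms(1), of x] unfolding gderiv_def .
    show "x \<in> - supp \<phi>" using assms(2) by simp
    show "\<phi> y = 0" if "y \<in> - supp \<phi>" for y using that nz by blast
  qed
  then have "(\<lambda>h. h \<bullet> \<psi> x) = (\<lambda>h. 0)"
    by (rule has_derivative_unique) (rule has_derivative_const)
  then have "\<psi> x \<bullet> \<psi> x = 0" by (rule fun_cong)
  then show "\<psi> x = 0" by simp
qed

lemma V_h_RT0:
  assumes "v \<in> V_h \<Omega> \<Gamma> \<T>" "T \<in> \<T>"
  shows "\<exists>a b. AE x in lebesgue_on T. v x = a + b *\<^sub>R x"
proof -
  obtain w where w: "w \<in> RT0" and ae: "AE x in lebesgue_on T. v x = w x"
    using assms unfolding V_h_def by auto
  obtain a b where "w = (\<lambda>x. a + b *\<^sub>R x)" using w unfolding RT0_def by auto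
  then have "AE x in lebesgue_on T. v x = a + b *\<^sub>R x" using ae by simp
  then show ?thesis by (intro exI)
qed

locale bounded_open =
  fixes \<Omega> :: "(real^'d) set"
  assumes open_dom: "open \<Omega>" and bounded_dom: "bounded \<Omega>"
begin

lemma lmeasurable_dom: "\<Omega> \<in> lmeasurable"
  using bounded_dom open_dom by (rule lmeasurable_open)

lemma sets_dom: "\<Omega> \<in> sets lebesgue"
  using lmeasurable_dom by (rule fmeasurableD)

lemma test_L2: "test_function \<phi> \<psi> \<Longrightarrow> \<phi> \<in> L2 \<Omega>" "test_function \<phi> \<psi> \<Longrightarrow> \<psi> \<in> L2 \<Omega>"
  by (rule continuous_L2[OF test_functionD(2) lmeasurable_dom bounded_dom], assumption)
     (rule continuous_L2[OF test_functionD(3) lmeasurable_dom bounded_dom], assumption)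

lemma L2_integrable:
  fixes g :: "real^'d \<Rightarrow> real"
  assumes "g \<in> L2 \<Omega>"
  shows "integrable (lebesgue_on \<Omega>) g"
proof -
  have "(\<lambda>x. 1::real) \<in> L2 \<Omega>" using continuous_L2[OF continuous_on_const lmeasurable_dom bounded_dom] .
  then show ?thesis using L2_integrable_inner[OF assms, of "\<lambda>x. 1"] by simp
qed

lemma weak_divD:
  assumes "v \<in> Hdiv \<Omega>"
  shows "weak_div \<Omega> v \<in> L2 \<Omega>" "has_weak_div \<Omega> v (weak_div \<Omega> v)"
proof -
  have "\<exists>g. g \<in> L2 \<Omega> \<and> has_weak_div \<Omega> v g" using assms unfolding Hdiv_def by blast
  then have "weak_div \<Omega> v \<in> L2 \<Omega> \<and> has_weak_div \<Omega> v (weak_div \<Omega> v)" unfolding weak_div_def by (rule someI_ex)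
  then show "weak_div \<Omega> v \<in> L2 \<Omega>" "has_weak_div \<Omega> v (weak_div \<Omega> v)" by blast+
qed

lemma weak_div_unique:
  assumes "g \<in> L2 \<Omega>" "g' \<in> L2 \<Omega>" "has_weak_div \<Omega> v g" "has_weak_div \<Omega> v g'"
  shows "AE x in lebesgue_on \<Omega>. g x = g' x"
proof -
  have "AE x in lebesgue_on \<Omega>. lin 1 g (-1) g' x = 0"
  proof (rule fundamental_lemma[OF open_dom])
    show "integrable (lebesgue_on \<Omega>) (lin 1 g (-1) g')" by (intro L2_integrable L2_lin assms)
    fix \<phi> \<psi> assume t: "test_function \<phi> \<psi>" "supp \<phi> \<subseteq> \<Omega>"
    have "L2_inner \<Omega> g \<phi> = L2_inner \<Omega> g' \<phi>"
      using assms(3,4) t unfolding has_weak_div_def by force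
    then show "L2_inner \<Omega> (lin 1 g (-1) g') \<phi> = 0"
      by (simp add: L2_inner_lin_left[OF assms(1,2) test_L2(1)[OF t(1)]])
  qed
  then show ?thesis by eventually_elim (simp add: lin_def)
qed

lemma weak_div_eqI:
  assumes "v \<in> L2 \<Omega>" "g \<in> L2 \<Omega>" "has_weak_div \<Omega> v g"
  shows "v \<in> Hdiv \<Omega>" "AE x in lebesgue_on \<Omega>. weak_div \<Omega> v x = g x"
proof -
  show v: "v \<in> Hdiv \<Omega>" using assms unfolding Hdiv_def by blast
  show "AE x in lebesgue_on \<Omega>. weak_div \<Omega> v x = g x"
    using weak_div_unique[OF weak_divD(1)[OF v] assms(2) weak_divD(2)[OF v] assms(3)] .
qed

lemma Hdiv_L2: "v \<in> Hdiv \<Omega> \<Longrightarrow> v \<in> L2 \<Omega>"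
  unfolding Hdiv_def by blast

lemma weak_div_lin:
  assumes "u \<in> Hdiv \<Omega>" "v \<in> Hdiv \<Omega>"
  shows "lin s u t v \<in> Hdiv \<Omega>"
    "AE x in lebesgue_on \<Omega>. weak_div \<Omega> (lin s u t v) x = lin s (weak_div \<Omega> u) t (weak_div \<Omega> v) x"
proof -
  note L = Hdiv_L2[OF assms(1)] Hdiv_L2[OF assms(2)] weak_divD(1)[OF assms(1)] weak_divD(1)[OF assms(2)]
  have "has_weak_div \<Omega> (lin s u t v) (lin s (weak_div \<Omega> u) t (weak_div \<Omega> v))"
    unfolding has_weak_div_def
  proof (intro allI impI)
    fix \<phi> \<psi> assume t: "test_function \<phi> \<psi> \<and> supp \<phi> \<subseteq> \<Omega>"
    then have "L2_inner \<Omega> u \<psi> = - L2_inner \<Omega> (weak_div \<Omega> u) \<phi>" "L2_inner \<Omega> v \<psi> = - L2_inner \<Omega> (weak_div \<Omega> v) \<phi>"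
      using weak_divD(2)[OF assms(1)] weak_divD(2)[OF assms(2)] unfolding has_weak_div_def by blast+
    then show "L2_inner \<Omega> (lin s u t v) \<psi> = - L2_inner \<Omega> (lin s (weak_div \<Omega> u) t (weak_div \<Omega> v)) \<phi>"
      using L2_inner_lin_left[OF L(1,2) test_L2(2), of \<phi> \<psi>] L2_inner_lin_left[OF L(3,4) test_L2(1), of \<phi> \<psi>] t by simp
  qed
  then show "lin s u t v \<in> Hdiv \<Omega>"
    "AE x in lebesgue_on \<Omega>. weak_div \<Omega> (lin s u t v) x = lin s (weak_div \<Omega> u) t (weak_div \<Omega> v) x"
    using weak_div_eqI[OF L2_lin[OF L(1,2)] L2_lin[OF L(3,4)]] by blast+
qed

lemma inner_weak_div_lin:
  assumes "u \<in> Hdiv \<Omega>" "v \<in> Hdiv \<Omega>" "q \<in> L2 \<Omega>"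
  shows "L2_inner \<Omega> (weak_div \<Omega> (lin s u t v)) q = s * L2_inner \<Omega> (weak_div \<Omega> u) q + t * L2_inner \<Omega> (weak_div \<Omega> v) q"
proof -
  note L = weak_divD(1)[OF assms(1)] weak_divD(1)[OF assms(2)] weak_divD(1)[OF weak_div_lin(1)[OF assms(1,2)]]
  have "L2_inner \<Omega> (weak_div \<Omega> (lin s u t v)) q = L2_inner \<Omega> (lin s (weak_div \<Omega> u) t (weak_div \<Omega> v)) q"
    by (rule L2_inner_cong_AE[OF weak_div_lin(2)[OF assms(1,2)] AE_I2 L(3) assms(3) L2_lin[OF L(1,2)] assms(3)]) simp
  then show ?thesis using L2_inner_lin_left[OF L(1,2) assms(3)] by simp
qed

lemma V_space_lin:
  assumes "u \<in> V_space \<Omega> \<Gamma>" "v \<in> V_space \<Omega> \<Gamma>"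
  shows "lin s u t v \<in> V_space \<Omega> \<Gamma>"
proof -
  have H: "u \<in> Hdiv \<Omega>" "v \<in> Hdiv \<Omega>" and z: "zero_normal_trace \<Omega> \<Gamma> u" "zero_normal_trace \<Omega> \<Gamma> v"
    using assms unfolding V_space_def by auto
  have "zero_normal_trace \<Omega> \<Gamma> (lin s u t v)"
    unfolding zero_normal_trace_def
  proof (intro allI impI)
    fix \<phi> \<psi> assume tf: "test_function \<phi> \<psi> \<and> supp \<phi> \<inter> frontier \<Omega> \<subseteq> \<Gamma>"
    then have 1: "L2_inner \<Omega> u \<psi> + L2_inner \<Omega> (weak_div \<Omega> u) \<phi> = 0" "L2_inner \<Omega> v \<psi> + L2_inner \<Omega> (weak_div \<Omega> v) \<phi> = 0"
      using z unfolding zero_normal_trace_def by blast+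
    have "L2_inner \<Omega> (lin s u t v) \<psi> + L2_inner \<Omega> (weak_div \<Omega> (lin s u t v)) \<phi>
       = s * (L2_inner \<Omega> u \<psi> + L2_inner \<Omega> (weak_div \<Omega> u) \<phi>) + t * (L2_inner \<Omega> v \<psi> + L2_inner \<Omega> (weak_div \<Omega> v) \<phi>)"
      using L2_inner_lin_left[OF Hdiv_L2[OF H(1)] Hdiv_L2[OF H(2)] test_L2(2), of \<phi> \<psi> s t]
        inner_weak_div_lin[OF H test_L2(1), of \<phi> \<psi> s t] tf by (simp add: algebra_simps)
    then show "L2_inner \<Omega> (lin s u t v) \<psi> + L2_inner \<Omega> (weak_div \<Omega> (lin s u t v)) \<phi> = 0" unfolding 1 by simp
  qed
  then show ?thesis using weak_div_lin(1)[OF H] unfolding V_space_def by blast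
qed

lemma V_h_lin:
  assumes "u \<in> V_h \<Omega> \<Gamma> \<T>" "v \<in> V_h \<Omega> \<Gamma> \<T>"
  shows "lin s u t v \<in> V_h \<Omega> \<Gamma> \<T>"
proof -
  have uv: "u \<in> V_space \<Omega> \<Gamma>" "v \<in> V_space \<Omega> \<Gamma>" using assms unfolding V_h_def by simp_all
  have "\<exists>w\<in>RT0. AE x in lebesgue_on T. lin s u t v x = w x" if T: "T \<in> \<T>" for T
  proof -
    obtain a b where 1: "AE x in lebesgue_on T. u x = a + b *\<^sub>R x" using V_h_RT0[OF assms(1) T] by (elim exE)
    obtain a' b' where 2: "AE x in lebesgue_on T. v x = a' + b' *\<^sub>R x" using V_h_RT0[OF assms(2) T] by (elim exE)
    show ?thesis
    proof (rule bexI)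
      show "(\<lambda>x. (s *\<^sub>R a + t *\<^sub>R a') + (s * b + t * b') *\<^sub>R x) \<in> RT0" unfolding RT0_def by blast
      show "AE x in lebesgue_on T. lin s u t v x = (s *\<^sub>R a + t *\<^sub>R a') + (s * b + t * b') *\<^sub>R x"
        using 1 2 by eventually_elim (simp add: lin_def algebra_simps)
    qed
  qed
  then show ?thesis using V_space_lin[OF uv] unfolding V_h_def by simp
qed

lemma W_h_lin:
  assumes "p \<in> W_h \<Omega> \<T>" "q \<in> W_h \<Omega> \<T>"
  shows "lin s p t q \<in> W_h \<Omega> \<T>"
proof -
  have pq: "p \<in> L2 \<Omega>" "q \<in> L2 \<Omega>" using assms unfolding W_h_def by simp_all
  have "\<exists>c. AE x in lebesgue_on T. lin s p t q x = c" if T: "T \<in> \<T>" for T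
  proof -
    have "\<exists>c. AE x in lebesgue_on T. p x = c" "\<exists>c. AE x in lebesgue_on T. q x = c"
      using assms T unfolding W_h_def by simp_all
    then obtain c c' where 1: "AE x in lebesgue_on T. p x = c" and 2: "AE x in lebesgue_on T. q x = c'"
      by (elim exE)
    have "AE x in lebesgue_on T. lin s p t q x = s *\<^sub>R c + t *\<^sub>R c'"
      using 1 2 by eventually_elim (simp add: lin_def)
    then show ?thesis by (rule exI)
  qed
  then show ?thesis using L2_lin[OF pq] unfolding W_h_def by simp
qed

end

section \<open>Stability from the inf-sup condition\<close>

text \<open>The six numbers are the entries of the Gram matrices of \<open>u\<close>, of a nearly optimal unit field
  \<open>v\<close> for the inf-sup condition at \<open>y = div u + p\<close>, and of \<open>g = div u\<close>; \<open>kk\<close> is the squared norm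
  of the Riesz representative of \<open>w \<mapsto> (div w, y)\<close> in the span of \<open>u\<close> and \<open>v\<close>. For \<open>uu = uv\<^sup>2\<close>
  the quotient is 0.\<close>

lemma saddle_algebra:
  fixes uu uv bu bv GG YY c kk :: real
  assumes c: "0 < c" "c \<le> 1" and uv: "uv\<^sup>2 \<le> uu" and G: "0 \<le> GG" and Y: "0 \<le> YY"
    and bu: "bu\<^sup>2 \<le> GG * YY" and bv: "c * YY \<le> bv\<^sup>2" and deg: "uu = uv\<^sup>2 \<Longrightarrow> bu = uv * bv"
    and kk: "kk = bv\<^sup>2 + (bu - uv * bv)\<^sup>2 / (uu - uv\<^sup>2)"
  shows "0 \<le> uu - 2 * bu + kk" "c\<^sup>2 * (uu + YY - 2 * bu + GG) \<le> uu - 2 * bu + kk + GG"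
proof -
  define e where "e = uu - uv\<^sup>2"
  define w where "w = bu - uv * bv"
  have e0: "0 \<le> e" using uv unfolding e_def by simp
  have uu0: "0 \<le> uu" using uv zero_le_power2[of uv] by linarith
  have kkw: "kk = bv\<^sup>2 + w\<^sup>2 / e" using kk unfolding w_def e_def .
  have kkb: "bv\<^sup>2 \<le> kk" unfolding kkw using e0 by simp
  have kk0: "0 \<le> kk" using kkb zero_le_power2[of bv] by linarith
  have cs: "bu\<^sup>2 \<le> uu * kk"
  proof (cases "e = 0")
    case True
    then have "bu = uv * bv" "uu = uv\<^sup>2" using deg unfolding e_def by auto
    moreover have "kk = bv\<^sup>2" using True unfolding kkw by simp
    ultimately show ?thesis by (simp add: power_mult_distrib)
  next
    case False
    then have e: "0 < e" using e0 by simp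
    have "uu = uv\<^sup>2 + e" "bu = uv * bv + w" unfolding e_def w_def by auto
    then have "uu * kk - bu\<^sup>2 = (uv * w - e * bv)\<^sup>2 / e"
      unfolding kkw using e by (simp add: field_simps power2_eq_square)
    also have "\<dots> \<ge> 0" using e by simp
    finally show ?thesis by simp
  qed
  define z2 where "z2 = uu - 2 * bu + kk"
  have "(2 * bu)\<^sup>2 \<le> (uu + kk)\<^sup>2"
  proof -
    have "0 \<le> (uu - kk)\<^sup>2" by simp
    then show ?thesis using cs by (simp add: power2_eq_square algebra_simps)
  qed
  then have "\<bar>2 * bu\<bar> \<le> \<bar>uu + kk\<bar>" by (simp only: abs_le_square_iff)
  then have z20: "0 \<le> z2" unfolding z2_def using uu0 kk0 by simp
  then show "0 \<le> uu - 2 * bu + kk" unfolding z2_def .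
  have cz: "(bu - kk)\<^sup>2 \<le> kk * z2"
    using cs unfolding z2_def by (simp add: power2_eq_square algebra_simps)
  have Yk: "YY \<le> kk / c" using bv kkb c(1) by (simp add: pos_le_divide_eq mult.commute)
  have kb: "kk \<le> (1 / c + 1) * (GG + z2)"
  proof (cases "kk = 0")
    case True
    then show ?thesis using c G z20 by simp
  next
    case False
    define r where "r = sqrt kk"
    have r: "0 < r" "r\<^sup>2 = kk" unfolding r_def using kk0 False by auto
    have "bu\<^sup>2 \<le> GG * (kk / c)" using bu mult_left_mono[OF Yk G] by linarith
    then have "\<bar>bu\<bar> \<le> sqrt (GG * (kk / c))" using real_le_rsqrt[of "\<bar>bu\<bar>"] by simp
    also have "GG * (kk / c) = (GG / c) * kk" by simp
    also have "sqrt ((GG / c) * kk) = sqrt (GG / c) * r" unfolding r_def by (rule real_sqrt_mult)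
    finally have 1: "\<bar>bu\<bar> \<le> sqrt (GG / c) * r" .
    have "\<bar>bu - kk\<bar> \<le> sqrt (kk * z2)" using cz real_le_rsqrt[of "\<bar>bu - kk\<bar>"] by simp
    also have "\<dots> = r * sqrt z2" unfolding r_def by (rule real_sqrt_mult)
    finally have 2: "\<bar>bu - kk\<bar> \<le> r * sqrt z2" .
    have "r * r \<le> r * (sqrt (GG / c) + sqrt z2)"
      using 1 2 r(2) by (simp add: power2_eq_square algebra_simps)
    then have rr: "r \<le> sqrt (GG / c) + sqrt z2" using r(1) by simp
    then have "r\<^sup>2 \<le> (sqrt (GG / c) + sqrt z2)\<^sup>2" using r(1) by (intro power_mono) auto
    also have "\<dots> \<le> (1 / c + 1) * (GG + z2)"
    proof -
      define p where "p = sqrt GG"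
      define q where "q = sqrt z2"
      define t where "t = 1 / sqrt c"
      have s: "GG = p\<^sup>2" "z2 = q\<^sup>2" "1 / c = t\<^sup>2" "sqrt (GG / c) = t * p"
        unfolding p_def q_def t_def using G z20 c(1) by (auto simp: power_divide real_sqrt_divide)
      have "0 \<le> (t * q - p)\<^sup>2" by simp
      then show ?thesis unfolding s(4) q_def[symmetric] unfolding s(1,2,3) by (simp add: power2_eq_square algebra_simps)
    qed
    finally show ?thesis using r(2) by simp
  qed
  have c1: "0 \<le> 1 / c - 1" using c by simp
  have "uu + YY - 2 * bu + GG = (z2 + GG) - kk + YY" unfolding z2_def by simp
  also have "\<dots> \<le> (z2 + GG) + kk * (1 / c - 1)" using Yk by (simp add: algebra_simps)
  also have "\<dots> \<le> (z2 + GG) + ((1 / c + 1) * (GG + z2)) * (1 / c - 1)"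
    using mult_right_mono[OF kb c1] by simp
  also have "\<dots> = (z2 + GG) / c\<^sup>2"
    using c(1) by (simp add: field_simps power2_eq_square)
  finally have "uu + YY - 2 * bu + GG \<le> (z2 + GG) / c\<^sup>2" .
  then show "c\<^sup>2 * (uu + YY - 2 * bu + GG) \<le> uu - 2 * bu + kk + GG"
    using c(1) unfolding z2_def by (simp add: pos_le_divide_eq mult.commute)
qed

lemma three_term_Cauchy_Schwarz:
  fixes a b c x y z :: real
  shows "a * x + b * y + c * z \<le> sqrt (a\<^sup>2 + b\<^sup>2 + c\<^sup>2) * sqrt (x\<^sup>2 + y\<^sup>2 + z\<^sup>2)"
proof -
  have "0 \<le> (a * y - b * x)\<^sup>2 + (a * z - c * x)\<^sup>2 + (b * z - c * y)\<^sup>2" by simp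
  then have "(a * x + b * y + c * z)\<^sup>2 \<le> (a\<^sup>2 + b\<^sup>2 + c\<^sup>2) * (x\<^sup>2 + y\<^sup>2 + z\<^sup>2)"
    by (simp add: power2_eq_square algebra_simps)
  then show ?thesis unfolding real_sqrt_mult[symmetric] by (rule real_le_rsqrt)
qed

lemma invertible_matrix_inv_right: "invertible A \<Longrightarrow> A ** matrix_inv A = mat 1"
  unfolding matrix_inv_def invertible_def by (rule someI2_ex) auto

lemma inverse_matrix_bounds:
  fixes A :: "real^'n^'n"
  assumes sym: "transpose A = A" and ge: "\<And>\<xi>. \<xi> \<bullet> \<xi> \<le> (A *v \<xi>) \<bullet> \<xi>"
  shows "(matrix_inv A *v \<xi>) \<bullet> \<zeta> = (matrix_inv A *v \<zeta>) \<bullet> \<xi>"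
    "0 \<le> (matrix_inv A *v \<xi>) \<bullet> \<xi>" "(matrix_inv A *v \<xi>) \<bullet> \<xi> \<le> \<xi> \<bullet> \<xi>"
    "norm (matrix_inv A *v \<xi>) \<le> norm \<xi>" "det A \<noteq> 0"
proof -
  have ker: "x = 0" if "A *v x = 0" for x
  proof -
    have "x \<bullet> x \<le> 0" using ge[of x] that by simp
    then show ?thesis by (metis inner_eq_zero_iff inner_ge_zero order_antisym)
  qed
  then have "\<exists>B. B ** A = mat 1" unfolding matrix_left_invertible_ker by blast
  then have inv: "invertible A" using invertible_left_inverse by blast
  then show "det A \<noteq> 0" by (simp add: invertible_det_nz)
  have right: "A ** matrix_inv A = mat 1" using inv by (rule invertible_matrix_inv_right)
  have K: "A *v (matrix_inv A *v x) = x" for x unfolding matrix_vector_mul_assoc right by simp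
  have adj: "(A *v x) \<bullet> y = x \<bullet> (A *v y)" for x y
    using dot_lmul_matrix[of x A y] transpose_matrix_vector[of A x] sym by simp
  show s: "(matrix_inv A *v \<xi>) \<bullet> \<zeta> = (matrix_inv A *v \<zeta>) \<bullet> \<xi>" for \<xi> \<zeta>
  proof -
    have "(matrix_inv A *v \<xi>) \<bullet> \<zeta> = (matrix_inv A *v \<xi>) \<bullet> (A *v (matrix_inv A *v \<zeta>))" unfolding K ..
    also have "\<dots> = (A *v (matrix_inv A *v \<xi>)) \<bullet> (matrix_inv A *v \<zeta>)" unfolding adj ..
    finally show ?thesis unfolding K by (simp add: inner_commute)
  qed
  have 1: "(norm (matrix_inv A *v \<xi>))\<^sup>2 \<le> (matrix_inv A *v \<xi>) \<bullet> \<xi>"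
    using ge[of "matrix_inv A *v \<xi>"] unfolding K by (simp add: power2_norm_eq_inner inner_commute)
  then show "0 \<le> (matrix_inv A *v \<xi>) \<bullet> \<xi>" using zero_le_power2 order_trans by blast
  have 2: "(matrix_inv A *v \<xi>) \<bullet> \<xi> \<le> norm (matrix_inv A *v \<xi>) * norm \<xi>" by (rule norm_cauchy_schwarz)
  then have "norm (matrix_inv A *v \<xi>) * norm (matrix_inv A *v \<xi>) \<le> norm (matrix_inv A *v \<xi>) * norm \<xi>"
    using 1 unfolding power2_eq_square by linarith
  then show n: "norm (matrix_inv A *v \<xi>) \<le> norm \<xi>"
    by (cases "matrix_inv A *v \<xi> = 0") auto
  have "norm (matrix_inv A *v \<xi>) * norm \<xi> \<le> norm \<xi> * norm \<xi>" using n by (intro mult_right_mono) auto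
  then show "(matrix_inv A *v \<xi>) \<bullet> \<xi> \<le> \<xi> \<bullet> \<xi>" using 2 by (simp add: dot_square_norm power2_eq_square)
qed

text \<open>\<open>matrix_inv\<close> takes one and the same junk value on all singular matrices.\<close>

lemma matrix_inv_entry:
  fixes A :: "real^'n^'n"
  shows "matrix_inv A $ i $ j = (if det A \<noteq> 0 then det (\<chi> k l. if l = i then axis j 1 $ k else A $ k $ l) / det A
     else (SOME B :: real^'n^'n. False) $ i $ j)"
proof (cases "det A = 0")
  case True
  then have "\<not> invertible A" by (simp add: invertible_det_nz)
  then have "(\<lambda>B. A ** B = mat 1 \<and> B ** A = mat 1) = (\<lambda>B. False)" unfolding invertible_def by blast
  then show ?thesis using True unfolding matrix_inv_def by simp
next
  case False
  then have "invertible A" by (simp add: invertible_det_nz)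
  then have "A *v (matrix_inv A *v axis j 1) = axis j 1"
    by (simp only: matrix_vector_mul_assoc invertible_matrix_inv_right matrix_vector_mul_lid)
  then have eq: "matrix_inv A *v axis j 1 = (\<chi> i. det (\<chi> k l. if l = i then axis j 1 $ k else A $ k $ l) / det A)"
    using cramer[OF False] by blast
  have "matrix_inv A $ i $ j = (matrix_inv A *v axis j 1) $ i"
    by (simp add: matrix_vector_mult_basis column_def)
  also have "\<dots> = det (\<chi> k l. if l = i then axis j 1 $ k else A $ k $ l) / det A"
    unfolding eq by simp
  finally show ?thesis using False by simp
qed

lemma borel_measurable_det:
  fixes A :: "'a \<Rightarrow> real^'n^'n"
  assumes "\<And>i j. (\<lambda>x. A x $ i $ j) \<in> borel_measurable M"
  shows "(\<lambda>x. det (A x)) \<in> borel_measurable M"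
  unfolding det_def by (intro borel_measurable_sum borel_measurable_times borel_measurable_const borel_measurable_prod assms)

lemma measurable_inverse_field:
  fixes K :: "real^'d \<Rightarrow> real^'d^'d"
  assumes K: "K \<in> borel_measurable M" and u: "u \<in> borel_measurable M"
  shows "(\<lambda>x. inverse_field K x *v u x) \<in> borel_measurable M"
proof -
  have Kij: "(\<lambda>x. K x $ i $ j) \<in> borel_measurable M" for i j
    by (rule measurable_compose[OF K borel_measurable_continuous_onI]) (intro continuous_intros)
  have uj: "(\<lambda>x. u x $ j) \<in> borel_measurable M" for j
    by (rule measurable_compose[OF u borel_measurable_continuous_onI]) (intro continuous_intros)
  have d: "(\<lambda>x. det (K x)) \<in> borel_measurable M" by (rule borel_measurable_det[OF Kij])
  have aij: "(\<lambda>x. inverse_field K x $ i $ j) \<in> borel_measurable M" for i j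
    unfolding inverse_field_def matrix_inv_entry
  proof (rule measurable_If)
    show "(\<lambda>x. det (\<chi> k l. if l = i then axis j 1 $ k else K x $ k $ l) / det (K x)) \<in> borel_measurable M"
    proof (intro borel_measurable_divide d borel_measurable_det)
      fix k l show "(\<lambda>x. (\<chi> k l. if l = i then axis j 1 $ k else K x $ k $ l) $ k $ l) \<in> borel_measurable M"
        by (cases "l = i") (simp_all add: Kij)
    qed
    show "{x \<in> space M. det (K x) \<noteq> 0} \<in> sets M" using d by measurable
  qed simp
  have "(\<lambda>x. (inverse_field K x *v u x) \<bullet> b) \<in> borel_measurable M" if b: "b \<in> Basis" for b
  proof -
    obtain i where "b = axis i 1" using b unfolding Basis_vec_def by auto
    then have "(\<lambda>x. (inverse_field K x *v u x) \<bullet> b) = (\<lambda>x. \<Sum>j\<in>UNIV. inverse_field K x $ i $ j * u x $ j)"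
      by (simp add: inner_axis matrix_vector_mult_def)
    then show ?thesis by (simp only:) (intro borel_measurable_sum borel_measurable_times aij uj)
  qed
  then show ?thesis using borel_measurable_euclidean_space by blast
qed

locale weighted_dom = bounded_open +
  fixes \<alpha> :: "real^'a \<Rightarrow> real^'a^'a"
  assumes weight_L2: "\<And>u. u \<in> L2 \<Omega> \<Longrightarrow> (\<lambda>x. \<alpha> x *v u x) \<in> L2 \<Omega>"
    and weight_sym: "AE x in lebesgue_on \<Omega>. \<forall>\<xi> \<zeta>. (\<alpha> x *v \<xi>) \<bullet> \<zeta> = (\<alpha> x *v \<zeta>) \<bullet> \<xi>"
    and weight_nonneg: "AE x in lebesgue_on \<Omega>. \<forall>\<xi>. 0 \<le> (\<alpha> x *v \<xi>) \<bullet> \<xi>"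
    and weight_le: "AE x in lebesgue_on \<Omega>. \<forall>\<xi>. (\<alpha> x *v \<xi>) \<bullet> \<xi> \<le> \<xi> \<bullet> \<xi>"

lemma weighted_dom_inverse_field:
  fixes \<Omega> :: "(real^'d) set"
  assumes "open \<Omega>" "bounded \<Omega>" "permeability \<Omega> K" "bounded_below_by_identity \<Omega> K"
  shows "weighted_dom \<Omega> (inverse_field K)"
proof -
  have bd: "bounded_open \<Omega>" using assms(1,2) by (rule bounded_open.intro)
  have Km: "K \<in> borel_measurable (lebesgue_on \<Omega>)" and s: "AE x in lebesgue_on \<Omega>. transpose (K x) = K x"
    using assms(3) unfolding permeability_def by auto
  have ge: "AE x in lebesgue_on \<Omega>. \<forall>\<xi>. \<xi> \<bullet> \<xi> \<le> (K x *v \<xi>) \<bullet> \<xi>"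
    using assms(4) unfolding bounded_below_by_identity_def .
  have n: "AE x in lebesgue_on \<Omega>. \<forall>\<xi>. norm (inverse_field K x *v \<xi>) \<le> norm \<xi>"
    using s ge by eventually_elim (simp add: inverse_field_def inverse_matrix_bounds(4))
  show ?thesis
  proof (rule weighted_dom.intro[OF bd], unfold_locales)
    show "AE x in lebesgue_on \<Omega>. \<forall>\<xi> \<zeta>. (inverse_field K x *v \<xi>) \<bullet> \<zeta> = (inverse_field K x *v \<zeta>) \<bullet> \<xi>"
      using s ge by eventually_elim (auto simp: inverse_field_def intro: inverse_matrix_bounds(1))
    show "AE x in lebesgue_on \<Omega>. \<forall>\<xi>. 0 \<le> (inverse_field K x *v \<xi>) \<bullet> \<xi>"
      using s ge by eventually_elim (simp add: inverse_field_def inverse_matrix_bounds(2))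
    show "AE x in lebesgue_on \<Omega>. \<forall>\<xi>. (inverse_field K x *v \<xi>) \<bullet> \<xi> \<le> \<xi> \<bullet> \<xi>"
      using s ge by eventually_elim (simp add: inverse_field_def inverse_matrix_bounds(3))
    fix u :: "real^'d \<Rightarrow> real^'d" assume u: "u \<in> L2 \<Omega>"
    have m: "(\<lambda>x. inverse_field K x *v u x) \<in> borel_measurable (lebesgue_on \<Omega>)"
      by (rule measurable_inverse_field[OF Km L2_meas[OF u]])
    have "integrable (lebesgue_on \<Omega>) (\<lambda>x. (norm (inverse_field K x *v u x))\<^sup>2)"
    proof (rule Bochner_Integration.integrable_bound)
      show "integrable (lebesgue_on \<Omega>) (\<lambda>x. (norm (u x))\<^sup>2)" using u unfolding L2_def by simp
      show "(\<lambda>x. (norm (inverse_field K x *v u x))\<^sup>2) \<in> borel_measurable (lebesgue_on \<Omega>)"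
        by (intro borel_measurable_power measurable_compose[OF m borel_measurable_norm]) 
      show "AE x in lebesgue_on \<Omega>. norm ((norm (inverse_field K x *v u x))\<^sup>2) \<le> norm ((norm (u x))\<^sup>2)"
        using n by eventually_elim (simp add: power_mono)
    qed
    then show "(\<lambda>x. inverse_field K x *v u x) \<in> L2 \<Omega>" using m unfolding L2_def by simp
  qed
qed

context weighted_dom
begin

abbreviation "wi \<equiv> weighted_inner \<Omega> \<alpha>"

lemma wi_lin_left:
  assumes "u \<in> L2 \<Omega>" "v \<in> L2 \<Omega>" "w \<in> L2 \<Omega>"
  shows "wi (lin s u t v) w = s * wi u w + t * wi v w"
proof -
  have "(\<lambda>x. \<alpha> x *v lin s u t v x) = lin s (\<lambda>x. \<alpha> x *v u x) t (\<lambda>x. \<alpha> x *v v x)"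
    unfolding lin_def by (simp add: matrix_vector_right_distrib matrix_vector_mult_scaleR)
  then show ?thesis
    unfolding weighted_inner_def using L2_inner_lin_left[OF weight_L2[OF assms(1)] weight_L2[OF assms(2)] assms(3)] by simp
qed

lemma wi_commute:
  assumes "u \<in> L2 \<Omega>" "v \<in> L2 \<Omega>"
  shows "wi u v = wi v u"
  unfolding weighted_inner_def L2_inner_def
proof (rule integral_cong_AE)
  show "(\<lambda>x. (\<alpha> x *v u x) \<bullet> v x) \<in> borel_measurable (lebesgue_on \<Omega>)" "(\<lambda>x. (\<alpha> x *v v x) \<bullet> u x) \<in> borel_measurable (lebesgue_on \<Omega>)"
    by (intro borel_measurable_inner L2_meas weight_L2 assms)+
  show "AE x in lebesgue_on \<Omega>. (\<alpha> x *v u x) \<bullet> v x = (\<alpha> x *v v x) \<bullet> u x"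
    using weight_sym by eventually_elim blast
qed

lemma wi_lin_right:
  assumes "u \<in> L2 \<Omega>" "v \<in> L2 \<Omega>" "w \<in> L2 \<Omega>"
  shows "wi w (lin s u t v) = s * wi w u + t * wi w v"
  unfolding weighted_inner_def by (rule L2_inner_lin_right[OF assms(1,2) weight_L2[OF assms(3)]])

lemma wi_nonneg: "u \<in> L2 \<Omega> \<Longrightarrow> 0 \<le> wi u u"
  unfolding weighted_inner_def L2_inner_def using weight_nonneg
  by (intro integral_nonneg_AE) (auto elim: eventually_mono)

lemma wi_le:
  assumes "u \<in> L2 \<Omega>"
  shows "wi u u \<le> L2_inner \<Omega> u u"
  unfolding weighted_inner_def L2_inner_def
proof (rule integral_mono_AE)
  show "integrable (lebesgue_on \<Omega>) (\<lambda>x. (\<alpha> x *v u x) \<bullet> u x)" "integrable (lebesgue_on \<Omega>) (\<lambda>x. u x \<bullet> u x)"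
    by (intro L2_integrable_inner weight_L2 assms)+
  show "AE x in lebesgue_on \<Omega>. (\<alpha> x *v u x) \<bullet> u x \<le> u x \<bullet> u x"
    using weight_le by eventually_elim blast
qed

definition Lam :: "(real^'a \<Rightarrow> real^'a) \<Rightarrow> (real^'a \<Rightarrow> real^'a) \<Rightarrow> real" where
  "Lam u v = wi u v + L2_inner \<Omega> (weak_div \<Omega> u) (weak_div \<Omega> v)"

lemma Lam_lin_left:
  assumes "u \<in> Hdiv \<Omega>" "v \<in> Hdiv \<Omega>" "w \<in> Hdiv \<Omega>"
  shows "Lam (lin s u t v) w = s * Lam u w + t * Lam v w"
  unfolding Lam_def using inner_weak_div_lin[OF assms(1,2) weak_divD(1)[OF assms(3)]]
    wi_lin_left[OF Hdiv_L2[OF assms(1)] Hdiv_L2[OF assms(2)] Hdiv_L2[OF assms(3)]] by (simp add: algebra_simps)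

lemma Lam_commute:
  assumes "u \<in> Hdiv \<Omega>" "v \<in> Hdiv \<Omega>"
  shows "Lam u v = Lam v u"
  unfolding Lam_def using wi_commute[OF Hdiv_L2[OF assms(1)] Hdiv_L2[OF assms(2)]] L2_inner_commute by metis

lemma Lam_lin_right:
  assumes "u \<in> Hdiv \<Omega>" "v \<in> Hdiv \<Omega>" "w \<in> Hdiv \<Omega>"
  shows "Lam w (lin s u t v) = s * Lam w u + t * Lam w v"
  using Lam_lin_left[OF assms] Lam_commute[OF assms(3) weak_div_lin(1)[OF assms(1,2)]]
    Lam_commute[OF assms(3,1)] Lam_commute[OF assms(3,2)] by simp

lemma Lam_nonneg: "u \<in> Hdiv \<Omega> \<Longrightarrow> 0 \<le> Lam u u"
  unfolding Lam_def using wi_nonneg[OF Hdiv_L2] L2_inner_nonneg by (metis add_nonneg_nonneg)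

lemma Lam_lin_lin:
  assumes "u \<in> Hdiv \<Omega>" "v \<in> Hdiv \<Omega>"
  shows "Lam (lin s u t v) (lin s u t v) = s\<^sup>2 * Lam u u + 2 * s * t * Lam u v + t\<^sup>2 * Lam v v"
  using Lam_lin_left[OF assms weak_div_lin(1)[OF assms], of s t s t] Lam_lin_right[OF assms assms(1), of s t]
    Lam_lin_right[OF assms assms(2), of s t] Lam_commute[OF assms]
  by (simp add: power2_eq_square algebra_simps)

lemma Lam_Cauchy_Schwarz:
  assumes "u \<in> Hdiv \<Omega>" "v \<in> Hdiv \<Omega>"
  shows "(Lam u v)\<^sup>2 \<le> Lam u u * Lam v v"
  by (rule discriminant_bound) (metis Lam_lin_lin[OF assms] Lam_nonneg weak_div_lin(1)[OF assms])

lemma wi_Cauchy_Schwarz: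
  assumes "u \<in> L2 \<Omega>" "v \<in> L2 \<Omega>"
  shows "(wi u v)\<^sup>2 \<le> wi u u * wi v v"
proof (rule discriminant_bound)
  fix s t
  have "0 \<le> wi (lin s u t v) (lin s u t v)" by (rule wi_nonneg[OF L2_lin[OF assms]])
  also have "\<dots> = s\<^sup>2 * wi u u + 2 * s * t * wi u v + t\<^sup>2 * wi v v"
    using wi_lin_left[OF assms L2_lin[OF assms], of s t s t] wi_lin_right[OF assms assms(1), of s t]
      wi_lin_right[OF assms assms(2), of s t] wi_commute[OF assms]
    by (simp add: power2_eq_square algebra_simps)
  finally show "0 \<le> s\<^sup>2 * wi u u + 2 * s * t * wi u v + t\<^sup>2 * wi v v" .
qed

lemma Lambda_norm_sq: "u \<in> Hdiv \<Omega> \<Longrightarrow> (Lambda_norm \<Omega> \<alpha> u)\<^sup>2 = Lam u u"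
  unfolding Lambda_norm_def Lam_def[symmetric] using Lam_nonneg by simp

lemma pair_norm_eq: "u \<in> Hdiv \<Omega> \<Longrightarrow> pair_norm \<Omega> \<alpha> u q = sqrt (Lam u u + L2_inner \<Omega> q q)"
  unfolding pair_norm_def L2_norm_def using Lambda_norm_sq L2_inner_nonneg[of \<Omega> q] by simp

end

lemma saddle_identities:
  fixes uu uv bu bv e w \<delta> \<mu> \<nu> kk :: real
  assumes deg: "uu = uv\<^sup>2 \<Longrightarrow> bu = uv * bv"
    and \<delta>: "\<delta> = (bu - uv * bv) / (uu - uv\<^sup>2)" and \<mu>: "\<mu> = 1 - \<delta>" and \<nu>: "\<nu> = \<delta> * uv - bv"
    and kk: "kk = bv\<^sup>2 + (bu - uv * bv)\<^sup>2 / (uu - uv\<^sup>2)"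
  shows "\<mu>\<^sup>2 * uu + 2 * \<mu> * \<nu> * uv + \<nu>\<^sup>2 = uu - 2 * bu + kk"
    "\<mu> * uu + \<nu> * uv - (\<mu> * bu + \<nu> * bv) = uu - 2 * bu + kk"
proof -
  define e where "e = uu - uv\<^sup>2"
  define w where "w = bu - uv * bv"
  have uu: "uu = uv\<^sup>2 + e" and bu: "bu = uv * bv + w" unfolding e_def w_def by auto
  have \<delta>e: "\<delta> * e = w"
    using deg unfolding \<delta> e_def[symmetric] w_def[symmetric] by (cases "e = 0") (auto simp: e_def w_def)
  have kk': "kk = bv\<^sup>2 + \<delta> * w"
    unfolding kk \<delta> w_def e_def by (simp add: power2_eq_square)
  have s: "\<mu> * uv + \<nu> = uv - bv" unfolding \<mu> \<nu> by (simp add: algebra_simps)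
  have "\<mu>\<^sup>2 * uu + 2 * \<mu> * \<nu> * uv + \<nu>\<^sup>2 = (\<mu> * uv + \<nu>)\<^sup>2 + \<mu>\<^sup>2 * e"
    unfolding uu by (simp add: power2_eq_square algebra_simps)
  also have "\<mu>\<^sup>2 * e = e - 2 * (\<delta> * e) + \<delta> * (\<delta> * e)" unfolding \<mu> by (simp add: power2_eq_square algebra_simps)
  finally show "\<mu>\<^sup>2 * uu + 2 * \<mu> * \<nu> * uv + \<nu>\<^sup>2 = uu - 2 * bu + kk"
    unfolding s \<delta>e kk' uu bu by (simp add: power2_eq_square algebra_simps)
  have "\<mu> * uu + \<nu> * uv - (\<mu> * bu + \<nu> * bv) = (uv - bv) * (\<mu> * uv + \<nu>) + (\<mu> * e - \<mu> * w)"
    unfolding uu bu by (simp add: power2_eq_square algebra_simps)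
  also have "\<mu> * e - \<mu> * w = e - \<delta> * e - w + \<delta> * w" unfolding \<mu> by (simp add: algebra_simps)
  finally show "\<mu> * uu + \<nu> * uv - (\<mu> * bu + \<nu> * bv) = uu - 2 * bu + kk"
    unfolding s \<delta>e kk' uu bu by (simp add: power2_eq_square algebra_simps)
qed

lemma L2_zero_inner:
  fixes f :: "real^'d \<Rightarrow> 'b::euclidean_space"
  assumes "L2_zero \<Omega> f"
  shows "L2_inner \<Omega> f g = 0" "L2_inner \<Omega> g f = 0"
proof -
  have "AE x in lebesgue_on \<Omega>. f x \<bullet> g x = 0" "AE x in lebesgue_on \<Omega>. g x \<bullet> f x = 0"
    using assms unfolding L2_zero_def by (eventually_elim, simp)+
  then show "L2_inner \<Omega> f g = 0" "L2_inner \<Omega> g f = 0"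
    unfolding L2_inner_def by (simp_all add: integral_eq_zero_AE)
qed

context weighted_dom
begin

lemma Lam_zero:
  assumes "z \<in> Hdiv \<Omega>" "L2_zero \<Omega> z"
  shows "Lam z z = 0"
proof -
  have "wi z z = 0" unfolding weighted_inner_def by (rule L2_zero_inner(2)[OF assms(2)])
  moreover have "L2_inner \<Omega> (weak_div \<Omega> z) (weak_div \<Omega> z) = 0"
  proof -
    have z0: "(\<lambda>x. 0::real) \<in> L2 \<Omega>" using continuous_L2[OF continuous_on_const lmeasurable_dom bounded_dom] .
    have "has_weak_div \<Omega> z (\<lambda>x. 0)"
      unfolding has_weak_div_def using L2_zero_inner(1)[OF assms(2)] by (simp add: L2_inner_def)
    then have "AE x in lebesgue_on \<Omega>. weak_div \<Omega> z x = 0" by (rule weak_div_eqI(2)[OF Hdiv_L2[OF assms(1)] z0])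
    then show ?thesis by (intro L2_zero_inner) (simp add: L2_zero_def)
  qed
  ultimately show ?thesis unfolding Lam_def by simp
qed

lemma A_form_le:
  assumes u: "u \<in> Hdiv \<Omega>" and v: "v \<in> Hdiv \<Omega>" and p: "p \<in> L2 \<Omega>" and q: "q \<in> L2 \<Omega>"
  shows "A_form \<Omega> \<alpha> u p v q \<le> pair_norm \<Omega> \<alpha> u p * pair_norm \<Omega> \<alpha> v q"
proof -
  let ?Du = "weak_div \<Omega> u" and ?Dv = "weak_div \<Omega> v"
  note L = Hdiv_L2[OF u] Hdiv_L2[OF v] weak_divD(1)[OF u] weak_divD(1)[OF v]
  have 1: "wi u v \<le> sqrt (wi u u) * sqrt (wi v v)"
    unfolding real_sqrt_mult[symmetric] by (rule real_le_rsqrt[OF wi_Cauchy_Schwarz[OF L(1,2)]])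
  have 2: "- L2_inner \<Omega> p ?Dv \<le> sqrt (L2_inner \<Omega> p p) * sqrt (L2_inner \<Omega> ?Dv ?Dv)"
    unfolding real_sqrt_mult[symmetric] using L2_Cauchy_Schwarz[OF p L(4)] by (intro real_le_rsqrt) simp
  have 3: "- L2_inner \<Omega> ?Du q \<le> sqrt (L2_inner \<Omega> ?Du ?Du) * sqrt (L2_inner \<Omega> q q)"
    unfolding real_sqrt_mult[symmetric] using L2_Cauchy_Schwarz[OF L(3) q] by (intro real_le_rsqrt) simp
  have "A_form \<Omega> \<alpha> u p v q \<le> sqrt (wi u u) * sqrt (wi v v) + sqrt (L2_inner \<Omega> p p) * sqrt (L2_inner \<Omega> ?Dv ?Dv)
      + sqrt (L2_inner \<Omega> ?Du ?Du) * sqrt (L2_inner \<Omega> q q)"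
    unfolding A_form_def using 1 2 3 by linarith
  also have "\<dots> \<le> sqrt ((sqrt (wi u u))\<^sup>2 + (sqrt (L2_inner \<Omega> p p))\<^sup>2 + (sqrt (L2_inner \<Omega> ?Du ?Du))\<^sup>2)
     * sqrt ((sqrt (wi v v))\<^sup>2 + (sqrt (L2_inner \<Omega> ?Dv ?Dv))\<^sup>2 + (sqrt (L2_inner \<Omega> q q))\<^sup>2)"
    by (rule three_term_Cauchy_Schwarz)
  also have "\<dots> = pair_norm \<Omega> \<alpha> u p * pair_norm \<Omega> \<alpha> v q"
    unfolding pair_norm_eq[OF u] pair_norm_eq[OF v] Lam_def
    using wi_nonneg[OF L(1)] wi_nonneg[OF L(2)] by (simp add: L2_inner_nonneg add_ac)
  finally show ?thesis .
qed

lemma stable_from_inf_sup: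
  assumes dv: "\<And>u. u \<in> V_h \<Omega> \<Gamma> \<T> \<Longrightarrow> weak_div \<Omega> u \<in> W_h \<Omega> \<T>"
    and q0: "q0 \<in> W_h \<Omega> \<T>" "\<not> L2_zero \<Omega> q0"
    and \<gamma>: "0 < \<gamma>" "ereal \<gamma> \<le> inf_sup_value \<Omega> \<Gamma> \<T> \<alpha>"
  shows "stable_with \<Omega> \<Gamma> \<T> \<alpha> (1 / (1 + 1 / \<gamma>\<^sup>2))"
  unfolding stable_with_def
proof (intro ballI conjI)
  fix u p assume u: "u \<in> V_h \<Omega> \<Gamma> \<T>" and p: "p \<in> W_h \<Omega> \<T>"
  have VH: "v \<in> Hdiv \<Omega>" if "v \<in> V_h \<Omega> \<Gamma> \<T>" for v using that unfolding V_h_def V_space_def by simp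
  have WL: "q \<in> L2 \<Omega>" if "q \<in> W_h \<Omega> \<T>" for q using that unfolding W_h_def by simp
  let ?N = "pair_norm \<Omega> \<alpha> u p"
  have uH: "u \<in> Hdiv \<Omega>" and pL: "p \<in> L2 \<Omega>" using VH[OF u] WL[OF p] .
  have N0: "0 \<le> ?N" unfolding pair_norm_eq[OF uH] using Lam_nonneg[OF uH] L2_inner_nonneg[of \<Omega> p] by simp
  show "stability_sup \<Omega> \<Gamma> \<T> \<alpha> u p \<le> ereal ?N"
    unfolding stability_sup_def
  proof (rule SUP_least, clarsimp)
    fix v q assume v: "v \<in> V_h \<Omega> \<Gamma> \<T>" and q: "q \<in> W_h \<Omega> \<T>"
    have le: "A_form \<Omega> \<alpha> u p v q \<le> ?N * pair_norm \<Omega> \<alpha> v q" by (rule A_form_le[OF uH VH[OF v] pL WL[OF q]])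
    have M0: "0 \<le> pair_norm \<Omega> \<alpha> v q"
      unfolding pair_norm_eq[OF VH[OF v]] using Lam_nonneg[OF VH[OF v]] L2_inner_nonneg[of \<Omega> q] by simp
    show "A_form \<Omega> \<alpha> u p v q / pair_norm \<Omega> \<alpha> v q \<le> ?N"
    proof (cases "pair_norm \<Omega> \<alpha> v q = 0")
      case True then show ?thesis using N0 by simp
    next
      case False then show ?thesis using le M0 by (simp add: pos_divide_le_eq)
    qed
  qed
  define c where "c = 1 / (1 + 1 / \<gamma>\<^sup>2)"
  have c\<gamma>: "c = \<gamma>\<^sup>2 / (\<gamma>\<^sup>2 + 1)" unfolding c_def using \<gamma>(1) by (simp add: field_simps)
  have g2: "0 < \<gamma>\<^sup>2" using \<gamma>(1) by simp
  have c: "0 < c" "c \<le> 1" "c < \<gamma>\<^sup>2"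
  proof -
    have p: "0 < \<gamma>\<^sup>2 + 1" using g2 by linarith
    show "0 < c" unfolding c\<gamma> using g2 p by (rule divide_pos_pos)
    show "c \<le> 1" unfolding c\<gamma> using p by (simp add: divide_le_eq_1)
    have "\<gamma>\<^sup>2 * 1 < \<gamma>\<^sup>2 * (\<gamma>\<^sup>2 + 1)" using g2 by (intro mult_strict_left_mono) auto
    then show "c < \<gamma>\<^sup>2" unfolding c\<gamma> using p by (simp add: pos_divide_less_eq)
  qed
  have sc: "sqrt c < \<gamma>" using c(3) \<gamma>(1) by (intro real_less_lsqrt) auto
  define g where "g = weak_div \<Omega> u"
  define y where "y = lin 1 g 1 p"
  have gW: "g \<in> W_h \<Omega> \<T>" unfolding g_def using dv[OF u] .
  have yW: "y \<in> W_h \<Omega> \<T>" unfolding y_def by (rule W_h_lin[OF gW p])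
  note gL = WL[OF gW] and yL = WL[OF yW]
  have yin: "L2_inner \<Omega> y h = L2_inner \<Omega> g h + L2_inner \<Omega> p h" if "h \<in> L2 \<Omega>" for h
    unfolding y_def using L2_inner_lin_left[OF gL pL that, of 1 1] by simp
  define uu where "uu = Lam u u"
  define GG where "GG = L2_inner \<Omega> g g"
  define YY where "YY = L2_inner \<Omega> y y"
  define bu where "bu = L2_inner \<Omega> g y"
  have bu2: "bu\<^sup>2 \<le> GG * YY" unfolding bu_def GG_def YY_def by (rule L2_Cauchy_Schwarz[OF gL yL])
  obtain v1 where v1: "v1 \<in> V_h \<Omega> \<Gamma> \<T>"
    and v1n: "Lam v1 v1 = 1 \<or> (YY = 0 \<and> Lam v1 v1 = 0 \<and> Lam u v1 = 0)"
    and bvY: "c * YY \<le> (L2_inner \<Omega> (weak_div \<Omega> v1) y)\<^sup>2"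
  proof (cases "L2_zero \<Omega> y")
    case True
    let ?v = "lin 0 u 0 u"
    have Y0: "YY = 0" unfolding YY_def using L2_zero_inner[OF True] by simp
    show ?thesis
    proof (rule that)
      show "?v \<in> V_h \<Omega> \<Gamma> \<T>" by (rule V_h_lin[OF u u])
      show "Lam ?v ?v = 1 \<or> (YY = 0 \<and> Lam ?v ?v = 0 \<and> Lam u ?v = 0)"
        using Y0 Lam_lin_lin[OF uH uH, of 0 0] Lam_lin_right[OF uH uH uH, of 0 0] by simp
      show "c * YY \<le> (L2_inner \<Omega> (weak_div \<Omega> ?v) y)\<^sup>2" using Y0 by simp
    qed
  next
    case False
    have "inf_sup_value \<Omega> \<Gamma> \<T> \<alpha> \<le> (SUP v \<in> {v \<in> V_h \<Omega> \<Gamma> \<T>. \<not> L2_zero \<Omega> v}.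
        ereal (L2_inner \<Omega> (weak_div \<Omega> v) y / (Lambda_norm \<Omega> \<alpha> v * L2_norm \<Omega> y)))"
      unfolding inf_sup_value_def using yW False by (intro INF_lower) simp
    moreover have "ereal (sqrt c) < ereal \<gamma>" using sc by simp
    ultimately have "ereal (sqrt c) < (SUP v \<in> {v \<in> V_h \<Omega> \<Gamma> \<T>. \<not> L2_zero \<Omega> v}.
        ereal (L2_inner \<Omega> (weak_div \<Omega> v) y / (Lambda_norm \<Omega> \<alpha> v * L2_norm \<Omega> y)))"
      using \<gamma>(2) by (meson less_le_trans)
    then obtain v where v: "v \<in> V_h \<Omega> \<Gamma> \<T>"
      and lt: "sqrt c < L2_inner \<Omega> (weak_div \<Omega> v) y / (Lambda_norm \<Omega> \<alpha> v * L2_norm \<Omega> y)"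
      unfolding less_SUP_iff by auto
    define l where "l = Lambda_norm \<Omega> \<alpha> v"
    have ll: "l\<^sup>2 = Lam v v" unfolding l_def by (rule Lambda_norm_sq[OF VH[OF v]])
    have l0: "0 \<le> l" unfolding l_def Lambda_norm_def Lam_def[symmetric] using Lam_nonneg[OF VH[OF v]] by simp
    have Yn: "0 \<le> L2_norm \<Omega> y" "(L2_norm \<Omega> y)\<^sup>2 = YY" unfolding L2_norm_def YY_def using L2_inner_nonneg[of \<Omega> y] by auto
    have "0 < sqrt c" using c(1) by simp
    then have "l * L2_norm \<Omega> y \<noteq> 0" using lt unfolding l_def[symmetric] by auto
    then have lp: "0 < l" "0 < L2_norm \<Omega> y" using l0 Yn(1) by auto
    have lt': "sqrt c * L2_norm \<Omega> y < L2_inner \<Omega> (weak_div \<Omega> v) y / l"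
      using lt lp unfolding l_def[symmetric] by (simp add: pos_less_divide_eq mult_ac)
    let ?v = "lin (1 / l) v 0 v"
    have D: "L2_inner \<Omega> (weak_div \<Omega> ?v) y = L2_inner \<Omega> (weak_div \<Omega> v) y / l"
      using inner_weak_div_lin[OF VH[OF v] VH[OF v] yL, of "1 / l" 0] by simp
    show ?thesis
    proof (rule that)
      show "?v \<in> V_h \<Omega> \<Gamma> \<T>" by (rule V_h_lin[OF v v])
      show "Lam ?v ?v = 1 \<or> (YY = 0 \<and> Lam ?v ?v = 0 \<and> Lam u ?v = 0)"
        using Lam_lin_lin[OF VH[OF v] VH[OF v], of "1 / l" 0] lp(1) unfolding ll[symmetric] by (simp add: power_divide)
      have "(sqrt c * L2_norm \<Omega> y)\<^sup>2 \<le> (L2_inner \<Omega> (weak_div \<Omega> ?v) y)\<^sup>2"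
        unfolding D using lt' c(1) Yn(1) by (intro power_mono) auto
      then show "c * YY \<le> (L2_inner \<Omega> (weak_div \<Omega> ?v) y)\<^sup>2"
        using c(1) Yn(2) by (simp add: power_mult_distrib)
    qed
  qed
  have v1H: "v1 \<in> Hdiv \<Omega>" using VH[OF v1] .
  define uv where "uv = Lam u v1"
  define bv where "bv = L2_inner \<Omega> (weak_div \<Omega> v1) y"
  have uv2: "uv\<^sup>2 \<le> uu"
    using Lam_Cauchy_Schwarz[OF uH v1H] v1n Lam_nonneg[OF uH] unfolding uv_def uu_def by auto
  have uvv: "uv\<^sup>2 = uv\<^sup>2 * Lam v1 v1" and nvv: "\<nu>\<^sup>2 * Lam v1 v1 = \<nu>\<^sup>2 \<or> YY = 0" for \<nu> :: real
    using v1n unfolding uv_def by auto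
  have deg: "bu = uv * bv" if "uu = uv\<^sup>2"
  proof (cases "YY = 0")
    case True
    then have "bu\<^sup>2 \<le> 0" using bu2 by simp
    then have "bu = 0" by simp
    moreover have "bv = 0"
      using L2_Cauchy_Schwarz[OF weak_divD(1)[OF v1H] yL] True unfolding bv_def YY_def by simp
    ultimately show ?thesis by simp
  next
    case False
    then have vv: "Lam v1 v1 = 1" using v1n by blast
    let ?w = "lin 1 u (- uv) v1"
    have wH: "?w \<in> Hdiv \<Omega>" by (rule weak_div_lin(1)[OF uH v1H])
    have "Lam ?w ?w = uu - uv\<^sup>2"
      using Lam_lin_lin[OF uH v1H, of 1 "- uv"] vv unfolding uu_def[symmetric] uv_def[symmetric] by (simp add: power2_eq_square)
    then have "Lam ?w ?w = 0" using that by simp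
    then have "L2_inner \<Omega> (weak_div \<Omega> ?w) (weak_div \<Omega> ?w) = 0"
      unfolding Lam_def using wi_nonneg[OF Hdiv_L2[OF wH]] L2_inner_nonneg[of \<Omega> "weak_div \<Omega> ?w"] by linarith
    then have "L2_inner \<Omega> (weak_div \<Omega> ?w) y = 0" using L2_Cauchy_Schwarz[OF weak_divD(1)[OF wH] yL] by simp
    then show ?thesis using inner_weak_div_lin[OF uH v1H yL, of 1 "- uv"] unfolding bu_def bv_def g_def by simp
  qed
  define \<delta> where "\<delta> = (bu - uv * bv) / (uu - uv\<^sup>2)"
  define \<mu> where "\<mu> = 1 - \<delta>"
  define \<nu> where "\<nu> = \<delta> * uv - bv"
  define kk where "kk = bv\<^sup>2 + (bu - uv * bv)\<^sup>2 / (uu - uv\<^sup>2)"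
  note id = saddle_identities[OF deg \<delta>_def \<mu>_def \<nu>_def kk_def]
  note alg = saddle_algebra[OF c(1,2) uv2 L2_inner_nonneg[of \<Omega> g, folded GG_def] L2_inner_nonneg[of \<Omega> y, folded YY_def]
      bu2 bvY[folded bv_def] deg kk_def]
  define z where "z = lin \<mu> u \<nu> v1"
  have zV: "z \<in> V_h \<Omega> \<Gamma> \<T>" unfolding z_def by (rule V_h_lin[OF u v1])
  note zH = VH[OF zV]
  define s2 where "s2 = uu - 2 * bu + kk + GG"
  have zz: "Lam z z = uu - 2 * bu + kk"
  proof (cases "Lam v1 v1 = 1")
    case True
    then show ?thesis unfolding z_def Lam_lin_lin[OF uH v1H] uu_def[symmetric] uv_def[symmetric] using id(1) by simp
  next
    case False
    then have 0: "YY = 0" "Lam v1 v1 = 0" "uv = 0" using v1n unfolding uv_def by auto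
    have "bv = 0" using L2_Cauchy_Schwarz[OF weak_divD(1)[OF v1H] yL] 0 unfolding bv_def YY_def by simp
    then have "\<nu> = 0" unfolding \<nu>_def using 0 by simp
    then show ?thesis unfolding z_def Lam_lin_lin[OF uH v1H] uu_def[symmetric] uv_def[symmetric] using id(1) by simp
  qed
  have uz: "Lam u z = \<mu> * uu + \<nu> * uv" unfolding z_def uu_def uv_def by (rule Lam_lin_right[OF uH v1H uH])
  have Dzy: "L2_inner \<Omega> (weak_div \<Omega> z) y = \<mu> * bu + \<nu> * bv"
    unfolding z_def bu_def bv_def g_def by (rule inner_weak_div_lin[OF uH v1H yL])
  define q where "q = lin (-1) g 0 g"
  have qW: "q \<in> W_h \<Omega> \<T>" unfolding q_def by (rule W_h_lin[OF gW gW])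
  have gq: "L2_inner \<Omega> g q = - GG" unfolding q_def GG_def using L2_inner_lin_right[OF gL gL gL, of "-1" 0] by simp
  have qq: "L2_inner \<Omega> q q = GG"
    using L2_inner_lin_left[OF gL gL WL[OF qW], of "-1" 0] gq unfolding q_def[symmetric] by simp
  have A: "A_form \<Omega> \<alpha> u p z q = s2"
  proof -
    have "A_form \<Omega> \<alpha> u p z q = Lam u z - (L2_inner \<Omega> g (weak_div \<Omega> z) + L2_inner \<Omega> p (weak_div \<Omega> z)) + GG"
      unfolding A_form_def Lam_def g_def[symmetric] gq by simp
    also have "L2_inner \<Omega> g (weak_div \<Omega> z) + L2_inner \<Omega> p (weak_div \<Omega> z) = L2_inner \<Omega> (weak_div \<Omega> z) y"
      unfolding yin[OF weak_divD(1)[OF zH], symmetric] by (rule L2_inner_commute)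
    finally show ?thesis unfolding uz Dzy s2_def using id(2) by simp
  qed
  have s20: "0 \<le> s2" unfolding s2_def GG_def using alg(1) L2_inner_nonneg[of \<Omega> g] by simp
  have pn: "pair_norm \<Omega> \<alpha> z q = sqrt s2" unfolding pair_norm_eq[OF zH] zz qq s2_def ..
  have NN: "?N\<^sup>2 = uu + YY - 2 * bu + GG"
  proof -
    have "bu = GG + L2_inner \<Omega> p g"
      unfolding bu_def GG_def L2_inner_commute[of \<Omega> g y] by (rule yin[OF gL])
    moreover have "YY = bu + L2_inner \<Omega> p y" unfolding YY_def bu_def by (rule yin[OF yL])
    moreover have "L2_inner \<Omega> p y = L2_inner \<Omega> p g + L2_inner \<Omega> p p"
      unfolding L2_inner_commute[of \<Omega> p y] yin[OF pL] by (simp add: L2_inner_commute)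
    moreover have "?N\<^sup>2 = uu + L2_inner \<Omega> p p"
      unfolding pair_norm_eq[OF uH] uu_def using Lam_nonneg[OF uH] L2_inner_nonneg[of \<Omega> p] by simp
    ultimately show ?thesis by linarith
  qed
  have "(c * ?N)\<^sup>2 \<le> s2" using alg(2) unfolding s2_def power_mult_distrib NN .
  then have cN: "c * ?N \<le> sqrt s2" by (rule real_le_rsqrt)
  show "ereal (1 / (1 + 1 / \<gamma>\<^sup>2) * ?N) \<le> stability_sup \<Omega> \<Gamma> \<T> \<alpha> u p"
    unfolding c_def[symmetric]
  proof (cases "s2 = 0")
    case False
    have "\<not> (L2_zero \<Omega> z \<and> L2_zero \<Omega> q)"
    proof
      assume "L2_zero \<Omega> z \<and> L2_zero \<Omega> q"
      then have "Lam z z = 0" "L2_inner \<Omega> q q = 0" using Lam_zero[OF zH] L2_zero_inner by blast+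
      then show False using False zz qq unfolding s2_def by simp
    qed
    then have "ereal (A_form \<Omega> \<alpha> u p z q / pair_norm \<Omega> \<alpha> z q) \<le> stability_sup \<Omega> \<Gamma> \<T> \<alpha> u p"
      unfolding stability_sup_def using zV qW by (intro SUP_upper2[of "(z, q)"]) auto
    moreover have "A_form \<Omega> \<alpha> u p z q / pair_norm \<Omega> \<alpha> z q = sqrt s2"
      unfolding A pn using s20 False by (simp add: real_div_sqrt)
    ultimately show "ereal (c * ?N) \<le> stability_sup \<Omega> \<Gamma> \<T> \<alpha> u p" using cN by (metis ereal_less_eq(3) order_trans)
  next
    case True
    let ?v = "lin 0 u 0 u"
    have vV: "?v \<in> V_h \<Omega> \<Gamma> \<T>" by (rule V_h_lin[OF u u])
    have "GG = 0" using True alg(1) L2_inner_nonneg[of \<Omega> g] unfolding s2_def GG_def by linarith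
    then have "L2_inner \<Omega> g q0 = 0" using L2_Cauchy_Schwarz[OF gL WL[OF q0(1)]] unfolding GG_def by simp
    moreover have "wi u ?v = 0" using wi_lin_right[OF Hdiv_L2[OF uH] Hdiv_L2[OF uH] Hdiv_L2[OF uH], of 0 0] by simp
    moreover have "L2_inner \<Omega> p (weak_div \<Omega> ?v) = 0"
      using inner_weak_div_lin[OF uH uH pL, of 0 0] by (simp add: L2_inner_commute)
    ultimately have A0: "A_form \<Omega> \<alpha> u p ?v q0 = 0" unfolding A_form_def g_def[symmetric] by simp
    have "ereal (A_form \<Omega> \<alpha> u p ?v q0 / pair_norm \<Omega> \<alpha> ?v q0) \<le> stability_sup \<Omega> \<Gamma> \<T> \<alpha> u p"
      unfolding stability_sup_def using vV q0 by (intro SUP_upper2[of "(?v, q0)"]) auto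
    then have "0 \<le> stability_sup \<Omega> \<Gamma> \<T> \<alpha> u p" unfolding A0 by (simp add: zero_ereal_def)
    moreover have "c * ?N \<le> 0" using cN True by simp
    ultimately show "ereal (c * ?N) \<le> stability_sup \<Omega> \<Gamma> \<T> \<alpha> u p"
      by (metis ereal_less_eq(3) order_trans zero_ereal_def)
  qed
qed

end

section \<open>Conforming meshes\<close>

lemma (in full_simplex) bary_pos_rel_interior:
  assumes a: "a \<in> C" and y: "y \<in> rel_interior (convex hull (C - {a}))" and c: "c \<in> C" "c \<noteq> a"
  shows "0 < bary C c y"
proof -
  have "\<not> affine_dependent (C - {a})" using affine_independent_Diff[OF aff_indep] .
  then obtain u where u: "\<forall>x\<in>C - {a}. 0 < u x" "sum u (C - {a}) = 1" "(\<Sum>x\<in>C - {a}. u x *\<^sub>R x) = y"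
    using y unfolding rel_interior_convex_hull_explicit[OF \<open>\<not> affine_dependent (C - {a})\<close>] by blast
  have fin: "finite (C - {a})" using finite_C by simp
  have "bary C c y = (\<Sum>x\<in>C - {a}. u x * bary C c x)"
    using bary_affine_sum[OF fin u(2), of C c "\<lambda>x. x"] u(3) by simp
  also have "\<dots> = (\<Sum>x\<in>C - {a}. if x = c then u c else 0)"
    using c(1) by (intro sum.cong refl) (auto simp: bary_vertex)
  also have "\<dots> = u c" using c fin by simp
  finally show ?thesis using u(1) c by simp
qed

locale conforming =
  fixes \<T> :: "(real^'d) set set" and \<Omega> :: "(real^'d) set"
  assumes dim2: "2 \<le> CARD('d)" and simplicial: "simplicial \<T>" and cover: "\<Union>\<T> = closure \<Omega>"
    and conform: "\<And>T T'. T \<in> \<T> \<Longrightarrow> T' \<in> \<T> \<Longrightarrow> (T \<inter> T') face_of T"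
    and dom_open: "open \<Omega>" and dom_bounded: "bounded \<Omega>" and regular: "interior (closure \<Omega>) = \<Omega>"
begin

lemma finite_mesh: "finite \<T>" and mesh_simplex: "T \<in> \<T> \<Longrightarrow> int DIM(real^'d) simplex T"
  using simplicial unfolding simplicial_def by auto

sublocale bounded_open \<Omega>
  using dom_open dom_bounded by unfold_locales

lemma frontier_dom: "frontier \<Omega> = closure \<Omega> - \<Omega>"
  using dom_open by (simp add: frontier_def interior_open)

lemma cell_convex: "T \<in> \<T> \<Longrightarrow> convex T" and cell_compact: "T \<in> \<T> \<Longrightarrow> compact T"
  using mesh_simplex convex_simplex compact_simplex by blast+

lemma interior_cell_subset: "T \<in> \<T> \<Longrightarrow> interior T \<subseteq> \<Omega>"
  using interior_mono[of T "closure \<Omega>"] cover regular by blast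

lemma cells_eq:
  assumes "T \<in> \<T>" "T' \<in> \<T>" "x \<in> interior T" "x \<in> T'"
  shows "T = T'"
proof -
  have sub: "T \<subseteq> T'" if "T \<in> \<T>" "T' \<in> \<T>" "x \<in> interior T" "x \<in> T'" for T T'
  proof -
    have "x \<in> rel_interior T" using that(3) interior_subset_rel_interior by blast
    then have "T \<subseteq> T \<inter> T'"
      using subset_of_face_of[OF conform[OF that(1,2)] order_refl] that(4) rel_interior_subset by blast
    then show ?thesis by blast
  qed
  have s: "T \<subseteq> T'" by (rule sub[OF assms])
  then have "x \<in> interior T'" using assms(3) interior_mono by blast
  moreover have "x \<in> T" using assms(3) interior_subset by blast
  ultimately have "T' \<subseteq> T" using sub[OF assms(2,1)] by blast
  then show ?thesis using s by blast
qed

lemma facet_of_cell: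
  assumes T0: "T0 \<in> \<T>" "F facet_of T0" and T: "T \<in> \<T>" and y: "y \<in> rel_interior F" "y \<in> T"
  shows "F facet_of T"
proof (cases "T = T0")
  case True
  then show ?thesis using T0 by simp
next
  case False
  have F0: "F face_of T0" "F \<noteq> {}" "aff_dim F = aff_dim T0 - 1" using T0(2) unfolding facet_of_def by auto
  have dT: "aff_dim T = DIM(real^'d)" "aff_dim T0 = DIM(real^'d)"
    using aff_dim_simplex[OF mesh_simplex[OF T]] aff_dim_simplex[OF mesh_simplex[OF T0(1)]] by auto
  define G where "G = T0 \<inter> T"
  have G0: "G face_of T0" unfolding G_def by (rule conform[OF T0(1) T])
  have GT: "G face_of T" unfolding G_def using conform[OF T T0(1)] by (simp add: Int_commute)
  have FT0: "F \<subseteq> T0" using F0(1) by (rule face_of_imp_subset)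
  have "y \<in> G" using y FT0 rel_interior_subset unfolding G_def by blast
  then have FG: "F \<subseteq> G" using subset_of_face_of[OF G0 FT0] y(1) by blast
  have "G \<noteq> T0"
  proof
    assume "G = T0"
    then have "interior T0 \<subseteq> T" unfolding G_def using interior_subset by blast
    moreover have "interior T0 \<noteq> {}"
      using full_simplex.interior_nonempty[OF simplex_verts(1)[OF mesh_simplex[OF T0(1)]]]
      unfolding simplex_verts(2)[OF mesh_simplex[OF T0(1)], symmetric] .
    ultimately show False using cells_eq[OF T0(1) T] False by blast
  qed
  then have "aff_dim G < aff_dim T0" using face_of_aff_dim_lt[OF cell_convex[OF T0(1)] G0] by blast
  moreover have "F face_of G" using face_of_subset[OF F0(1) FG face_of_imp_subset[OF G0]] .
  moreover have "convex G" using face_of_imp_convex[OF G0] cell_convex[OF T0(1)] by blast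
  ultimately have "F = G" using face_of_aff_dim_lt[of G F] F0(3) by linarith
  then show ?thesis using GT F0 dT unfolding facet_of_def by simp
qed

lemma facet_closed_convex: "F \<in> facets \<T> \<Longrightarrow> closed F \<and> convex F \<and> F \<noteq> {}"
proof -
  assume "F \<in> facets \<T>"
  then obtain T where T: "T \<in> \<T>" "F facet_of T" unfolding facets_def by blast
  have F: "F face_of T" "F \<noteq> {}" using T(2) unfolding facet_of_def by auto
  have "closed F" using face_of_imp_closed[OF cell_convex[OF T(1)] compact_imp_closed[OF cell_compact[OF T(1)]] F(1)] .
  then show ?thesis using face_of_imp_convex[OF F(1)] cell_convex[OF T(1)] F(2) by blast
qed

lemma orient_cases:
  assumes "T \<in> \<T>" "F facet_of T"
  shows "orient T F = 1 \<or> orient T F = - 1"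
proof -
  obtain k where k: "k \<noteq> 0" "orient T F = sgn k"
    by (rule facet_orient[OF mesh_simplex[OF assms(1)] assms(2)])
  then show ?thesis by (cases "0 < k") auto
qed

lemma bary_along_normal:
  assumes T: "T \<in> \<T>" "F facet_of T" and y: "y \<in> F"
  shows "bary (verts T) (opp T F) (y + t *\<^sub>R facet_normal F) = t * (facet_grad T F \<bullet> facet_normal F)"
proof -
  interpret full_simplex "verts T" by (rule simplex_verts(1)[OF mesh_simplex[OF T(1)]])
  note o = opp_facet(1)[OF mesh_simplex[OF T(1)] T(2)] opp_facet(2)[OF mesh_simplex[OF T(1)] T(2), symmetric]
  have "bary (verts T) (opp T F) y = 0" using mem_facet_iff[OF o(1), of y] y unfolding o(2) by simp
  then show ?thesis unfolding bary_add facet_grad_def by simp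
qed

lemma facet_normal_nonzero:
  assumes "T \<in> \<T>" "F facet_of T"
  shows "facet_normal F \<noteq> 0"
  by (rule facet_orient[OF mesh_simplex[OF assms(1)] assms(2)])

lemma inner_side_of_facet:
  assumes T: "T \<in> \<T>" "F facet_of T" and y: "y \<in> rel_interior F"
  shows "\<exists>e>0. \<forall>\<delta>. 0 < \<delta> \<and> \<delta> * norm (facet_normal F) < e \<longrightarrow> y + (orient T F * \<delta>) *\<^sub>R facet_normal F \<in> interior T"
proof -
  interpret full_simplex "verts T" by (rule simplex_verts(1)[OF mesh_simplex[OF T(1)]])
  note o = opp_facet(1)[OF mesh_simplex[OF T(1)] T(2)] opp_facet(2)[OF mesh_simplex[OF T(1)] T(2), symmetric]
  define n where "n = facet_normal F"
  define s where "s = orient T F"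
  define W where "W = (\<Inter>c\<in>verts T - {opp T F}. {x. 0 < bary (verts T) c x})"
  have yF: "y \<in> F" by (rule subsetD[OF rel_interior_subset y])
  have "finite (verts T - {opp T F})" using finite_C by simp
  moreover have "\<forall>c\<in>verts T - {opp T F}. open {x. 0 < bary (verts T) c x}"
    by (rule ballI, rule open_Collect_less[OF continuous_on_const continuous_bary])
  ultimately have Wo: "open W" unfolding W_def by (rule open_INT)
  have "y \<in> W"
    unfolding W_def
  proof (rule INT_I, rule CollectI)
    fix c assume c: "c \<in> verts T - {opp T F}"
    have yr: "y \<in> rel_interior (convex hull (verts T - {opp T F}))" unfolding o(2) by (rule y)
    show "0 < bary (verts T) c y"
      by (rule bary_pos_rel_interior[OF o(1) yr]) (use c in simp_all)
  qed
  then obtain e where e: "0 < e" "ball y e \<subseteq> W" using Wo unfolding open_contains_ball by (metis (no_types))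
  have s: "s = 1 \<or> s = - 1" unfolding s_def by (rule orient_cases[OF T])
  have sg: "0 < s * (facet_grad T F \<bullet> n)"
    using s unfolding s_def orient_def n_def[symmetric] by (auto simp: sgn_if split: if_splits)
  have "y + (s * \<delta>) *\<^sub>R n \<in> interior T" if \<delta>: "0 < \<delta>" "\<delta> * norm n < e" for \<delta>
  proof -
    define z where "z = y + (s * \<delta>) *\<^sub>R n"
    have "dist y z = \<delta> * norm n" unfolding z_def using s \<delta>(1) by (auto simp: dist_norm)
    then have "z \<in> ball y e" using \<delta>(2) by simp
    then have zW: "z \<in> W" by (rule subsetD[OF e(2)])
    have zo: "0 < bary (verts T) (opp T F) z"
      unfolding z_def n_def bary_along_normal[OF T yF] using mult_pos_pos[OF \<delta>(1) sg] unfolding n_def by (simp add: mult_ac)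
    have "0 < bary (verts T) c z" if "c \<in> verts T" for c
    proof (cases "c = opp T F")
      case True then show ?thesis using zo by simp
    next
      case False then show ?thesis using zW that unfolding W_def by simp
    qed
    then have "z \<in> {x. \<forall>c\<in>verts T. 0 < bary (verts T) c x}" by simp
    then have "z \<in> interior (convex hull (verts T))" by (rule subsetD[OF bary_pos_interior])
    then show ?thesis unfolding simplex_verts(2)[OF mesh_simplex[OF T(1)], symmetric] z_def .
  qed
  then show ?thesis using e(1) unfolding s_def n_def by (intro exI[of _ e]) simp
qed

lemma cell_on_side_unique:
  assumes T: "T \<in> \<T>" "F facet_of T" and T': "T' \<in> \<T>" "F facet_of T'" and eq: "orient T F = orient T' F"
    and y: "y \<in> rel_interior F"
  shows "T = T'"
proof -
  define n where "n = facet_normal F"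
  have n0: "0 < norm n" unfolding n_def using facet_normal_nonzero[OF T] by simp
  obtain e1 where e1: "0 < e1" and i1: "\<forall>\<delta>. 0 < \<delta> \<and> \<delta> * norm n < e1 \<longrightarrow> y + (orient T F * \<delta>) *\<^sub>R n \<in> interior T"
    using inner_side_of_facet[OF T y] unfolding n_def by (elim exE conjE)
  obtain e2 where e2: "0 < e2" and i2: "\<forall>\<delta>. 0 < \<delta> \<and> \<delta> * norm n < e2 \<longrightarrow> y + (orient T' F * \<delta>) *\<^sub>R n \<in> interior T'"
    using inner_side_of_facet[OF T' y] unfolding n_def by (elim exE conjE)
  define \<delta> where "\<delta> = min e1 e2 / (2 * norm n)"
  have d: "0 < \<delta>" "\<delta> * norm n < e1" "\<delta> * norm n < e2" unfolding \<delta>_def using e1 e2 n0 by auto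
  have "y + (orient T F * \<delta>) *\<^sub>R n \<in> interior T" using i1[rule_format, of \<delta>] d by simp
  moreover have "y + (orient T F * \<delta>) *\<^sub>R n \<in> interior T'" unfolding eq using i2[rule_format, of \<delta>] d by simp
  then have "y + (orient T F * \<delta>) *\<^sub>R n \<in> T'" by (rule subsetD[OF interior_subset])
  ultimately show ?thesis by (rule cells_eq[OF T(1) T'(1)])
qed

lemma cell_on_side_exists:
  assumes T0: "T0 \<in> \<T>" "F facet_of T0" and y: "y \<in> rel_interior F" "y \<in> \<Omega>" and s: "s = 1 \<or> s = - 1"
  shows "\<exists>T\<in>\<T>. F facet_of T \<and> orient T F = s"
proof -
  define n where "n = facet_normal F"
  have n0: "0 < norm n" unfolding n_def using facet_normal_nonzero[OF T0] by simp
  have yF: "y \<in> F" by (rule subsetD[OF rel_interior_subset y(1)])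
  define U where "U = \<Omega> \<inter> (\<Inter>T\<in>{T\<in>\<T>. y \<notin> T}. - T)"
  have "finite {T\<in>\<T>. y \<notin> T}" using finite_mesh by simp
  moreover have "\<forall>T\<in>{T\<in>\<T>. y \<notin> T}. open (- T)"
    using compact_imp_closed[OF cell_compact] by (simp add: open_Compl)
  ultimately have "open (\<Inter>T\<in>{T\<in>\<T>. y \<notin> T}. - T)" by (rule open_INT)
  then have "open U" unfolding U_def by (rule open_Int[OF dom_open])
  moreover have "y \<in> U" unfolding U_def using y(2) by simp
  ultimately obtain e where e: "0 < e" "ball y e \<subseteq> U" unfolding open_contains_ball by (metis (no_types))
  define \<delta> where "\<delta> = e / (2 * norm n)"
  have \<delta>: "0 < \<delta>" unfolding \<delta>_def using e(1) n0 by simp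
  define z where "z = y + (s * \<delta>) *\<^sub>R n"
  have "dist y z = \<delta> * norm n" unfolding z_def using s \<delta> by (auto simp: dist_norm)
  also have "\<dots> < e" unfolding \<delta>_def using e(1) n0 by simp
  finally have "z \<in> ball y e" by simp
  then have z: "z \<in> U" by (rule subsetD[OF e(2)])
  then have "z \<in> \<Omega>" unfolding U_def by simp
  then have "z \<in> closure \<Omega>" by (rule subsetD[OF closure_subset])
  then obtain T where T: "T \<in> \<T>" "z \<in> T" unfolding cover[symmetric] by (rule UnionE)
  have "y \<in> T"
  proof (rule ccontr)
    assume "y \<notin> T"
    then show False using z T unfolding U_def by simp
  qed
  then have FT: "F facet_of T" by (rule facet_of_cell[OF T0 T(1) y(1)])
  interpret full_simplex "verts T" by (rule simplex_verts(1)[OF mesh_simplex[OF T(1)]])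
  have "\<forall>a\<in>verts T. 0 \<le> bary (verts T) a z"
    using T(2) mem_simplex_iff[of z] unfolding simplex_verts(2)[OF mesh_simplex[OF T(1)], symmetric] by simp
  then have "0 \<le> bary (verts T) (opp T F) z" using opp_facet(1)[OF mesh_simplex[OF T(1)] FT] by simp
  then have nn: "0 \<le> \<delta> * (s * (facet_grad T F \<bullet> n))"
    unfolding z_def n_def bary_along_normal[OF T(1) FT yF] by (simp only: mult_ac)
  have nn': "0 \<le> s * (facet_grad T F \<bullet> n)"
  proof (rule ccontr)
    assume "\<not> 0 \<le> s * (facet_grad T F \<bullet> n)"
    then have "s * (facet_grad T F \<bullet> n) < 0" by linarith
    then have "\<delta> * (s * (facet_grad T F \<bullet> n)) < 0" by (rule mult_pos_neg[OF \<delta>])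
    then show False using nn by linarith
  qed
  have "orient T F = s"
    using orient_cases[OF T(1) FT] s nn' unfolding orient_def n_def[symmetric] by (auto simp: sgn_if split: if_splits)
  then show ?thesis using T(1) FT by (intro bexI[of _ T] conjI)
qed

text \<open>An interior facet has exactly one cell on each side.\<close>

lemma interior_facet_orient_sum:
  assumes F: "F \<in> facets \<T>" "\<not> F \<subseteq> frontier \<Omega>"
  shows "(\<Sum>T\<in>{T\<in>\<T>. F facet_of T}. orient T F) = 0"
proof -
  obtain T0 where T0: "T0 \<in> \<T>" "F facet_of T0" using F(1) unfolding facets_def by blast
  have FcO: "F \<subseteq> closure \<Omega>" using facet_of_imp_subset[OF T0(2)] T0(1) cover by blast
  have cF: "convex F" using facet_closed_convex[OF F(1)] by simp
  obtain y0 where yF0: "y0 \<in> F" "y0 \<notin> frontier \<Omega>" using F(2) by (meson subsetI)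
  have "y0 \<in> closure \<Omega>" by (rule subsetD[OF FcO yF0(1)])
  then have y0: "y0 \<in> \<Omega>" using yF0(2) unfolding frontier_dom by simp
  have "y0 \<in> closure F" using yF0(1) by (rule subsetD[OF closure_subset])
  then have "y0 \<in> closure (rel_interior F)" unfolding convex_closure_rel_interior[OF cF] .
  then have "\<Omega> \<inter> closure (rel_interior F) \<noteq> {}" using y0 by (metis IntI empty_iff)
  then have "\<Omega> \<inter> rel_interior F \<noteq> {}" unfolding open_Int_closure_eq_empty[OF dom_open] .
  then obtain y where y: "y \<in> \<Omega>" "y \<in> rel_interior F" by (metis IntE ex_in_conv)
  note ex = cell_on_side_exists[OF T0 y(2,1)]
  obtain Tp where Tp: "Tp \<in> \<T>" "F facet_of Tp" "orient Tp F = 1" using ex[of 1] by auto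
  obtain Tm where Tm: "Tm \<in> \<T>" "F facet_of Tm" "orient Tm F = - 1" using ex[of "- 1"] by auto
  have "T = Tp \<or> T = Tm" if T: "T \<in> \<T>" "F facet_of T" for T
    using orient_cases[OF T]
  proof
    assume "orient T F = 1"
    then show ?thesis using cell_on_side_unique[OF T Tp(1,2) _ y(2)] Tp(3) by simp
  next
    assume "orient T F = - 1"
    then show ?thesis using cell_on_side_unique[OF T Tm(1,2) _ y(2)] Tm(3) by simp
  qed
  then have "{T\<in>\<T>. F facet_of T} = {Tp, Tm}" using Tp(1,2) Tm(1,2) by auto
  moreover have "Tp \<noteq> Tm" using Tp(3) Tm(3) by auto
  ultimately show ?thesis using Tp(3) Tm(3) by simp
qed

definition skeleton :: "(real^'d) set" where
  "skeleton = (\<Union>T\<in>\<T>. frontier T)"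

lemma null_skeleton: "skeleton \<in> null_sets lebesgue"
proof -
  have "negligible skeleton"
    unfolding skeleton_def using finite_mesh cell_convex
    by (intro negligible_Union finite_imageI) (auto intro: negligible_convex_frontier)
  then show ?thesis using negligible_iff_null_sets by blast
qed

lemma indicator_cells:
  assumes "x \<notin> skeleton"
  shows "indicator \<Omega> x = (\<Sum>T\<in>\<T>. indicator T x :: real)"
proof (cases "x \<in> \<Omega>")
  case True
  then have "x \<in> closure \<Omega>" by (rule subsetD[OF closure_subset])
  then obtain T where T: "T \<in> \<T>" "x \<in> T" using cover by blast
  have xi: "x \<in> interior T"
  proof -
    have "x \<in> closure T" using T(2) by (rule subsetD[OF closure_subset])
    moreover have "x \<notin> frontier T" using assms T(1) unfolding skeleton_def by simp
    ultimately show ?thesis unfolding frontier_def by simp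
  qed
  have "(\<Sum>T'\<in>\<T>. indicator T' x :: real) = (\<Sum>T'\<in>\<T>. if T' = T then 1 else 0)"
  proof (intro sum.cong refl)
    fix T' assume T': "T' \<in> \<T>"
    show "(indicator T' x :: real) = (if T' = T then 1 else 0)"
    proof (cases "T' = T")
      case False
      then have "x \<notin> T'" using cells_eq[OF T(1) T' xi] by metis
      then show ?thesis using False by simp
    qed (use T(2) in simp)
  qed
  then show ?thesis using True T(1) finite_mesh by simp
next
  case False
  have "x \<notin> T" if "T \<in> \<T>" for T
  proof
    assume "x \<in> T"
    then have "x \<in> closure T" by (rule subsetD[OF closure_subset])
    moreover have "x \<notin> frontier T" using assms that unfolding skeleton_def by simp
    ultimately have "x \<in> interior T" unfolding frontier_def by simp
    then show False using interior_cell_subset[OF that] False by blast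
  qed
  then show ?thesis using False by simp
qed

lemma AE_cell_iff:
  assumes "T \<in> \<T>"
  shows "(AE x in lebesgue_on T. P x) \<longleftrightarrow> (AE x in lebesgue. x \<in> interior T \<longrightarrow> P x)"
proof -
  have Ts: "T \<in> sets lebesgue" using lmeasurable_compact[OF cell_compact[OF assms]] by (rule fmeasurableD)
  have ae: "AE x in lebesgue. x \<notin> skeleton" using null_skeleton by (rule AE_not_in)
  have mem: "x \<in> T \<longleftrightarrow> x \<in> interior T" if "x \<notin> skeleton" for x
  proof -
    have "x \<in> closure T \<longleftrightarrow> x \<in> T" using closure_closed[OF compact_imp_closed[OF cell_compact[OF assms]]] by simp
    then show ?thesis using that assms interior_subset[of T] unfolding skeleton_def frontier_def by blast
  qed
  have "(AE x in lebesgue_on T. P x) \<longleftrightarrow> (AE x in lebesgue. x \<in> T \<longrightarrow> P x)"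
    using Ts by (simp add: AE_restrict_space_iff)
  also have "\<dots> \<longleftrightarrow> (AE x in lebesgue. x \<in> interior T \<longrightarrow> P x)"
  proof
    assume "AE x in lebesgue. x \<in> T \<longrightarrow> P x"
    then show "AE x in lebesgue. x \<in> interior T \<longrightarrow> P x" using ae by eventually_elim (simp add: mem)
  next
    assume "AE x in lebesgue. x \<in> interior T \<longrightarrow> P x"
    then show "AE x in lebesgue. x \<in> T \<longrightarrow> P x" using ae by eventually_elim (simp add: mem)
  qed
  finally show ?thesis .
qed

lemma integral_cells:
  fixes f :: "real^'d \<Rightarrow> real"
  assumes f: "integrable (lebesgue_on \<Omega>) f"
  shows "\<And>T. T \<in> \<T> \<Longrightarrow> integrable (lebesgue_on T) f"
    "integral\<^sup>L (lebesgue_on \<Omega>) f = (\<Sum>T\<in>\<T>. integral\<^sup>L (lebesgue_on T) f)"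
proof -
  let ?G = "\<lambda>x. indicator \<Omega> x * f x"
  have G: "integrable lebesgue ?G" using f sets_dom by (simp add: integrable_restrict_space)
  have Ts: "T \<in> sets lebesgue" if "T \<in> \<T>" for T using lmeasurable_compact[OF cell_compact[OF that]] by (rule fmeasurableD)
  have ae: "AE x in lebesgue. x \<notin> skeleton" using null_skeleton by (rule AE_not_in)
  have TG: "indicator T x * f x = indicator T x * ?G x" if T: "T \<in> \<T>" and x: "x \<notin> skeleton" for T x
  proof (cases "x \<in> T")
    case True
    then have "x \<in> closure T" by (rule subsetD[OF closure_subset])
    then have "x \<in> interior T" using x T unfolding skeleton_def frontier_def by blast
    then have "x \<in> \<Omega>" using interior_cell_subset[OF T] by blast
    then show ?thesis by simp
  qed simp
  have iT: "integrable lebesgue (\<lambda>x. indicator T x * ?G x)" if "T \<in> \<T>" for T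
    using integrable_mult_indicator[OF Ts[OF that] G] by simp
  have Gm: "?G \<in> borel_measurable lebesgue" using G by (rule borel_measurable_integrable)
  have aeT: "AE x in lebesgue. indicator T x * ?G x = indicator T x * f x" if "T \<in> \<T>" for T
    using ae
  proof eventually_elim
    case (elim x)
    then show ?case by (rule TG[OF that, symmetric])
  qed
  have mT: "(\<lambda>x. indicator T x * f x) \<in> borel_measurable lebesgue" if "T \<in> \<T>" for T
    using borel_measurable_integrable[OF iT[OF that]] aeT[OF that] by (rule borel_measurable_AE)
  show "integrable (lebesgue_on T) f" if T: "T \<in> \<T>" for T
    using integrable_cong_AE_imp[OF iT[OF T] mT[OF T] aeT[OF T]] Ts[OF T] by (simp add: integrable_restrict_space)
  have "integral\<^sup>L (lebesgue_on \<Omega>) f = integral\<^sup>L lebesgue ?G"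
    using sets_dom by (simp add: integral_restrict_space)
  also have "\<dots> = integral\<^sup>L lebesgue (\<lambda>x. \<Sum>T\<in>\<T>. indicator T x * ?G x)"
  proof (rule integral_cong_AE[OF Gm])
    show "(\<lambda>x. \<Sum>T\<in>\<T>. indicator T x * ?G x) \<in> borel_measurable lebesgue"
      using iT by (intro borel_measurable_sum borel_measurable_integrable)
    show "AE x in lebesgue. ?G x = (\<Sum>T\<in>\<T>. indicator T x * ?G x)"
      using ae
    proof eventually_elim
      case (elim x)
      have "(\<Sum>T\<in>\<T>. indicator T x * ?G x) = indicator \<Omega> x * ?G x"
        unfolding indicator_cells[OF elim] by (simp only: sum_distrib_right)
      then show ?case by (simp add: indicator_def)
    qed
  qed
  also have "\<dots> = (\<Sum>T\<in>\<T>. integral\<^sup>L lebesgue (\<lambda>x. indicator T x * ?G x))"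
    using iT by (rule Bochner_Integration.integral_sum)
  also have "\<dots> = (\<Sum>T\<in>\<T>. integral\<^sup>L (lebesgue_on T) f)"
  proof (intro sum.cong refl)
    fix T assume T: "T \<in> \<T>"
    have "integral\<^sup>L lebesgue (\<lambda>x. indicator T x * ?G x) = integral\<^sup>L lebesgue (\<lambda>x. indicator T x * f x)"
      by (rule integral_cong_AE[OF borel_measurable_integrable[OF iT[OF T]] mT[OF T] aeT[OF T]])
    then show "integral\<^sup>L lebesgue (\<lambda>x. indicator T x * ?G x) = integral\<^sup>L (lebesgue_on T) f"
      using Ts[OF T] by (simp add: integral_restrict_space)
  qed
  finally show "integral\<^sup>L (lebesgue_on \<Omega>) f = (\<Sum>T\<in>\<T>. integral\<^sup>L (lebesgue_on T) f)" .
qed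

end

section \<open>Raviart-Thomas fields\<close>

lemma (in full_simplex) interior_bary_pos:
  assumes x: "x \<in> interior (convex hull C)" and a: "a \<in> C"
  shows "0 < bary C a x"
proof (rule ccontr)
  assume n: "\<not> 0 < bary C a x"
  obtain e where e: "0 < e" "ball x e \<subseteq> convex hull C" using x unfolding mem_interior by metis
  let ?g = "bary_grad C a"
  have g: "?g \<noteq> 0" using bary_grad_nonzero[OF a] .
  let ?t = "e / (2 * norm ?g)"
  have "dist x (x + (- ?t) *\<^sub>R ?g) = e / 2" using g e(1) by (simp add: dist_norm)
  then have "x + (- ?t) *\<^sub>R ?g \<in> ball x e" using e(1) by simp
  then have "x + (- ?t) *\<^sub>R ?g \<in> convex hull C" using e(2) by (rule rev_subsetD)
  then have "0 \<le> bary C a (x + (- ?t) *\<^sub>R ?g)" using a unfolding mem_simplex_iff by (rule bspec)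
  then have "0 \<le> bary C a x - ?t * (?g \<bullet> ?g)" unfolding bary_add[of a x "- ?t" ?g] by linarith
  moreover have "0 < ?t * (?g \<bullet> ?g)" using g e(1) by simp
  ultimately show False using n by linarith
qed

lemma cell_integral_lborel:
  fixes f :: "real^'d \<Rightarrow> real"
  assumes T: "compact T" and f: "continuous_on UNIV f"
  shows "integral\<^sup>L (lebesgue_on T) f = (LINT x:T|lborel. f x)"
proof -
  have Tb: "T \<in> sets borel" using compact_imp_closed[OF T] by (rule borel_closed)
  have fb: "f \<in> borel_measurable borel" using f by (rule borel_measurable_continuous_onI)
  have m: "(\<lambda>x. indicator T x *\<^sub>R f x) \<in> borel_measurable lborel" using Tb fb by simp
  have "integral\<^sup>L (lebesgue_on T) f = integral\<^sup>L lebesgue (\<lambda>x. indicator T x *\<^sub>R f x)"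
    using Tb by (simp add: integral_restrict_space)
  also have "\<dots> = integral\<^sup>L lborel (\<lambda>x. indicator T x *\<^sub>R f x)" by (rule integral_completion[OF m])
  finally show ?thesis unfolding set_lebesgue_integral_def .
qed

lemma L2_indicator:
  fixes f :: "real^'d \<Rightarrow> 'b::euclidean_space"
  assumes T: "T \<in> sets lebesgue" and f: "f \<in> L2 \<Omega>"
  shows "(\<lambda>x. indicator T x *\<^sub>R f x) \<in> L2 \<Omega>"
proof -
  have i: "(indicator T :: real^'d \<Rightarrow> real) \<in> borel_measurable (lebesgue_on \<Omega>)"
    using T by (intro measurable_restrict_space1 borel_measurable_indicator)
  have m: "(\<lambda>x. indicator T x *\<^sub>R f x) \<in> borel_measurable (lebesgue_on \<Omega>)"
    using i L2_meas[OF f] by (rule borel_measurable_scaleR)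
  have "integrable (lebesgue_on \<Omega>) (\<lambda>x. (norm (f x))\<^sup>2)" using f unfolding L2_def by simp
  then have "integrable (lebesgue_on \<Omega>) (\<lambda>x. (norm (indicator T x *\<^sub>R f x))\<^sup>2)"
  proof (rule Bochner_Integration.integrable_bound)
    show "(\<lambda>x. (norm (indicator T x *\<^sub>R f x))\<^sup>2) \<in> borel_measurable (lebesgue_on \<Omega>)"
      by (rule borel_measurable_power[OF measurable_compose[OF m borel_measurable_norm]])
    show "AE x in lebesgue_on \<Omega>. norm ((norm (indicator T x *\<^sub>R f x))\<^sup>2) \<le> norm ((norm (f x))\<^sup>2)"
      by (intro AE_I2) (simp add: indicator_def)
  qed
  then show ?thesis using m unfolding L2_def by simp
qed

lemma L2_sum:
  fixes f :: "'i \<Rightarrow> real^'d \<Rightarrow> 'b::euclidean_space"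
  assumes "finite I" "\<And>i. i \<in> I \<Longrightarrow> f i \<in> L2 \<Omega>"
  shows "(\<lambda>x. \<Sum>i\<in>I. f i x) \<in> L2 \<Omega>"
  using assms
proof (induction I rule: finite_induct)
  case empty
  show ?case unfolding L2_def by simp
next
  case (insert i I)
  have "lin 1 (f i) 1 (\<lambda>x. \<Sum>i\<in>I. f i x) \<in> L2 \<Omega>"
    using insert.prems[of i] insert.IH insert.prems by (intro L2_lin) simp_all
  then show ?case using insert.hyps unfolding lin_def by simp
qed

context conforming
begin

lemma L2_inner_cells:
  fixes f g :: "real^'d \<Rightarrow> 'b::euclidean_space"
  assumes "f \<in> L2 \<Omega>" "g \<in> L2 \<Omega>"
  shows "\<And>T. T \<in> \<T> \<Longrightarrow> integrable (lebesgue_on T) (\<lambda>x. f x \<bullet> g x)"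
    "L2_inner \<Omega> f g = (\<Sum>T\<in>\<T>. integral\<^sup>L (lebesgue_on T) (\<lambda>x. f x \<bullet> g x))"
  using integral_cells[OF L2_integrable_inner[OF assms]] unfolding L2_inner_def by blast+

lemma cell_integral_cong_AE:
  fixes f g :: "real^'d \<Rightarrow> real"
  assumes "T \<in> \<T>" "integrable (lebesgue_on T) f" "continuous_on UNIV g" "AE x in lebesgue_on T. f x = g x"
  shows "integral\<^sup>L (lebesgue_on T) f = (LINT x:T|lborel. g x)"
proof -
  have "integral\<^sup>L (lebesgue_on T) f = integral\<^sup>L (lebesgue_on T) g"
    by (rule integral_cong_AE[OF borel_measurable_integrable[OF assms(2)] continuous_measurable_lebesgue_on[OF assms(3)] assms(4)])
  then show ?thesis using cell_integral_lborel[OF cell_compact[OF assms(1)] assms(3)] by simp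
qed

lemma weak_div_cell:
  assumes u: "u \<in> Hdiv \<Omega>" and T: "T \<in> \<T>" and ab: "AE x in lebesgue_on T. u x = a + b *\<^sub>R x"
  shows "AE x in lebesgue_on T. weak_div \<Omega> u x = real CARD('d) * b"
proof -
  let ?g = "weak_div \<Omega> u" let ?U = "interior T"
  interpret T: full_simplex "verts T" using simplex_verts(1)[OF mesh_simplex[OF T]] .
  have TC: "T = convex hull (verts T)" using simplex_verts(2)[OF mesh_simplex[OF T]] .
  have gL: "?g \<in> L2 \<Omega>" and wd: "has_weak_div \<Omega> u ?g" using weak_divD[OF u] by blast+
  have Ts: "T \<in> sets lebesgue" using lmeasurable_compact[OF cell_compact[OF T]] by (rule fmeasurableD)
  have Us: "?U \<in> sets lebesgue" by simp
  have UT: "?U \<subseteq> T" by (rule interior_subset)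
  have iT: "integrable (lebesgue_on T) (\<lambda>x. ?g x - real CARD('d) * b)"
  proof (rule Bochner_Integration.integrable_diff)
    show "integrable (lebesgue_on T) ?g" by (rule integral_cells(1)[OF L2_integrable[OF gL] T])
    show "integrable (lebesgue_on T) (\<lambda>x. real CARD('d) * b)"
      by (rule finite_measure.integrable_const[OF finite_measure_lebesgue_on[OF lmeasurable_compact[OF cell_compact[OF T]]]])
  qed
  have iU: "integrable (lebesgue_on ?U) (\<lambda>x. ?g x - real CARD('d) * b)"
  proof -
    have "integrable lebesgue (\<lambda>x. indicator T x *\<^sub>R (?g x - real CARD('d) * b))"
      using iT Ts by (simp add: integrable_restrict_space)
    then have "integrable lebesgue (\<lambda>x. indicator ?U x *\<^sub>R (indicator T x *\<^sub>R (?g x - real CARD('d) * b)))"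
      by (rule integrable_mult_indicator[OF Us])
    moreover have "(\<lambda>x. indicator ?U x *\<^sub>R (indicator T x *\<^sub>R (?g x - real CARD('d) * b))) = (\<lambda>x. indicator ?U x *\<^sub>R (?g x - real CARD('d) * b))"
      using UT by (auto simp: indicator_def fun_eq_iff)
    ultimately show ?thesis using Us by (simp add: integrable_restrict_space)
  qed
  have "AE x in lebesgue_on ?U. ?g x - real CARD('d) * b = 0"
  proof (rule fundamental_lemma[OF open_interior iU])
    fix \<phi> \<psi> assume t: "test_function \<phi> \<psi>" and s: "supp \<phi> \<subseteq> ?U"
    have s\<Omega>: "supp \<phi> \<subseteq> \<Omega>" using s interior_cell_subset[OF T] by (rule subset_trans)
    have out: "\<phi> x = 0" "\<psi> x = 0" if "x \<notin> ?U" for x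
    proof -
      have "x \<notin> supp \<phi>" using s that by (rule contra_subsetD)
      then show "\<phi> x = 0" "\<psi> x = 0" using test_function_outside[OF t] by auto
    qed
    have uL: "u \<in> L2 \<Omega>" using u by (rule Hdiv_L2)
    have only: "integral\<^sup>L (lebesgue_on T') h = 0" if "T' \<in> \<T>" "T' \<noteq> T" and hz: "\<And>x. x \<notin> ?U \<Longrightarrow> h x = 0" for T' and h :: "real^'d \<Rightarrow> real"
    proof -
      have "h x = 0" if x: "x \<in> T'" for x
      proof (rule hz)
        show "x \<notin> ?U" using cells_eq[OF T \<open>T' \<in> \<T>\<close> _ x] \<open>T' \<noteq> T\<close> by metis
      qed
      then have "integral\<^sup>L (lebesgue_on T') h = integral\<^sup>L (lebesgue_on T') (\<lambda>x. 0)"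
        by (intro Bochner_Integration.integral_cong refl) (simp add: space_restrict_space)
      then show ?thesis by simp
    qed
    have sum_only: "(\<Sum>T'\<in>\<T>. integral\<^sup>L (lebesgue_on T') h) = integral\<^sup>L (lebesgue_on T) h" if "\<And>x. x \<notin> ?U \<Longrightarrow> h x = 0" for h :: "real^'d \<Rightarrow> real"
    proof -
      have "(\<Sum>T'\<in>\<T>. integral\<^sup>L (lebesgue_on T') h) = (\<Sum>T'\<in>\<T>. if T' = T then integral\<^sup>L (lebesgue_on T') h else 0)"
        using only[where h = h, OF _ _ that] by (intro sum.cong refl) simp
      then show ?thesis using T finite_mesh by simp
    qed
    have U1: "L2_inner \<Omega> u \<psi> = integral\<^sup>L (lebesgue_on T) (\<lambda>x. u x \<bullet> \<psi> x)"
      unfolding L2_inner_cells(2)[OF uL test_L2(2)[OF t]] by (rule sum_only) (simp add: out)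
    have U2: "L2_inner \<Omega> ?g \<phi> = integral\<^sup>L (lebesgue_on T) (\<lambda>x. ?g x \<bullet> \<phi> x)"
      unfolding L2_inner_cells(2)[OF gL test_L2(1)[OF t]] by (rule sum_only) (simp add: out)
    have c1: "continuous_on UNIV (\<lambda>x. (a + b *\<^sub>R x) \<bullet> \<psi> x)"
      by (intro continuous_intros test_functionD(3)[OF t])
    have c2: "continuous_on UNIV (\<lambda>x. real CARD('d) * b * \<phi> x)"
      by (intro continuous_intros test_functionD(2)[OF t])
    have "integral\<^sup>L (lebesgue_on T) (\<lambda>x. u x \<bullet> \<psi> x) = (LINT x:T|lborel. (a + b *\<^sub>R x) \<bullet> \<psi> x)"
    proof (rule cell_integral_cong_AE[OF T L2_inner_cells(1)[OF uL test_L2(2)[OF t] T] c1])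
      show "AE x in lebesgue_on T. u x \<bullet> \<psi> x = (a + b *\<^sub>R x) \<bullet> \<psi> x"
        using ab by eventually_elim simp
    qed
    also have "\<dots> = - (DIM(real^'d) * b) * (LINT x:T|lborel. \<phi> x)"
    proof (rule T.affine_field_flux[OF test_functionD(1)[OF t] test_functionD(3)[OF t], unfolded TC[symmetric]])
      fix x c assume c: "c \<in> verts T" and z: "bary (verts T) c x = 0"
      have "x \<notin> ?U"
      proof
        assume "x \<in> ?U"
        then have "x \<in> interior (convex hull verts T)" using TC by simp
        then show False using T.interior_bary_pos[OF _ c] z by force
      qed
      then show "\<phi> x = 0" by (rule out(1))
    qed
    finally have e1: "L2_inner \<Omega> u \<psi> = - (CARD('d) * b) * (LINT x:T|lborel. \<phi> x)" using U1 by simp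
    have e2: "(LINT x:T|lborel. real CARD('d) * b * \<phi> x) = real CARD('d) * b * (LINT x:T|lborel. \<phi> x)"
      by (rule set_integral_mult_right)
    have e3: "L2_inner \<Omega> u \<psi> = - L2_inner \<Omega> ?g \<phi>" using wd t s\<Omega> unfolding has_weak_div_def by blast
    have i1: "integrable (lebesgue_on T) (\<lambda>x. ?g x \<bullet> \<phi> x)" by (rule L2_inner_cells(1)[OF gL test_L2(1)[OF t] T])
    have i2: "integrable (lebesgue_on T) (\<lambda>x. real CARD('d) * b * \<phi> x)"
      using integral_cells(1)[OF L2_integrable[OF test_L2(1)[OF t]] T] by simp
    have "L2_inner ?U (\<lambda>x. ?g x - real CARD('d) * b) \<phi> = integral\<^sup>L lebesgue (\<lambda>x. indicator ?U x *\<^sub>R ((?g x - real CARD('d) * b) * \<phi> x))"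
      unfolding L2_inner_def using Us by (simp add: integral_restrict_space)
    also have "(\<lambda>x. indicator ?U x *\<^sub>R ((?g x - real CARD('d) * b) * \<phi> x)) = (\<lambda>x. indicator T x *\<^sub>R ((?g x - real CARD('d) * b) * \<phi> x))"
    proof
      fix x show "indicator ?U x *\<^sub>R ((?g x - real CARD('d) * b) * \<phi> x) = indicator T x *\<^sub>R ((?g x - real CARD('d) * b) * \<phi> x)"
      proof (cases "x \<in> ?U")
        case True then show ?thesis using subsetD[OF UT True] by simp
      next
        case False then show ?thesis using out(1)[OF False] by simp
      qed
    qed
    also have "integral\<^sup>L lebesgue \<dots> = integral\<^sup>L (lebesgue_on T) (\<lambda>x. (?g x - real CARD('d) * b) * \<phi> x)"
      using Ts by (simp add: integral_restrict_space)
    also have "\<dots> = integral\<^sup>L (lebesgue_on T) (\<lambda>x. ?g x \<bullet> \<phi> x - real CARD('d) * b * \<phi> x)"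
      by (simp only: left_diff_distrib inner_real_def)
    also have "\<dots> = integral\<^sup>L (lebesgue_on T) (\<lambda>x. ?g x \<bullet> \<phi> x) - integral\<^sup>L (lebesgue_on T) (\<lambda>x. real CARD('d) * b * \<phi> x)"
      by (rule Bochner_Integration.integral_diff[OF i1 i2])
    also have "\<dots> = 0"
      using U2 e1 e2 e3 cell_integral_lborel[OF cell_compact[OF T] c2] unfolding inner_real_def mult_minus_left by linarith
    finally show "L2_inner ?U (\<lambda>x. ?g x - real CARD('d) * b) \<phi> = 0" .
  qed
  then have "AE x in lebesgue. x \<in> ?U \<longrightarrow> ?g x - real CARD('d) * b = 0" using Us by (simp add: AE_restrict_space_iff)
  then have "AE x in lebesgue. x \<in> ?U \<longrightarrow> ?g x = real CARD('d) * b" by eventually_elim simp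
  then show ?thesis using AE_cell_iff[OF T, of "\<lambda>x. ?g x = real CARD('d) * b"] by blast
qed

lemma weak_div_in_W_h:
  assumes "u \<in> V_h \<Omega> \<Gamma> \<T>"
  shows "weak_div \<Omega> u \<in> W_h \<Omega> \<T>"
proof -
  have u: "u \<in> Hdiv \<Omega>" using assms unfolding V_h_def V_space_def by simp
  have "\<exists>c. AE x in lebesgue_on T. weak_div \<Omega> u x = c" if T: "T \<in> \<T>" for T
  proof -
    obtain a b where "AE x in lebesgue_on T. u x = a + b *\<^sub>R x" using V_h_RT0[OF assms T] by metis
    from weak_div_cell[OF u T this] show ?thesis by (rule exI)
  qed
  then show ?thesis using weak_divD(1)[OF u] unfolding W_h_def by simp
qed

lemma one_in_W_h:
  assumes "\<Omega> \<noteq> {}"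
  shows "(\<lambda>x. 1) \<in> W_h \<Omega> \<T>" "\<not> L2_zero \<Omega> (\<lambda>x. 1 :: real)"
proof -
  have "(\<lambda>x. 1 :: real) \<in> L2 \<Omega>" by (rule continuous_L2[OF continuous_on_const lmeasurable_dom bounded_dom])
  then show "(\<lambda>x. 1) \<in> W_h \<Omega> \<T>" unfolding W_h_def by (simp, intro ballI exI[of _ 1]) simp
  show "\<not> L2_zero \<Omega> (\<lambda>x. 1 :: real)"
  proof
    assume "L2_zero \<Omega> (\<lambda>x. 1 :: real)"
    then have "AE x in lebesgue. x \<notin> \<Omega>" unfolding L2_zero_def using sets_dom by (simp add: AE_restrict_space_iff)
    then have "\<Omega> \<in> null_sets lebesgue" using sets_dom by (simp add: AE_iff_null_sets)
    then have "negligible \<Omega>" by (simp add: negligible_iff_null_sets)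
    then show False using open_not_negligible[OF dom_open assms] by simp
  qed
qed

definition cell_field :: "((real^'d) set \<Rightarrow> real) \<Rightarrow> (real^'d) set \<Rightarrow> real^'d \<Rightarrow> real^'d" where
  "cell_field m T x = (\<Sum>F\<in>{F. F facet_of T}. (m F * orient T F / measure lborel T) *\<^sub>R (x - opp T F))"

definition cell_div :: "((real^'d) set \<Rightarrow> real) \<Rightarrow> (real^'d) set \<Rightarrow> real" where
  "cell_div m T = real CARD('d) * (\<Sum>F\<in>{F. F facet_of T}. m F * orient T F) / measure lborel T"

definition flux_field :: "((real^'d) set \<Rightarrow> real) \<Rightarrow> real^'d \<Rightarrow> real^'d" where
  "flux_field m x = (\<Sum>T\<in>\<T>. indicator T x *\<^sub>R cell_field m T x)"

definition flux_div :: "((real^'d) set \<Rightarrow> real) \<Rightarrow> real^'d \<Rightarrow> real" where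
  "flux_div m x = (\<Sum>T\<in>\<T>. indicator T x *\<^sub>R cell_div m T)"

lemma continuous_cell_field: "continuous_on S (cell_field m T)"
  unfolding cell_field_def by (intro continuous_intros)

lemma cell_sets: "T \<in> \<T> \<Longrightarrow> T \<in> sets lebesgue"
  using lmeasurable_compact[OF cell_compact] by (rule fmeasurableD)

lemma flux_field_L2: "flux_field m \<in> L2 \<Omega>"
  unfolding flux_field_def
  by (intro L2_sum finite_mesh L2_indicator cell_sets continuous_L2 continuous_cell_field lmeasurable_dom bounded_dom)

lemma flux_div_L2: "flux_div m \<in> L2 \<Omega>"
  unfolding flux_div_def
  by (intro L2_sum finite_mesh L2_indicator cell_sets continuous_L2 continuous_on_const lmeasurable_dom bounded_dom)

lemma sum_indicator_cell:
  fixes h :: "(real^'d) set \<Rightarrow> 'b::real_vector"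
  assumes "T \<in> \<T>" "x \<in> interior T"
  shows "(\<Sum>T'\<in>\<T>. indicator T' x *\<^sub>R h T') = h T"
proof -
  have "(\<Sum>T'\<in>\<T>. indicator T' x *\<^sub>R h T') = (\<Sum>T'\<in>\<T>. if T' = T then h T' else 0)"
  proof (intro sum.cong refl)
    fix T' assume T': "T' \<in> \<T>"
    show "indicator T' x *\<^sub>R h T' = (if T' = T then h T' else 0)"
    proof (cases "T' = T")
      case True
      then show ?thesis using subsetD[OF interior_subset assms(2)] by simp
    next
      case False
      then have "x \<notin> T'" using cells_eq[OF assms(1) T' assms(2)] by metis
      then show ?thesis using False by simp
    qed
  qed
  then show ?thesis using assms(1) finite_mesh by simp
qed

lemma flux_field_cell: "T \<in> \<T> \<Longrightarrow> AE x in lebesgue_on T. flux_field m x = cell_field m T x"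
  and flux_div_cell: "T \<in> \<T> \<Longrightarrow> AE x in lebesgue_on T. flux_div m x = cell_div m T"
  unfolding AE_cell_iff flux_field_def flux_div_def
  using sum_indicator_cell[where h = "\<lambda>T. cell_field m T x" and x = x for x] sum_indicator_cell[where h = "cell_div m"]
  by (intro AE_I2 impI, simp)+

lemma sum_cell_facets:
  fixes h :: "(real^'d) set \<Rightarrow> (real^'d) set \<Rightarrow> real"
  shows "(\<Sum>T\<in>\<T>. \<Sum>F\<in>{F. F facet_of T}. h T F) = (\<Sum>F\<in>facets \<T>. \<Sum>T\<in>{T\<in>\<T>. F facet_of T}. h T F)"
proof -
  have "(\<Sum>T\<in>\<T>. \<Sum>F\<in>{F. F facet_of T}. h T F) = (\<Sum>T\<in>\<T>. \<Sum>F\<in>{F \<in> facets \<T>. F facet_of T}. h T F)"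
    by (intro sum.cong refl) (auto simp: facets_def)
  also have "\<dots> = (\<Sum>F\<in>facets \<T>. \<Sum>T\<in>{T\<in>\<T>. F facet_of T}. h T F)"
    by (rule sum.swap_restrict[OF finite_mesh finite_facets[OF simplicial]])
  finally show ?thesis .
qed

lemma cell_green:
  assumes t: "test_function \<phi> \<psi>" and T: "T \<in> \<T>"
  shows "(LINT x:T|lborel. cell_field m T x \<bullet> \<psi> x + cell_div m T * \<phi> x)
    = (\<Sum>F\<in>{F. F facet_of T}. m F * orient T F * facet_flux \<phi> \<psi> T F)"
proof -
  let ?f = "\<lambda>F x. real DIM(real^'d) * \<phi> x + \<psi> x \<bullet> (x - opp T F)"
  have si: "set_integrable lborel T (\<lambda>x. m F * orient T F / measure lborel T * ?f F x)" for F
    by (intro set_integrable_continuous_compact cell_compact[OF T] continuous_intros test_functionD(2,3)[OF t])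
  have "cell_field m T x \<bullet> \<psi> x + cell_div m T * \<phi> x = (\<Sum>F\<in>{F. F facet_of T}. m F * orient T F / measure lborel T * ?f F x)" for x
  proof -
    have "(\<Sum>F\<in>{F. F facet_of T}. m F * orient T F / measure lborel T * ?f F x)
      = (\<Sum>F\<in>{F. F facet_of T}. ((m F * orient T F / measure lborel T) *\<^sub>R (x - opp T F)) \<bullet> \<psi> x)
        + (\<Sum>F\<in>{F. F facet_of T}. real CARD('d) * (m F * orient T F) / measure lborel T * \<phi> x)"
      unfolding sum.distrib[symmetric] by (intro sum.cong refl) (simp add: distrib_left inner_commute[of "\<psi> x"])
    also have "\<dots> = cell_field m T x \<bullet> \<psi> x + cell_div m T * \<phi> x"
      unfolding cell_field_def cell_div_def inner_sum_left sum_distrib_left sum_divide_distrib sum_distrib_right ..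
    finally show ?thesis by (rule sym)
  qed
  then have "(LINT x:T|lborel. cell_field m T x \<bullet> \<psi> x + cell_div m T * \<phi> x)
      = (LINT x:T|lborel. (\<Sum>F\<in>{F. F facet_of T}. m F * orient T F / measure lborel T * ?f F x))"
    by (simp only:)
  also have "\<dots> = (\<Sum>F\<in>{F. F facet_of T}. (LINT x:T|lborel. m F * orient T F / measure lborel T * ?f F x))"
    using si unfolding set_lebesgue_integral_def set_integrable_def scaleR_sum_right
    by (rule Bochner_Integration.integral_sum)
  also have "\<dots> = (\<Sum>F\<in>{F. F facet_of T}. m F * orient T F * facet_flux \<phi> \<psi> T F)"
    unfolding facet_flux_def set_integral_mult_right by (intro sum.cong refl) simp
  finally show ?thesis .
qed

lemma flux_green:
  assumes t: "test_function \<phi> \<psi>"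
    and b: "\<And>F x. F \<in> facets \<T> \<Longrightarrow> F \<subseteq> frontier \<Omega> \<Longrightarrow> m F \<noteq> 0 \<Longrightarrow> x \<in> F \<Longrightarrow> \<phi> x = 0"
  shows "L2_inner \<Omega> (flux_field m) \<psi> + L2_inner \<Omega> (flux_div m) \<phi> = 0"
proof -
  note t\<phi> = test_functionD(1)[OF t] test_functionD(3)[OF t]
  have cell: "integral\<^sup>L (lebesgue_on T) (\<lambda>x. flux_field m x \<bullet> \<psi> x) + integral\<^sup>L (lebesgue_on T) (\<lambda>x. flux_div m x \<bullet> \<phi> x)
      = (\<Sum>F\<in>{F. F facet_of T}. m F * orient T F * facet_flux \<phi> \<psi> T F)" if T: "T \<in> \<T>" for T
  proof -
    have c1: "continuous_on UNIV (\<lambda>x. cell_field m T x \<bullet> \<psi> x)"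
      by (intro continuous_intros continuous_cell_field test_functionD(3)[OF t])
    have c2: "continuous_on UNIV (\<lambda>x. cell_div m T * \<phi> x)" by (intro continuous_intros test_functionD(2)[OF t])
    have "integral\<^sup>L (lebesgue_on T) (\<lambda>x. flux_field m x \<bullet> \<psi> x) = (LINT x:T|lborel. cell_field m T x \<bullet> \<psi> x)"
    proof (rule cell_integral_cong_AE[OF T L2_inner_cells(1)[OF flux_field_L2 test_L2(2)[OF t] T] c1])
      show "AE x in lebesgue_on T. flux_field m x \<bullet> \<psi> x = cell_field m T x \<bullet> \<psi> x"
        using flux_field_cell[OF T, of m] by eventually_elim simp
    qed
    moreover have "integral\<^sup>L (lebesgue_on T) (\<lambda>x. flux_div m x \<bullet> \<phi> x) = (LINT x:T|lborel. cell_div m T * \<phi> x)"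
    proof (rule cell_integral_cong_AE[OF T L2_inner_cells(1)[OF flux_div_L2 test_L2(1)[OF t] T] c2])
      show "AE x in lebesgue_on T. flux_div m x \<bullet> \<phi> x = cell_div m T * \<phi> x"
        using flux_div_cell[OF T, of m] by eventually_elim simp
    qed
    moreover have "(LINT x:T|lborel. cell_field m T x \<bullet> \<psi> x) + (LINT x:T|lborel. cell_div m T * \<phi> x)
        = (LINT x:T|lborel. cell_field m T x \<bullet> \<psi> x + cell_div m T * \<phi> x)"
      by (rule set_integral_add(2)[symmetric]) (rule set_integrable_continuous_compact[OF cell_compact[OF T]], fact c1 c2)+
    ultimately show ?thesis using cell_green[OF t T] by simp
  qed
  have facet: "(\<Sum>T\<in>{T\<in>\<T>. F facet_of T}. m F * orient T F * facet_flux \<phi> \<psi> T F) = 0" if F: "F \<in> facets \<T>" for F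
  proof (cases "F \<subseteq> frontier \<Omega>")
    case True
    have "m F * orient T F * facet_flux \<phi> \<psi> T F = 0" if "T \<in> \<T>" "F facet_of T" for T
    proof (cases "m F = 0")
      case False
      have "facet_flux \<phi> \<psi> T F = 0"
        by (rule facet_flux_zero[OF mesh_simplex[OF that(1)] that(2) t\<phi> b[OF F True False]])
      then show ?thesis by simp
    qed simp
    then show ?thesis by (intro sum.neutral) simp
  next
    case False
    obtain T0 where T0: "T0 \<in> \<T>" "F facet_of T0" using F unfolding facets_def by blast
    have eq: "facet_flux \<phi> \<psi> T F = facet_flux \<phi> \<psi> T0 F" if "T \<in> \<T>" "F facet_of T" for T
      by (rule facet_flux_eq[OF mesh_simplex[OF that(1)] that(2) mesh_simplex[OF T0(1)] T0(2) t\<phi>])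
    have "(\<Sum>T\<in>{T\<in>\<T>. F facet_of T}. m F * orient T F * facet_flux \<phi> \<psi> T F)
        = (\<Sum>T\<in>{T\<in>\<T>. F facet_of T}. m F * facet_flux \<phi> \<psi> T0 F * orient T F)"
      by (intro sum.cong refl) (simp add: eq)
    also have "\<dots> = m F * facet_flux \<phi> \<psi> T0 F * (\<Sum>T\<in>{T\<in>\<T>. F facet_of T}. orient T F)"
      by (simp only: sum_distrib_left)
    also have "\<dots> = 0" using interior_facet_orient_sum[OF F False] by simp
    finally show ?thesis .
  qed
  have "L2_inner \<Omega> (flux_field m) \<psi> + L2_inner \<Omega> (flux_div m) \<phi>
     = (\<Sum>T\<in>\<T>. \<Sum>F\<in>{F. F facet_of T}. m F * orient T F * facet_flux \<phi> \<psi> T F)"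
    unfolding L2_inner_cells(2)[OF flux_field_L2 test_L2(2)[OF t]] L2_inner_cells(2)[OF flux_div_L2 test_L2(1)[OF t]]
      sum.distrib[symmetric]
    by (intro sum.cong refl cell)
  also have "\<dots> = (\<Sum>F\<in>facets \<T>. \<Sum>T\<in>{T\<in>\<T>. F facet_of T}. m F * orient T F * facet_flux \<phi> \<psi> T F)"
    by (rule sum_cell_facets)
  also have "\<dots> = 0" using facet by (rule sum.neutral[OF ballI])
  finally show ?thesis .
qed

lemma flux_field_weak_div:
  shows "flux_field m \<in> Hdiv \<Omega>" "AE x in lebesgue_on \<Omega>. weak_div \<Omega> (flux_field m) x = flux_div m x"
proof -
  have "has_weak_div \<Omega> (flux_field m) (flux_div m)"
    unfolding has_weak_div_def
  proof (intro allI impI)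
    fix \<phi> \<psi> assume a: "test_function \<phi> \<psi> \<and> supp \<phi> \<subseteq> \<Omega>"
    have "L2_inner \<Omega> (flux_field m) \<psi> + L2_inner \<Omega> (flux_div m) \<phi> = 0"
    proof (rule flux_green)
      show "test_function \<phi> \<psi>" using a by simp
      fix F x assume "F \<subseteq> frontier \<Omega>" "x \<in> F"
      then have "x \<notin> \<Omega>" unfolding frontier_dom by blast
      then have "x \<notin> supp \<phi>" using a by blast
      then show "\<phi> x = 0" using test_function_outside(1) a by blast
    qed
    then show "L2_inner \<Omega> (flux_field m) \<psi> = - L2_inner \<Omega> (flux_div m) \<phi>" by simp
  qed
  then show "flux_field m \<in> Hdiv \<Omega>" "AE x in lebesgue_on \<Omega>. weak_div \<Omega> (flux_field m) x = flux_div m x"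
    using weak_div_eqI[OF flux_field_L2 flux_div_L2] by blast+
qed

lemma flux_field_V_h:
  assumes b: "\<And>\<phi> \<psi> F x. test_function \<phi> \<psi> \<Longrightarrow> supp \<phi> \<inter> frontier \<Omega> \<subseteq> \<Gamma> \<Longrightarrow>
     F \<in> facets \<T> \<Longrightarrow> F \<subseteq> frontier \<Omega> \<Longrightarrow> m F \<noteq> 0 \<Longrightarrow> x \<in> F \<Longrightarrow> \<phi> x = 0"
  shows "flux_field m \<in> V_h \<Omega> \<Gamma> \<T>"
proof -
  note H = flux_field_weak_div(1)[of m]
  have "zero_normal_trace \<Omega> \<Gamma> (flux_field m)"
    unfolding zero_normal_trace_def
  proof (intro allI impI)
    fix \<phi> \<psi> assume a: "test_function \<phi> \<psi> \<and> supp \<phi> \<inter> frontier \<Omega> \<subseteq> \<Gamma>"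
    then have t: "test_function \<phi> \<psi>" by simp
    have "L2_inner \<Omega> (weak_div \<Omega> (flux_field m)) \<phi> = L2_inner \<Omega> (flux_div m) \<phi>"
      by (rule L2_inner_cong_AE[OF flux_field_weak_div(2) AE_I2 weak_divD(1)[OF H] test_L2(1)[OF t] flux_div_L2 test_L2(1)[OF t]]) simp
    moreover have "L2_inner \<Omega> (flux_field m) \<psi> + L2_inner \<Omega> (flux_div m) \<phi> = 0"
      by (rule flux_green[OF t b[OF t conjunct2[OF a]]])
    ultimately show "L2_inner \<Omega> (flux_field m) \<psi> + L2_inner \<Omega> (weak_div \<Omega> (flux_field m)) \<phi> = 0" by simp
  qed
  moreover have "\<exists>w\<in>RT0. AE x in lebesgue_on T. flux_field m x = w x" if "T \<in> \<T>" for T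
  proof
    show "AE x in lebesgue_on T. flux_field m x = cell_field m T x" by (rule flux_field_cell[OF that])
    let ?c = "\<lambda>F. m F * orient T F / measure lborel T"
    have "cell_field m T = (\<lambda>x. (- (\<Sum>F\<in>{F. F facet_of T}. ?c F *\<^sub>R opp T F)) + (\<Sum>F\<in>{F. F facet_of T}. ?c F) *\<^sub>R x)"
      unfolding cell_field_def scaleR_diff_right sum_subtractf scaleR_sum_left by (simp add: fun_eq_iff)
    then show "cell_field m T \<in> RT0" unfolding RT0_def by blast
  qed
  ultimately show ?thesis using H unfolding V_h_def V_space_def by simp
qed

end

section \<open>The Dirichlet boundary\<close>

lemma surface_measure_mono: "A \<subseteq> B \<Longrightarrow> surface_measure A \<le> surface_measure B"
  unfolding surface_measure_def
  by (intro SUP_mono' INF_superset_mono order_refl) auto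

lemma surface_measure_zero_cover:
  assumes "surface_measure (S :: (real^'d) set) = 0" "0 < \<epsilon>"
  obtains C :: "nat \<Rightarrow> (real^'d) set" where "S \<subseteq> (\<Union>i. C i)" "\<And>i. bounded (C i)" "\<And>i. diameter (C i) \<le> 1"
    "(\<Sum>i. ennreal (diameter (C i) ^ (CARD('d) - 1))) < ennreal \<epsilon>"
proof -
  let ?A = "{C :: nat \<Rightarrow> (real^'d) set. S \<subseteq> (\<Union>i. C i) \<and> (\<forall>i. bounded (C i) \<and> diameter (C i) \<le> 1)}"
  let ?s = "\<lambda>C :: nat \<Rightarrow> (real^'d) set. \<Sum>i. ennreal (diameter (C i) ^ (CARD('d) - 1))"
  have "(INF C\<in>?A. ?s C) \<le> surface_measure S"
    unfolding surface_measure_def by (rule SUP_upper) simp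
  then have "(INF C\<in>?A. ?s C) < ennreal \<epsilon>" using assms by simp
  then have "\<exists>C\<in>?A. ?s C < ennreal \<epsilon>" unfolding INF_less_iff .
  then obtain C where C: "C \<in> ?A" "?s C < ennreal \<epsilon>" by (rule bexE)
  show thesis
  proof (rule that)
    show "S \<subseteq> (\<Union>i. C i)" "\<And>i. bounded (C i)" "\<And>i. diameter (C i) \<le> 1" using C(1) by simp_all
    show "?s C < ennreal \<epsilon>" by (rule C(2))
  qed
qed

text \<open>Each covering set of small diameter sweeps out a tube of comparable volume, so the prism over
  a set of surface measure zero is a null set.\<close>

lemma prism_null:
  fixes S O' :: "(real^'d) set" and n :: "real^'d"
  assumes dim: "2 \<le> CARD('d)" and S: "surface_measure S = 0"
    and O': "open O'" "\<And>z. z \<in> O' \<Longrightarrow> \<exists>y\<in>S. \<exists>\<sigma>. 0 \<le> \<sigma> \<and> \<sigma> \<le> 1 \<and> z = y + \<sigma> *\<^sub>R n"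
  shows "O' = {}"
proof -
  define A where "A = (1 + 2 * 1) * unit_ball_vol (real DIM(real^'d)) * (1 + norm n) ^ DIM(real^'d)"
  have A0: "0 \<le> A" unfolding A_def by (intro mult_nonneg_nonneg zero_le_power unit_ball_vol_nonneg) auto
  let ?k = "CARD('d) - 1"
  have bound: "emeasure lebesgue O' \<le> ennreal (2 * A * \<epsilon>)" if \<epsilon>: "0 < \<epsilon>" "\<epsilon> \<le> 1" for \<epsilon> :: real
  proof -
    obtain C :: "nat \<Rightarrow> (real^'d) set" where C: "S \<subseteq> (\<Union>i. C i)" "\<And>i. bounded (C i)" "\<And>i. diameter (C i) \<le> 1"
      "(\<Sum>i. ennreal (diameter (C i) ^ ?k)) < ennreal \<epsilon>"
      using surface_measure_zero_cover[OF S \<epsilon>(1)] by metis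
    define \<eta> :: "nat \<Rightarrow> real" where "\<eta> i = \<epsilon> * (1/2) ^ Suc i" for i
    define h :: "nat \<Rightarrow> real" where "h i = (if 0 < diameter (C i) then diameter (C i) else \<eta> i)" for i
    have \<eta>: "0 < \<eta> i" "\<eta> i \<le> 1" for i
    proof -
      show "0 < \<eta> i" using \<epsilon>(1) unfolding \<eta>_def by simp
      have "(1/2 :: real) ^ Suc i \<le> 1" by (rule power_le_one) auto
      then show "\<eta> i \<le> 1" unfolding \<eta>_def using \<epsilon> mult_le_one[of \<epsilon> "(1/2) ^ Suc i"] by simp
    qed
    have dge: "0 \<le> diameter (C i)" for i using C(2) by (rule diameter_ge_0)
    have h: "0 < h i" "h i \<le> 1" "diameter (C i) \<le> h i" for i
      using \<eta>[of i] C(3)[of i] dge[of i] unfolding h_def by auto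
    have hk: "h i ^ ?k \<le> diameter (C i) ^ ?k + \<eta> i" for i
    proof (cases "0 < diameter (C i)")
      case True then show ?thesis using \<eta>(1)[of i] unfolding h_def by simp
    next
      case False
      have "\<eta> i ^ ?k \<le> \<eta> i ^ 1" by (rule power_decreasing) (use dim \<eta>[of i] in auto)
      moreover have "0 \<le> diameter (C i) ^ ?k" using dge by simp
      ultimately show ?thesis using False unfolding h_def by simp
    qed
    have "\<exists>R. R \<in> lmeasurable \<and> (\<forall>y\<in>C i. \<forall>\<sigma>. 0 \<le> \<sigma> \<and> \<sigma> \<le> 1 \<longrightarrow> y + \<sigma> *\<^sub>R n \<in> R) \<and> measure lebesgue R \<le> A * h i ^ ?k" for i
    proof (cases "C i = {}")
      case True
      have "0 \<le> A * h i ^ ?k" using A0 h(1)[of i] by simp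
      then show ?thesis using True by (intro exI[of _ "{}"]) simp
    next
      case False
      then obtain p where p: "p \<in> C i" by blast
      obtain R where R: "R \<in> lmeasurable" "{p + \<sigma> *\<^sub>R n + z |\<sigma> z. 0 \<le> \<sigma> \<and> \<sigma> \<le> 1 \<and> norm z \<le> 1 * h i} \<subseteq> R"
        "measure lebesgue R \<le> (1 + 2 * 1) * unit_ball_vol (real DIM(real^'d)) * (1 + norm n) ^ DIM(real^'d) * h i ^ (DIM(real^'d) - 1)"
        by (rule tube_cover[where p = p and e = n and L = "norm n" and K = 1, OF h(1)[of i] h(2)[of i] order_refl zero_le_one])
      have "y + \<sigma> *\<^sub>R n \<in> R" if y: "y \<in> C i" and \<sigma>: "0 \<le> \<sigma>" "\<sigma> \<le> 1" for y \<sigma>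
      proof (rule subsetD[OF R(2)])
        have "norm (y - p) \<le> diameter (C i)" using diameter_bounded_bound[OF C(2) y p] by (simp add: dist_norm)
        then have "norm (y - p) \<le> 1 * h i" using h(3)[of i] by simp
        moreover have "y + \<sigma> *\<^sub>R n = p + \<sigma> *\<^sub>R n + (y - p)" by simp
        ultimately show "y + \<sigma> *\<^sub>R n \<in> {p + \<sigma> *\<^sub>R n + z |\<sigma> z. 0 \<le> \<sigma> \<and> \<sigma> \<le> 1 \<and> norm z \<le> 1 * h i}"
          using \<sigma> by blast
      qed
      then show ?thesis using R(1,3) unfolding A_def by (intro exI[of _ R]) simp
    qed
    then obtain R where R: "\<And>i. R i \<in> lmeasurable" "\<And>i y \<sigma>. y \<in> C i \<Longrightarrow> 0 \<le> \<sigma> \<Longrightarrow> \<sigma> \<le> 1 \<Longrightarrow> y + \<sigma> *\<^sub>R n \<in> R i"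
      "\<And>i. measure lebesgue (R i) \<le> A * h i ^ ?k" by metis
    have sub: "O' \<subseteq> (\<Union>i. R i)"
    proof
      fix z assume "z \<in> O'"
      from O'(2)[OF this] obtain y \<sigma> where z: "y \<in> S" "0 \<le> \<sigma>" "\<sigma> \<le> 1" "z = y + \<sigma> *\<^sub>R n" by metis
      obtain i where "y \<in> C i" using subsetD[OF C(1) z(1)] by (rule UN_E)
      then have "z \<in> R i" using R(2) z by simp
      then show "z \<in> (\<Union>i. R i)" by (rule UN_I[OF UNIV_I])
    qed
    have Rs: "R i \<in> sets lebesgue" for i using R(1) by (rule fmeasurableD)
    have "emeasure lebesgue O' \<le> emeasure lebesgue (\<Union>i. R i)"
      by (rule emeasure_mono[OF sub]) (use Rs in auto)
    also have "\<dots> \<le> (\<Sum>i. emeasure lebesgue (R i))"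
      by (rule emeasure_subadditive_countably) (use Rs in auto)
    also have "\<dots> \<le> (\<Sum>i. ennreal A * (ennreal (diameter (C i) ^ ?k) + ennreal (\<eta> i)))"
    proof (rule suminf_le[OF _ summableI summableI])
      fix i
      have "emeasure lebesgue (R i) = ennreal (measure lebesgue (R i))" using R(1) by (simp add: emeasure_eq_measure2)
      also have "\<dots> \<le> ennreal (A * (diameter (C i) ^ ?k + \<eta> i))"
        using order_trans[OF R(3)[of i] mult_left_mono[OF hk[of i] A0]] by (rule ennreal_leI)
      also have "\<dots> = ennreal A * (ennreal (diameter (C i) ^ ?k) + ennreal (\<eta> i))"
        using A0 dge[of i] \<eta>(1)[of i] by (simp add: ennreal_mult ennreal_plus[symmetric] del: ennreal_plus)
      finally show "emeasure lebesgue (R i) \<le> ennreal A * (ennreal (diameter (C i) ^ ?k) + ennreal (\<eta> i))" .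
    qed
    also have "\<dots> = ennreal A * ((\<Sum>i. ennreal (diameter (C i) ^ ?k)) + (\<Sum>i. ennreal (\<eta> i)))"
      by (simp add: ennreal_suminf_cmult suminf_add[symmetric] summableI)
    also have "(\<Sum>i. ennreal (\<eta> i)) = ennreal \<epsilon>"
    proof (rule suminf_ennreal_eq)
      show "\<And>i. 0 \<le> \<eta> i" using \<eta>(1) by (rule less_imp_le)
      show "\<eta> sums \<epsilon>" using sums_mult[OF power_half_series, of \<epsilon>] unfolding \<eta>_def by simp
    qed
    also have "ennreal A * ((\<Sum>i. ennreal (diameter (C i) ^ ?k)) + ennreal \<epsilon>) \<le> ennreal A * (ennreal \<epsilon> + ennreal \<epsilon>)"
      using C(4) by (intro mult_left_mono add_right_mono) auto
    also have "\<dots> = ennreal (2 * A * \<epsilon>)"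
      using A0 \<epsilon>(1) by (simp add: ennreal_mult[symmetric] ennreal_plus[symmetric] del: ennreal_plus)
    finally show ?thesis .
  qed
  have "emeasure lebesgue O' \<le> 0"
  proof (rule ennreal_le_epsilon)
    fix e :: real assume e: "0 < e"
    let ?\<epsilon> = "min 1 (e / (2 * A + 1))"
    have "0 < ?\<epsilon>" using e A0 by simp
    moreover have "2 * A * ?\<epsilon> \<le> e"
    proof -
      have "2 * A * ?\<epsilon> \<le> (2 * A + 1) * (e / (2 * A + 1))" using A0 e by (intro mult_mono) auto
      also have "\<dots> = e" using A0 by simp
      finally show ?thesis .
    qed
    ultimately show "emeasure lebesgue O' \<le> 0 + ennreal e" using order_trans[OF bound[of ?\<epsilon>] ennreal_leI] by simp
  qed
  then have "O' \<in> null_sets lebesgue" using O'(1) by (intro null_setsI) auto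
  then have "negligible O'" by (simp add: negligible_iff_null_sets)
  then show ?thesis using open_not_negligible[OF O'(1)] by metis
qed

lemma (in full_simplex) facet_prism:
  assumes a: "a \<in> C" and x: "x \<in> convex hull (C - {a})" and e: "0 < e"
  obtains O' where "open O'" "O' \<noteq> {}"
    "\<And>z. z \<in> O' \<Longrightarrow> \<exists>y\<in>ball x e \<inter> convex hull (C - {a}). \<exists>\<sigma>. 0 \<le> \<sigma> \<and> \<sigma> \<le> 1 \<and> z = y + \<sigma> *\<^sub>R (a - x)"
proof -
  let ?T = "convex hull C" let ?g = "norm (bary_grad C a)"
  have bx: "bary C a x = 0" "\<And>c. c \<in> C \<Longrightarrow> 0 \<le> bary C c x" using x unfolding mem_facet_iff[OF a] by auto
  have xT: "x \<in> ?T" unfolding mem_simplex_iff using bx(2) by blast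
  have ba: "bary C a a = 1" "\<And>c. c \<in> C \<Longrightarrow> c \<noteq> a \<Longrightarrow> bary C c a = 0"
    using bary_vertex a by auto
  define L where "L = 1 + ?g * norm (a - x) + ?g"
  have L: "1 \<le> L" unfolding L_def by simp
  define e' where "e' = min e 1 / L"
  have e': "0 < e'" "e' * L = min e 1" using e L unfolding e'_def by auto
  have "closure (interior ?T) = ?T"
    using convex_closure_interior[OF convex_convex_hull interior_nonempty] closure_closed[OF compact_imp_closed[OF simplex_compact]] by simp
  then have "x \<in> closure (interior ?T)" using xT by simp
  then have ne: "interior ?T \<inter> ball x e' \<noteq> {}" using e'(1)
    by (metis closure_approachable disjoint_iff dist_commute mem_ball)
  show thesis
  proof (rule that[of "interior ?T \<inter> ball x e'"])
    show "open (interior ?T \<inter> ball x e')" by (intro open_Int open_interior open_ball)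
    show "interior ?T \<inter> ball x e' \<noteq> {}" by (rule ne)
    fix z assume z: "z \<in> interior ?T \<inter> ball x e'"
    then have zT: "z \<in> ?T" and zx: "norm (z - x) < e'" using subsetD[OF interior_subset] by (auto simp: dist_norm norm_minus_commute)
    have bz: "\<And>c. c \<in> C \<Longrightarrow> 0 \<le> bary C c z" using zT unfolding mem_simplex_iff by blast
    define \<sigma> where "\<sigma> = bary C a z"
    have \<sigma>0: "0 \<le> \<sigma>" unfolding \<sigma>_def by (rule bz[OF a])
    have "\<sigma> = bary_grad C a \<bullet> (z - x)" using bary_diff[of a z x] bx(1) unfolding \<sigma>_def by simp
    then have "\<sigma> \<le> ?g * norm (z - x)" using norm_cauchy_schwarz[of "bary_grad C a" "z - x"] by simp
    also have g1: "\<dots> \<le> ?g * e'" using zx by (intro mult_left_mono) auto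
    finally have \<sigma>g: "\<sigma> \<le> ?g * e'" .
    have "?g * e' \<le> e' * L" unfolding L_def using e'(1) by (simp add: algebra_simps)
    then have \<sigma>1: "\<sigma> \<le> 1" using \<sigma>g e'(2) by simp
    let ?y = "z + (- \<sigma>) *\<^sub>R (a - x)"
    have bc: "bary C c ?y = bary C c z - \<sigma> * (bary C c a - bary C c x)" for c
      unfolding bary_add bary_diff[of c a x] by simp
    have "?y \<in> convex hull (C - {a})"
      unfolding mem_facet_iff[OF a]
    proof
      show a0: "bary C a ?y = 0" by (simp only: bc ba(1) bx(1)) (simp add: \<sigma>_def)
      show "\<forall>c\<in>C. 0 \<le> bary C c ?y"
      proof
        fix c assume c: "c \<in> C"
        show "0 \<le> bary C c ?y"
        proof (cases "c = a")
          case False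
          show ?thesis unfolding bc ba(2)[OF c False] using bz[OF c] bx(2)[OF c] \<sigma>0 by simp
        next
          case True
          show ?thesis unfolding True a0 by (rule order_refl)
        qed
      qed
    qed
    moreover have "?y \<in> ball x e"
    proof -
      have "norm (?y - x) \<le> norm (z - x) + norm ((- \<sigma>) *\<^sub>R (a - x))"
        using norm_triangle_ineq[of "z - x" "(- \<sigma>) *\<^sub>R (a - x)"] by (simp add: algebra_simps)
      also have "\<dots> = norm (z - x) + \<sigma> * norm (a - x)" using \<sigma>0 by simp
      also have "\<dots> < e' + ?g * e' * norm (a - x)" using zx mult_right_mono[OF \<sigma>g norm_ge_zero[of "a - x"]] by linarith
      also have "\<dots> \<le> e' * L" unfolding L_def using e'(1) by (simp add: algebra_simps)
      also have "\<dots> \<le> e" using e'(2) by simp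
      finally show ?thesis by (simp add: dist_norm norm_minus_commute)
    qed
    ultimately have "?y \<in> ball x e \<inter> convex hull (C - {a})" by (rule IntI[rotated])
    moreover have "z = ?y + \<sigma> *\<^sub>R (a - x)" by simp
    ultimately show "\<exists>y\<in>ball x e \<inter> convex hull (C - {a}). \<exists>\<sigma>. 0 \<le> \<sigma> \<and> \<sigma> \<le> 1 \<and> z = y + \<sigma> *\<^sub>R (a - x)"
      using \<sigma>0 \<sigma>1 by metis
  qed
qed

lemma surface_measure_facet_pos:
  fixes T :: "(real^'d) set"
  assumes dim: "2 \<le> CARD('d)" and T: "int DIM(real^'d) simplex T" "F facet_of T" and x: "x \<in> F" and e: "0 < e"
  shows "surface_measure (ball x e \<inter> F) \<noteq> 0"
proof
  assume z: "surface_measure (ball x e \<inter> F) = 0"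
  interpret full_simplex "verts T" using simplex_verts(1)[OF T(1)] .
  note o = opp_facet[OF T]
  have x': "x \<in> convex hull (verts T - {opp T F})" using x o(2) by simp
  obtain O' where O': "open O'" "O' \<noteq> {}"
    "\<And>z. z \<in> O' \<Longrightarrow> \<exists>y\<in>ball x e \<inter> convex hull (verts T - {opp T F}). \<exists>\<sigma>. 0 \<le> \<sigma> \<and> \<sigma> \<le> 1 \<and> z = y + \<sigma> *\<^sub>R (opp T F - x)"
    using facet_prism[OF o(1) x' e] by metis
  show False using prism_null[OF dim z O'(1) O'(3)[folded o(2)]] O'(2) by simp
qed

lemma vanishes_on_Dirichlet_facet:
  fixes T :: "(real^'d) set"
  assumes dim: "2 \<le> CARD('d)" and T: "int DIM(real^'d) simplex T" "F facet_of T"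
    and s: "surface_measure (closure \<Gamma>D \<inter> closure \<Gamma>N) = 0"
    and F: "F \<subseteq> frontier \<Omega>" "F \<subseteq> closure \<Gamma>D"
    and t: "test_function \<phi> \<psi>" "supp \<phi> \<inter> frontier \<Omega> \<subseteq> \<Gamma>N" and x: "x \<in> F"
  shows "\<phi> x = 0"
proof (rule ccontr)
  assume nz: "\<phi> x \<noteq> 0"
  have c: "continuous_on UNIV \<phi>" by (rule test_functionD(2)[OF t(1)])
  have op: "open {y. \<phi> y \<noteq> 0}" by (rule open_Collect_neq[OF c continuous_on_const])
  have "x \<in> {y. \<phi> y \<noteq> 0}" using nz by simp
  then obtain e where e: "0 < e" "ball x e \<subseteq> {y. \<phi> y \<noteq> 0}" using op unfolding open_contains_ball by metis
  have "ball x e \<inter> F \<subseteq> closure \<Gamma>D \<inter> closure \<Gamma>N"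
  proof
    fix y assume y: "y \<in> ball x e \<inter> F"
    then have "y \<in> supp \<phi>" unfolding supp_def using e(2) subsetD[OF closure_subset[of "{y. \<phi> y \<noteq> 0}"]] by blast
    then have "y \<in> \<Gamma>N" using y F(1) t(2) by blast
    then show "y \<in> closure \<Gamma>D \<inter> closure \<Gamma>N" using y F(2) subsetD[OF closure_subset[of \<Gamma>N]] by simp blast
  qed
  then have "surface_measure (ball x e \<inter> F) \<le> 0" using surface_measure_mono s by metis
  then show False using surface_measure_facet_pos[OF dim T x e(1)] by simp
qed

section \<open>The inf-sup condition\<close>

text \<open>Gaussian elimination: the Schur complement of a positive diagonal entry is again positive
  definite.\<close>

lemma positive_definite_solvable:
  fixes M :: "'x \<Rightarrow> 'x \<Rightarrow> real"
  assumes "finite X"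
    and "\<And>r. (\<Sum>x\<in>X. r x * (\<Sum>y\<in>X. M x y * r y)) \<le> 0 \<Longrightarrow> (\<forall>x\<in>X. r x = 0)"
  shows "\<exists>r. \<forall>x\<in>X. (\<Sum>y\<in>X. M x y * r y) = b x"
  using assms
proof (induction X arbitrary: M b rule: finite_induct)
  case (insert z X)
  note fin = insert.hyps(1) and zX = insert.hyps(2) and pos = insert.prems
  have ins: "(\<Sum>y\<in>insert z X. f y) = f z + (\<Sum>y\<in>X. f y)" for f :: "'x \<Rightarrow> real"
    using fin zX by (rule sum.insert)
  have cX: "(\<Sum>y\<in>X. f (if y = z then a else s y) y) = (\<Sum>y\<in>X. f (s y) y)" for f :: "real \<Rightarrow> 'x \<Rightarrow> real" and a s
    using zX by (intro sum.cong refl) auto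
  have Mz: "0 < M z z"
  proof (rule ccontr)
    assume n: "\<not> 0 < M z z"
    let ?r = "\<lambda>y. if y = z then 1 else 0 :: real"
    have row: "(\<Sum>y\<in>insert z X. M x y * ?r y) = M x z" for x
      unfolding ins using cX[of "\<lambda>a y. M x y * a" 1 "\<lambda>_. 0"] by simp
    have "(\<Sum>x\<in>insert z X. ?r x * (\<Sum>y\<in>insert z X. M x y * ?r y)) = M z z"
      unfolding row unfolding ins using cX[of "\<lambda>a x. a * M x z" 1 "\<lambda>_. 0"] by simp
    then have "(\<Sum>x\<in>insert z X. ?r x * (\<Sum>y\<in>insert z X. M x y * ?r y)) \<le> 0" using n by linarith
    from pos[OF this] have "?r z = 0" by (rule bspec) simp
    then show False by simp
  qed
  define N where "N x y = M x y - M x z * M z y / M z z" for x y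
  define ext where "ext r t = (\<lambda>y. if y = z then (t - (\<Sum>u\<in>X. M z u * r u)) / M z z else r y)" for r :: "'x \<Rightarrow> real" and t :: real
  have ext_z: "(\<Sum>y\<in>insert z X. M z y * ext r t y) = t" for r t
    unfolding ins unfolding ext_def using cX[of "\<lambda>a y. M z y * a" _ r] Mz by simp
  have ext_x: "(\<Sum>y\<in>insert z X. M x y * ext r t y) = (\<Sum>y\<in>X. N x y * r y) + M x z * t / M z z" for r t x
  proof -
    have "(\<Sum>y\<in>insert z X. M x y * ext r t y) = M x z * ((t - (\<Sum>u\<in>X. M z u * r u)) / M z z) + (\<Sum>y\<in>X. M x y * r y)"
      unfolding ins unfolding ext_def using cX[of "\<lambda>a y. M x y * a" _ r] by simp
    moreover have "(\<Sum>y\<in>X. N x y * r y) = (\<Sum>y\<in>X. M x y * r y) - M x z / M z z * (\<Sum>y\<in>X. M z y * r y)"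
      unfolding N_def left_diff_distrib sum_subtractf sum_distrib_left by (simp add: mult.assoc)
    ultimately show ?thesis using Mz by (simp add: diff_divide_distrib right_diff_distrib)
  qed
  have "\<exists>r. \<forall>x\<in>X. (\<Sum>y\<in>X. N x y * r y) = b x - M x z * b z / M z z"
  proof (rule insert.IH)
    fix r assume le: "(\<Sum>x\<in>X. r x * (\<Sum>y\<in>X. N x y * r y)) \<le> 0"
    have "(\<Sum>x\<in>insert z X. ext r 0 x * (\<Sum>y\<in>insert z X. M x y * ext r 0 y)) = (\<Sum>x\<in>X. ext r 0 x * (\<Sum>y\<in>X. N x y * r y))"
      unfolding ins[of "\<lambda>x. ext r 0 x * _ x"] ext_z unfolding ext_x by simp
    also have "\<dots> = (\<Sum>x\<in>X. r x * (\<Sum>y\<in>X. N x y * r y))"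
      unfolding ext_def by (rule cX[of "\<lambda>a x. a * (\<Sum>y\<in>X. N x y * r y)"])
    finally have "\<forall>x\<in>insert z X. ext r 0 x = 0" using pos[of "ext r 0"] le by simp
    show "\<forall>x\<in>X. r x = 0"
    proof
      fix x assume x: "x \<in> X"
      then have "ext r 0 x = 0" using \<open>\<forall>x\<in>insert z X. ext r 0 x = 0\<close> by simp
      moreover have "x \<noteq> z" using x zX by metis
      ultimately show "r x = 0" unfolding ext_def by simp
    qed
  qed
  then obtain r where r: "\<And>x. x \<in> X \<Longrightarrow> (\<Sum>y\<in>X. N x y * r y) = b x - M x z * b z / M z z" by metis
  have "(\<Sum>y\<in>insert z X. M x y * ext r (b z) y) = b x" if "x \<in> insert z X" for x
  proof (cases "x = z")
    case True then show ?thesis using ext_z by simp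
  next
    case False
    then have "x \<in> X" using that by simp
    then show ?thesis unfolding ext_x r[OF \<open>x \<in> X\<close>] by simp
  qed
  then show ?case by (intro exI[of _ "ext r (b z)"]) simp
qed simp

lemma shape_regular_measure:
  fixes T :: "(real^'d) set"
  assumes T: "int DIM(real^'d) simplex T" and \<rho>: "diameter T / inscribed_ball_diameter T \<le> \<rho>" and d: "2 \<le> CARD('d)"
  shows "unit_ball_vol (real CARD('d)) / (4 * max \<rho> 1) ^ CARD('d) * diameter T ^ CARD('d) \<le> measure lebesgue T"
proof -
  interpret full_simplex "verts T" using simplex_verts(1)[OF T] .
  have TC: "T = convex hull verts T" using simplex_verts(2)[OF T] .
  have cT: "compact T" using simplex_compact TC by simp
  let ?S = "{r. 0 \<le> r \<and> (\<exists>c. cball c r \<subseteq> T)}"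
  obtain x0 where "x0 \<in> interior T" using interior_nonempty TC by auto
  then obtain r0 where r0: "0 < r0" "cball x0 r0 \<subseteq> T" unfolding mem_interior_cball by metis
  have up: "r \<le> diameter T" if r: "r \<in> ?S" for r
  proof -
    obtain c where c: "0 \<le> r" "cball c r \<subseteq> T" using r by blast
    obtain u :: "real^'d" where u: "norm u = 1" using vector_choose_size[of 1] by auto
    have "dist c (c + r *\<^sub>R u) \<le> diameter T"
      by (rule diameter_bounded_bound[OF compact_imp_bounded[OF cT]])
        (use subsetD[OF c(2)] c(1) u in \<open>auto simp: dist_norm\<close>)
    then show ?thesis using c(1) u by (simp add: dist_norm)
  qed
  then have bdd: "bdd_above ?S" by (rule bdd_aboveI)
  have r0S: "r0 \<in> ?S" using r0 by auto
  have s0: "r0 \<le> Sup ?S" by (rule cSup_upper[OF r0S bdd])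
  have "Sup ?S / 2 < Sup ?S" using s0 r0(1) by simp
  then obtain r where r: "r \<in> ?S" "Sup ?S / 2 < r" using less_cSupD[of ?S "Sup ?S / 2"] r0S by blast
  then obtain c where c: "cball c r \<subseteq> T" by blast
  have ins: "inscribed_ball_diameter T = 2 * Sup ?S" unfolding inscribed_ball_diameter_def ..
  have "diameter T \<le> \<rho> * (2 * Sup ?S)"
    using \<rho> s0 r0(1) unfolding ins by (simp add: divide_le_eq)
  also have "\<dots> \<le> max \<rho> 1 * (2 * Sup ?S)" using s0 r0(1) by (intro mult_right_mono) auto
  also have "\<dots> \<le> max \<rho> 1 * (4 * r)" using r(2) by (intro mult_left_mono) auto
  finally have dT: "diameter T / (4 * max \<rho> 1) \<le> r" by (simp add: divide_le_eq mult.commute mult.left_commute)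
  have rr: "0 \<le> r" using r(1) by simp
  have "unit_ball_vol (real CARD('d)) / (4 * max \<rho> 1) ^ CARD('d) * diameter T ^ CARD('d)
      = unit_ball_vol (real CARD('d)) * (diameter T / (4 * max \<rho> 1)) ^ CARD('d)"
    by (simp add: power_divide)
  also have "\<dots> \<le> unit_ball_vol (real CARD('d)) * r ^ CARD('d)"
    using dT diameter_ge_0[OF compact_imp_bounded[OF cT]]
    by (intro mult_left_mono power_mono unit_ball_vol_nonneg divide_nonneg_nonneg) auto
  also have "\<dots> = measure lebesgue (cball c r)" using content_cball[OF rr, of c] by simp
  also have "\<dots> \<le> measure lebesgue T"
    by (rule measure_mono_fmeasurable[OF c _ lmeasurable_compact[OF cT]]) simp
  finally show ?thesis .
qed

context conforming
begin

lemma facet_cells_cases: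
  assumes F: "F \<in> facets \<T>"
  shows "(\<exists>T. T \<in> \<T> \<and> {T\<in>\<T>. F facet_of T} = {T} \<and> \<bar>orient T F\<bar> = 1) \<or>
    (\<exists>T T'. T \<noteq> T' \<and> {T\<in>\<T>. F facet_of T} = {T, T'} \<and> \<bar>orient T F\<bar> = 1 \<and> orient T' F = - orient T F)"
proof -
  let ?S = "{T\<in>\<T>. F facet_of T}"
  obtain T where T: "T \<in> \<T>" "F facet_of T" using F unfolding facets_def by blast
  have "rel_interior F \<noteq> {}" using facet_closed_convex[OF F] rel_interior_eq_empty[of F] by metis
  then obtain y where y: "y \<in> rel_interior F" by blast
  have uniq: "T1 = T2" if "T1 \<in> ?S" "T2 \<in> ?S" "orient T1 F = orient T2 F" for T1 T2
    using cell_on_side_unique[of T1 F T2 y] that y by simp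
  have o: "orient T1 F = 1 \<or> orient T1 F = - 1" if "T1 \<in> ?S" for T1
    using orient_cases that by simp
  have TS: "T \<in> ?S" using T by simp
  have oT: "\<bar>orient T F\<bar> = 1" using o[OF TS] by auto
  show ?thesis
  proof (cases "?S = {T}")
    case True
    then show ?thesis using T(1) oT by (intro disjI1 exI[of _ T]) simp
  next
    case False
    then obtain T' where T': "T' \<in> ?S" "T' \<noteq> T" using TS by blast
    have "orient T' F = - orient T F" using o[OF T'(1)] o[OF TS] uniq[OF T'(1) TS] T'(2) by auto
    moreover have "?S = {T, T'}"
    proof (intro set_eqI iffI)
      fix T'' assume T'': "T'' \<in> ?S"
      have "orient T'' F = orient T F \<or> orient T'' F = orient T' F"
        using o[OF T''] o[OF TS] \<open>orient T' F = - orient T F\<close> by auto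
      then show "T'' \<in> {T, T'}" using uniq[OF T'' TS] uniq[OF T'' T'(1)] by auto
    qed (use TS T' in auto)
    ultimately show ?thesis using oT T'(2) by (intro disjI2 exI[of _ T] exI[of _ T']) simp
  qed
qed

lemma jump_square_bound:
  assumes F: "F \<in> facets \<T>"
  shows "\<bar>jump \<T> (\<lambda>T. (r T)\<^sup>2) F\<bar> = \<bar>jump \<T> r F\<bar> * \<bar>\<Sum>T\<in>{T\<in>\<T>. F facet_of T}. r T\<bar>"
    "(\<Sum>T\<in>{T\<in>\<T>. F facet_of T}. r T)\<^sup>2 \<le> 2 * (\<Sum>T\<in>{T\<in>\<T>. F facet_of T}. (r T)\<^sup>2)"
    "card {T\<in>\<T>. F facet_of T} \<le> 2"
proof -
  let ?P = "\<bar>jump \<T> (\<lambda>T. (r T)\<^sup>2) F\<bar> = \<bar>jump \<T> r F\<bar> * \<bar>\<Sum>T\<in>{T\<in>\<T>. F facet_of T}. r T\<bar>"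
  let ?Q = "(\<Sum>T\<in>{T\<in>\<T>. F facet_of T}. r T)\<^sup>2 \<le> 2 * (\<Sum>T\<in>{T\<in>\<T>. F facet_of T}. (r T)\<^sup>2)"
  let ?R = "card {T\<in>\<T>. F facet_of T} \<le> 2"
  have "?P \<and> ?Q \<and> ?R"
    using facet_cells_cases[OF F]
  proof (elim disjE exE conjE)
    fix T assume S: "{T\<in>\<T>. F facet_of T} = {T}" and o: "\<bar>orient T F\<bar> = 1"
    have p: ?P
      unfolding jump_def S by (simp add: abs_mult o power2_eq_square)
    have q: ?Q
      unfolding S by simp
    have "card {T\<in>\<T>. F facet_of T} \<le> 2" unfolding S by simp
    with p q show "?P \<and> ?Q \<and> ?R" by (intro conjI)
  next
    fix T T' assume ne: "T \<noteq> T'" and S: "{T\<in>\<T>. F facet_of T} = {T, T'}"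
      and o: "\<bar>orient T F\<bar> = 1" "orient T' F = - orient T F"
    have s: "sum h {T, T'} = h T + h T'" for h :: "(real^'d) set \<Rightarrow> real" using ne by simp
    have p: ?P
    proof -
      have "jump \<T> (\<lambda>T. (r T)\<^sup>2) F = jump \<T> r F * (\<Sum>T\<in>{T\<in>\<T>. F facet_of T}. r T)"
        unfolding jump_def S s o(2) by (simp add: algebra_simps power2_eq_square)
      then show ?thesis by (simp add: abs_mult)
    qed
    have q: ?Q
      unfolding S s using zero_le_power2[of "r T - r T'"] by (simp add: power2_eq_square algebra_simps)
    have ?R unfolding S using ne by simp
    with p q show "?P \<and> ?Q \<and> ?R" by (intro conjI)
  qed
  then show ?P ?Q ?R by blast+
qed

lemma card_facets_of_cell:
  assumes "T \<in> \<T>"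
  shows "card {F. F facet_of T} = CARD('d) + 1"
  using bij_betw_same_card[OF facets_bij[OF mesh_simplex[OF assms]]]
    full_simplex.card_C[OF simplex_verts(1)[OF mesh_simplex[OF assms]]] by simp

lemma cell_measure:
  assumes "T \<in> \<T>"
  shows "measure lborel T = measure lebesgue T" "0 < measure lebesgue T"
proof -
  have "T \<in> sets lborel" using compact_imp_closed[OF cell_compact[OF assms]] by simp
  then show eq: "measure lborel T = measure lebesgue T" by (simp add: measure_completion)
  show "0 < measure lebesgue T"
    using full_simplex.simplex_measure_pos[OF simplex_verts(1)[OF mesh_simplex[OF assms]]]
      simplex_verts(2)[OF mesh_simplex[OF assms]] eq by simp
qed

lemma facet_diameter:
  assumes "T \<in> \<T>" "F facet_of T"
  shows "0 \<le> diameter F" "diameter F \<le> diameter T"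
proof -
  have b: "bounded T" using compact_imp_bounded[OF cell_compact[OF assms(1)]] .
  have sub: "F \<subseteq> T" using facet_of_imp_subset[OF assms(2)] .
  show "0 \<le> diameter F" by (rule diameter_ge_0[OF bounded_subset[OF b sub]])
  show "diameter F \<le> diameter T" by (rule diameter_subset[OF sub b])
qed

definition flux_facets :: "(real^'d) set \<Rightarrow> (real^'d) set set" where
  "flux_facets N = {F\<in>facets \<T>. \<not> (F \<subseteq> frontier \<Omega> \<and> F \<subseteq> N)}"

definition energy :: "(real^'d) set \<Rightarrow> ((real^'d) set \<Rightarrow> real) \<Rightarrow> real" where
  "energy N r = (\<Sum>F\<in>flux_facets N. diameter F ^ (CARD('d) - 2) * (jump \<T> r F)\<^sup>2)"

lemma facet_diameter_ge_0: "F \<in> facets \<T> \<Longrightarrow> 0 \<le> diameter F"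
  using facet_diameter(1) unfolding facets_def by blast

end

locale estimate = conforming +
  fixes N :: "(real^'a) set" and c A :: real
  assumes c_pos: "0 < c" and thick: "\<And>T. T \<in> \<T> \<Longrightarrow> c * diameter T ^ CARD('a) \<le> measure lebesgue T"
    and A_pos: "0 < A"
    and poincare: "\<And>w. (\<forall>T\<in>\<T>. 0 \<le> w T) \<Longrightarrow> (\<Sum>T\<in>\<T>. w T * measure lebesgue T) \<le> A * jump_sum \<Omega> N \<T> w"
begin

definition P0 :: real where "P0 = 2 * A\<^sup>2 * (real CARD('a) + 1) / c"

lemma P0_pos: "0 < P0"
  unfolding P0_def using A_pos c_pos by (intro divide_pos_pos mult_pos_pos) auto

lemma weighted_Young:
  fixes d x y t :: real
  assumes "0 < t"
  shows "d * x * y \<le> t / 2 * x\<^sup>2 + d\<^sup>2 * y\<^sup>2 / (2 * t)"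
proof -
  have "0 \<le> (t * x - d * y)\<^sup>2 / (2 * t)" using assms by simp
  also have "\<dots> = t / 2 * x\<^sup>2 + d\<^sup>2 * y\<^sup>2 / (2 * t) - d * x * y"
    using assms by (simp add: power2_eq_square field_simps)
  finally show ?thesis by simp
qed

lemma facet_term_bound:
  assumes F: "F \<in> flux_facets N" and t: "0 < t"
  shows "diameter F ^ (CARD('a) - 1) * \<bar>jump \<T> (\<lambda>T. (r T)\<^sup>2) F\<bar>
    \<le> t / 2 * (diameter F ^ (CARD('a) - 2) * (jump \<T> r F)\<^sup>2) + 1 / (c * t) * (\<Sum>T\<in>{T\<in>\<T>. F facet_of T}. (r T)\<^sup>2 * measure lebesgue T)"
proof -
  have F': "F \<in> facets \<T>" using F unfolding flux_facets_def by simp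
  let ?S = "{T\<in>\<T>. F facet_of T}"
  let ?d = "diameter F" let ?e = "diameter F ^ (CARD('a) - 2)" let ?j = "jump \<T> r F"
  let ?s = "\<Sum>T\<in>?S. r T" let ?R = "\<Sum>T\<in>?S. (r T)\<^sup>2"
  have d0: "0 \<le> ?d" by (rule facet_diameter_ge_0[OF F'])
  have e0: "0 \<le> ?e" using d0 by simp
  have p1: "?d ^ (CARD('a) - 1) = ?e * ?d" and p2: "?d ^ CARD('a) = ?e * ?d\<^sup>2"
  proof -
    obtain k where "CARD('a) = k + 2" using dim2 le_iff_add[of 2 "CARD('a)"] by auto
    then show "?d ^ (CARD('a) - 1) = ?e * ?d" "?d ^ CARD('a) = ?e * ?d\<^sup>2" by (simp_all add: power_add power2_eq_square)
  qed
  have "?d * \<bar>?j\<bar> * \<bar>?s\<bar> \<le> t / 2 * \<bar>?j\<bar>\<^sup>2 + ?d\<^sup>2 * \<bar>?s\<bar>\<^sup>2 / (2 * t)" by (rule weighted_Young[OF t])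
  also have "\<dots> = t / 2 * ?j\<^sup>2 + ?d\<^sup>2 / (2 * t) * ?s\<^sup>2" by (simp only: power2_abs times_divide_eq_left)
  also have "\<dots> \<le> t / 2 * ?j\<^sup>2 + ?d\<^sup>2 / (2 * t) * (2 * ?R)"
    using jump_square_bound(2)[OF F', of r] t by (intro add_left_mono mult_left_mono) auto
  also have "\<dots> = t / 2 * ?j\<^sup>2 + ?d\<^sup>2 * ?R / t" by simp
  finally have "?d * \<bar>?j\<bar> * \<bar>?s\<bar> \<le> t / 2 * ?j\<^sup>2 + ?d\<^sup>2 * ?R / t" .
  then have "?e * (?d * \<bar>?j\<bar> * \<bar>?s\<bar>) \<le> ?e * (t / 2 * ?j\<^sup>2 + ?d\<^sup>2 * ?R / t)"
    by (rule mult_left_mono[OF _ e0])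
  also have "\<dots> = t / 2 * (?e * ?j\<^sup>2) + (?e * ?d\<^sup>2) * ?R / t" by (simp add: algebra_simps)
  also have "\<dots> \<le> t / 2 * (?e * ?j\<^sup>2) + 1 / (c * t) * (\<Sum>T\<in>?S. (r T)\<^sup>2 * measure lebesgue T)"
  proof -
    have "c * (?d ^ CARD('a) * ?R) \<le> (\<Sum>T\<in>?S. (r T)\<^sup>2 * measure lebesgue T)"
      unfolding sum_distrib_left
    proof (rule sum_mono)
      fix T assume T: "T \<in> ?S"
      have "?d ^ CARD('a) \<le> diameter T ^ CARD('a)" using facet_diameter[of T F] T by (intro power_mono) auto
      then have "c * ?d ^ CARD('a) \<le> c * diameter T ^ CARD('a)" by (rule mult_left_mono[OF _ less_imp_le[OF c_pos]])
      also have "\<dots> \<le> measure lebesgue T" using T by (intro thick) simp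
      finally have "c * ?d ^ CARD('a) \<le> measure lebesgue T" .
      then have "(r T)\<^sup>2 * (c * ?d ^ CARD('a)) \<le> (r T)\<^sup>2 * measure lebesgue T" by (rule mult_left_mono) simp
      then show "c * (?d ^ CARD('a) * (r T)\<^sup>2) \<le> (r T)\<^sup>2 * measure lebesgue T" by (simp add: algebra_simps)
    qed
    then have "?e * ?d\<^sup>2 * ?R \<le> (\<Sum>T\<in>?S. (r T)\<^sup>2 * measure lebesgue T) / c"
      unfolding p2 using c_pos by (simp only: pos_le_divide_eq mult.commute[of _ c])
    then have "?e * ?d\<^sup>2 * ?R / t \<le> (\<Sum>T\<in>?S. (r T)\<^sup>2 * measure lebesgue T) / c / t"
      using t by (intro divide_right_mono) auto
    then show ?thesis by simp
  qed
  finally show ?thesis unfolding jump_square_bound(1)[OF F'] p1 by (simp only: mult.assoc)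
qed

lemma energy_poincare: "(\<Sum>T\<in>\<T>. (r T)\<^sup>2 * measure lebesgue T) \<le> P0 * energy N r"
proof -
  let ?X = "\<Sum>T\<in>\<T>. (r T)\<^sup>2 * measure lebesgue T"
  let ?n = "real CARD('a) + 1"
  define t where "t = 2 * A * ?n / c"
  have t: "0 < t" unfolding t_def using A_pos c_pos by (intro divide_pos_pos mult_pos_pos) auto
  let ?f = "\<lambda>F. \<Sum>T\<in>{T\<in>\<T>. F facet_of T}. (r T)\<^sup>2 * measure lebesgue T"
  have "?X \<le> A * jump_sum \<Omega> N \<T> (\<lambda>T. (r T)\<^sup>2)" by (rule poincare) simp
  also have "jump_sum \<Omega> N \<T> (\<lambda>T. (r T)\<^sup>2) \<le> (\<Sum>F\<in>flux_facets N. t / 2 * (diameter F ^ (CARD('a) - 2) * (jump \<T> r F)\<^sup>2) + 1 / (c * t) * ?f F)"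
    unfolding jump_sum_def flux_facets_def[symmetric] using facet_term_bound[OF _ t] by (intro sum_mono) simp
  also have "\<dots> = t / 2 * energy N r + 1 / (c * t) * (\<Sum>F\<in>flux_facets N. ?f F)"
    unfolding energy_def sum.distrib sum_distrib_left ..
  also have "\<dots> \<le> t / 2 * energy N r + 1 / (c * t) * (?n * ?X)"
  proof (intro add_left_mono mult_left_mono)
    have "(\<Sum>F\<in>flux_facets N. ?f F) \<le> (\<Sum>F\<in>facets \<T>. ?f F)"
      by (rule sum_mono2[OF finite_facets[OF simplicial]]) (auto simp: flux_facets_def intro: sum_nonneg)
    also have "\<dots> = (\<Sum>T\<in>\<T>. \<Sum>F\<in>{F. F facet_of T}. (r T)\<^sup>2 * measure lebesgue T)"
      by (rule sum_cell_facets[symmetric])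
    also have "\<dots> = (\<Sum>T\<in>\<T>. ?n * ((r T)\<^sup>2 * measure lebesgue T))"
      by (intro sum.cong refl) (simp add: card_facets_of_cell)
    also have "\<dots> = ?n * ?X" by (rule sum_distrib_left[symmetric])
    finally show "(\<Sum>F\<in>flux_facets N. ?f F) \<le> ?n * ?X" .
    show "0 \<le> 1 / (c * t)" using c_pos t by simp
  qed
  finally have "?X \<le> A * (t / 2 * energy N r + 1 / (c * t) * (?n * ?X))" using A_pos by simp
  also have "\<dots> = A * t / 2 * energy N r + A * ?n / (c * t) * ?X" by (simp add: algebra_simps add_divide_distrib)
  also have "A * ?n / (c * t) = 1 / 2"
  proof -
    have "c * t = 2 * (A * ?n)" unfolding t_def using c_pos by simp
    moreover have "A * ?n \<noteq> 0" using A_pos by (simp add: add_nonneg_eq_0_iff)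
    ultimately show ?thesis by simp
  qed
  finally have "?X \<le> A * t * energy N r" by simp
  also have "A * t = P0" unfolding t_def P0_def by (simp add: power2_eq_square)
  finally show ?thesis .
qed

definition inc :: "(real^'a) set \<Rightarrow> (real^'a) set \<Rightarrow> real" where
  "inc T F = (if F facet_of T then orient T F else 0)"

lemma jump_inc: "jump \<T> r F = (\<Sum>T\<in>\<T>. inc T F * r T)"
proof -
  have "jump \<T> r F = (\<Sum>T\<in>\<T>. if F facet_of T then orient T F * r T else 0)"
    unfolding jump_def using finite_mesh by (simp add: sum.inter_filter)
  also have "\<dots> = (\<Sum>T\<in>\<T>. inc T F * r T)" unfolding inc_def by (intro sum.cong refl) simp
  finally show ?thesis .
qed

definition flux_coeff :: "((real^'a) set \<Rightarrow> real) \<Rightarrow> (real^'a) set \<Rightarrow> real" where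
  "flux_coeff r F = (if F \<in> flux_facets N then diameter F ^ (CARD('a) - 2) * jump \<T> r F else 0)"

lemma cell_div_flux_coeff:
  assumes T: "T \<in> \<T>"
  shows "cell_div (flux_coeff r) T * measure lebesgue T
    = (\<Sum>F\<in>flux_facets N. real CARD('a) * diameter F ^ (CARD('a) - 2) * inc T F * jump \<T> r F)"
proof -
  have sub: "{F. F facet_of T} \<subseteq> facets \<T>" using T unfolding facets_def by blast
  have "(\<Sum>F\<in>{F. F facet_of T}. flux_coeff r F * orient T F) = (\<Sum>F\<in>{F. F facet_of T}. flux_coeff r F * inc T F)"
    unfolding inc_def by (intro sum.cong refl) simp
  also have "\<dots> = (\<Sum>F\<in>facets \<T>. flux_coeff r F * inc T F)"
    by (rule sum.mono_neutral_left[OF finite_facets[OF simplicial] sub]) (simp add: inc_def)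
  also have "\<dots> = (\<Sum>F\<in>flux_facets N. flux_coeff r F * inc T F)"
    by (rule sum.mono_neutral_right[OF finite_facets[OF simplicial]]) (auto simp: flux_coeff_def flux_facets_def)
  also have "\<dots> = (\<Sum>F\<in>flux_facets N. diameter F ^ (CARD('a) - 2) * inc T F * jump \<T> r F)"
    by (intro sum.cong refl) (simp add: flux_coeff_def)
  finally show ?thesis
    using cell_measure[OF T] unfolding cell_div_def by (simp add: sum_distrib_left mult.assoc)
qed

lemma solve_flux:
  obtains r where "\<And>T. T \<in> \<T> \<Longrightarrow> cell_div (flux_coeff r) T = q T"
    "energy N r \<le> P0 * (\<Sum>T\<in>\<T>. (q T)\<^sup>2 * measure lebesgue T)"
proof -
  let ?D = "real CARD('a)"
  define M where "M T T' = (\<Sum>F\<in>flux_facets N. ?D * diameter F ^ (CARD('a) - 2) * inc T F * inc T' F)" for T T'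
  have row: "(\<Sum>T'\<in>\<T>. M T T' * r T') = (\<Sum>F\<in>flux_facets N. ?D * diameter F ^ (CARD('a) - 2) * inc T F * jump \<T> r F)" for T r
    unfolding M_def sum_distrib_right jump_inc sum_distrib_left
    by (subst sum.swap) (simp only: mult.assoc)
  have form: "(\<Sum>T\<in>\<T>. r T * (\<Sum>T'\<in>\<T>. M T T' * r T')) = ?D * energy N r" for r
  proof -
    have "(\<Sum>T\<in>\<T>. r T * (\<Sum>T'\<in>\<T>. M T T' * r T'))
      = (\<Sum>F\<in>flux_facets N. \<Sum>T\<in>\<T>. r T * (?D * diameter F ^ (CARD('a) - 2) * inc T F * jump \<T> r F))"
      unfolding row sum_distrib_left by (rule sum.swap)
    also have "\<dots> = (\<Sum>F\<in>flux_facets N. ?D * (diameter F ^ (CARD('a) - 2) * (jump \<T> r F)\<^sup>2))"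
    proof (intro sum.cong refl)
      fix F
      have "(\<Sum>T\<in>\<T>. r T * (?D * diameter F ^ (CARD('a) - 2) * inc T F * jump \<T> r F))
        = (\<Sum>T\<in>\<T>. (?D * diameter F ^ (CARD('a) - 2) * jump \<T> r F) * (inc T F * r T))"
        by (intro sum.cong refl) simp
      also have "\<dots> = (?D * diameter F ^ (CARD('a) - 2) * jump \<T> r F) * jump \<T> r F"
        unfolding sum_distrib_left[symmetric] jump_inc[symmetric] ..
      finally show "(\<Sum>T\<in>\<T>. r T * (?D * diameter F ^ (CARD('a) - 2) * inc T F * jump \<T> r F))
         = ?D * (diameter F ^ (CARD('a) - 2) * (jump \<T> r F)\<^sup>2)" by (simp add: power2_eq_square)
    qed
    finally show ?thesis unfolding energy_def sum_distrib_left .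
  qed
  have D2: "2 \<le> ?D" using dim2 by simp
  have e0: "0 \<le> energy N r" for r
    unfolding energy_def
  proof (rule sum_nonneg)
    fix F assume "F \<in> flux_facets N"
    then have "F \<in> facets \<T>" unfolding flux_facets_def by simp
    then show "0 \<le> diameter F ^ (CARD('a) - 2) * (jump \<T> r F)\<^sup>2"
      by (rule mult_nonneg_nonneg[OF zero_le_power[OF facet_diameter_ge_0] zero_le_power2])
  qed
  have "\<exists>r. \<forall>T\<in>\<T>. (\<Sum>T'\<in>\<T>. M T T' * r T') = q T * measure lebesgue T"
  proof (rule positive_definite_solvable[OF finite_mesh])
    fix r assume "(\<Sum>T\<in>\<T>. r T * (\<Sum>T'\<in>\<T>. M T T' * r T')) \<le> 0"
    then have "?D * energy N r \<le> 0" unfolding form .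
    then have "energy N r \<le> 0" using D2 by (simp add: mult_le_0_iff)
    then have "P0 * energy N r \<le> 0" using P0_pos by (simp add: mult_le_0_iff)
    then have le: "(\<Sum>T\<in>\<T>. (r T)\<^sup>2 * measure lebesgue T) \<le> 0" using energy_poincare[of r] by linarith
    have nn: "\<And>T. T \<in> \<T> \<Longrightarrow> 0 \<le> (r T)\<^sup>2 * measure lebesgue T" by simp
    have z: "(\<Sum>T\<in>\<T>. (r T)\<^sup>2 * measure lebesgue T) = 0" using le sum_nonneg[of \<T> "\<lambda>T. (r T)\<^sup>2 * measure lebesgue T", OF nn] by linarith
    show "\<forall>T\<in>\<T>. r T = 0"
    proof
      fix T assume T: "T \<in> \<T>"
      have "(r T)\<^sup>2 * measure lebesgue T = 0" using z sum_nonneg_eq_0_iff[OF finite_mesh nn] T by simp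
      then show "r T = 0" using cell_measure(2)[OF T] by simp
    qed
  qed
  then obtain r where r: "\<And>T. T \<in> \<T> \<Longrightarrow> (\<Sum>T'\<in>\<T>. M T T' * r T') = q T * measure lebesgue T" by metis
  show thesis
  proof (rule that[of r])
    show "cell_div (flux_coeff r) T = q T" if T: "T \<in> \<T>" for T
      using cell_div_flux_coeff[OF T, of r] r[OF T] cell_measure(2)[OF T] unfolding row by simp
    let ?Q = "\<Sum>T\<in>\<T>. (q T)\<^sup>2 * measure lebesgue T"
    let ?X = "\<Sum>T\<in>\<T>. (r T)\<^sup>2 * measure lebesgue T"
    have "?D * energy N r = (\<Sum>T\<in>\<T>. r T * (q T * measure lebesgue T))"
      unfolding form[symmetric] using r by (intro sum.cong refl) simp
    also have "\<dots> \<le> (\<Sum>T\<in>\<T>. P0 / 2 * ((q T)\<^sup>2 * measure lebesgue T) + 1 / (2 * P0) * ((r T)\<^sup>2 * measure lebesgue T))"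
    proof (rule sum_mono)
      fix T
      have "0 \<le> (P0 * q T - r T)\<^sup>2" by simp
      then have "2 * P0 * (r T * q T) \<le> P0\<^sup>2 * (q T)\<^sup>2 + (r T)\<^sup>2" by (simp add: power2_eq_square algebra_simps)
      then have "r T * q T \<le> P0 / 2 * (q T)\<^sup>2 + 1 / (2 * P0) * (r T)\<^sup>2"
        using P0_pos by (simp add: field_simps power2_eq_square)
      then have "r T * q T * measure lebesgue T \<le> (P0 / 2 * (q T)\<^sup>2 + 1 / (2 * P0) * (r T)\<^sup>2) * measure lebesgue T"
        by (rule mult_right_mono) simp
      then show "r T * (q T * measure lebesgue T) \<le> P0 / 2 * ((q T)\<^sup>2 * measure lebesgue T) + 1 / (2 * P0) * ((r T)\<^sup>2 * measure lebesgue T)"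
        by (simp only: distrib_right mult.assoc)
    qed
    also have "\<dots> = P0 / 2 * ?Q + 1 / (2 * P0) * ?X" unfolding sum.distrib sum_distrib_left ..
    also have "\<dots> \<le> P0 / 2 * ?Q + 1 / (2 * P0) * (P0 * energy N r)"
      using energy_poincare[of r] P0_pos by (intro add_left_mono mult_left_mono) auto
    also have "\<dots> = P0 / 2 * ?Q + energy N r / 2" using P0_pos by simp
    finally have "?D * energy N r \<le> P0 / 2 * ?Q + energy N r / 2" .
    moreover have "2 * energy N r \<le> ?D * energy N r" by (rule mult_right_mono[OF D2 e0])
    moreover have "0 \<le> P0 * ?Q" using P0_pos by (intro mult_nonneg_nonneg sum_nonneg) auto
    ultimately show "energy N r \<le> P0 * ?Q" using e0[of r] by linarith
  qed
qed

lemma cell_field_bound: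
  assumes T: "T \<in> \<T>" and x: "x \<in> T"
  shows "(norm (cell_field m T x))\<^sup>2 \<le> (real CARD('a) + 1) * (diameter T / measure lebesgue T)\<^sup>2 * (\<Sum>F\<in>{F. F facet_of T}. (m F)\<^sup>2)"
proof -
  let ?G = "{F. F facet_of T}" let ?k = "diameter T / measure lebesgue T"
  have b: "bounded T" using compact_imp_bounded[OF cell_compact[OF T]] .
  have k0: "0 \<le> ?k" using diameter_ge_0[OF b] by simp
  have "norm (cell_field m T x) \<le> (\<Sum>F\<in>?G. \<bar>m F\<bar> * ?k)"
    unfolding cell_field_def
  proof (rule sum_norm_le)
    fix F assume F: "F \<in> ?G"
    then have F': "F facet_of T" by simp
    have "opp T F \<in> verts T" by (rule opp_facet(1)[OF mesh_simplex[OF T] F'])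
    then have "opp T F \<in> T" unfolding verts_def extreme_point_of_def by simp
    then have d: "norm (x - opp T F) \<le> diameter T" using diameter_bounded_bound[OF b x] by (simp add: dist_norm)
    have "norm ((m F * orient T F / measure lborel T) *\<^sub>R (x - opp T F)) = \<bar>m F\<bar> * (norm (x - opp T F) / measure lebesgue T)"
    proof -
      have "\<bar>orient T F\<bar> = 1" using orient_cases[OF T F'] by linarith
      then show ?thesis unfolding cell_measure(1)[OF T] norm_scaleR abs_divide abs_mult by simp
    qed
    also have "\<dots> \<le> \<bar>m F\<bar> * ?k" using d by (intro mult_left_mono divide_right_mono) auto
    finally show "norm ((m F * orient T F / measure lborel T) *\<^sub>R (x - opp T F)) \<le> \<bar>m F\<bar> * ?k" .
  qed
  then have "(norm (cell_field m T x))\<^sup>2 \<le> (\<Sum>F\<in>?G. \<bar>m F\<bar> * ?k)\<^sup>2" by (rule power_mono) simp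
  also have "\<dots> = (\<Sum>F\<in>?G. 1 * \<bar>m F\<bar>)\<^sup>2 * ?k\<^sup>2" 
  proof -
    have "(\<Sum>F\<in>?G. \<bar>m F\<bar> * ?k) = (\<Sum>F\<in>?G. \<bar>m F\<bar>) * ?k" by (rule sum_distrib_right[symmetric])
    then show ?thesis by (simp only: power_mult_distrib mult_1)
  qed
  also have "\<dots> \<le> ((\<Sum>F\<in>?G. 1\<^sup>2) * (\<Sum>F\<in>?G. \<bar>m F\<bar>\<^sup>2)) * ?k\<^sup>2"
    by (rule mult_right_mono[OF Cauchy_Schwarz_ineq_sum]) simp
  also have "\<dots> = (real CARD('a) + 1) * ?k\<^sup>2 * (\<Sum>F\<in>?G. (m F)\<^sup>2)" 
    by (simp only: power_one power2_abs sum_constant card_facets_of_cell[OF T] mult_1_right of_nat_add of_nat_1 mult.assoc mult.commute[of _ "?k\<^sup>2"])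
  finally show ?thesis .
qed

lemma flux_field_norm:
  "L2_inner \<Omega> (flux_field (flux_coeff r)) (flux_field (flux_coeff r)) \<le> 2 * (real CARD('a) + 1) / c * energy N r"
proof -
  let ?m = "flux_coeff r" let ?n = "real CARD('a) + 1"
  let ?h = "\<lambda>F. if F \<in> flux_facets N then diameter F ^ (CARD('a) - 2) * (jump \<T> r F)\<^sup>2 else 0"
  have h0: "0 \<le> ?h F" for F using facet_diameter_ge_0[of F] by (simp add: flux_facets_def)
  have cell: "integral\<^sup>L (lebesgue_on T) (\<lambda>x. flux_field ?m x \<bullet> flux_field ?m x) \<le> (\<Sum>F\<in>{F. F facet_of T}. ?n / c * ?h F)" if T: "T \<in> \<T>" for T
  proof -
    let ?K = "?n * (diameter T / measure lebesgue T)\<^sup>2 * (\<Sum>F\<in>{F. F facet_of T}. (?m F)\<^sup>2)"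
    have fin: "finite_measure (lebesgue_on T)" by (rule finite_measure_lebesgue_on[OF lmeasurable_compact[OF cell_compact[OF T]]])
    define K0 :: real where "K0 = ?K"
    have ae: "AE x in lebesgue_on T. flux_field ?m x \<bullet> flux_field ?m x \<le> K0"
    proof -
      have "AE x in lebesgue_on T. x \<in> T" by (rule AE_I2) (simp add: space_restrict_space)
      then show ?thesis
        using flux_field_cell[OF T, of ?m]
      proof eventually_elim
        case (elim x)
        show ?case using cell_field_bound[OF T elim(1), of ?m] unfolding elim(2) power2_norm_eq_inner K0_def .
      qed
    qed
    have i0: "integrable (lebesgue_on T) (\<lambda>x. flux_field ?m x \<bullet> flux_field ?m x)"
      by (rule L2_inner_cells(1)[OF flux_field_L2 flux_field_L2 T])
    have i1: "integrable (lebesgue_on T) (\<lambda>x. K0)" by (rule finite_measure.integrable_const[OF fin])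
    have i2: "integral\<^sup>L (lebesgue_on T) (\<lambda>x. K0) = K0 * measure lebesgue T"
      using cell_sets[OF T] by (simp add: measure_restrict_space space_restrict_space)
    have 1: "integral\<^sup>L (lebesgue_on T) (\<lambda>x. flux_field ?m x \<bullet> flux_field ?m x) \<le> K0 * measure lebesgue T"
      using integral_mono_AE[OF i0 i1 ae] unfolding i2 .
    have term_le: "(diameter T)\<^sup>2 / measure lebesgue T * (?m F)\<^sup>2 \<le> 1 / c * ?h F" if F: "F facet_of T" for F
    proof -
      show ?thesis
      proof (cases "F \<in> flux_facets N")
        case True
        let ?a = "diameter F ^ (CARD('a) - 2)"
        have d: "0 \<le> diameter F" "diameter F \<le> diameter T" using facet_diameter[OF T F] .
        obtain k where k: "CARD('a) = k + 2" using dim2 le_iff_add[of 2 "CARD('a)"] by auto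
        have "?a \<le> diameter T ^ (CARD('a) - 2)" using d by (rule power_mono[rotated])
        then have "c * ((diameter T)\<^sup>2 * ?a) \<le> c * ((diameter T)\<^sup>2 * diameter T ^ (CARD('a) - 2))"
          using c_pos by (intro mult_left_mono) auto
        also have "\<dots> = c * diameter T ^ CARD('a)" unfolding k by (simp add: power_add power2_eq_square)
        also have "\<dots> \<le> measure lebesgue T" by (rule thick[OF T])
        finally have le: "(diameter T)\<^sup>2 * ?a / measure lebesgue T \<le> 1 / c"
          using c_pos cell_measure(2)[OF T] by (simp add: field_simps)
        have "(diameter T)\<^sup>2 / measure lebesgue T * (?m F)\<^sup>2 = (diameter T)\<^sup>2 * ?a / measure lebesgue T * (?a * (jump \<T> r F)\<^sup>2)"
          using True by (simp add: flux_coeff_def power2_eq_square)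
        also have "\<dots> \<le> 1 / c * (?a * (jump \<T> r F)\<^sup>2)" using d by (intro mult_right_mono le) auto
        finally show ?thesis using True by simp
      qed (simp add: flux_coeff_def)
    qed
    have S: "(diameter T)\<^sup>2 / measure lebesgue T * (\<Sum>F\<in>{F. F facet_of T}. (?m F)\<^sup>2) \<le> (\<Sum>F\<in>{F. F facet_of T}. 1 / c * ?h F)"
      (is "?k * ?S \<le> ?U")
      unfolding sum_distrib_left[of ?k] by (rule sum_mono) (rule term_le, simp)
    have k: "(diameter T / measure lebesgue T)\<^sup>2 * measure lebesgue T = ?k"
      using cell_measure(2)[OF T] by (simp add: power_divide power2_eq_square)
    have g: "n * k * S * u = n * (k * u * S)" for n k u S :: real by simp
    have "K0 * measure lebesgue T = ?n * (?k * ?S)" unfolding K0_def g k ..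
    also have "\<dots> \<le> ?n * ?U" by (rule mult_left_mono[OF S]) simp
    also have "\<dots> = (\<Sum>F\<in>{F. F facet_of T}. ?n * (1 / c * ?h F))" by (rule sum_distrib_left)
    also have "\<dots> = (\<Sum>F\<in>{F. F facet_of T}. ?n / c * ?h F)" by (rule sum.cong[OF refl]) simp
    finally have "K0 * measure lebesgue T \<le> (\<Sum>F\<in>{F. F facet_of T}. ?n / c * ?h F)" .
    with 1 show ?thesis by (rule order_trans)
  qed
  have "L2_inner \<Omega> (flux_field ?m) (flux_field ?m) \<le> (\<Sum>T\<in>\<T>. \<Sum>F\<in>{F. F facet_of T}. ?n / c * ?h F)"
    unfolding L2_inner_cells(2)[OF flux_field_L2 flux_field_L2] by (rule sum_mono[OF cell])
  also have "\<dots> = (\<Sum>F\<in>facets \<T>. \<Sum>T\<in>{T\<in>\<T>. F facet_of T}. ?n / c * ?h F)" by (rule sum_cell_facets)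
  also have "\<dots> \<le> (\<Sum>F\<in>facets \<T>. 2 * (?n / c * ?h F))"
  proof (rule sum_mono)
    fix F assume F: "F \<in> facets \<T>"
    have "0 \<le> ?n / c * ?h F" using c_pos h0[of F] by (intro mult_nonneg_nonneg) auto
    moreover have "real (card {T\<in>\<T>. F facet_of T}) \<le> 2" using jump_square_bound(3)[OF F] by simp
    ultimately have "real (card {T\<in>\<T>. F facet_of T}) * (?n / c * ?h F) \<le> 2 * (?n / c * ?h F)" by (rule mult_right_mono[rotated])
    then show "(\<Sum>T\<in>{T\<in>\<T>. F facet_of T}. ?n / c * ?h F) \<le> 2 * (?n / c * ?h F)" by (simp only: sum_constant)
  qed
  also have "\<dots> = 2 * ?n / c * (\<Sum>F\<in>facets \<T>. ?h F)" unfolding sum_distrib_left by (intro sum.cong refl) simp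
  also have "(\<Sum>F\<in>facets \<T>. ?h F) = energy N r"
  proof -
    have "{F \<in> facets \<T>. F \<in> flux_facets N} = flux_facets N" unfolding flux_facets_def by blast
    then show ?thesis unfolding energy_def
      using sum.inter_filter[OF finite_facets[OF simplicial], of "\<lambda>F. diameter F ^ (CARD('a) - 2) * (jump \<T> r F)\<^sup>2" "\<lambda>F. F \<in> flux_facets N"] by simp
  qed
  finally show ?thesis .
qed

end

context conforming
begin

lemma AE_cells:
  assumes "\<And>T. T \<in> \<T> \<Longrightarrow> AE x in lebesgue_on T. P x"
  shows "AE x in lebesgue_on \<Omega>. P x"
proof -
  have a: "AE x in lebesgue. x \<in> T \<longrightarrow> P x" if "T \<in> \<T>" for T
    using assms[OF that] cell_sets[OF that] by (simp add: AE_restrict_space_iff)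
  have "AE x in lebesgue. \<forall>T\<in>\<T>. x \<in> T \<longrightarrow> P x" by (rule AE_finite_allI[OF finite_mesh a])
  then have "AE x in lebesgue. x \<in> \<Omega> \<longrightarrow> P x"
  proof eventually_elim
    case (elim x)
    show ?case
    proof
      assume "x \<in> \<Omega>"
      then have "x \<in> \<Union>\<T>" unfolding cover by (rule subsetD[OF closure_subset])
      then show "P x" using elim by blast
    qed
  qed
  then show ?thesis using sets_dom by (simp add: AE_restrict_space_iff)
qed

lemma L2_norm_cells:
  assumes g: "g \<in> L2 \<Omega>" and q: "\<And>T. T \<in> \<T> \<Longrightarrow> AE x in lebesgue_on T. g x = q T"
  shows "L2_inner \<Omega> g g = (\<Sum>T\<in>\<T>. (q T)\<^sup>2 * measure lebesgue T)"
  unfolding L2_inner_cells(2)[OF g g]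
proof (rule sum.cong[OF refl])
  fix T assume T: "T \<in> \<T>"
  have "integral\<^sup>L (lebesgue_on T) (\<lambda>x. g x \<bullet> g x) = integral\<^sup>L (lebesgue_on T) (\<lambda>x. (q T)\<^sup>2)"
  proof (rule integral_cong_AE[OF borel_measurable_integrable[OF L2_inner_cells(1)[OF g g T]] borel_measurable_const])
    show "AE x in lebesgue_on T. g x \<bullet> g x = (q T)\<^sup>2"
      using q[OF T] by eventually_elim (simp add: power2_eq_square)
  qed
  also have "\<dots> = (q T)\<^sup>2 * measure lebesgue T"
    using cell_sets[OF T] by (simp add: measure_restrict_space space_restrict_space)
  finally show "integral\<^sup>L (lebesgue_on T) (\<lambda>x. g x \<bullet> g x) = (q T)\<^sup>2 * measure lebesgue T" .
qed

end

context estimate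
begin

lemma inf_sup_bound:
  fixes \<Gamma> :: "(real^'a) set" and \<alpha> :: "real^'a \<Rightarrow> real^'a^'a"
  assumes w: "weighted_dom \<Omega> \<alpha>"
    and b: "\<And>\<phi> \<psi> F x. test_function \<phi> \<psi> \<Longrightarrow> supp \<phi> \<inter> frontier \<Omega> \<subseteq> \<Gamma> \<Longrightarrow>
     F \<in> facets \<T> \<Longrightarrow> F \<subseteq> frontier \<Omega> \<Longrightarrow> \<not> F \<subseteq> N \<Longrightarrow> x \<in> F \<Longrightarrow> \<phi> x = 0"
  shows "ereal (1 / sqrt (2 * (real CARD('a) + 1) / c * P0 + 1)) \<le> inf_sup_value \<Omega> \<Gamma> \<T> \<alpha>"
proof -
  interpret w: weighted_dom \<Omega> \<alpha> by (rule w)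
  let ?C = "2 * (real CARD('a) + 1) / c * P0"
  have C0: "0 \<le> ?C" using c_pos P0_pos by simp
  show ?thesis
    unfolding inf_sup_value_def
  proof (rule INF_greatest)
    fix q assume "q \<in> {q \<in> W_h \<Omega> \<T>. \<not> L2_zero \<Omega> q}"
    then have qW: "q \<in> W_h \<Omega> \<T>" and qn: "\<not> L2_zero \<Omega> q" by simp_all
    have qL: "q \<in> L2 \<Omega>" using qW unfolding W_h_def by simp
    have "\<forall>T\<in>\<T>. \<exists>k. AE x in lebesgue_on T. q x = k" using qW unfolding W_h_def by simp
    then obtain k where k: "\<And>T. T \<in> \<T> \<Longrightarrow> AE x in lebesgue_on T. q x = k T" by (metis bchoice)
    obtain r where r: "\<And>T. T \<in> \<T> \<Longrightarrow> cell_div (flux_coeff r) T = k T"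
      "energy N r \<le> P0 * (\<Sum>T\<in>\<T>. (k T)\<^sup>2 * measure lebesgue T)"
      using solve_flux[of k] by metis
    define v where "v = flux_field (flux_coeff r)"
    define Q where "Q = L2_inner \<Omega> q q"
    have QL: "Q = (\<Sum>T\<in>\<T>. (k T)\<^sup>2 * measure lebesgue T)" unfolding Q_def by (rule L2_norm_cells[OF qL k])
    have vH: "v \<in> Hdiv \<Omega>" unfolding v_def by (rule flux_field_weak_div(1))
    have vV: "v \<in> V_h \<Omega> \<Gamma> \<T>"
      unfolding v_def
    proof (rule flux_field_V_h)
      fix \<phi> \<psi> F x assume a: "test_function \<phi> \<psi>" "supp \<phi> \<inter> frontier \<Omega> \<subseteq> \<Gamma>" "F \<in> facets \<T>" "F \<subseteq> frontier \<Omega>"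
        "flux_coeff r F \<noteq> 0" "x \<in> F"
      have "F \<in> flux_facets N" using a(5) unfolding flux_coeff_def by metis
      then have "\<not> F \<subseteq> N" using a(4) unfolding flux_facets_def by simp
      then show "\<phi> x = 0" using b a by metis
    qed
    have div: "AE x in lebesgue_on \<Omega>. weak_div \<Omega> v x = q x"
    proof -
      have "AE x in lebesgue_on \<Omega>. flux_div (flux_coeff r) x = q x"
      proof (rule AE_cells)
        fix T assume T: "T \<in> \<T>"
        show "AE x in lebesgue_on T. flux_div (flux_coeff r) x = q x"
          using flux_div_cell[OF T, of "flux_coeff r"] k[OF T] by eventually_elim (simp add: r(1)[OF T])
      qed
      then show ?thesis using flux_field_weak_div(2)[of "flux_coeff r"] unfolding v_def by eventually_elim simp
    qed
    have dL: "weak_div \<Omega> v \<in> L2 \<Omega>" by (rule weak_divD(1)[OF vH])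
    have dq: "L2_inner \<Omega> (weak_div \<Omega> v) q = Q" unfolding Q_def
      by (rule L2_inner_cong_AE[OF div AE_I2 dL qL qL qL]) simp
    have dd: "L2_inner \<Omega> (weak_div \<Omega> v) (weak_div \<Omega> v) = Q" unfolding Q_def
      by (rule L2_inner_cong_AE[OF div div dL dL qL qL])
    have Q0: "0 < Q"
    proof -
      have "Q \<noteq> 0"
      proof
        assume "Q = 0"
        then have "\<forall>T\<in>\<T>. (k T)\<^sup>2 * measure lebesgue T = 0"
          unfolding QL by (subst (asm) sum_nonneg_eq_0_iff[OF finite_mesh]) auto
        then have k0: "k T = 0" if "T \<in> \<T>" for T using that cell_measure(2)[OF that] by force
        have "AE x in lebesgue_on \<Omega>. q x = 0"
        proof (rule AE_cells)
          fix T assume T: "T \<in> \<T>"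
          show "AE x in lebesgue_on T. q x = 0" using k[OF T] unfolding k0[OF T] .
        qed
        then show False using qn unfolding L2_zero_def by blast
      qed
      then show ?thesis using L2_inner_nonneg[of \<Omega> q] unfolding Q_def by linarith
    qed
    have vv: "L2_inner \<Omega> v v \<le> ?C * Q"
    proof -
      have "L2_inner \<Omega> v v \<le> 2 * (real CARD('a) + 1) / c * energy N r" unfolding v_def by (rule flux_field_norm)
      also have "\<dots> \<le> 2 * (real CARD('a) + 1) / c * (P0 * Q)"
        unfolding QL using c_pos by (intro mult_left_mono[OF r(2)]) simp
      finally show ?thesis by (simp only: mult.assoc)
    qed
    have L: "(Lambda_norm \<Omega> \<alpha> v)\<^sup>2 \<le> (?C + 1) * Q"
      unfolding w.Lambda_norm_sq[OF vH] w.Lam_def dd using w.wi_le[OF Hdiv_L2[OF vH]] vv by (simp only: distrib_right mult_1)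
    have L': "Q \<le> (Lambda_norm \<Omega> \<alpha> v)\<^sup>2"
      unfolding w.Lambda_norm_sq[OF vH] w.Lam_def dd using w.wi_nonneg[OF Hdiv_L2[OF vH]] by simp
    have L0: "0 < Lambda_norm \<Omega> \<alpha> v"
    proof -
      have "0 \<le> Lambda_norm \<Omega> \<alpha> v" unfolding Lambda_norm_def
        using w.wi_nonneg[OF Hdiv_L2[OF vH]] L2_inner_nonneg[of \<Omega> "weak_div \<Omega> v"] by simp
      moreover have "Lambda_norm \<Omega> \<alpha> v \<noteq> 0" using L' Q0 by force
      ultimately show ?thesis by linarith
    qed
    have vn: "\<not> L2_zero \<Omega> v"
    proof
      assume "L2_zero \<Omega> v"
      then have "w.Lam v v = 0" by (rule w.Lam_zero[OF vH])
      then show False using L' Q0 unfolding w.Lambda_norm_sq[OF vH] by linarith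
    qed
    have "1 / sqrt (?C + 1) \<le> L2_inner \<Omega> (weak_div \<Omega> v) q / (Lambda_norm \<Omega> \<alpha> v * L2_norm \<Omega> q)"
    proof -
      have n: "L2_norm \<Omega> q = sqrt Q" unfolding L2_norm_def Q_def ..
      have "Lambda_norm \<Omega> \<alpha> v \<le> sqrt ((?C + 1) * Q)" using L by (rule real_le_rsqrt)
      then have le: "Lambda_norm \<Omega> \<alpha> v \<le> sqrt (?C + 1) * sqrt Q" by (simp only: real_sqrt_mult)
      have s: "0 < sqrt (?C + 1)" using C0 by simp
      have sQ: "sqrt Q * sqrt Q = Q" "0 < sqrt Q" using Q0 by simp_all
      have "1 / sqrt (?C + 1) \<le> sqrt Q / Lambda_norm \<Omega> \<alpha> v"
      proof -
        have "1 / a \<le> q / l" if "l \<le> a * q" "0 < a" "0 < l" for a q l :: real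
          using that by (simp add: field_simps)
        then show ?thesis using le s L0 .
      qed
      also have "\<dots> = Q / (Lambda_norm \<Omega> \<alpha> v * sqrt Q)" using sQ L0 by (simp add: field_simps)
      finally show ?thesis unfolding dq n .
    qed
    then have "ereal (1 / sqrt (?C + 1)) \<le> ereal (L2_inner \<Omega> (weak_div \<Omega> v) q / (Lambda_norm \<Omega> \<alpha> v * L2_norm \<Omega> q))"
      by (simp only: ereal_less_eq)
    also have "\<dots> \<le> (SUP v\<in>{v \<in> V_h \<Omega> \<Gamma> \<T>. \<not> L2_zero \<Omega> v}. ereal (L2_inner \<Omega> (weak_div \<Omega> v) q / (Lambda_norm \<Omega> \<alpha> v * L2_norm \<Omega> q)))"
      using vV vn by (intro SUP_upper) simp
    finally show "ereal (1 / sqrt (?C + 1)) \<le> (SUP v\<in>{v \<in> V_h \<Omega> \<Gamma> \<T>. \<not> L2_zero \<Omega> v}. ereal (L2_inner \<Omega> (weak_div \<Omega> v) q / (Lambda_norm \<Omega> \<alpha> v * L2_norm \<Omega> q)))" .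
  qed
qed

end

lemma mesh_conforming:
  assumes d: "2 \<le> CARD('d)" and \<Omega>: "polyhedral_domain (\<Omega> :: (real^'d) set)" and m: "mesh \<Omega> \<Gamma>D \<Gamma>N \<T>"
  shows "conforming \<T> \<Omega>"
proof
  show "2 \<le> CARD('d)" by (rule d)
  show "simplicial \<T>" using m unfolding mesh_def triangulation_def simplicial_def by simp
  show "\<Union>\<T> = closure \<Omega>" using m unfolding mesh_def by simp
  show "\<And>T T'. T \<in> \<T> \<Longrightarrow> T' \<in> \<T> \<Longrightarrow> (T \<inter> T') face_of T" using m unfolding mesh_def triangulation_def by simp
  show "open \<Omega>" "bounded \<Omega>" "interior (closure \<Omega>) = \<Omega>" using \<Omega> unfolding polyhedral_domain_def by simp_all
qed

lemma Dirichlet_point: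
  assumes "boundary_splitting \<Omega> \<Gamma>D \<Gamma>N"
  obtains y where "y \<in> frontier \<Omega>" "y \<notin> closure \<Gamma>N"
proof -
  have s: "surface_measure (closure \<Gamma>D \<inter> closure \<Gamma>N) = 0" "0 < surface_measure \<Gamma>D" "\<Gamma>D \<union> \<Gamma>N = frontier \<Omega>"
    using assms unfolding boundary_splitting_def by simp_all
  have "\<not> \<Gamma>D \<subseteq> closure \<Gamma>N"
  proof
    assume "\<Gamma>D \<subseteq> closure \<Gamma>N"
    then have "\<Gamma>D \<subseteq> closure \<Gamma>D \<inter> closure \<Gamma>N" using closure_subset[of \<Gamma>D] by (rule Int_greatest[rotated])
    then have "surface_measure \<Gamma>D \<le> surface_measure (closure \<Gamma>D \<inter> closure \<Gamma>N)" by (rule surface_measure_mono)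
    then show False using s by simp
  qed
  then obtain y where "y \<in> \<Gamma>D" "y \<notin> closure \<Gamma>N" by (meson subsetI)
  then show thesis using that s(3) by blast
qed

lemma uniform_inf_sup_exists:
  fixes \<Omega> \<Gamma>D \<Gamma>N :: "(real^'d) set" and \<rho> :: real
  assumes d: "2 \<le> CARD('d)" and \<Omega>: "polyhedral_domain \<Omega>" and s: "boundary_splitting \<Omega> \<Gamma>D \<Gamma>N"
  shows "\<exists>\<gamma>>0. \<forall>\<F>. shape_regular_family \<Omega> \<Gamma>D \<Gamma>N \<rho> \<F> \<longrightarrow> uniform_inf_sup \<Omega> \<Gamma>N \<F> \<gamma>"
proof -
  have \<Omega>': "bounded \<Omega>" "open \<Omega>" "connected \<Omega>" "interior (closure \<Omega>) = \<Omega>"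
    using \<Omega> unfolding polyhedral_domain_def by simp_all
  obtain \<P> where P: "finite \<P>" "\<And>P. P \<in> \<P> \<Longrightarrow> polytope P" "closure \<Omega> = \<Union>\<P>"
    using \<Omega> unfolding polyhedral_domain_def by blast
  obtain y0 where y0: "y0 \<in> frontier \<Omega>" "y0 \<notin> closure \<Gamma>N" by (rule Dirichlet_point[OF s])
  have dim: "2 \<le> DIM(real^'d)" using d by simp
  obtain A where A: "0 \<le> A" "\<And>\<T> w. simplicial \<T> \<Longrightarrow> \<Union>\<T> = closure \<Omega> \<Longrightarrow> (\<forall>T\<in>\<T>. 0 \<le> w T) \<Longrightarrow>
     (\<Sum>T\<in>\<T>. w T * measure lebesgue T) \<le> A * jump_sum \<Omega> (closure \<Gamma>N) \<T> w"
    by (rule discrete_poincare[OF dim \<Omega>' P closed_closure y0]) (assumption, rule that)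
  define c where "c = unit_ball_vol (real CARD('d)) / (4 * max \<rho> 1) ^ CARD('d)"
  define A' where "A' = A + 1"
  have c0: "0 < c" unfolding c_def by (intro divide_pos_pos zero_less_power unit_ball_vol_pos) auto
  have A0: "0 < A'" unfolding A'_def using A(1) by simp
  define B0 where "B0 = 2 * A'\<^sup>2 * (real CARD('d) + 1) / c"
  define \<gamma> where "\<gamma> = 1 / sqrt (2 * (real CARD('d) + 1) / c * B0 + 1)"
  have "0 \<le> B0" unfolding B0_def using c0 by simp
  then have "0 \<le> 2 * (real CARD('d) + 1) / c * B0" using c0 by simp
  then have \<gamma>0: "0 < \<gamma>" unfolding \<gamma>_def by simp
  have sm: "surface_measure (closure \<Gamma>D \<inter> closure \<Gamma>N) = 0" using s unfolding boundary_splitting_def by simp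
  have "ereal \<gamma> \<le> inf_sup_value \<Omega> \<Gamma>N \<T> (inverse_field K)"
    if fam: "shape_regular_family \<Omega> \<Gamma>D \<Gamma>N \<rho> \<F>" and K: "permeability \<Omega> K" "bounded_below_by_identity \<Omega> K" and T: "\<T> \<in> \<F>" for \<F> K \<T>
  proof -
    have m: "mesh \<Omega> \<Gamma>D \<Gamma>N \<T>" and reg: "\<And>T. T \<in> \<T> \<Longrightarrow> diameter T / inscribed_ball_diameter T \<le> \<rho>"
      using fam T unfolding shape_regular_family_def by auto
    interpret conforming \<T> \<Omega> by (rule mesh_conforming[OF d \<Omega> m])
    interpret estimate \<T> \<Omega> "closure \<Gamma>N" c A'
    proof
      show "0 < c" "0 < A'" by fact+
      show "c * diameter T ^ CARD('d) \<le> measure lebesgue T" if "T \<in> \<T>" for T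
        unfolding c_def by (rule shape_regular_measure[OF mesh_simplex[OF that] reg[OF that] d])
      fix w :: "(real^'d) set \<Rightarrow> real" assume w: "\<forall>T\<in>\<T>. 0 \<le> w T"
      have "0 \<le> jump_sum \<Omega> (closure \<Gamma>N) \<T> w" unfolding jump_sum_def
        using facet_diameter_ge_0 by (intro sum_nonneg mult_nonneg_nonneg zero_le_power) auto
      then have "A * jump_sum \<Omega> (closure \<Gamma>N) \<T> w \<le> A' * jump_sum \<Omega> (closure \<Gamma>N) \<T> w"
        unfolding A'_def by (intro mult_right_mono) auto
      then show "(\<Sum>T\<in>\<T>. w T * measure lebesgue T) \<le> A' * jump_sum \<Omega> (closure \<Gamma>N) \<T> w"
        using A(2)[OF simplicial cover w] by linarith
    qed
    have B0: "B0 = P0" unfolding P0_def B0_def ..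
    show ?thesis
      unfolding \<gamma>_def B0
    proof (rule inf_sup_bound)
      show "weighted_dom \<Omega> (inverse_field K)" by (rule weighted_dom_inverse_field[OF \<Omega>'(2,1) K])
      fix \<phi> \<psi> F x assume a: "test_function \<phi> \<psi>" "supp \<phi> \<inter> frontier \<Omega> \<subseteq> \<Gamma>N" "F \<in> facets \<T>" "F \<subseteq> frontier \<Omega>"
        "\<not> F \<subseteq> closure \<Gamma>N" "x \<in> F"
      obtain T where T: "T \<in> \<T>" "F facet_of T" using a(3) unfolding facets_def by blast
      have "F \<subseteq> closure \<Gamma>D" using m T a(4,5) unfolding mesh_def by metis
      then show "\<phi> x = 0"
        by (rule vanishes_on_Dirichlet_facet[OF d mesh_simplex[OF T(1)] T(2) sm a(4) _ a(1,2,6)])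
    qed
  qed
  then show ?thesis using \<gamma>0 unfolding uniform_inf_sup_def by (intro exI[of _ \<gamma>]) blast
qed

lemma uniformly_stable_from_inf_sup:
  fixes \<Omega> \<Gamma>D \<Gamma>N :: "(real^'d) set"
  assumes d: "2 \<le> CARD('d)" and \<Omega>: "polyhedral_domain \<Omega>"
    and fam: "shape_regular_family \<Omega> \<Gamma>D \<Gamma>N \<rho> \<F>" and \<gamma>: "0 < \<gamma>" "uniform_inf_sup \<Omega> \<Gamma>N \<F> \<gamma>"
  shows "uniformly_stable \<Omega> \<Gamma>N \<F> (1 / (1 + 1 / \<gamma>\<^sup>2))"
  unfolding uniformly_stable_def
proof (intro allI impI ballI)
  fix K \<T> assume K: "permeability \<Omega> K \<and> bounded_below_by_identity \<Omega> K" and T: "\<T> \<in> \<F>"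
  have \<Omega>': "open \<Omega>" "bounded \<Omega>" "\<Omega> \<noteq> {}" using \<Omega> unfolding polyhedral_domain_def by simp_all
  have m: "mesh \<Omega> \<Gamma>D \<Gamma>N \<T>" using fam T unfolding shape_regular_family_def by simp
  interpret conforming \<T> \<Omega> by (rule mesh_conforming[OF d \<Omega> m])
  interpret w: weighted_dom \<Omega> "inverse_field K"
    by (rule weighted_dom_inverse_field[OF \<Omega>'(1,2) conjunct1[OF K] conjunct2[OF K]])
  have "ereal \<gamma> \<le> inf_sup_value \<Omega> \<Gamma>N \<T> (inverse_field K)" using \<gamma>(2) K T unfolding uniform_inf_sup_def by blast
  with weak_div_in_W_h one_in_W_h[OF \<Omega>'(3)] \<gamma>(1)
  show "stable_with \<Omega> \<Gamma>N \<T> (inverse_field K) (1 / (1 + 1 / \<gamma>\<^sup>2))"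
    by (rule w.stable_from_inf_sup)
qed

theorem theorem3p1:
  fixes \<Omega> \<Gamma>D \<Gamma>N :: "(real^'d) set" and \<rho> :: real
  assumes "CARD('d) = 2 \<or> CARD('d) = 3"
    and "polyhedral_domain \<Omega>"
    and "boundary_splitting \<Omega> \<Gamma>D \<Gamma>N"
  shows "(\<exists>\<alpha>0>0. \<forall>\<F>. shape_regular_family \<Omega> \<Gamma>D \<Gamma>N \<rho> \<F> \<longrightarrow> uniformly_stable \<Omega> \<Gamma>N \<F> \<alpha>0)
    \<and> (\<exists>\<gamma>>0. \<forall>\<F>. shape_regular_family \<Omega> \<Gamma>D \<Gamma>N \<rho> \<F> \<longrightarrow> uniform_inf_sup \<Omega> \<Gamma>N \<F> \<gamma>)
    \<and> (\<forall>\<F>. \<forall>\<gamma>>0. shape_regular_family \<Omega> \<Gamma>D \<Gamma>N \<rho> \<F> \<and> uniform_inf_sup \<Omega> \<Gamma>N \<F> \<gamma> \<longrightarrow>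
          (\<exists>\<alpha>0 \<ge> 1 / (1 + 1 / \<gamma>\<^sup>2). uniformly_stable \<Omega> \<Gamma>N \<F> \<alpha>0))"
proof -
  have d: "2 \<le> CARD('d)" using assms(1) by linarith
  note stable = uniformly_stable_from_inf_sup[OF d assms(2)]
  obtain \<gamma> where \<gamma>: "0 < \<gamma>" "\<And>\<F>. shape_regular_family \<Omega> \<Gamma>D \<Gamma>N \<rho> \<F> \<Longrightarrow> uniform_inf_sup \<Omega> \<Gamma>N \<F> \<gamma>"
    using uniform_inf_sup_exists[OF d assms(2,3), of \<rho>] by blast
  have "0 < 1 / (1 + 1 / \<gamma>\<^sup>2)" using \<gamma>(1) by (simp add: add_pos_pos)
  moreover have "uniformly_stable \<Omega> \<Gamma>N \<F> (1 / (1 + 1 / \<gamma>\<^sup>2))" if "shape_regular_family \<Omega> \<Gamma>D \<Gamma>N \<rho> \<F>" for \<F>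
    by (rule stable[OF that \<gamma>(1) \<gamma>(2)[OF that]])
  moreover have "\<exists>\<alpha>0\<ge>1 / (1 + 1 / \<gamma>'\<^sup>2). uniformly_stable \<Omega> \<Gamma>N \<F> \<alpha>0"
    if "0 < \<gamma>'" "shape_regular_family \<Omega> \<Gamma>D \<Gamma>N \<rho> \<F>" "uniform_inf_sup \<Omega> \<Gamma>N \<F> \<gamma>'" for \<F> \<gamma>'
    by (intro exI[of _ "1 / (1 + 1 / \<gamma>'\<^sup>2)"] conjI order_refl stable[OF that(2,1,3)])
  ultimately show ?thesis using \<gamma> by blast
qed

end
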